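(* Let $\vec n(d)=(n_1(d),\ldots,n_p(d))$, $d=1,2,\ldots$, be multi-indices of positive integers with $n(d)=|\vec n(d)|\to\infty$ and $\lim_{d\to\infty}\vec n(d)/n(d)=(r_1,\ldots,r_p)$. For $i=1,\ldots,p$ let $Q_i$ be a continuous real-valued function on $\Gamma_i$ and let $\tau_i$ be a finite positive Borel measure on $\Gamma_i$ satisfying the strong weighted Bernstein–Markov (BM) inequality on $\Gamma_i$. Then the sequence of probability measures $\sigma^Q_{\vec n(d)}$ on $\mathcal M_r(\Gamma)$ satisfies a large deviation principle with speed $(n(d))^2$ and good rate function $$R(\mu)=\log W^Q(\mu_{\Gamma,Q})-\log W^Q(\mu)=E^Q(\mu)-E^Q(\mu_{\Gamma,Q}),\qquad\mu\in\mathcal M_r(\Gamma),$$ where $W^Q(\mu)$ denotes the common value $\overline W^Q(\mu)=\underline W^Q(\mu)$ (these being equal for every $\mu\in\mathcal M_r(\Gamma)$).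
   Context: Fix $p\ge1$ and pairwise disjoint non-degenerate compact intervals $\Gamma_1,\ldots,\Gamma_p\subset\mathbb R$, with $\Gamma_{j+1}$ to the right of $\Gamma_j$; let $\Gamma=\Gamma_1\cup\cdots\cup\Gamma_p$. Fix reals $r_1,\ldots,r_p>0$ with $\sum_i r_i=1$. Write $Q=(Q_1,\ldots,Q_p)$. For a multi-index $\vec n=(n_1,\ldots,n_p)$ of positive integers put $n=|\vec n|=n_1+\cdots+n_p$ and $L_n=\{x\in\mathbb R^n: x_1\le\cdots\le x_n\}$. A vector $X\in\Gamma_1^{n_1}\times\cdots\times\Gamma_p^{n_p}\subset\mathbb R^n$ is written $X=(X^{(1)},\ldots,X^{(p)})$ with $X^{(i)}=(x^{(i)}_1,\ldots,x^{(i)}_{n_i})\in\Gamma_i^{n_i}$. For vectors $Y=(y_1,\ldots,y_m)$, $Y'=(y'_1,\ldots,y'_l)$ let $\Delta(Y)=\prod_{j<k}(y_k-y_j)$ and $\Delta(Y,Y')=\prod_{k=1}^m\prod_{j=1}^l(y_k-y'_j)$. Define $$A^Q_{\vec n}(X)=\prod_{i=1}^p\Delta(X^{(i)})^2\prod_{1\le i<j\le p}\Delta(X^{(j)},X^{(i)})\exp\Big(-2n\sum_{i=1}^p\sum_{j=1}^{n_i}Q_i(x^{(i)}_j)\Big).$$ Let $\Lambda_{\vec n}=L_n\cap(\Gamma_1^{n_1}\times\cdots\times\Gamma_p^{n_p})$, $d\tau(X)=\prod_{i=1}^p\prod_{k=1}^{n_i}d\tau_i(x^{(i)}_k)$ and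 $Z^Q_{\vec n}=\int_{\Lambda_{\vec n}}A^Q_{\vec n}\,d\tau$. $\mathcal M_r(\Gamma)$ is the set of $p$-tuples $\nu=(\nu_1,\ldots,\nu_p)$ of positive Borel measures with $\mathrm{supp}\,\nu_i\subset\Gamma_i$ and $\nu_i(\Gamma_i)=r_i$, with the weak* topology (compact). Define $j^r_{\vec n}:\Lambda_{\vec n}\to\mathcal M_r(\Gamma)$ by $$j^r_{\vec n}(X)=\Big(\tfrac{r_1}{n_1}\sum_{j=1}^{n_1}\delta(x^{(1)}_j),\ldots,\tfrac{r_p}{n_p}\sum_{j=1}^{n_p}\delta(x^{(p)}_j)\Big),$$ with $\delta(x)$ the Dirac mass at $x$, and let $\sigma^Q_{\vec n}=(j^r_{\vec n})_*\big(\frac{A^Q_{\vec n}(X)}{Z^Q_{\vec n}}d\tau(X)|_{\Lambda_{\vec n}}\big)$. For $G\subset\mathcal M_r(\Gamma)$ open, $W^Q_{\vec n}(G)=\sup\{A^Q_{\vec n}(X)^{1/n^2}: X\in\Lambda_{\vec n},\ j^r_{\vec n}(X)\in G\}$ (with $\sup\emptyset=0$), $\overline W^Q(G)=\limsup_{d\to\infty}W^Q_{\vec n(d)}(G)$, $\underline W^Q(G)=\liminf_{d\to\infty}W^Q_{\vec n(d)}(G)$, and for $\mu\in\mathcal M_r(\Gamma)$, $\overline W^Q(\mu)=\inf_{G\ni\mu}\overline W^Q(G)$, $\underline W^Q(\mu)=\inf_{G\ni\mu}\underline W^Q(G)$, infima over open $G$ containing $\mu$; $\log0=-\infty$. For $\nu\in\mathcal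 M_r(\Gamma)$, $$E^Q(\nu)=\sum_{i=1}^p\int_{\Gamma_i}\int_{\Gamma_i}\log\frac1{|x-y|}d\nu_i(x)d\nu_i(y)+\sum_{1\le i<j\le p}\int_{\Gamma_i}\int_{\Gamma_j}\log\frac1{|x-y|}d\nu_i(x)d\nu_j(y)+2\sum_{i=1}^p\int_{\Gamma_i}Q_i\,d\nu_i\in(-\infty,+\infty].$$ By a known theorem of Gonchar–Rakhmanov, $E^Q$ has a unique minimizer over $\mathcal M_r(\Gamma)$, denoted $\mu_{\Gamma,Q}$. A positive Borel measure $\tau$ satisfies the weighted BM inequality for the weight $\exp(-q)$ ($q$ continuous real-valued) on a compact set $K\subset\mathbb C$ if for every $\epsilon>0$ there is $C>0$ such that $\sup_K|P|e^{-mq}\le C(1+\epsilon)^{m}\int_K|P|e^{-mq}d\tau$ for all integers $m\ge 0$ and all (complex) polynomials $P$ of degree $\le m$; it satisfies the strong weighted BM inequality on $K$ if this holds for every continuous $q:K\to\mathbb R$. A sequence $\{\beta_d\}$ of Borel probability measures on a compact Hausdorff space $\mathcal X$ satisfies a large deviation principle with good rate function $R$ and speed $a_d$ if $a_d>0$, $a_d\to\infty$, $R:\mathcal X\to[0,+\infty]$ is lower semicontinuous, and for all Borel $\mathcal B\subset\mathcal X$, $$-\inf_{x\in\mathcal B^\circ}R(x)\le\liminf_{d\to\infty}\frac1{a_d}\log\beta_d(\mathcal B)\le\limsup_{d\to\infty}\frac1{a_d}\log\beta_d(\mathcal B)\le-\inf_{x\in\overline{\mathcal B}}R(x).$$ 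*)

theory Defs
  imports "HOL-Probability.Probability" "HOL-Computational_Algebra.Polynomial"
begin

definition eln :: "ennreal \<Rightarrow> ereal" where
  "eln x = (if x = 0 then - \<infinity> else if x = \<infinity> then \<infinity> else ereal (ln (enn2real x)))"

text \<open>The library has no integral with values in the extended reals. The definition below is
  meaningful only when one of the two parts is finite; all integrands used here are bounded below
  on the set of integration and all measures are finite.\<close>

definition ext_set_integral :: "'a measure \<Rightarrow> 'a set \<Rightarrow> ('a \<Rightarrow> ereal) \<Rightarrow> ereal" where
  "ext_set_integral M A f =
     enn2ereal (\<integral>\<^sup>+x\<in>A. e2ennreal (f x) \<partial>M) - enn2ereal (\<integral>\<^sup>+x\<in>A. e2ennreal (- f x) \<partial>M)"

definition borel_of :: "'a topology \<Rightarrow> 'a measure" where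
  "borel_of T = sigma (topspace T) {U. openin T U}"

definition lower_semicontinuous_map :: "'a topology \<Rightarrow> ('a \<Rightarrow> ereal) \<Rightarrow> bool" where
  "lower_semicontinuous_map T R \<longleftrightarrow> (\<forall>c. openin T {x \<in> topspace T. c < R x})"

text \<open>The underlying space is compact, so goodness of \<open>R\<close> amounts to lower semicontinuity.\<close>

definition satisfies_LDP ::
    "'a topology \<Rightarrow> (nat \<Rightarrow> 'a measure) \<Rightarrow> (nat \<Rightarrow> real) \<Rightarrow> ('a \<Rightarrow> ereal) \<Rightarrow> bool" where
  "satisfies_LDP T \<beta> a R \<longleftrightarrow>
     compact_space T \<and> Hausdorff_space T \<and>
     (\<forall>d. prob_space (\<beta> d) \<and> space (\<beta> d) = topspace T \<and> sets (\<beta> d) = sets (borel_of T)) \<and>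
     (\<forall>d. 0 < a d) \<and> filterlim a at_top sequentially \<and>
     (\<forall>x\<in>topspace T. 0 \<le> R x) \<and> lower_semicontinuous_map T R \<and>
     (\<forall>B\<in>sets (borel_of T).
        - (INF x\<in>T interior_of B. R x) \<le> liminf (\<lambda>d. ereal (1 / a d) * eln (emeasure (\<beta> d) B)) \<and>
        liminf (\<lambda>d. ereal (1 / a d) * eln (emeasure (\<beta> d) B))
          \<le> limsup (\<lambda>d. ereal (1 / a d) * eln (emeasure (\<beta> d) B)) \<and>
        limsup (\<lambda>d. ereal (1 / a d) * eln (emeasure (\<beta> d) B)) \<le> - (INF x\<in>T closure_of B. R x))"

definition weighted_BM :: "complex set \<Rightarrow> (complex \<Rightarrow> real) \<Rightarrow> complex measure \<Rightarrow> bool" where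
  "weighted_BM K q \<tau> \<longleftrightarrow>
     (\<forall>\<epsilon>>0. \<exists>C>0. \<forall>m. \<forall>P :: complex poly. degree P \<le> m \<longrightarrow>
        (SUP z\<in>K. ennreal (cmod (poly P z) * exp (- real m * q z)))
          \<le> ennreal (C * (1 + \<epsilon>) ^ m) *
            (\<integral>\<^sup>+z\<in>K. ennreal (cmod (poly P z) * exp (- real m * q z)) \<partial>\<tau>))"

definition strong_weighted_BM :: "complex set \<Rightarrow> complex measure \<Rightarrow> bool" where
  "strong_weighted_BM K \<tau> \<longleftrightarrow> (\<forall>q. continuous_on K q \<longrightarrow> weighted_BM K q \<tau>)"

definition measure_supp :: "'a::topological_space measure \<Rightarrow> 'a set" where
  "measure_supp \<mu> = {x. \<forall>U. open U \<and> x \<in> U \<longrightarrow> 0 < emeasure \<mu> U}"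

definition measures_of_mass :: "real set \<Rightarrow> real \<Rightarrow> real measure set" where
  "measures_of_mass K c =
     {\<nu>. sets \<nu> = sets borel \<and> measure_supp \<nu> \<subseteq> K \<and> emeasure \<nu> K = ennreal c}"

definition weak_star_topology :: "real set \<Rightarrow> real \<Rightarrow> real measure topology" where
  "weak_star_topology K c = topology_generated_by
     {{\<nu> \<in> measures_of_mass K c. (LINT x:K|\<nu>. f x) \<in> U} | f U. continuous_on K f \<and> open (U :: real set)}"

text \<open>The \<open>p\<close> components are indexed by \<open>{..<p}\<close>; \<open>p\<close>-tuples of measures are functions
  that are \<^const>\<open>extensional\<close> on this set.\<close>

definition M_space :: "nat \<Rightarrow> (nat \<Rightarrow> real set) \<Rightarrow> (nat \<Rightarrow> real) \<Rightarrow> (nat \<Rightarrow> real measure) set" where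
  "M_space p \<Gamma> r = (\<Pi>\<^sub>E i\<in>{..<p}. measures_of_mass (\<Gamma> i) (r i))"

definition M_topology ::
    "nat \<Rightarrow> (nat \<Rightarrow> real set) \<Rightarrow> (nat \<Rightarrow> real) \<Rightarrow> (nat \<Rightarrow> real measure) topology" where
  "M_topology p \<Gamma> r = product_topology (\<lambda>i. weak_star_topology (\<Gamma> i) (r i)) {..<p}"

definition log_energy :: "real set \<Rightarrow> real measure \<Rightarrow> real set \<Rightarrow> real measure \<Rightarrow> ereal" where
  "log_energy A \<mu> B \<nu> =
     ext_set_integral \<mu> A (\<lambda>x. ext_set_integral \<nu> B (\<lambda>y. eln (1 / ennreal \<bar>x - y\<bar>)))"

definition weighted_energy ::
    "nat \<Rightarrow> (nat \<Rightarrow> real set) \<Rightarrow> (nat \<Rightarrow> real \<Rightarrow> real) \<Rightarrow> (nat \<Rightarrow> real measure) \<Rightarrow> ereal" where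
  "weighted_energy p \<Gamma> Q \<nu> =
     (\<Sum>i<p. log_energy (\<Gamma> i) (\<nu> i) (\<Gamma> i) (\<nu> i)) +
     (\<Sum>j<p. \<Sum>i<j. log_energy (\<Gamma> i) (\<nu> i) (\<Gamma> j) (\<nu> j)) +
     ereal (2 * (\<Sum>i<p. LINT x:\<Gamma> i|\<nu> i. Q i x))"

text \<open>By a theorem of Gonchar and Rakhmanov the minimizer exists and is unique, so
  \<^const>\<open>arg_min_on\<close> leaves no choice.\<close>

definition equilibrium_measure ::
    "nat \<Rightarrow> (nat \<Rightarrow> real set) \<Rightarrow> (nat \<Rightarrow> real) \<Rightarrow> (nat \<Rightarrow> real \<Rightarrow> real) \<Rightarrow> (nat \<Rightarrow> real measure)" where
  "equilibrium_measure p \<Gamma> r Q = arg_min_on (weighted_energy p \<Gamma> Q) (M_space p \<Gamma> r)"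

text \<open>For a multi-index \<open>n\<close>, the entry \<open>X (i, k)\<close> is the \<open>k\<close>-th coordinate (counted from \<open>0\<close>)
  of the \<open>i\<close>-th block of the vector \<open>X\<close>; the coordinates of \<open>X\<close> are listed in
  lexicographic order of \<open>(i, k)\<close>.\<close>

definition mi_norm :: "nat \<Rightarrow> (nat \<Rightarrow> nat) \<Rightarrow> nat" where
  "mi_norm p n = (\<Sum>i<p. n i)"

definition coords :: "nat \<Rightarrow> (nat \<Rightarrow> nat) \<Rightarrow> (nat \<times> nat) set" where
  "coords p n = (SIGMA i:{..<p}. {..<n i})"

definition ordered_configs ::
    "nat \<Rightarrow> (nat \<Rightarrow> real set) \<Rightarrow> (nat \<Rightarrow> nat) \<Rightarrow> (nat \<times> nat \<Rightarrow> real) set" where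
  "ordered_configs p \<Gamma> n =
     {X \<in> (\<Pi>\<^sub>E (i, k)\<in>coords p n. \<Gamma> i).
        \<forall>(i, k)\<in>coords p n. \<forall>(j, l)\<in>coords p n.
          i < j \<or> (i = j \<and> k \<le> l) \<longrightarrow> X (i, k) \<le> X (j, l)}"

definition vandermonde :: "nat \<Rightarrow> (nat \<Rightarrow> real) \<Rightarrow> real" where
  "vandermonde m y = (\<Prod>k<m. \<Prod>j<k. y k - y j)"

definition mixed_vandermonde :: "nat \<Rightarrow> (nat \<Rightarrow> real) \<Rightarrow> nat \<Rightarrow> (nat \<Rightarrow> real) \<Rightarrow> real" where
  "mixed_vandermonde m y l y' = (\<Prod>k<m. \<Prod>j<l. y k - y' j)"

definition A_weight ::
    "nat \<Rightarrow> (nat \<Rightarrow> real \<Rightarrow> real) \<Rightarrow> (nat \<Rightarrow> nat) \<Rightarrow> (nat \<times> nat \<Rightarrow> real) \<Rightarrow> real" where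
  "A_weight p Q n X =
     (\<Prod>i<p. (vandermonde (n i) (\<lambda>k. X (i, k)))\<^sup>2) *
     (\<Prod>j<p. \<Prod>i<j. mixed_vandermonde (n j) (\<lambda>k. X (j, k)) (n i) (\<lambda>k. X (i, k))) *
     exp (- 2 * real (mi_norm p n) * (\<Sum>i<p. \<Sum>k<n i. Q i (X (i, k))))"

definition tau_prod ::
    "nat \<Rightarrow> (nat \<Rightarrow> real measure) \<Rightarrow> (nat \<Rightarrow> nat) \<Rightarrow> (nat \<times> nat \<Rightarrow> real) measure" where
  "tau_prod p \<tau> n = (\<Pi>\<^sub>M (i, k)\<in>coords p n. \<tau> i)"

definition Z_const ::
    "nat \<Rightarrow> (nat \<Rightarrow> real set) \<Rightarrow> (nat \<Rightarrow> real \<Rightarrow> real) \<Rightarrow> (nat \<Rightarrow> real measure) \<Rightarrow> (nat \<Rightarrow> nat) \<Rightarrow> real" where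
  "Z_const p \<Gamma> Q \<tau> n = (LINT X:ordered_configs p \<Gamma> n|tau_prod p \<tau> n. A_weight p Q n X)"

text \<open>Sums and multiples of measures are formed setwise.\<close>

definition scaled_dirac_sum :: "real \<Rightarrow> nat \<Rightarrow> (nat \<Rightarrow> real) \<Rightarrow> real measure" where
  "scaled_dirac_sum c m x =
     measure_of UNIV (sets borel) (\<lambda>B. ennreal c * (\<Sum>k<m. emeasure (return borel (x k)) B))"

definition j_map ::
    "nat \<Rightarrow> (nat \<Rightarrow> real) \<Rightarrow> (nat \<Rightarrow> nat) \<Rightarrow> (nat \<times> nat \<Rightarrow> real) \<Rightarrow> (nat \<Rightarrow> real measure)" where
  "j_map p r n X = (\<lambda>i\<in>{..<p}. scaled_dirac_sum (r i / real (n i)) (n i) (\<lambda>k. X (i, k)))"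

definition sigma_measure ::
    "nat \<Rightarrow> (nat \<Rightarrow> real set) \<Rightarrow> (nat \<Rightarrow> real) \<Rightarrow> (nat \<Rightarrow> real \<Rightarrow> real) \<Rightarrow> (nat \<Rightarrow> real measure) \<Rightarrow>
     (nat \<Rightarrow> nat) \<Rightarrow> (nat \<Rightarrow> real measure) measure" where
  "sigma_measure p \<Gamma> r Q \<tau> n =
     distr (density (restrict_space (tau_prod p \<tau> n) (ordered_configs p \<Gamma> n))
              (\<lambda>X. ennreal (A_weight p Q n X / Z_const p \<Gamma> Q \<tau> n)))
       (borel_of (M_topology p \<Gamma> r)) (j_map p r n)"

text \<open>The \<open>W\<close>-functionals take values in \<^typ>\<open>ennreal\<close>, where the supremum of the empty set is \<open>0\<close>.\<close>

definition W_open ::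
    "nat \<Rightarrow> (nat \<Rightarrow> real set) \<Rightarrow> (nat \<Rightarrow> real) \<Rightarrow> (nat \<Rightarrow> real \<Rightarrow> real) \<Rightarrow> (nat \<Rightarrow> nat) \<Rightarrow>
     (nat \<Rightarrow> real measure) set \<Rightarrow> ennreal" where
  "W_open p \<Gamma> r Q n G =
     (SUP X\<in>{X \<in> ordered_configs p \<Gamma> n. j_map p r n X \<in> G}.
        ennreal (A_weight p Q n X powr (1 / (real (mi_norm p n))\<^sup>2)))"

definition W_upper ::
    "nat \<Rightarrow> (nat \<Rightarrow> real set) \<Rightarrow> (nat \<Rightarrow> real) \<Rightarrow> (nat \<Rightarrow> real \<Rightarrow> real) \<Rightarrow> (nat \<Rightarrow> nat \<Rightarrow> nat) \<Rightarrow>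
     (nat \<Rightarrow> real measure) \<Rightarrow> ennreal" where
  "W_upper p \<Gamma> r Q n \<mu> =
     (INF G\<in>{G. openin (M_topology p \<Gamma> r) G \<and> \<mu> \<in> G}. limsup (\<lambda>d. W_open p \<Gamma> r Q (n d) G))"

definition W_lower ::
    "nat \<Rightarrow> (nat \<Rightarrow> real set) \<Rightarrow> (nat \<Rightarrow> real) \<Rightarrow> (nat \<Rightarrow> real \<Rightarrow> real) \<Rightarrow> (nat \<Rightarrow> nat \<Rightarrow> nat) \<Rightarrow>
     (nat \<Rightarrow> real measure) \<Rightarrow> ennreal" where
  "W_lower p \<Gamma> r Q n \<mu> =
     (INF G\<in>{G. openin (M_topology p \<Gamma> r) G \<and> \<mu> \<in> G}. liminf (\<lambda>d. W_open p \<Gamma> r Q (n d) G))"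

end

theory Submission
  imports Defs
begin

text \<open>Spreading the external field over pairs turns \<open>A\<^sup>2\<close> into a product over ordered pairs of points,
  hence \<open>- 2 log A / n\<^sup>2\<close> into a pair interaction that is nearly a double integral against the
  empirical measures. Truncating the logarithmic kernel gives continuous lower bounds of the energy,
  thus its lower semicontinuity and the upper bound for \<open>A\<close> near a given tuple \<open>\<mu>\<close>. For the lower
  bound, independent random points with laws \<open>\<mu> i / r i\<close> have mean interaction close to the energy of
  \<open>\<mu>\<close>, so some configuration near \<open>\<mu>\<close> has a large weight; this argument applies to any \<open>\<mu>\<close> of finite
  energy and needs no regularization.

  To pass from the weight of one configuration to the mass of a neighbourhood, the strong weighted
  Bernstein-Markov inequality is used with a weight that vanishes near a point and is steep elsewhere:
  a polynomial of degree \<open>m\<close> is then bounded at this point by its integral over a small interval, up to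
  a factor \<open>C (1 + \<epsilon>) ^ m\<close>. Applied to one coordinate after the other this costs only
  \<open>exp (o (n\<^sup>2))\<close>, as does the factor \<open>n!\<close> from dropping the order of the coordinates. For the upper
  bound, the closed sets are compact and finitely many neighbourhoods suffice.\<close>

section \<open>The weak-* topology\<close>

text \<open>Empirical measures have atoms, so their own logarithmic energy is infinite and cannot be
  compared with that of a limit. Truncation at \<open>exp (- N)\<close> costs only
  \<open>2 * N\<close> per point on the diagonal, which is linear in n for an N fixed beforehand.
  The atoms have mass r_i / n_i instead of 1 / n; as the kernel is made nonnegative, the convergence
  of n_i / n to r_i enters as one-sided factors \<theta> < 1 and \<kappa> > 1 close to 1. In the
  passage to masses the fields stay out of the polynomials: the inequality is applied to the product
  of gaps alone, which is the modulus of a polynomial of degree at most 2n in each coordinate, and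
  the fields are controlled by uniform continuity on the small intervals. The freedom of the weight
  serves the localization. The W-functionals and the probabilities rest on the same two facts, the
  bound of \<open>A\<close> near a tuple and the existence of good configurations. The normalizing
  constant is the mass of the whole space, which is how the minimal energy enters the rate
  function.\<close>

text \<open>The support is defined by neighbourhoods of single points, so a priori its complement is
  only a union of uncountably many null open sets; by second countability (Lindelof) countably many
  of them suffice.\<close>

lemma emeasure_compl_eq_0_if_measure_supp_subset:
  fixes \<nu> :: "'a::second_countable_topology measure"
  assumes sets: "sets \<nu> = sets borel" and "closed K" and supp: "measure_supp \<nu> \<subseteq> K"
  shows "emeasure \<nu> (- K) = 0"
proof -
  define \<U> where "\<U> = {U. open U \<and> emeasure \<nu> U = 0}"
  obtain \<V> where \<V>: "\<V> \<subseteq> \<U>" "countable \<V>" "\<Union>\<V> = \<Union>\<U>"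
    using Lindelof_openin[of \<U> UNIV] unfolding \<U>_def by (auto simp: subtopology_UNIV)
  have "- K \<subseteq> \<Union>\<U>"
  proof
    fix x assume "x \<in> - K"
    then have "x \<notin> measure_supp \<nu>" using supp by blast
    then obtain U where "open U" "x \<in> U" "\<not> 0 < emeasure \<nu> U"
      unfolding measure_supp_def by blast
    then have "U \<in> \<U>" by (simp add: \<U>_def)
    then show "x \<in> \<Union>\<U>" using \<open>x \<in> U\<close> by blast
  qed
  moreover have "\<Union>\<V> \<in> null_sets \<nu>"
  proof -
    have "(\<Union>V\<in>\<V>. V) \<in> null_sets \<nu>"
      using \<V> by (intro null_sets_UN') (auto simp: \<U>_def null_sets_def sets)
    then show ?thesis by simp
  qed
  moreover have "- K \<in> sets \<nu>" using \<open>closed K\<close> by (simp add: sets)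
  ultimately have "- K \<in> null_sets \<nu>"
    using \<V>(3) null_sets_subset by metis
  then show ?thesis by (simp add: null_setsD1)
qed

lemma measures_of_massD:
  assumes "\<nu> \<in> measures_of_mass K c" "closed K"
  shows "sets \<nu> = sets borel" "space \<nu> = UNIV" "emeasure \<nu> (- K) = 0" "emeasure \<nu> K = ennreal c"
    "emeasure \<nu> UNIV = ennreal c" "finite_measure \<nu>" "AE x in \<nu>. x \<in> K"
proof -
  show sets: "sets \<nu> = sets borel" and K: "emeasure \<nu> K = ennreal c"
    using assms by (auto simp: measures_of_mass_def)
  show sp: "space \<nu> = UNIV" using sets sets_eq_imp_space_eq by fastforce
  show 0: "emeasure \<nu> (- K) = 0"
    using assms emeasure_compl_eq_0_if_measure_supp_subset[of \<nu> K]
    by (auto simp: measures_of_mass_def)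
  have Ks: "K \<in> sets \<nu>" "- K \<in> sets \<nu>" using assms(2) by (auto simp: sets)
  have "emeasure \<nu> UNIV = emeasure \<nu> K + emeasure \<nu> (- K)"
    using plus_emeasure[of K \<nu> "- K"] Ks by (simp add: Compl_partition)
  then show U: "emeasure \<nu> UNIV = ennreal c" by (simp add: K 0)
  show "finite_measure \<nu>" by (rule finite_measureI) (simp add: sp U)
  show "AE x in \<nu>. x \<in> K"
    by (rule AE_I[of _ _ "- K"]) (use 0 Ks in \<open>auto simp: sp\<close>)
qed

lemma measures_of_massI:
  assumes "sets \<nu> = sets borel" "closed K" "emeasure \<nu> (- K) = 0" "emeasure \<nu> UNIV = ennreal c"
  shows "\<nu> \<in> measures_of_mass K c"
proof -
  have Ks: "K \<in> sets \<nu>" "- K \<in> sets \<nu>" using assms by auto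
  have "emeasure \<nu> UNIV = emeasure \<nu> K + emeasure \<nu> (- K)"
    using plus_emeasure[of K \<nu> "- K"] Ks by (simp add: Compl_partition)
  moreover have "measure_supp \<nu> \<subseteq> K"
  proof
    fix x assume "x \<in> measure_supp \<nu>"
    then have "open (- K) \<and> x \<in> - K \<longrightarrow> 0 < emeasure \<nu> (- K)"
      unfolding measure_supp_def by blast
    then show "x \<in> K" using assms by auto
  qed
  ultimately show ?thesis using assms by (simp add: measures_of_mass_def)
qed

lemma topspace_weak_star [simp]: "topspace (weak_star_topology K c) = measures_of_mass K c"
proof (intro equalityI subsetI)
  fix \<nu> assume \<nu>: "\<nu> \<in> measures_of_mass K c"
  \<comment> \<open>The test function 0 with the open set \<open>UNIV\<close> exhibits the whole set
    as one of the generators.\<close>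
  have "{\<nu> \<in> measures_of_mass K c. (LINT x:K|\<nu>. 0) \<in> (UNIV :: real set)} \<in>
      {{\<nu> \<in> measures_of_mass K c. (LINT x:K|\<nu>. f x) \<in> U} | f U. continuous_on K f \<and> open (U :: real set)}"
    by (intro CollectI exI[of _ "\<lambda>_. 0"] exI[of _ UNIV]) simp
  then show "\<nu> \<in> topspace (weak_star_topology K c)"
    unfolding weak_star_topology_def topology_generated_by_topspace using \<nu> by blast
next
  fix \<nu> assume "\<nu> \<in> topspace (weak_star_topology K c)"
  then show "\<nu> \<in> measures_of_mass K c"
    unfolding weak_star_topology_def topology_generated_by_topspace by blast
qed

lemma topspace_M_topology [simp]: "topspace (M_topology p \<Gamma> r) = M_space p \<Gamma> r"
  by (simp add: M_topology_def M_space_def)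

lemma continuous_map_weak_star_integral:
  assumes "continuous_on K f"
  shows "continuous_map (weak_star_topology K c) euclideanreal (\<lambda>\<nu>. LINT x:K|\<nu>. f x)"
  unfolding continuous_map_def
proof (intro conjI allI impI)
  fix U assume "openin euclideanreal U"
  then show "openin (weak_star_topology K c)
      {x \<in> topspace (weak_star_topology K c). (LINT y:K|x. f y) \<in> U}"
    using assms unfolding topspace_weak_star unfolding weak_star_topology_def
    by (intro topology_generated_by_Basis CollectI exI[of _ f] exI[of _ U]) simp
qed simp

lemma continuous_map_into_weak_star:
  assumes "\<And>x. x \<in> topspace X \<Longrightarrow> g x \<in> measures_of_mass K c"
    and "\<And>f. continuous_on K f \<Longrightarrow> continuous_map X euclideanreal (\<lambda>x. LINT y:K|g x. f y)"
  shows "continuous_map X (weak_star_topology K c) g"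
  unfolding weak_star_topology_def
proof (rule continuous_on_generated_topo)
  fix U
  assume "U \<in> {{\<nu> \<in> measures_of_mass K c. (LINT x:K|\<nu>. f x) \<in> U} |f U. continuous_on K f \<and> open (U::real set)}"
  then obtain f V where f: "continuous_on K f" "open (V::real set)"
    "U = {\<nu> \<in> measures_of_mass K c. (LINT x:K|\<nu>. f x) \<in> V}" by blast
  have "g -` U \<inter> topspace X = {x \<in> topspace X. (LINT y:K|g x. f y) \<in> V}"
    using assms(1) f(3) by auto
  then show "openin X (g -` U \<inter> topspace X)"
    using assms(2)[OF f(1)] f(2) by (simp add: openin_continuous_map_preimage)
next
  show "g ` topspace X \<subseteq> \<Union> {{\<nu> \<in> measures_of_mass K c. (LINT x:K|\<nu>. f x) \<in> U} |f U. continuous_on K f \<and> open (U::real set)}"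
    using assms(1) topspace_weak_star[of K c]
    unfolding weak_star_topology_def topology_generated_by_topspace by blast
qed

lemma set_integrable_measures_of_mass:
  fixes f :: "real \<Rightarrow> 'a::{banach,second_countable_topology}"
  assumes "\<nu> \<in> measures_of_mass K c" "compact K" "continuous_on K f"
  shows "set_integrable \<nu> K f"
proof -
  have cl: "closed K" using assms compact_imp_closed by blast
  note D = measures_of_massD[OF assms(1) cl]
  interpret finite_measure \<nu> by (rule D)
  obtain B where B: "\<And>x. x \<in> K \<Longrightarrow> norm (f x) \<le> B"
    using compact_imp_bounded[OF compact_continuous_image[OF assms(3,2)]]
    by (auto simp: bounded_iff)
  have m: "(\<lambda>x. indicator K x *\<^sub>R f x) \<in> borel_measurable \<nu>"
    using borel_measurable_continuous_on_indicator[of K f] assms(3) cl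
    by (simp add: measurable_cong_sets[OF D(1) refl])
  show ?thesis unfolding set_integrable_def
    by (rule integrable_const_bound[of _ "\<bar>B\<bar>"])
      (use B m in \<open>auto simp: indicator_def intro!: AE_I2, force\<close>)
qed

lemma set_integral_const_measures_of_mass:
  assumes "\<nu> \<in> measures_of_mass K c" "compact K" "0 \<le> c"
  shows "(LINT x:K|\<nu>. (k::real)) = k * c"
proof -
  note D = measures_of_massD[OF assms(1) compact_imp_closed[OF assms(2)]]
  have "measure \<nu> K = c" using D(4) assms(3) by (simp add: measure_def)
  then show ?thesis
    using D(1) assms(2) by (simp add: set_lebesgue_integral_def compact_imp_closed mult.commute)
qed

lemma set_integral_dist_le:
  fixes f g :: "real \<Rightarrow> real"
  assumes \<nu>: "\<nu> \<in> measures_of_mass K c" "compact K" "0 \<le> c"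
    and f: "continuous_on K f" "continuous_on K g"
    and e: "\<And>x. x \<in> K \<Longrightarrow> \<bar>f x - g x\<bar> \<le> e"
  shows "\<bar>(LINT x:K|\<nu>. f x) - (LINT x:K|\<nu>. g x)\<bar> \<le> e * c"
proof -
  note I = set_integrable_measures_of_mass[OF \<nu>(1,2)]
  have d: "(LINT x:K|\<nu>. f x) - (LINT x:K|\<nu>. g x) = (LINT x:K|\<nu>. f x - g x)"
    by (rule set_integral_diff(2)[symmetric]) (rule I f)+
  have "(LINT x:K|\<nu>. f x - g x) \<le> (LINT x:K|\<nu>. e)"
    by (rule set_integral_mono) (use e f in \<open>fastforce intro!: I continuous_intros\<close>)+
  moreover have "(LINT x:K|\<nu>. - e) \<le> (LINT x:K|\<nu>. f x - g x)"
    by (rule set_integral_mono) (use e f in \<open>fastforce intro!: I continuous_intros\<close>)+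
  ultimately show ?thesis
    unfolding d by (simp add: set_integral_const_measures_of_mass[OF \<nu>] abs_le_iff)
qed

section \<open>Uniqueness and compactness through moments\<close>

lemma set_integral_polynomial:
  assumes "\<nu> \<in> measures_of_mass K c" "compact K"
  shows "(LINT x:K|\<nu>. (\<Sum>i\<le>m. q i * x ^ i)) = (\<Sum>i\<le>m. q i * (LINT x:K|\<nu>. x ^ i))"
proof -
  have "(LINT x:K|\<nu>. (\<Sum>i\<le>m. q i * x ^ i)) = (\<Sum>i\<le>m. LINT x:K|\<nu>. q i * x ^ i)"
    unfolding set_lebesgue_integral_def scaleR_sum_right
    by (rule Bochner_Integration.integral_sum)
      (rule set_integrable_measures_of_mass[OF assms, unfolded set_integrable_def], intro continuous_intros)
  then show ?thesis by simp
qed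

lemma polynomial_approx:
  fixes f :: "real \<Rightarrow> real"
  assumes "compact K" "continuous_on K f" "0 < e"
  shows "\<exists>q m. \<forall>x\<in>K. \<bar>f x - (\<Sum>i\<le>m. q i * x ^ i)\<bar> < e"
  using Stone_Weierstrass_real_polynomial_function[OF assms] real_polynomial_function_iff_sum
  by metis

lemma set_integral_eq_if_moments_eq:
  assumes "\<nu> \<in> measures_of_mass K c" "\<nu>' \<in> measures_of_mass K c" "compact K" "0 \<le> c"
    and eq: "\<And>k. (LINT x:K|\<nu>. x ^ k) = (LINT x:K|\<nu>'. x ^ k)"
    and f: "continuous_on K (f :: real \<Rightarrow> real)"
  shows "(LINT x:K|\<nu>. f x) = (LINT x:K|\<nu>'. f x)"
proof -
  have "\<bar>(LINT x:K|\<nu>. f x) - (LINT x:K|\<nu>'. f x)\<bar> \<le> e" if "e > 0" for e :: real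
  proof -
    \<comment> \<open>The denominator has \<open>c + 1\<close> instead of \<open>c\<close> because
      mass 0 is allowed here; each of the two approximation errors is then at most
      \<open>e / 2\<close>.\<close>
    have "0 < e / (2 * (c + 1))" using that assms(4) by simp
    from polynomial_approx[OF assms(3) f this]
    obtain q m where q: "\<And>x. x \<in> K \<Longrightarrow> \<bar>f x - (\<Sum>i\<le>m. q i * x ^ i)\<bar> < e / (2 * (c + 1))"
      by blast
    let ?P = "\<lambda>x. \<Sum>i\<le>m. q i * x ^ i"
    have P: "continuous_on K ?P" by (intro continuous_intros)
    have "e / (2 * (c + 1)) * c \<le> e / 2"
      using assms(4) that by (simp add: field_simps)
    moreover have "\<bar>(LINT x:K|\<nu>. f x) - (LINT x:K|\<nu>. ?P x)\<bar> \<le> e / (2 * (c + 1)) * c"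
      by (rule set_integral_dist_le[OF assms(1,3,4) f P]) (use q in force)
    moreover have "\<bar>(LINT x:K|\<nu>'. f x) - (LINT x:K|\<nu>'. ?P x)\<bar> \<le> e / (2 * (c + 1)) * c"
      by (rule set_integral_dist_le[OF assms(2,3,4) f P]) (use q in force)
    moreover have "(LINT x:K|\<nu>. ?P x) = (LINT x:K|\<nu>'. ?P x)"
      using assms by (simp add: set_integral_polynomial)
    ultimately show ?thesis by linarith
  qed
  then show ?thesis
    by (metis abs_le_zero_iff field_le_epsilon add.left_neutral eq_iff_diff_eq_0)
qed

text \<open>Normalization to mass 1 gives access to characteristic functions and to the tightness
  criterion for real distributions.\<close>

lemma real_distribution_scale:
  assumes "\<nu> \<in> measures_of_mass K c" "closed K" "0 < c"
  shows "real_distribution (scale_measure (ennreal (1 / c)) \<nu>)"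
proof -
  note D = measures_of_massD[OF assms(1,2)]
  have "prob_space (scale_measure (ennreal (1 / c)) \<nu>)"
    by (rule prob_spaceI) (use D assms(3) in \<open>simp add: space_scale_measure ennreal_mult[symmetric]\<close>)
  then show ?thesis
    by (simp add: real_distribution_def real_distribution_axioms_def D(1))
qed

lemma integral_scale_measure:
  fixes f :: "'a \<Rightarrow> 'b::{banach,second_countable_topology}"
  assumes "f \<in> borel_measurable M" "0 \<le> c"
  shows "integral\<^sup>L (scale_measure (ennreal c) M) f = c *\<^sub>R integral\<^sup>L M f"
proof -
  have "scale_measure (ennreal c) M = density M (\<lambda>_. ennreal c)"
    by (rule measure_eqI) (simp_all add: emeasure_density_const)
  then show ?thesis using assms by (simp add: integral_density)
qed

lemma set_integral_measures_of_mass_eq: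
  fixes f :: "real \<Rightarrow> 'a::{banach,second_countable_topology}"
  assumes "\<nu> \<in> measures_of_mass K c" "closed K" "f \<in> borel_measurable borel"
  shows "(LINT x:K|\<nu>. f x) = (\<integral>x. f x \<partial>\<nu>)"
proof -
  note D = measures_of_massD[OF assms(1,2)]
  have m: "f \<in> borel_measurable \<nu>" using assms(3) by (simp add: measurable_cong_sets[OF D(1) refl])
  show ?thesis unfolding set_lebesgue_integral_def
  proof (rule integral_cong_AE)
    show "(\<lambda>x. indicator K x *\<^sub>R f x) \<in> borel_measurable \<nu>"
      using m assms(2) D(1) by (intro borel_measurable_scaleR borel_measurable_indicator) auto
  qed (use D m in \<open>auto elim: eventually_mono\<close>)
qed

text \<open>Real and imaginary part of the characteristic function are integrals of cosines and
  sines, which are continuous test functions. Equal integrals thus give equal characteristic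
  functions, and Levy uniqueness applies to the normalized measures.\<close>

lemma measures_of_mass_eqI:
  assumes \<nu>: "\<nu> \<in> measures_of_mass K c" "\<nu>' \<in> measures_of_mass K c" and K: "compact K" and c: "0 < c"
    and eq: "\<And>f :: real \<Rightarrow> real. continuous_on K f \<Longrightarrow> (LINT x:K|\<nu>. f x) = (LINT x:K|\<nu>'. f x)"
  shows "\<nu> = \<nu>'"
proof -
  let ?s = "\<lambda>\<nu>. scale_measure (ennreal (1 / c)) \<nu>"
  have cl: "closed K" using K compact_imp_closed by blast
  have rd: "real_distribution (?s \<nu>)" "real_distribution (?s \<nu>')"
    using real_distribution_scale[OF _ cl c] \<nu> by auto
  have ch: "char (?s \<nu>) t = Complex ((LINT x:K|\<nu>. cos (t * x)) / c) ((LINT x:K|\<nu>. sin (t * x)) / c)"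
    if \<nu>: "\<nu> \<in> measures_of_mass K c" for \<nu> t
  proof -
    note D = measures_of_massD[OF \<nu> cl]
    have [measurable_cong]: "sets \<nu> = sets borel" by (rule D)
    interpret finite_measure \<nu> by (rule D)
    have "char (?s \<nu>) t = (1 / c) *\<^sub>R (\<integral>x. iexp (t * x) \<partial>\<nu>)"
      unfolding char_def using c by (intro integral_scale_measure) simp_all
    moreover have i: "integrable \<nu> (\<lambda>x. iexp (t * x))"
      by (rule integrable_const_bound[of _ 1]) auto
    have "Re (\<integral>x. iexp (t * x) \<partial>\<nu>) = (\<integral>x. cos (t * x) \<partial>\<nu>)"
      "Im (\<integral>x. iexp (t * x) \<partial>\<nu>) = (\<integral>x. sin (t * x) \<partial>\<nu>)"
      using integral_Re[OF i] integral_Im[OF i] by (simp_all add: Re_exp Im_exp)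
    ultimately show ?thesis
      by (simp add: complex_eq_iff set_integral_measures_of_mass_eq[OF \<nu> cl, of "\<lambda>x. cos (t * x)"]
          set_integral_measures_of_mass_eq[OF \<nu> cl, of "\<lambda>x. sin (t * x)"])
  qed
  have "char (?s \<nu>) = char (?s \<nu>')"
    by (rule ext) (simp add: ch \<nu> eq continuous_intros)
  then have "?s \<nu> = ?s \<nu>'" by (rule Levy_uniqueness[OF rd])
  then have "scale_measure (ennreal c) (?s \<nu>) = scale_measure (ennreal c) (?s \<nu>')" by simp
  then show ?thesis using c by (simp add: ennreal_mult[symmetric])
qed

lemma tendsto_fun_iff:
  fixes f :: "'a \<Rightarrow> 'i \<Rightarrow> 'b::topological_space"
  shows "(f \<longlongrightarrow> l) F \<longleftrightarrow> (\<forall>i. ((\<lambda>x. f x i) \<longlongrightarrow> l i) F)"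
  using limitin_componentwise[of "\<lambda>_. euclidean" UNIV f l F]
  unfolding euclidean_product_topology limitin_canonical_iff by simp

text \<open>Tightness delivers convergent subsequences, which amount to compactness only in a
  metrizable space. Hence the statement concerns the moment sequences, points of a countable product
  of lines; \<open>compact_space_weak_star\<close> goes back to the measures.\<close>

lemma compact_moments:
  assumes "a < b" "0 < c"
  shows "compact ((\<lambda>\<nu> k. LINT x:{a..b}|\<nu>. x ^ k) ` measures_of_mass {a..b} c :: (nat \<Rightarrow> real) set)"
    (is "compact (?\<phi> ` ?M)")
  unfolding compact_eq_seq_compact_metric seq_compact_def
proof (intro allI impI)
  fix s :: "nat \<Rightarrow> nat \<Rightarrow> real" assume "\<forall>n. s n \<in> ?\<phi> ` ?M"
  then obtain \<nu> where \<nu>: "\<And>n. \<nu> n \<in> ?M" and s: "\<And>n. s n = ?\<phi> (\<nu> n)"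
    unfolding image_iff by metis
  \<comment> \<open>The clamp extends test functions from \<open>{a..b}\<close> to bounded
    continuous functions on the line, as weak convergence of real distributions requires.\<close>
  let ?cl = "\<lambda>x. max a (min b x)"
  define P where "P n = scale_measure (ennreal (1 / c)) (\<nu> n)" for n
  have rd: "real_distribution (P n)" for n
    unfolding P_def by (rule real_distribution_scale[OF \<nu> _ assms(2)]) simp
  have "tight P"
    unfolding tight_def
  proof (intro conjI allI impI rd)
    fix e :: real assume "0 < e"
    \<comment> \<open>The interval is open on the left, so it starts at \<open>a - 1\<close> in
      order to contain a possible atom at \<open>a\<close>.\<close>
    have "measure (P n) {a - 1<..b} = 1" for n
    proof -
      note D = measures_of_massD[OF \<nu>[of n] closed_atLeastAtMost]
      have "ennreal c \<le> emeasure (\<nu> n) {a - 1<..b}"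
        unfolding D(4)[symmetric] by (rule emeasure_mono) (auto simp: D(1))
      moreover have "emeasure (\<nu> n) {a - 1<..b} \<le> ennreal c"
        unfolding D(5)[symmetric] by (rule emeasure_mono) (auto simp: D(1))
      ultimately have "emeasure (\<nu> n) {a - 1<..b} = ennreal c" by (rule antisym[rotated])
      then show ?thesis using assms(2) by (simp add: P_def measure_def ennreal_mult[symmetric] del: ennreal_1)
    qed
    then show "\<exists>a b. a < b \<and> (\<forall>n. 1 - e < measure (P n) {a<..b})"
      using \<open>0 < e\<close> assms(1) by (intro exI[of _ "a - 1"] exI[of _ b]) auto
  qed
  then obtain \<rho> L where \<rho>: "strict_mono \<rho>" and L: "real_distribution L"
    and conv: "weak_conv_m (P \<circ> id \<circ> \<rho>) L"
    using tight_imp_convergent_subsubsequence[of P id] by (auto simp: strict_mono_id)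
  interpret L: real_distribution L by (rule L)
  have lim: "(\<lambda>n. integral\<^sup>L (P (\<rho> n)) f) \<longlonglongrightarrow> integral\<^sup>L L f"
    if "\<And>x. isCont f x" "\<And>x. norm (f x) \<le> B" for f :: "real \<Rightarrow> real" and B
    using weak_conv_imp_integral_bdd_continuous_conv[of "P \<circ> id \<circ> \<rho>" L f B] rd L conv that
    by simp
  have cont_clamp: "isCont ?cl x" for x by (intro continuous_intros)
  have int: "integral\<^sup>L (P n) (\<lambda>x. f (?cl x)) = (LINT x:{a..b}|\<nu> n. f x) / c"
    if "continuous_on UNIV (\<lambda>x. f (?cl x))" for f :: "real \<Rightarrow> real" and n
  proof -
    note D = measures_of_massD[OF \<nu>[of n] closed_atLeastAtMost]
    have m: "(\<lambda>x. f (?cl x)) \<in> borel_measurable borel"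
      using that by (rule borel_measurable_continuous_onI)
    have "integral\<^sup>L (P n) (\<lambda>x. f (?cl x)) = (\<integral>x. f (?cl x) \<partial>\<nu> n) / c"
      unfolding P_def using assms m
      by (subst integral_scale_measure) (auto simp: measurable_cong_sets[OF D(1) refl])
    also have "(\<integral>x. f (?cl x) \<partial>\<nu> n) = (LINT x:{a..b}|\<nu> n. f (?cl x))"
      by (rule set_integral_measures_of_mass_eq[OF \<nu> closed_atLeastAtMost m, symmetric])
    also have "\<dots> = (LINT x:{a..b}|\<nu> n. f x)"
      unfolding set_lebesgue_integral_def
      by (rule Bochner_Integration.integral_cong) (auto simp: indicator_def max_def min_def)
    finally show ?thesis .
  qed
  \<comment> \<open>A bounded continuous function that vanishes exactly on \<open>{a..b}\<close>.
    Its integral is 0 along the sequence, hence also for the limit, which therefore has no mass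
    outside of the interval.\<close>
  let ?d = "\<lambda>x. min 1 \<bar>x - ?cl x\<bar>"
  have "(\<lambda>n. integral\<^sup>L (P (\<rho> n)) ?d) \<longlonglongrightarrow> integral\<^sup>L L ?d"
    by (rule lim[of _ 1]) (auto intro!: continuous_intros)
  moreover have "integral\<^sup>L (P n) ?d = 0" for n
  proof -
    note D = measures_of_massD[OF \<nu>[of n] closed_atLeastAtMost]
    have "AE x in P n. ?d x = 0"
      unfolding P_def using D(7)
      by (intro AE_I'[of "- {a..b}"])
        (use D(1,3) in \<open>auto simp: null_sets_def max_def min_def space_scale_measure\<close>)
    then show ?thesis by (rule integral_eq_zero_AE)
  qed
  ultimately have "integral\<^sup>L L ?d = 0" by (simp add: LIMSEQ_const_iff)
  moreover have "integrable L ?d"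
    by (rule L.integrable_const_bound[of _ 1]) auto
  ultimately have "AE x in L. ?d x = 0"
    by (subst (asm) integral_nonneg_eq_0_iff_AE) auto
  then have AEL: "AE x in L. x \<in> {a..b}"
    by eventually_elim (use assms(1) in \<open>auto simp: max_def min_def split: if_splits\<close>)
  define \<mu> where "\<mu> = scale_measure (ennreal c) L"
  have "emeasure L (- {a..b}) = 0"
    using AE_iff_null_sets[of "- {a..b}" L] AEL by (simp add: null_setsD1)
  then have \<mu>: "\<mu> \<in> ?M"
    using L.emeasure_space_1 by (intro measures_of_massI) (auto simp: \<mu>_def)
  have "(\<lambda>n. s (\<rho> n) k) \<longlonglongrightarrow> ?\<phi> \<mu> k" for k
  proof -
    let ?f = "\<lambda>x. (?cl x) ^ k"
    have bd: "norm (?f x) \<le> (\<bar>a\<bar> + \<bar>b\<bar>) ^ k" for x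
      by (auto simp: power_abs intro!: power_mono)
    have "(\<lambda>n. integral\<^sup>L (P (\<rho> n)) ?f) \<longlonglongrightarrow> integral\<^sup>L L ?f"
      by (rule lim[OF _ bd]) (intro continuous_intros)
    then have "(\<lambda>n. ?\<phi> (\<nu> (\<rho> n)) k / c) \<longlonglongrightarrow> integral\<^sup>L L ?f"
      by (subst (asm) int) (auto intro!: continuous_intros)
    then have "(\<lambda>n. ?\<phi> (\<nu> (\<rho> n)) k / c * c) \<longlonglongrightarrow> integral\<^sup>L L ?f * c"
      by (intro tendsto_intros)
    moreover have "integral\<^sup>L L ?f * c = ?\<phi> \<mu> k"
    proof -
      have 1: "?\<phi> \<mu> k = integral\<^sup>L \<mu> (\<lambda>x. x ^ k)"
        by (rule set_integral_measures_of_mass_eq[OF \<mu>]) auto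
      have 2: "integral\<^sup>L \<mu> (\<lambda>x. x ^ k) = c * integral\<^sup>L L (\<lambda>x. x ^ k)"
        unfolding \<mu>_def using assms by (subst integral_scale_measure) auto
      have 3: "integral\<^sup>L L (\<lambda>x. x ^ k) = integral\<^sup>L L ?f"
      proof (rule integral_cong_AE)
        show "AE x in L. x ^ k = ?f x"
          using AEL by eventually_elim (use assms(1) in \<open>auto simp: max_def min_def\<close>)
      qed auto
      show ?thesis unfolding 1 2 3 by (rule mult.commute)
    qed
    ultimately show ?thesis using assms unfolding s by simp
  qed
  then have "(s \<circ> \<rho>) \<longlonglongrightarrow> ?\<phi> \<mu>" unfolding tendsto_fun_iff comp_def by blast
  then show "\<exists>l\<in>?\<phi> ` ?M. \<exists>r. strict_mono r \<and> (s \<circ> r) \<longlonglongrightarrow> l"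
    using \<rho> \<mu> by blast
qed

text \<open>The moment map is injective, and its inverse is continuous on the compact set of moment
  sequences: integrals of polynomials are finite linear combinations of moments, and the integral of
  any test function is a uniform limit of such combinations because all masses equal
  \<open>c\<close>. The space is a continuous image of a compact set.\<close>

lemma compact_space_weak_star:
  assumes "a < b" "0 < c"
  shows "compact_space (weak_star_topology {a..b} c)"
proof -
  let ?M = "measures_of_mass {a..b} c"
  define \<phi> where "\<phi> = (\<lambda>\<nu> (k::nat). LINT x:{a..b}|\<nu>. x ^ k :: real)"
  define g where "g = inv_into ?M \<phi>"
  have inj: "inj_on \<phi> ?M"
  proof (rule inj_onI)
    fix \<nu> \<nu>' assume \<nu>: "\<nu> \<in> ?M" "\<nu>' \<in> ?M" and "\<phi> \<nu> = \<phi> \<nu>'"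
    then have mom: "(LINT x:{a..b}|\<nu>. x ^ k :: real) = (LINT x:{a..b}|\<nu>'. x ^ k)" for k
      unfolding \<phi>_def by meson
    show "\<nu> = \<nu>'"
      by (rule measures_of_mass_eqI[OF \<nu> compact_Icc assms(2)])
        (rule set_integral_eq_if_moments_eq[OF \<nu> compact_Icc less_imp_le[OF assms(2)] mom])
  qed
  have gM: "g m \<in> ?M" and \<phi>g: "\<phi> (g m) = m" if "m \<in> \<phi> ` ?M" for m
    using that by (auto simp: g_def inv_into_into f_inv_into_f)
  have "continuous_map (top_of_set (\<phi> ` ?M)) (weak_star_topology {a..b} c) g"
  proof (rule continuous_map_into_weak_star)
    fix f :: "real \<Rightarrow> real" assume f: "continuous_on {a..b} f"
    have "\<exists>q m. \<forall>x\<in>{a..b}. \<bar>f x - (\<Sum>i\<le>m. q i * x ^ i)\<bar> < inverse (real (Suc n))" for n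
    proof -
      have "0 < inverse (real (Suc n))" by simp
      from polynomial_approx[OF compact_Icc f this] show ?thesis .
    qed
    then have "\<forall>n. \<exists>q m. \<forall>x\<in>{a..b}. \<bar>f x - (\<Sum>i\<le>m. q i * x ^ i)\<bar> < inverse (real (Suc n))" ..
    from choice[OF this] obtain q where
      "\<forall>n. \<exists>m. \<forall>x\<in>{a..b}. \<bar>f x - (\<Sum>i\<le>m. q n i * x ^ i)\<bar> < inverse (real (Suc n))" ..
    from choice[OF this] obtain m where qm: "\<And>n x. x \<in> {a..b} \<Longrightarrow>
        \<bar>f x - (\<Sum>i\<le>m n. q n i * x ^ i)\<bar> < inverse (real (Suc n))" by blast
    let ?F = "\<lambda>s. LINT x:{a..b}|g s. f x"
    have bound: "\<bar>(\<Sum>i\<le>m n. q n i * s i) - ?F s\<bar> \<le> c * inverse (real (Suc n))" if s: "s \<in> \<phi> ` ?M" for s n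
    proof -
      have "\<bar>?F s - (LINT x:{a..b}|g s. (\<Sum>i\<le>m n. q n i * x ^ i))\<bar> \<le> inverse (real (Suc n)) * c"
        by (rule set_integral_dist_le[OF gM[OF s]])
          (use assms qm f in \<open>auto intro!: continuous_intros less_imp_le\<close>)
      moreover have "(LINT x:{a..b}|g s. x ^ i) = s i" for i
        using fun_cong[OF \<phi>g[OF s], of i] unfolding \<phi>_def .
      ultimately show ?thesis
        unfolding set_integral_polynomial[OF gM[OF s] compact_Icc]
        by (simp only: abs_minus_commute mult.commute[of c])
    qed
    have "uniform_limit (\<phi> ` ?M) (\<lambda>n s. \<Sum>i\<le>m n. q n i * s i) ?F sequentially"
    proof (rule uniform_limitI)
      fix e :: real assume "0 < e"
      have "(\<lambda>n. c * inverse (real (Suc n))) \<longlonglongrightarrow> c * 0"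
        by (intro tendsto_intros LIMSEQ_inverse_real_of_nat)
      then have "\<forall>\<^sub>F n in sequentially. c * inverse (real (Suc n)) < e"
        using \<open>0 < e\<close> by (simp add: order_tendsto_iff)
      then show "\<forall>\<^sub>F n in sequentially. \<forall>s\<in>\<phi> ` ?M. dist (\<Sum>i\<le>m n. q n i * s i) (?F s) < e"
      proof eventually_elim
        case (elim n)
        show ?case
          unfolding dist_real_def using le_less_trans[OF bound elim] by blast
      qed
    qed
    then have "continuous_on (\<phi> ` ?M) ?F"
      by (rule uniform_limit_theorem[rotated])
        (auto intro!: always_eventually continuous_intros continuous_on_subset[OF continuous_on_product_coordinates])
    then show "continuous_map (top_of_set (\<phi> ` ?M)) euclideanreal ?F"
      by simp
  qed (use gM in auto)
  then have "compactin (weak_star_topology {a..b} c) (g ` (\<phi> ` ?M))"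
    by (rule image_compactin[rotated]) (use compact_moments[OF assms] in \<open>simp add: \<phi>_def compactin_subtopology\<close>)
  moreover have "g ` (\<phi> ` ?M) = ?M"
    using inj by (simp add: g_def image_comp inv_into_image_cancel)
  ultimately show ?thesis by (simp add: compact_space_def)
qed

lemma Hausdorff_space_weak_star:
  assumes "a < b" "0 < c"
  shows "Hausdorff_space (weak_star_topology {a..b} c)"
  unfolding Hausdorff_space_def
proof (intro allI impI)
  fix \<nu> \<nu>'
  assume A: "\<nu> \<in> topspace (weak_star_topology {a..b} c) \<and> \<nu>' \<in> topspace (weak_star_topology {a..b} c) \<and> \<nu> \<noteq> \<nu>'"
  then obtain f :: "real \<Rightarrow> real" where f: "continuous_on {a..b} f"
    and ne: "(LINT x:{a..b}|\<nu>. f x) \<noteq> (LINT x:{a..b}|\<nu>'. f x)"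
    using measures_of_mass_eqI[of \<nu> "{a..b}" c \<nu>'] assms by auto
  let ?F = "\<lambda>\<nu>. LINT x:{a..b}|\<nu>. f x"
  obtain U V where UV: "open U" "open V" "?F \<nu> \<in> U" "?F \<nu>' \<in> V" "U \<inter> V = {}"
    using hausdorff[OF ne] by blast
  have op: "openin (weak_star_topology {a..b} c) {\<nu> \<in> topspace (weak_star_topology {a..b} c). ?F \<nu> \<in> W}"
    if "open W" for W
    using openin_continuous_map_preimage[OF continuous_map_weak_star_integral[OF f, of c], of W] that by simp
  show "\<exists>U V. openin (weak_star_topology {a..b} c) U \<and> openin (weak_star_topology {a..b} c) V \<and>
      \<nu> \<in> U \<and> \<nu>' \<in> V \<and> disjnt U V"
    using op[OF UV(1)] op[OF UV(2)] UV A unfolding disjnt_def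
    by (intro exI conjI) (assumption, assumption, auto)
qed

lemma compact_Hausdorff_M_topology:
  assumes "\<And>i. i < p \<Longrightarrow> a i < b i" "\<And>i. i < p \<Longrightarrow> \<Gamma> i = {a i..b i}" "\<And>i. i < p \<Longrightarrow> 0 < r i"
  shows "compact_space (M_topology p \<Gamma> r)" "Hausdorff_space (M_topology p \<Gamma> r)"
  using compact_space_weak_star Hausdorff_space_weak_star assms
  unfolding M_topology_def by (simp_all add: compact_space_product_topology Hausdorff_space_product_topology)

section \<open>Double integrals against product measures\<close>

lemma set_integrable_pair_measures_of_mass:
  fixes g :: "real \<times> real \<Rightarrow> real"
  assumes \<mu>: "\<mu> \<in> measures_of_mass K c" and \<nu>: "\<nu> \<in> measures_of_mass K' c'"
    and K: "compact K" "compact K'" and g: "continuous_on (K \<times> K') g"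
  shows "set_integrable (\<mu> \<Otimes>\<^sub>M \<nu>) (K \<times> K') g"
proof -
  note D = measures_of_massD[OF \<mu> compact_imp_closed[OF K(1)]]
  note D' = measures_of_massD[OF \<nu> compact_imp_closed[OF K(2)]]
  have [measurable_cong]: "sets \<mu> = sets borel" "sets \<nu> = sets borel" by (rule D D')+
  interpret finite_measure "\<mu> \<Otimes>\<^sub>M \<nu>"
    by (rule finite_measure_pair_measure) (rule D D')+
  have KK: "compact (K \<times> K')" using K by (rule compact_Times)
  obtain B where B: "\<forall>x \<in> K \<times> K'. norm (g x) \<le> B"
    using compact_imp_bounded[OF compact_continuous_image[OF g KK]] by (auto simp: bounded_iff)
  have "(\<lambda>x. indicator (K \<times> K') x *\<^sub>R g x) \<in> borel_measurable borel"
    using g by (intro borel_measurable_continuous_on_indicator borel_closed compact_imp_closed[OF KK])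
  then have m: "(\<lambda>x. indicator (K \<times> K') x *\<^sub>R g x) \<in> borel_measurable (\<mu> \<Otimes>\<^sub>M \<nu>)"
    by (simp add: borel_prod[symmetric] cong: measurable_cong_sets sets_pair_measure_cong)
  show ?thesis unfolding set_integrable_def
  proof (rule integrable_const_bound[OF AE_I2 m])
    fix x show "norm (indicator (K \<times> K') x *\<^sub>R g x) \<le> \<bar>B\<bar>"
      using B[rule_format, of x] by (cases "x \<in> K \<times> K'") auto
  qed
qed

lemma measure_pair_measures_of_mass:
  assumes \<mu>: "\<mu> \<in> measures_of_mass K c" and \<nu>: "\<nu> \<in> measures_of_mass K' c'"
    and K: "compact K" "compact K'" and c: "0 \<le> c" "0 \<le> c'"
  shows "measure (\<mu> \<Otimes>\<^sub>M \<nu>) (K \<times> K') = c * c'" "K \<times> K' \<in> sets (\<mu> \<Otimes>\<^sub>M \<nu>)"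
proof -
  note D = measures_of_massD[OF \<mu> compact_imp_closed[OF K(1)]]
  note D' = measures_of_massD[OF \<nu> compact_imp_closed[OF K(2)]]
  interpret finite_measure \<nu> by (rule D')
  have s: "K \<in> sets \<mu>" "K' \<in> sets \<nu>"
    using K by (auto simp: D(1) D'(1) compact_imp_closed)
  then show "K \<times> K' \<in> sets (\<mu> \<Otimes>\<^sub>M \<nu>)" by (rule pair_measureI)
  have "emeasure (\<mu> \<Otimes>\<^sub>M \<nu>) (K \<times> K') = ennreal (c * c')"
    using emeasure_pair_measure_Times[OF s] c by (simp add: D D' ennreal_mult)
  then show "measure (\<mu> \<Otimes>\<^sub>M \<nu>) (K \<times> K') = c * c'"
    using c by (simp add: measure_def)
qed

lemma set_integral_pair_dist_le:
  fixes f g :: "real \<times> real \<Rightarrow> real"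
  assumes \<mu>: "\<mu> \<in> measures_of_mass K c" "\<nu> \<in> measures_of_mass K' c'"
    "compact K" "compact K'" and c: "0 \<le> c" "0 \<le> c'"
    and f: "continuous_on (K \<times> K') f" "continuous_on (K \<times> K') g"
    and e: "\<And>z. z \<in> K \<times> K' \<Longrightarrow> \<bar>f z - g z\<bar> \<le> e"
  shows "\<bar>(LINT z:K\<times>K'|\<mu> \<Otimes>\<^sub>M \<nu>. f z) - (LINT z:K\<times>K'|\<mu> \<Otimes>\<^sub>M \<nu>. g z)\<bar> \<le> e * (c * c')"
proof -
  note I = set_integrable_pair_measures_of_mass[OF \<mu>]
  have d: "(LINT z:K\<times>K'|\<mu> \<Otimes>\<^sub>M \<nu>. f z) - (LINT z:K\<times>K'|\<mu> \<Otimes>\<^sub>M \<nu>. g z) = (LINT z:K\<times>K'|\<mu> \<Otimes>\<^sub>M \<nu>. f z - g z)"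
    by (rule set_integral_diff(2)[symmetric]) (rule I f)+
  have const: "(LINT z:K\<times>K'|\<mu> \<Otimes>\<^sub>M \<nu>. k) = k * (c * c')" for k :: real
    using measure_pair_measures_of_mass[OF \<mu> c]
    by (simp add: set_lebesgue_integral_def)
  have i: "set_integrable (\<mu> \<Otimes>\<^sub>M \<nu>) (K \<times> K') (\<lambda>z. f z - g z)"
    "set_integrable (\<mu> \<Otimes>\<^sub>M \<nu>) (K \<times> K') (\<lambda>z. k)" for k :: real
    by (rule I, intro continuous_intros f)+
  have "(LINT z:K\<times>K'|\<mu> \<Otimes>\<^sub>M \<nu>. f z - g z) \<le> (LINT z:K\<times>K'|\<mu> \<Otimes>\<^sub>M \<nu>. e)"
    by (rule set_integral_mono[OF i]) (use e in \<open>fastforce simp: abs_le_iff\<close>)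
  moreover have "(LINT z:K\<times>K'|\<mu> \<Otimes>\<^sub>M \<nu>. - e) \<le> (LINT z:K\<times>K'|\<mu> \<Otimes>\<^sub>M \<nu>. f z - g z)"
    by (rule set_integral_mono[OF i(2,1)]) (use e in \<open>fastforce simp: abs_le_iff\<close>)
  ultimately show ?thesis
    unfolding d const by (simp add: abs_le_iff)
qed

lemma set_integral_pair_product:
  fixes f g :: "real \<Rightarrow> real"
  assumes \<mu>: "\<mu> \<in> measures_of_mass K c" "\<nu> \<in> measures_of_mass K' c'"
    "compact K" "compact K'" and f: "continuous_on K f" "continuous_on K' g"
  shows "(LINT z:K\<times>K'|\<mu> \<Otimes>\<^sub>M \<nu>. f (fst z) * g (snd z)) = (LINT x:K|\<mu>. f x) * (LINT y:K'|\<nu>. g y)"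
proof -
  note D = measures_of_massD[OF \<mu>(1) compact_imp_closed[OF \<mu>(3)]]
  note D' = measures_of_massD[OF \<mu>(2) compact_imp_closed[OF \<mu>(4)]]
  interpret M: finite_measure \<mu> by (rule D)
  interpret N: finite_measure \<nu> by (rule D')
  interpret pair_sigma_finite \<mu> \<nu> ..
  have c1: "continuous_on (K \<times> K') (\<lambda>z. f (fst z))" "continuous_on (K \<times> K') (\<lambda>z. g (snd z))"
    by (auto intro!: continuous_on_compose2[OF f(1)] continuous_on_compose2[OF f(2)] continuous_on_fst
        continuous_on_snd continuous_on_id)
  have "set_integrable (\<mu> \<Otimes>\<^sub>M \<nu>) (K \<times> K') (\<lambda>z. f (fst z) * g (snd z))"
    by (rule set_integrable_pair_measures_of_mass[OF \<mu>]) (intro continuous_intros c1)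
  then have i: "integrable (\<mu> \<Otimes>\<^sub>M \<nu>) (\<lambda>z. indicator (K \<times> K') z *\<^sub>R (f (fst z) * g (snd z)))"
    unfolding set_integrable_def .
  have e: "indicator (K \<times> K') (x, y) *\<^sub>R (f (fst (x, y)) * g (snd (x, y)))
      = (indicator K x *\<^sub>R f x) * (indicator K' y *\<^sub>R g y)" for x y
    by (simp add: indicator_times)
  show ?thesis
    unfolding set_lebesgue_integral_def integral_fst'[OF i, symmetric] e by simp
qed

text \<open>The functions through which weak-* convergence of two measures passes to their product.\<close>

inductive tensor_sum :: "(real \<times> real \<Rightarrow> real) \<Rightarrow> bool" where
  prod: "continuous_on UNIV f \<Longrightarrow> continuous_on UNIV h \<Longrightarrow> tensor_sum (\<lambda>z. f (fst z) * h (snd z))"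
| add: "tensor_sum g \<Longrightarrow> tensor_sum g' \<Longrightarrow> tensor_sum (\<lambda>z. g z + g' z)"

lemma tensor_sum_mult:
  assumes "tensor_sum g" "tensor_sum g'"
  shows "tensor_sum (\<lambda>z. g z * g' z)"
  using assms(1)
proof induction
  case (prod f h)
  note fh = prod
  show ?case using assms(2)
  proof induction
    case (prod f' h')
    have "tensor_sum (\<lambda>z. (f (fst z) * f' (fst z)) * (h (snd z) * h' (snd z)))"
      using tensor_sum.prod[of "\<lambda>x. f x * f' x" "\<lambda>y. h y * h' y"] fh prod
      by (simp add: continuous_on_mult)
    then show ?case by (simp only: mult_ac)
  next
    case (add g1 g2)
    then show ?case unfolding distrib_left by (intro tensor_sum.add)
  qed
next
  case (add g1 g2)
  then show ?case unfolding distrib_right by (intro tensor_sum.add)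
qed

text \<open>A linear functional on the plane splits into one functional for each coordinate; sums
  and products are covered by the closure properties of tensor sums.\<close>

lemma tensor_sum_real_polynomial_function:
  assumes "real_polynomial_function g"
  shows "tensor_sum g"
  using assms
proof induction
  case (linear g)
  interpret bounded_linear g by (rule linear)
  have "g = (\<lambda>z. g (fst z, 0) * 1 + 1 * g (0, snd z))"
  proof
    fix z :: "real \<times> real"
    have "z = (fst z, 0) + (0, snd z)" by simp
    then have "g z = g ((fst z, 0) + (0, snd z))" by presburger
    then show "g z = g (fst z, 0) * 1 + 1 * g (0, snd z)" unfolding add by simp
  qed
  moreover have "tensor_sum (\<lambda>z. g (fst z, 0) * 1 + 1 * g (0, snd z))"
    by (intro tensor_sum.add tensor_sum.prod[of "\<lambda>x. g (x, 0)" "\<lambda>_. 1"]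
        tensor_sum.prod[of "\<lambda>_. 1" "\<lambda>y. g (0, y)"] continuous_on continuous_intros)
  ultimately show ?case by simp
next
  case (const c)
  show ?case using tensor_sum.prod[of "\<lambda>_. c" "\<lambda>_. 1"] by simp
next
  case (add f g)
  then show ?case by (intro tensor_sum.add)
next
  case (mult f g)
  then show ?case by (intro tensor_sum_mult)
qed

lemma continuous_on_tensor_sum:
  assumes "tensor_sum g"
  shows "continuous_on S g"
  using assms
proof induction
  case (prod f h)
  show ?case
    by (intro continuous_on_mult continuous_on_compose2[OF prod(1)] continuous_on_compose2[OF prod(2)]
        continuous_on_fst continuous_on_snd continuous_on_id subset_UNIV)
next
  case (add g g')
  then show ?case by (intro continuous_on_add)
qed

lemma continuous_map_uniform_limit_real:
  fixes g :: "'a \<Rightarrow> real"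
  assumes "\<And>e. 0 < e \<Longrightarrow> \<exists>f. continuous_map X euclideanreal f \<and> (\<forall>x\<in>topspace X. \<bar>f x - g x\<bar> \<le> e)"
  shows "continuous_map X euclideanreal g"
proof -
  have "\<forall>n. \<exists>f. continuous_map X euclideanreal f \<and> (\<forall>x\<in>topspace X. \<bar>f x - g x\<bar> \<le> inverse (real (Suc n)))"
    using assms by simp
  from choice[OF this] obtain f where f: "\<And>n. continuous_map X euclideanreal (f n)"
    "\<And>n x. x \<in> topspace X \<Longrightarrow> \<bar>f n x - g x\<bar> \<le> inverse (real (Suc n))" by blast
  have "continuous_map X Met_TC.mtopology g"
  proof (rule Met_TC.continuous_map_uniform_limit[where F = sequentially and f = f])
    show "\<forall>\<^sub>F n in sequentially. continuous_map X Met_TC.mtopology (f n)" using f(1) by simp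
    fix e :: real assume "0 < e"
    then have "\<forall>\<^sub>F n in sequentially. inverse (real (Suc n)) < e"
      using LIMSEQ_inverse_real_of_nat by (simp add: order_tendsto_iff)
    then show "\<forall>\<^sub>F n in sequentially. \<forall>x\<in>topspace X. g x \<in> UNIV \<and> dist (f n x) (g x) < e"
    proof eventually_elim
      case (elim n)
      then show ?case using f(2)[of _ n] by (force simp: dist_real_def)
    qed
  qed simp
  then show ?thesis by simp
qed

text \<open>Polynomials in two variables are tensor sums and are uniformly dense on
  \<open>K \<times> K'\<close>; the approximation error is uniform in the measures because their
  masses are fixed. This makes the truncated energies weak-* continuous.\<close>

lemma continuous_map_double_integral:
  assumes \<alpha>: "continuous_map X (weak_star_topology K c) \<alpha>"
    and \<beta>: "continuous_map X (weak_star_topology K' c') \<beta>"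
    and K: "compact K" "compact K'" and c: "0 \<le> c" "0 \<le> c'"
    and g: "continuous_on (K \<times> K') g"
  shows "continuous_map X euclideanreal (\<lambda>\<omega>. LINT z:K\<times>K'|\<alpha> \<omega> \<Otimes>\<^sub>M \<beta> \<omega>. g z)"
proof (rule continuous_map_uniform_limit_real)
  fix e :: real assume e: "0 < e"
  have mem: "\<alpha> \<omega> \<in> measures_of_mass K c" "\<beta> \<omega> \<in> measures_of_mass K' c'" if "\<omega> \<in> topspace X" for \<omega>
    using continuous_map_image_subset_topspace[OF \<alpha>] continuous_map_image_subset_topspace[OF \<beta>] that
    by auto
  have tens: "continuous_map X euclideanreal (\<lambda>\<omega>. LINT z:K\<times>K'|\<alpha> \<omega> \<Otimes>\<^sub>M \<beta> \<omega>. h z)" if "tensor_sum h" for h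
    using that
  proof induction
    case (prod f h)
    have f: "continuous_on K f" "continuous_on K' h"
      by (rule continuous_on_subset[OF prod(1)], simp, rule continuous_on_subset[OF prod(2)], simp)
    have "continuous_map X euclideanreal (\<lambda>\<omega>. (LINT x:K|\<alpha> \<omega>. f x) * (LINT y:K'|\<beta> \<omega>. h y))"
      using continuous_map_compose[OF \<alpha> continuous_map_weak_star_integral[OF f(1), of c]]
        continuous_map_compose[OF \<beta> continuous_map_weak_star_integral[OF f(2), of c']]
      by (intro continuous_map_real_mult) (simp_all add: comp_def)
    then show ?case
      by (rule continuous_map_eq) (simp add: set_integral_pair_product[OF mem K f])
  next
    case (add h h')
    have "continuous_map X euclideanreal (\<lambda>\<omega>. (LINT z:K\<times>K'|\<alpha> \<omega> \<Otimes>\<^sub>M \<beta> \<omega>. h z) + (LINT z:K\<times>K'|\<alpha> \<omega> \<Otimes>\<^sub>M \<beta> \<omega>. h' z))"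
      using add by (intro continuous_map_add)
    then show ?case
    proof (rule continuous_map_eq)
      fix \<omega> assume w: "\<omega> \<in> topspace X"
      show "(LINT z:K\<times>K'|\<alpha> \<omega> \<Otimes>\<^sub>M \<beta> \<omega>. h z) + (LINT z:K\<times>K'|\<alpha> \<omega> \<Otimes>\<^sub>M \<beta> \<omega>. h' z)
          = (LINT z:K\<times>K'|\<alpha> \<omega> \<Otimes>\<^sub>M \<beta> \<omega>. h z + h' z)"
        by (rule set_integral_add(2)[symmetric])
          (rule set_integrable_pair_measures_of_mass[OF mem[OF w] K continuous_on_tensor_sum], rule add)+
    qed
  qed
  \<comment> \<open>The summand 1 avoids a division by 0 when one of the masses vanishes.\<close>
  define e' where "e' = e / (c * c' + 1)"
  have e': "0 < e'" "e' * (c * c') \<le> e"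
    using e c by (auto simp: e'_def field_simps add_pos_nonneg add_nonneg_pos intro: divide_pos_pos)
  obtain h where h: "real_polynomial_function h" "\<And>z. z \<in> K \<times> K' \<Longrightarrow> \<bar>g z - h z\<bar> < e'"
    using Stone_Weierstrass_real_polynomial_function[OF compact_Times[OF K] g e'(1)] by metis
  have th: "tensor_sum h" using h(1) by (rule tensor_sum_real_polynomial_function)
  have "\<bar>(LINT z:K\<times>K'|\<alpha> \<omega> \<Otimes>\<^sub>M \<beta> \<omega>. h z) - (LINT z:K\<times>K'|\<alpha> \<omega> \<Otimes>\<^sub>M \<beta> \<omega>. g z)\<bar> \<le> e"
    if w: "\<omega> \<in> topspace X" for \<omega>
  proof -
    have "\<bar>h z - g z\<bar> \<le> e'" if "z \<in> K \<times> K'" for z using h(2)[OF that] by linarith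
    from set_integral_pair_dist_le[OF mem[OF w] K c continuous_on_tensor_sum[OF th] g this]
    show ?thesis using e'(2) by linarith
  qed
  then show "\<exists>f. continuous_map X euclideanreal f \<and>
      (\<forall>\<omega>\<in>topspace X. \<bar>f \<omega> - (LINT z:K\<times>K'|\<alpha> \<omega> \<Otimes>\<^sub>M \<beta> \<omega>. g z)\<bar> \<le> e)"
    using tens[OF th] by blast
qed

section \<open>Configurations\<close>

lemma sets_scaled_dirac_sum [simp, measurable_cong]: "sets (scaled_dirac_sum c m x) = sets borel"
  unfolding scaled_dirac_sum_def using sets.sigma_sets_eq[of borel] by simp

text \<open>As the image of a weighted counting measure, a sum of point masses has integrals that
  are finite sums over the indices, with coinciding points counted according to their
  multiplicity.\<close>

lemma scaled_dirac_sum_eq_distr: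
  "scaled_dirac_sum c m x = distr (point_measure {..<m} (\<lambda>_. ennreal c)) borel x"
proof -
  let ?N = "distr (point_measure {..<m} (\<lambda>_. ennreal c)) borel x"
  have e: "emeasure ?N B = ennreal c * (\<Sum>k<m. emeasure (return borel (x k)) B)" if B: "B \<in> sets borel" for B
  proof -
    have "emeasure ?N B = emeasure (point_measure {..<m} (\<lambda>_. ennreal c)) (x -` B \<inter> {..<m})"
      using B by (subst emeasure_distr) (auto simp: space_point_measure)
    also have "\<dots> = (\<Sum>k\<in>x -` B \<inter> {..<m}. ennreal c)"
      by (rule emeasure_point_measure_finite) auto
    also have "\<dots> = (\<Sum>k<m. ennreal c * indicator B (x k))"
      by (rule sum.mono_neutral_cong_left) (auto simp: indicator_def)
    finally show ?thesis using B by (simp add: sum_distrib_left)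
  qed
  have "scaled_dirac_sum c m x = measure_of UNIV (sets borel) (emeasure ?N)"
    unfolding scaled_dirac_sum_def
  proof (rule measure_of_eq)
    fix B assume "B \<in> sigma_sets UNIV (sets borel :: real set set)"
    then have "B \<in> sets borel" using sets.sigma_sets_eq[of "borel :: real measure"] by simp
    then show "ennreal c * (\<Sum>k<m. emeasure (return borel (x k)) B) = emeasure ?N B" by (simp only: e)
  qed simp
  also have "\<dots> = ?N" using measure_of_of_measure[of ?N] by simp
  finally show ?thesis .
qed

lemma emeasure_scaled_dirac_sum:
  assumes "B \<in> sets borel"
  shows "emeasure (scaled_dirac_sum c m x) B = ennreal c * (\<Sum>k<m. indicator B (x k))"
proof -
  have "emeasure (scaled_dirac_sum c m x) B = emeasure (point_measure {..<m} (\<lambda>_. ennreal c)) (x -` B \<inter> {..<m})"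
    unfolding scaled_dirac_sum_eq_distr using assms by (subst emeasure_distr) (auto simp: space_point_measure)
  also have "\<dots> = (\<Sum>k\<in>x -` B \<inter> {..<m}. ennreal c)"
    by (rule emeasure_point_measure_finite) auto
  also have "\<dots> = (\<Sum>k<m. ennreal c * indicator B (x k))"
    by (rule sum.mono_neutral_cong_left) (auto simp: indicator_def)
  finally show ?thesis by (simp add: sum_distrib_left)
qed

lemma nn_integral_scaled_dirac_sum:
  assumes "f \<in> borel_measurable borel"
  shows "(\<integral>\<^sup>+x. f x \<partial>scaled_dirac_sum c m y) = ennreal c * (\<Sum>k<m. f (y k))"
  unfolding scaled_dirac_sum_eq_distr using assms
  by (simp add: nn_integral_distr nn_integral_point_measure_finite sum_distrib_left)

lemma scaled_dirac_sum_in_measures_of_mass: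
  assumes "closed K" "\<And>k. k < m \<Longrightarrow> x k \<in> K" "0 \<le> c"
  shows "scaled_dirac_sum c m x \<in> measures_of_mass K (c * real m)"
proof (rule measures_of_massI)
  have "(\<Sum>k<m. indicator (- K) (x k)) = (0 :: ennreal)" using assms(2) by (auto simp: indicator_def)
  then show "emeasure (scaled_dirac_sum c m x) (- K) = 0"
    using assms(1) by (simp add: emeasure_scaled_dirac_sum)
  show "emeasure (scaled_dirac_sum c m x) UNIV = ennreal (c * real m)"
    using assms(3) by (simp add: emeasure_scaled_dirac_sum ennreal_mult ennreal_of_nat_eq_real_of_nat)
qed (use assms in auto)

lemma set_integral_scaled_dirac_sum:
  fixes f :: "real \<Rightarrow> real"
  assumes "closed K" "continuous_on K f" "\<And>k. k < m \<Longrightarrow> x k \<in> K" "0 \<le> c"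
  shows "(LINT y:K|scaled_dirac_sum c m x. f y) = c * (\<Sum>k<m. f (x k))"
proof -
  have "(\<lambda>y. indicator K y *\<^sub>R f y) \<in> borel_measurable borel"
    using assms(1,2) by (intro borel_measurable_continuous_on_indicator) auto
  then have "(LINT y:K|scaled_dirac_sum c m x. f y)
      = (\<integral>k. indicator K (x k) *\<^sub>R f (x k) \<partial>point_measure {..<m} (\<lambda>_. ennreal c))"
    unfolding scaled_dirac_sum_eq_distr set_lebesgue_integral_def
    by (subst integral_distr) auto
  also have "\<dots> = (\<Sum>k<m. c *\<^sub>R (indicator K (x k) *\<^sub>R f (x k)))"
    using assms(4) by (intro lebesgue_integral_point_measure_finite) auto
  also have "\<dots> = c * (\<Sum>k<m. f (x k))"
    unfolding sum_distrib_left by (rule sum.cong) (use assms(3) in auto)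
  finally show ?thesis .
qed

lemma nn_integral_pair_scaled_dirac_sum:
  assumes [measurable]: "g \<in> borel_measurable (borel \<Otimes>\<^sub>M borel)" and c: "0 \<le> c" "0 \<le> c'"
  shows "(\<integral>\<^sup>+z. g z \<partial>(scaled_dirac_sum c m x \<Otimes>\<^sub>M scaled_dirac_sum c' m' y))
    = ennreal c * ennreal c' * (\<Sum>k<m. \<Sum>l<m'. g (x k, y l))"
proof -
  have "finite_measure (scaled_dirac_sum c m' y)" if "0 \<le> c" for c m' y
    using measures_of_massD(6)[OF scaled_dirac_sum_in_measures_of_mass[of UNIV m' y c]] that by simp
  then interpret N: finite_measure "scaled_dirac_sum c' m' y" using c by simp
  have "(\<integral>\<^sup>+z. g z \<partial>(scaled_dirac_sum c m x \<Otimes>\<^sub>M scaled_dirac_sum c' m' y))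
     = (\<integral>\<^sup>+u. \<integral>\<^sup>+v. g (u, v) \<partial>scaled_dirac_sum c' m' y \<partial>scaled_dirac_sum c m x)"
    by (rule N.nn_integral_fst[symmetric]) measurable
  also have "\<dots> = (\<integral>\<^sup>+u. ennreal c' * (\<Sum>l<m'. g (u, y l)) \<partial>scaled_dirac_sum c m x)"
    by (intro nn_integral_cong nn_integral_scaled_dirac_sum) measurable
  also have "\<dots> = ennreal c * (\<Sum>k<m. ennreal c' * (\<Sum>l<m'. g (x k, y l)))"
    by (rule nn_integral_scaled_dirac_sum) measurable
  finally show ?thesis by (simp add: sum_distrib_left mult.assoc)
qed

lemma finite_coords [simp, intro]: "finite (coords p n)"
  by (simp add: coords_def)

lemma card_coords [simp]: "card (coords p n) = mi_norm p n"
  by (simp add: coords_def mi_norm_def)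

lemma in_coords [simp]: "(i, k) \<in> coords p n \<longleftrightarrow> i < p \<and> k < n i"
  by (simp add: coords_def)

text \<open>The order of the coordinates is dropped, so that one coordinate can move through its
  interval while the others stay fixed.\<close>

abbreviation configs :: "nat \<Rightarrow> (nat \<Rightarrow> real set) \<Rightarrow> (nat \<Rightarrow> nat) \<Rightarrow> (nat \<times> nat \<Rightarrow> real) set" where
  "configs p \<Gamma> n \<equiv> \<Pi>\<^sub>E u\<in>coords p n. \<Gamma> (fst u)"

lemma ordered_configs_subset: "ordered_configs p \<Gamma> n \<subseteq> configs p \<Gamma> n"
  by (auto simp: ordered_configs_def case_prod_unfold)

lemma j_map_in_M_space:
  assumes "X \<in> configs p \<Gamma> n" "\<And>i. i < p \<Longrightarrow> closed (\<Gamma> i)" "\<And>i. i < p \<Longrightarrow> 0 < r i" "\<And>i. i < p \<Longrightarrow> 0 < n i"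
  shows "j_map p r n X \<in> M_space p \<Gamma> r"
proof -
  have "scaled_dirac_sum (r i / real (n i)) (n i) (\<lambda>k. X (i, k)) \<in> measures_of_mass (\<Gamma> i) (r i)"
    if i: "i < p" for i
  proof -
    have "X (i, k) \<in> \<Gamma> i" if "k < n i" for k using PiE_mem[OF assms(1), of "(i, k)"] i that by simp
    then show ?thesis
      using scaled_dirac_sum_in_measures_of_mass[of "\<Gamma> i" "n i" "\<lambda>k. X (i, k)" "r i / real (n i)"]
        assms(2-4)[OF i] by simp
  qed
  then show ?thesis by (simp add: M_space_def j_map_def)
qed

lemma continuous_map_j_map:
  assumes "S \<subseteq> configs p \<Gamma> n" "\<And>i. i < p \<Longrightarrow> closed (\<Gamma> i)" "\<And>i. i < p \<Longrightarrow> 0 < r i" "\<And>i. i < p \<Longrightarrow> 0 < n i"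
  shows "continuous_map (top_of_set S) (M_topology p \<Gamma> r) (j_map p r n)"
  unfolding M_topology_def continuous_map_componentwise
proof (intro conjI ballI)
  show "j_map p r n ` topspace (top_of_set S) \<subseteq> extensional {..<p}"
    by (auto simp: j_map_def)
  fix i assume "i \<in> {..<p}"
  then have i: "i < p" by simp
  have Xi: "X (i, k) \<in> \<Gamma> i" if "X \<in> S" "k < n i" for X k
    using PiE_mem[of X "coords p n" "\<lambda>u. \<Gamma> (fst u)" "(i, k)"] assms(1) i that by auto
  show "continuous_map (top_of_set S) (weak_star_topology (\<Gamma> i) (r i)) (\<lambda>X. j_map p r n X i)"
  proof (rule continuous_map_into_weak_star)
    fix X assume "X \<in> topspace (top_of_set S)"
    then have "X \<in> configs p \<Gamma> n" using assms(1) by auto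
    then have "j_map p r n X \<in> M_space p \<Gamma> r" by (rule j_map_in_M_space) (use assms in auto)
    then show "j_map p r n X i \<in> measures_of_mass (\<Gamma> i) (r i)"
      unfolding M_space_def using i by (simp add: PiE_iff)
  next
    fix f :: "real \<Rightarrow> real" assume f: "continuous_on (\<Gamma> i) f"
    have "continuous_on S (\<lambda>X. r i / real (n i) * (\<Sum>k<n i. f (X (i, k))))"
      by (intro continuous_intros continuous_on_compose2[OF f]
          continuous_on_subset[OF continuous_on_product_coordinates]) (use Xi in auto)
    moreover have "(LINT y:\<Gamma> i|j_map p r n X i. f y) = r i / real (n i) * (\<Sum>k<n i. f (X (i, k)))"
      if "X \<in> S" for X
      using set_integral_scaled_dirac_sum[OF assms(2)[OF i] f, of "n i" "\<lambda>k. X (i, k)" "r i / real (n i)"]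
        Xi[OF that] assms(3)[OF i] i by (simp add: j_map_def)
    ultimately have "continuous_on S (\<lambda>X. LINT y:\<Gamma> i|j_map p r n X i. f y)"
      by (simp cong: continuous_on_cong)
    then show "continuous_map (top_of_set S) euclideanreal (\<lambda>X. LINT y:\<Gamma> i|j_map p r n X i. f y)"
      by simp
  qed
qed

text \<open>Continuity and closedness are available on the full function space with its product
  topology, whereas measurability is wanted in the finite product. The inclusion of the latter is
  measurable, since the coordinates outside of \<open>C\<close> are frozen at
  \<open>undefined\<close>.\<close>

lemma open_Int_PiE_in_sets_PiM:
  fixes U :: "('i::countable \<Rightarrow> real) set"
  assumes C: "finite C" and U: "U \<in> sets borel"
    and M: "\<And>u. u \<in> C \<Longrightarrow> sets (M u) = sets (restrict_space borel (G u))"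
  shows "U \<inter> (\<Pi>\<^sub>E u\<in>C. G u) \<in> sets (Pi\<^sub>M C M)"
proof -
  have sp: "space (M u) = G u" if "u \<in> C" for u
    using sets_eq_imp_space_eq[OF M[OF that]] by (simp add: space_restrict_space)
  have "(\<lambda>X. X) \<in> measurable (Pi\<^sub>M C M) (Pi\<^sub>M UNIV (\<lambda>_. borel))"
  proof (rule measurable_PiM_single')
    fix u :: 'i
    show "(\<lambda>X. X u) \<in> borel_measurable (Pi\<^sub>M C M)"
    proof (cases "u \<in> C")
      case True
      have "(\<lambda>x. x) \<in> measurable (M u) borel"
        unfolding measurable_cong_sets[OF M[OF True] refl] by (rule measurable_restrict_space1) simp
      from measurable_compose[OF measurable_component_singleton[OF True, of M] this] show ?thesis by simp
    next
      case False
      then have "X u = undefined" if "X \<in> space (Pi\<^sub>M C M)" for X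
        using that by (auto simp: space_PiM)
      then have "(\<lambda>X. X u) \<in> borel_measurable (Pi\<^sub>M C M) \<longleftrightarrow>
          (\<lambda>X. undefined :: real) \<in> borel_measurable (Pi\<^sub>M C M)"
        by (rule measurable_cong)
      then show ?thesis by simp
    qed
  qed simp
  from measurable_sets[OF this, of U] U
  have "(\<lambda>X. X) -` U \<inter> space (Pi\<^sub>M C M) \<in> sets (Pi\<^sub>M C M)"
    by (simp add: sets_PiM_equal_borel)
  moreover have "space (Pi\<^sub>M C M) = (\<Pi>\<^sub>E u\<in>C. G u)"
    using sp by (simp add: space_PiM cong: PiE_cong)
  ultimately show ?thesis by simp
qed

section \<open>The square of the weight as a product of gaps\<close>

lemma prod_symmetric_square:
  fixes g :: "nat \<Rightarrow> nat \<Rightarrow> 'a::comm_semiring_1"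
  assumes "\<And>i j. g i j = g j i"
  shows "(\<Prod>i<m. \<Prod>j<m. g i j) = (\<Prod>i<m. g i i) * (\<Prod>i<m. \<Prod>j<i. g i j)\<^sup>2"
proof (induction m)
  case (Suc m)
  have "(\<Prod>i<m. g i m) = (\<Prod>j<m. g m j)" by (intro prod.cong) (auto intro: assms)
  then show ?case
    using Suc by (simp add: prod.distrib power2_eq_square mult_ac)
qed simp

text \<open>Over ordered pairs every factor of \<open>A\<close> occurs twice, which is why \<open>A\<^sup>2\<close> is considered.\<close>

definition pair_mult :: "nat \<Rightarrow> nat \<Rightarrow> nat" where
  "pair_mult i j = (if i = j then 2 else 1)"

text \<open>The neutral value 1 on the diagonal lets the product run over the full square of the
  index set.\<close>

definition gap :: "(nat \<times> nat \<Rightarrow> real) \<Rightarrow> nat \<times> nat \<Rightarrow> nat \<times> nat \<Rightarrow> real" where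
  "gap X u v = (if u = v then 1 else \<bar>X u - X v\<bar> ^ pair_mult (fst u) (fst v))"

lemma gap_commute: "gap X u v = gap X v u"
  by (auto simp: gap_def pair_mult_def abs_minus_commute)

lemma prod_coords: "(\<Prod>u\<in>coords p n. f u) = (\<Prod>i<p. \<Prod>k<n i. f (i, k))"
  unfolding coords_def by (subst prod.Sigma) auto

lemma sum_coords: "(\<Sum>u\<in>coords p n. f u) = (\<Sum>i<p. \<Sum>k<n i. f (i, k))"
  unfolding coords_def by (subst sum.Sigma) auto

text \<open>Inside a block a pair occurs twice with exponent 2, which gives the fourth power of the
  Vandermonde factor; across blocks it occurs twice with exponent 1, which gives the square of the
  mixed factor. Squaring also removes the signs, so that \<open>X\<close> may be arbitrary.\<close>

lemma A_weight_square:
  "(A_weight p Q n X)\<^sup>2 = (\<Prod>u\<in>coords p n. \<Prod>v\<in>coords p n. gap X u v) *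
     exp (- 4 * real (mi_norm p n) * (\<Sum>u\<in>coords p n. Q (fst u) (X u)))"
proof -
  define g where "g i j = (\<Prod>k<n i. \<Prod>l<n j. gap X (i, k) (j, l))" for i j
  have g_sym: "g i j = g j i" for i j
    unfolding g_def by (subst prod.swap) (simp add: gap_commute)
  have gii: "g i i = ((vandermonde (n i) (\<lambda>k. X (i, k)))\<^sup>2)\<^sup>2" for i
  proof -
    have "g i i = (\<Prod>k<n i. gap X (i, k) (i, k)) * (\<Prod>k<n i. \<Prod>l<k. gap X (i, k) (i, l))\<^sup>2"
      unfolding g_def by (rule prod_symmetric_square) (rule gap_commute)
    also have "(\<Prod>k<n i. \<Prod>l<k. gap X (i, k) (i, l)) = (\<Prod>k<n i. \<Prod>l<k. (X (i, k) - X (i, l))\<^sup>2)"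
      by (intro prod.cong) (auto simp: gap_def pair_mult_def)
    also have "\<dots> = (vandermonde (n i) (\<lambda>k. X (i, k)))\<^sup>2"
      by (simp add: vandermonde_def prod_power_distrib)
    finally show ?thesis by (simp add: gap_def)
  qed
  have gij: "(g j i)\<^sup>2 = (mixed_vandermonde (n j) (\<lambda>k. X (j, k)) (n i) (\<lambda>k. X (i, k)))\<^sup>2" if "i < j" for i j
  proof -
    have "g j i = \<bar>mixed_vandermonde (n j) (\<lambda>k. X (j, k)) (n i) (\<lambda>k. X (i, k))\<bar>"
      using that unfolding g_def mixed_vandermonde_def abs_prod
      by (intro prod.cong) (auto simp: gap_def pair_mult_def)
    then show ?thesis by simp
  qed
  have "(\<Prod>u\<in>coords p n. \<Prod>v\<in>coords p n. gap X u v) = (\<Prod>i<p. \<Prod>j<p. g i j)"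
    unfolding g_def prod_coords by (rule prod.cong[OF refl], subst prod.swap) (rule refl)
  also have "\<dots> = (\<Prod>i<p. g i i) * (\<Prod>j<p. \<Prod>i<j. g j i)\<^sup>2"
    by (rule prod_symmetric_square) (rule g_sym)
  also have "(\<Prod>j<p. \<Prod>i<j. g j i)\<^sup>2
      = (\<Prod>j<p. \<Prod>i<j. mixed_vandermonde (n j) (\<lambda>k. X (j, k)) (n i) (\<lambda>k. X (i, k)))\<^sup>2"
    unfolding prod_power_distrib by (intro prod.cong refl gij) simp
  also have "(\<Prod>i<p. g i i) * \<dots> = ((\<Prod>i<p. (vandermonde (n i) (\<lambda>k. X (i, k)))\<^sup>2) *
     (\<Prod>j<p. \<Prod>i<j. mixed_vandermonde (n j) (\<lambda>k. X (j, k)) (n i) (\<lambda>k. X (i, k))))\<^sup>2"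
    by (simp add: gii power_mult_distrib prod_power_distrib)
  finally have 1: "(\<Prod>u\<in>coords p n. \<Prod>v\<in>coords p n. gap X u v) = \<dots>" .
  have 2: "exp (- 4 * real (mi_norm p n) * (\<Sum>u\<in>coords p n. Q (fst u) (X u)))
     = (exp (- 2 * real (mi_norm p n) * (\<Sum>i<p. \<Sum>k<n i. Q i (X (i, k)))))\<^sup>2"
    unfolding exp_double[symmetric] sum_coords by (simp add: algebra_simps)
  show ?thesis unfolding 1 2 A_weight_def power_mult_distrib ..
qed

section \<open>Permutations within the blocks\<close>

text \<open>Mixing the blocks would change the exponents of the gaps and the fields, and would move
  points out of their intervals.\<close>

definition block_perms :: "nat \<Rightarrow> (nat \<Rightarrow> nat) \<Rightarrow> (nat \<times> nat \<Rightarrow> nat \<times> nat) set" where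
  "block_perms p n = {\<pi>. \<pi> permutes coords p n \<and> (\<forall>u\<in>coords p n. fst (\<pi> u) = fst u)}"

definition rearrange :: "nat \<Rightarrow> (nat \<Rightarrow> nat) \<Rightarrow> (nat \<times> nat \<Rightarrow> nat \<times> nat) \<Rightarrow> (nat \<times> nat \<Rightarrow> real) \<Rightarrow> (nat \<times> nat \<Rightarrow> real)" where
  "rearrange p n \<pi> X = (\<lambda>u\<in>coords p n. X (\<pi> u))"

lemma finite_block_perms: "finite (block_perms p n)" "card (block_perms p n) \<le> fact (mi_norm p n)"
proof -
  have s: "block_perms p n \<subseteq> {\<pi>. \<pi> permutes coords p n}" by (auto simp: block_perms_def)
  have f: "finite {\<pi>. \<pi> permutes coords p n}" by (rule finite_permutations) simp
  show "finite (block_perms p n)" using s f by (rule finite_subset)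
  show "card (block_perms p n) \<le> fact (mi_norm p n)"
    using card_mono[OF f s] card_permutations[OF card_coords finite_coords] by simp
qed

lemma rearrange_in_configs:
  assumes "\<pi> \<in> block_perms p n" "X \<in> configs p \<Gamma> n"
  shows "rearrange p n \<pi> X \<in> configs p \<Gamma> n"
proof -
  have "X (\<pi> u) \<in> \<Gamma> (fst u)" if "u \<in> coords p n" for u
    using PiE_mem[OF assms(2), of "\<pi> u"] assms(1) that permutes_in_image[of \<pi> "coords p n" u]
    by (auto simp: block_perms_def)
  then show ?thesis unfolding rearrange_def by auto
qed

text \<open>A gap depends only on the two points and their blocks, and the permutation carries both
  along. The product formula describes the square of the weight, hence the absolute value.\<close>

lemma abs_A_weight_rearrange:
  assumes "\<pi> \<in> block_perms p n"
  shows "\<bar>A_weight p Q n (rearrange p n \<pi> X)\<bar> = \<bar>A_weight p Q n X\<bar>"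
proof -
  let ?C = "coords p n"
  have \<pi>: "\<pi> permutes ?C" "\<And>u. u \<in> ?C \<Longrightarrow> fst (\<pi> u) = fst u" using assms by (auto simp: block_perms_def)
  have bij: "bij_betw \<pi> ?C ?C" using permutes_imp_bij[OF \<pi>(1)] .
  have inj: "\<pi> u = \<pi> v \<longleftrightarrow> u = v" for u v using permutes_inj[OF \<pi>(1)] by (auto dest: injD)
  have "gap (rearrange p n \<pi> X) u v = gap X (\<pi> u) (\<pi> v)" if "u \<in> ?C" "v \<in> ?C" for u v
    using that \<pi>(2) inj by (simp add: gap_def pair_mult_def rearrange_def)
  then have "(\<Prod>u\<in>?C. \<Prod>v\<in>?C. gap (rearrange p n \<pi> X) u v) = (\<Prod>u\<in>?C. \<Prod>v\<in>?C. gap X (\<pi> u) (\<pi> v))"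
    by (intro prod.cong) auto
  also have "\<dots> = (\<Prod>u\<in>?C. \<Prod>v\<in>?C. gap X u v)"
    unfolding prod.reindex_bij_betw[OF bij, of "\<lambda>u. \<Prod>v\<in>?C. gap X u (\<pi> v)"]
    by (simp add: prod.reindex_bij_betw[OF bij])
  finally have 1: "(\<Prod>u\<in>?C. \<Prod>v\<in>?C. gap (rearrange p n \<pi> X) u v) = \<dots>" .
  have "(\<Sum>u\<in>?C. Q (fst u) (rearrange p n \<pi> X u)) = (\<Sum>u\<in>?C. Q (fst (\<pi> u)) (X (\<pi> u)))"
    by (intro sum.cong) (simp_all add: rearrange_def \<pi>(2))
  also have "\<dots> = (\<Sum>u\<in>?C. Q (fst u) (X u))"
    by (rule sum.reindex_bij_betw[OF bij])
  finally have "(A_weight p Q n (rearrange p n \<pi> X))\<^sup>2 = (A_weight p Q n X)\<^sup>2"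
    unfolding A_weight_square 1 by simp
  then show ?thesis by (simp add: abs_eq_iff power2_eq_iff)
qed

text \<open>On each block the permutation restricts to a bijection, which merely reorders a finite
  sum of point masses.\<close>

lemma j_map_rearrange:
  assumes "\<pi> \<in> block_perms p n"
  shows "j_map p r n (rearrange p n \<pi> X) = j_map p r n X"
  unfolding j_map_def
proof (rule restrict_ext)
  fix i assume "i \<in> {..<p}"
  then have i: "i < p" by simp
  let ?B = "{i} \<times> {..<n i}"
  have \<pi>: "\<pi> permutes coords p n" "\<And>u. u \<in> coords p n \<Longrightarrow> fst (\<pi> u) = fst u"
    using assms by (auto simp: block_perms_def)
  have "\<pi> u \<in> ?B" if u: "u \<in> ?B" for u
  proof -
    have "u \<in> coords p n" using u i by (auto simp: coords_def)
    then have "\<pi> u \<in> coords p n" "fst (\<pi> u) = i" using \<pi> permutes_in_image u by fastforce+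
    then show ?thesis by (cases "\<pi> u") auto
  qed
  then have "\<pi> ` ?B \<subseteq> ?B" by blast
  moreover have "inj_on \<pi> ?B" using permutes_inj[OF \<pi>(1)] inj_on_subset by blast
  ultimately have bij: "bij_betw \<pi> ?B ?B"
    by (simp add: bij_betw_def endo_inj_surj)
  show "scaled_dirac_sum (r i / real (n i)) (n i) (\<lambda>k. rearrange p n \<pi> X (i, k)) =
      scaled_dirac_sum (r i / real (n i)) (n i) (\<lambda>k. X (i, k))"
  proof (rule measure_eqI)
    fix A assume "A \<in> sets (scaled_dirac_sum (r i / real (n i)) (n i) (\<lambda>k. rearrange p n \<pi> X (i, k)))"
    then have A: "A \<in> sets borel" by simp
    have S: "(\<Sum>k<n i. h (i, k)) = (\<Sum>u\<in>?B. h u)" for h :: "nat \<times> nat \<Rightarrow> ennreal"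
      by (rule sum.reindex_bij_witness[of _ snd "Pair i"]) auto
    have "(\<Sum>k<n i. indicator A (rearrange p n \<pi> X (i, k))) = (\<Sum>k<n i. indicator A (X (\<pi> (i, k))) :: ennreal)"
      using i by (intro sum.cong) (auto simp: rearrange_def)
    also have "\<dots> = (\<Sum>k<n i. indicator A (X (i, k)))"
      unfolding S[of "\<lambda>u. indicator A (X (\<pi> u))"] S[of "\<lambda>u. indicator A (X u)"]
      by (rule sum.reindex_bij_betw[OF bij])
    finally show "emeasure (scaled_dirac_sum (r i / real (n i)) (n i) (\<lambda>k. rearrange p n \<pi> X (i, k))) A
      = emeasure (scaled_dirac_sum (r i / real (n i)) (n i) (\<lambda>k. X (i, k))) A"
      by (simp add: emeasure_scaled_dirac_sum[OF A])
  qed simp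
qed

lemma exists_sorting_permutation:
  fixes y :: "nat \<Rightarrow> real"
  shows "\<exists>\<sigma>. \<sigma> permutes {..<m} \<and> (\<forall>k l. k \<le> l \<and> l < m \<longrightarrow> y (\<sigma> k) \<le> y (\<sigma> l))"
proof -
  let ?xs = "map y [0..<m]"
  obtain \<sigma> where \<sigma>: "\<sigma> permutes {..<length ?xs}" "permute_list \<sigma> ?xs = sort ?xs"
    using mset_eq_permutation[of "sort ?xs" ?xs] by auto
  have "y (\<sigma> k) \<le> y (\<sigma> l)" if "k \<le> l" "l < m" for k l
  proof -
    have nth: "sort ?xs ! k = y (\<sigma> k)" if "k < m" for k
      using permute_list_nth[OF \<sigma>(1), of k] permutes_in_image[OF \<sigma>(1), of k] that \<sigma>(2) by simp
    have "sort ?xs ! k \<le> sort ?xs ! l"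
      by (rule sorted_nth_mono) (use that in auto)
    then show ?thesis using nth that by simp
  qed
  then show ?thesis using \<sigma>(1) by auto
qed

text \<open>The blocks are ordered among each other by assumption, so it is enough to sort each of
  them separately.\<close>

lemma exists_rearrange_ordered:
  assumes X: "X \<in> configs p \<Gamma> n"
    and \<Gamma>: "\<And>i j x y. i < j \<Longrightarrow> j < p \<Longrightarrow> x \<in> \<Gamma> i \<Longrightarrow> y \<in> \<Gamma> j \<Longrightarrow> x \<le> y"
  shows "\<exists>\<pi>\<in>block_perms p n. rearrange p n \<pi> X \<in> ordered_configs p \<Gamma> n"
proof -
  have "\<forall>i. \<exists>\<sigma>. \<sigma> permutes {..<n i} \<and> (\<forall>k l. k \<le> l \<and> l < n i \<longrightarrow> X (i, \<sigma> k) \<le> X (i, \<sigma> l))"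
    using exists_sorting_permutation[of _ "\<lambda>k. X (_, k)"] by blast
  from choice[OF this] obtain \<sigma> where \<sigma>: "\<And>i. \<sigma> i permutes {..<n i}"
    "\<And>i k l. k \<le> l \<Longrightarrow> l < n i \<Longrightarrow> X (i, \<sigma> i k) \<le> X (i, \<sigma> i l)" by blast
  define \<pi> where "\<pi> u = (if u \<in> coords p n then (fst u, \<sigma> (fst u) (snd u)) else u)" for u
  have \<sigma>lt: "\<sigma> i k < n i \<longleftrightarrow> k < n i" for i k using permutes_in_image[OF \<sigma>(1)] by simp
  have \<sigma>inj: "\<sigma> i k = \<sigma> i l \<longleftrightarrow> k = l" for i k l
    using permutes_inj[OF \<sigma>(1)] by (auto dest: injD)
  have "bij_betw \<pi> (coords p n) (coords p n)"
    unfolding bij_betw_def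
  proof
    show inj: "inj_on \<pi> (coords p n)"
      by (rule inj_onI) (auto simp: \<pi>_def coords_def \<sigma>inj)
    have "\<pi> ` coords p n \<subseteq> coords p n" using \<sigma>lt by (auto simp: \<pi>_def coords_def)
    then show "\<pi> ` coords p n = coords p n" using inj by (simp add: endo_inj_surj)
  qed
  then have "\<pi> permutes coords p n" by (rule bij_imp_permutes) (simp add: \<pi>_def)
  then have P: "\<pi> \<in> block_perms p n" by (auto simp: block_perms_def \<pi>_def)
  note Y = rearrange_in_configs[OF P X]
  have "rearrange p n \<pi> X (i, k) \<le> rearrange p n \<pi> X (j, l)"
    if "(i, k) \<in> coords p n" "(j, l) \<in> coords p n" "i < j \<or> i = j \<and> k \<le> l" for i k j l
    using that(3)
  proof
    assume "i < j"
    then show ?thesis using \<Gamma>[of i j] PiE_mem[OF Y that(1)] PiE_mem[OF Y that(2)] that by simp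
  next
    assume "i = j \<and> k \<le> l"
    then show ?thesis using \<sigma>(2)[of k l i] that by (simp add: rearrange_def \<pi>_def)
  qed
  then have "rearrange p n \<pi> X \<in> ordered_configs p \<Gamma> n"
    using Y unfolding ordered_configs_def by (auto simp: case_prod_unfold)
  then show ?thesis using P by blast
qed

lemma A_weight_nonneg:
  assumes "X \<in> ordered_configs p \<Gamma> n"
  shows "0 \<le> A_weight p Q n X"
proof -
  have "0 \<le> mixed_vandermonde (n j) (\<lambda>k. X (j, k)) (n i) (\<lambda>k. X (i, k))" if "j < p" "i < j" for i j
    unfolding mixed_vandermonde_def
  proof (intro prod_nonneg ballI)
    fix k l assume "k \<in> {..<n j}" "l \<in> {..<n i}"
    then have "(j, k) \<in> coords p n" "(i, l) \<in> coords p n" using that by auto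
    then have "X (i, l) \<le> X (j, k)" using assms that(2) unfolding ordered_configs_def by fast
    then show "0 \<le> X (j, k) - X (i, l)" by simp
  qed
  then show ?thesis unfolding A_weight_def
    by (intro mult_nonneg_nonneg prod_nonneg ballI) auto
qed

section \<open>A local Bernstein-Markov inequality\<close>

text \<open>The interpolant and \<open>P\<close> agree at m + 1 distinct points, while their
  difference has degree at most m.\<close>

lemma poly_lagrange:
  fixes P :: "'a::field poly"
  assumes inj: "inj_on x {..m}" and deg: "degree P \<le> m"
  shows "poly P t = (\<Sum>j\<le>m. poly P (x j) * (\<Prod>k\<in>{..m} - {j}. (t - x k) / (x j - x k)))"
proof -
  define l where "l j = smult (inverse (\<Prod>k\<in>{..m} - {j}. x j - x k)) (\<Prod>k\<in>{..m} - {j}. [:- x k, 1:])" for j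
  have l: "poly (l j) t = (\<Prod>k\<in>{..m} - {j}. (t - x k) / (x j - x k))" for j t
    unfolding prod_dividef by (simp add: l_def poly_prod divide_inverse mult.commute)
  define R where "R = (\<Sum>j\<le>m. smult (poly P (x j)) (l j))"
  have dl: "degree (l j) \<le> m" if "j \<le> m" for j
  proof -
    have "degree (l j) \<le> degree (\<Prod>k\<in>{..m} - {j}. [:- x k, 1:])" unfolding l_def by (rule degree_smult_le)
    also have "\<dots> \<le> (\<Sum>k\<in>{..m} - {j}. degree [:- x k, 1:])" using degree_prod_sum_le[of "{..m} - {j}" "\<lambda>k. [:- x k, 1:]"] unfolding o_def by simp
    also have "\<dots> = m" using that by simp
    finally show ?thesis .
  qed
  have dR: "degree R \<le> m" unfolding R_def
    by (rule degree_sum_le) (auto intro: order_trans[OF degree_smult_le] dl)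
  have lx: "poly (l j) (x i) = (if i = j then 1 else 0)" if "i \<le> m" "j \<le> m" for i j
  proof (cases "i = j")
    case True
    have "(\<Prod>k\<in>{..m} - {j}. (x j - x k) / (x j - x k)) = 1"
      by (rule prod.neutral) (use inj that in \<open>auto simp: inj_on_def\<close>)
    then show ?thesis using True by (simp add: l)
  next
    case False
    have "(\<Prod>k\<in>{..m} - {j}. (x i - x k) / (x j - x k)) = 0"
      using False that by (intro prod_zero) auto
    then show ?thesis using False by (simp add: l)
  qed
  have e: "poly R (x i) = poly P (x i)" if i: "i \<le> m" for i
  proof -
    have "poly R (x i) = (\<Sum>j\<le>m. poly P (x j) * poly (l j) (x i))" by (simp add: R_def poly_sum)
    also have "\<dots> = (\<Sum>j\<le>m. if j = i then poly P (x i) else 0)"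
      by (rule sum.cong) (use i in \<open>auto simp: lx\<close>)
    finally show ?thesis using i by simp
  qed
  have "R = P"
  proof (rule ccontr)
    assume "R \<noteq> P"
    then have nz: "R - P \<noteq> 0" by simp
    have "x ` {..m} \<subseteq> {t. poly (R - P) t = 0}" using e by auto
    then have "card (x ` {..m}) \<le> card {t. poly (R - P) t = 0}"
      using poly_roots_finite[OF nz] by (rule card_mono[rotated])
    also have "\<dots> \<le> degree (R - P)" using nz by (rule card_poly_roots_bound)
    also have "\<dots> \<le> m" using dR deg by (meson degree_diff_le)
    finally show False using inj by (simp add: card_image)
  qed
  then have "poly P t = poly R t" by simp
  then show ?thesis by (simp add: R_def poly_sum l)
qed

text \<open>The quotient of \<open>m ^ m\<close> by the factorial of \<open>m\<close> is a single
  term of the exponential series at \<open>m\<close>.\<close>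

lemma fact_ge_power_exp: "(real m / exp 1) ^ m \<le> fact m"
proof (cases "m = 0")
  case False
  have s: "(\<lambda>k. real m ^ k / fact k) sums exp (real m)"
    using exp_converges[of "real m"] by (simp add: divide_inverse mult.commute)
  have "real m ^ m / fact m \<le> exp (real m)"
    using sum_le_suminf[of "\<lambda>k. real m ^ k / fact k" "{m}"] s
    by (simp add: sums_iff)
  then have "real m ^ m \<le> exp (real m) * fact m" by (simp add: field_simps)
  moreover have "exp (real m) = exp 1 ^ m" using exp_of_nat_mult[of m 1] by simp
  ultimately show ?thesis by (simp add: power_divide field_simps)
qed simp

lemma prod_equispaced:
  assumes "j \<le> m"
  shows "(\<Prod>k\<in>{..m} - {j}. \<bar>real j - real k\<bar>) = fact j * fact (m - j)"
proof -
  have "{..m} - {j} = {..<j} \<union> {j<..m}" using assms by auto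
  then have "(\<Prod>k\<in>{..m} - {j}. \<bar>real j - real k\<bar>) = (\<Prod>k\<in>{..<j} \<union> {j<..m}. \<bar>real j - real k\<bar>)"
    by (simp only:)
  also have "\<dots> = (\<Prod>k<j. \<bar>real j - real k\<bar>) * (\<Prod>k\<in>{j<..m}. \<bar>real j - real k\<bar>)"
    by (rule prod.union_disjoint) auto
  also have "(\<Prod>k<j. \<bar>real j - real k\<bar>) = (\<Prod>k<j. real (Suc k))"
    by (rule prod.reindex_bij_witness[of _ "\<lambda>k. j - Suc k" "\<lambda>k. j - Suc k"]) auto
  also have "\<dots> = fact j" by (simp add: fact_prod_Suc lessThan_atLeast0)
  also have "(\<Prod>k\<in>{j<..m}. \<bar>real j - real k\<bar>) = (\<Prod>k<m - j. real (Suc k))"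
    by (rule prod.reindex_bij_witness[of _ "\<lambda>k. j + Suc k" "\<lambda>k. k - Suc j"]) auto
  also have "\<dots> = fact (m - j)" by (simp add: fact_prod_Suc lessThan_atLeast0)
  finally show ?thesis .
qed

text \<open>Interpolation at equispaced points of \<open>{c..c + s}\<close>; the \<open>j\<close>-th Lagrange basis polynomial is
  at most \<open>L ^ m / ((s / m) ^ m * j! * (m - j)!)\<close>.\<close>

lemma poly_growth:
  fixes P :: "complex poly"
  assumes deg: "degree P \<le> m" and s: "0 < s" and L: "0 < L"
    and B: "\<And>y. y \<in> {c..c + s} \<Longrightarrow> cmod (poly P (of_real y)) \<le> B"
    and t: "\<And>y. y \<in> {c..c + s} \<Longrightarrow> \<bar>t - y\<bar> \<le> L"
  shows "cmod (poly P (of_real t)) \<le> (4 * exp 1 * L / s) ^ m * B"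
proof (cases "m = 0")
  case True
  then obtain a where "P = [:a:]" using deg degree_eq_zeroE by auto
  then show ?thesis using B[of c] s True by simp
next
  case False
  then have m: "0 < m" by simp
  define h where "h = s / real m"
  define x where "x j = c + real j * h" for j :: nat
  have h: "0 < h" using s m by (simp add: h_def)
  have xin: "x j \<in> {c..c + s}" if "j \<le> m" for j
    using that s m h mult_right_mono[of "real j" "real m" h] by (simp add: x_def h_def)
  have inj: "inj_on (\<lambda>j. complex_of_real (x j)) {..m}"
    using h by (auto simp: inj_on_def x_def)
  have "cmod (poly P (of_real c)) \<le> B" using B[of c] s by simp
  then have B0: "0 \<le> B" by (rule order_trans[OF norm_ge_zero])
  have basis: "(\<Prod>k\<in>{..m} - {j}. cmod ((of_real t - of_real (x k)) / (of_real (x j) - of_real (x k))))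
      \<le> L ^ m / (h ^ m * (fact j * fact (m - j)))" if j: "j \<le> m" for j
  proof -
    have "(\<Prod>k\<in>{..m} - {j}. cmod ((of_real t - of_real (x k)) / (of_real (x j) - of_real (x k))))
       = (\<Prod>k\<in>{..m} - {j}. \<bar>t - x k\<bar>) / (\<Prod>k\<in>{..m} - {j}. \<bar>x j - x k\<bar>)"
      by (simp add: norm_divide prod_dividef flip: of_real_diff)
    also have "(\<Prod>k\<in>{..m} - {j}. \<bar>x j - x k\<bar>) = (\<Prod>k\<in>{..m} - {j}. h * \<bar>real j - real k\<bar>)"
    proof (rule prod.cong)
      fix k
      have "x j - x k = h * (real j - real k)" by (simp add: x_def algebra_simps)
      then show "\<bar>x j - x k\<bar> = h * \<bar>real j - real k\<bar>" using h by (simp add: abs_mult)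
    qed simp
    also have "\<dots> = h ^ m * (fact j * fact (m - j))"
      using j by (simp add: prod.distrib prod_equispaced)
    also have "(\<Prod>k\<in>{..m} - {j}. \<bar>t - x k\<bar>) \<le> (\<Prod>k\<in>{..m} - {j}. L)"
      by (rule prod_mono) (use t xin in auto)
    also have "(\<Prod>k\<in>{..m} - {j}. L) = L ^ m" using j by simp
    finally show ?thesis using h by (simp add: divide_right_mono)
  qed
  have "cmod (poly P (of_real t))
     \<le> (\<Sum>j\<le>m. cmod (poly P (of_real (x j))) *
         (\<Prod>k\<in>{..m} - {j}. cmod ((of_real t - of_real (x k)) / (of_real (x j) - of_real (x k)))))"
    unfolding poly_lagrange[OF inj deg, of "of_real t"]
    by (rule order_trans[OF norm_sum]) (simp add: norm_mult prod_norm)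
  also have "\<dots> \<le> (\<Sum>j\<le>m. B * (L ^ m / (h ^ m * (fact j * fact (m - j)))))"
    by (intro sum_mono mult_mono B basis xin) (auto intro!: prod_nonneg B0)
  \<comment> \<open>Rewriting the factorials as binomial coefficients turns the sum into 2^m over
    the factorial of m. The lower bound \<open>(m / e) ^ m\<close> of this factorial then cancels
    the m in the step width \<open>h = s / m\<close>, so that only geometric growth is left.\<close>
  also have "\<dots> = (\<Sum>j\<le>m. B * L ^ m / (h ^ m * fact m) * real (m choose j))"
    by (rule sum.cong) (auto simp: binomial_fact field_simps)
  also have "\<dots> = B * L ^ m / (h ^ m * fact m) * (\<Sum>j\<le>m. real (m choose j))"
    by (simp add: sum_distrib_left)
  also have "(\<Sum>j\<le>m. real (m choose j)) = 2 ^ m"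
    by (metis choose_row_sum of_nat_numeral of_nat_power of_nat_sum)
  also have "B * L ^ m / (h ^ m * fact m) * 2 ^ m \<le> B * L ^ m / (s / exp 1) ^ m * 2 ^ m"
  proof -
    have "(s / exp 1) ^ m = h ^ m * (real m / exp 1) ^ m"
      using m by (simp add: h_def flip: power_mult_distrib)
    also have "\<dots> \<le> h ^ m * fact m"
      using h by (intro mult_left_mono fact_ge_power_exp) simp
    finally show ?thesis using s B0 L h
      by (intro mult_right_mono divide_left_mono mult_nonneg_nonneg) (auto intro!: mult_pos_pos)
  qed
  also have "\<dots> = B * (2 * exp 1 * L / s) ^ m"
    by (simp add: power_mult_distrib power_divide field_simps)
  also have "\<dots> \<le> B * (4 * exp 1 * L / s) ^ m"
    using B0 s L by (intro mult_left_mono power_mono divide_right_mono mult_right_mono) auto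
  finally show ?thesis by (simp add: mult.commute)
qed

section \<open>Localization by a steep weight\<close>

text \<open>Transport to the line: a weight on \<open>K\<close> becomes a weight on the image in the
  plane by composition with \<open>Re\<close>, and the supremum is released into single points of
  \<open>K\<close>.\<close>

lemma weighted_BM_real:
  assumes K: "compact K" and \<tau>: "sets \<tau> = sets (restrict_space borel K)"
    and BM: "strong_weighted_BM (complex_of_real ` K) (distr \<tau> borel complex_of_real)"
    and q: "continuous_on K q" and \<epsilon>: "0 < \<epsilon>"
  shows "\<exists>C>0. \<forall>m. \<forall>P :: complex poly. degree P \<le> m \<longrightarrow> (\<forall>x\<in>K.
      ennreal (cmod (poly P (of_real x)) * exp (- real m * q x))
        \<le> ennreal (C * (1 + \<epsilon>) ^ m) * (\<integral>\<^sup>+y. ennreal (cmod (poly P (of_real y)) * exp (- real m * q y)) \<partial>\<tau>))"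
proof -
  let ?K = "complex_of_real ` K"
  have sp: "space \<tau> = K" using sets_eq_imp_space_eq[OF \<tau>] by (simp add: space_restrict_space)
  have cl: "closed ?K" by (intro compact_imp_closed compact_continuous_image K continuous_intros)
  have q': "continuous_on ?K (\<lambda>z. q (Re z))"
    by (rule continuous_on_compose2[OF q]) (auto intro!: continuous_intros)
  then have "weighted_BM ?K (\<lambda>z. q (Re z)) (distr \<tau> borel complex_of_real)"
    using BM by (auto simp: strong_weighted_BM_def)
  then obtain C where C: "0 < C" and *: "\<And>m (P :: complex poly). degree P \<le> m \<Longrightarrow>
        (SUP z\<in>?K. ennreal (cmod (poly P z) * exp (- real m * q (Re z))))
          \<le> ennreal (C * (1 + \<epsilon>) ^ m) *
            (\<integral>\<^sup>+z\<in>?K. ennreal (cmod (poly P z) * exp (- real m * q (Re z))) \<partial>distr \<tau> borel complex_of_real)"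
    using \<epsilon> unfolding weighted_BM_def by blast
  have mo: "complex_of_real \<in> borel_measurable \<tau>"
    unfolding measurable_cong_sets[OF \<tau> refl] by (rule measurable_restrict_space1) simp
  have eq: "(\<integral>\<^sup>+z\<in>?K. ennreal (cmod (poly P z) * exp (- real m * q (Re z))) \<partial>distr \<tau> borel complex_of_real)
     = (\<integral>\<^sup>+y. ennreal (cmod (poly P (of_real y)) * exp (- real m * q y)) \<partial>\<tau>)" for P :: "complex poly" and m :: nat
  proof -
    let ?f = "\<lambda>z. cmod (poly P z) * exp (- real m * q (Re z))"
    have "continuous_on ?K ?f" by (intro continuous_intros q')
    then have "(\<lambda>z. indicator ?K z *\<^sub>R ?f z) \<in> borel_measurable borel"
      using cl by (intro borel_measurable_continuous_on_indicator) auto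
    then have "(\<lambda>z. ennreal (indicator ?K z *\<^sub>R ?f z)) \<in> borel_measurable borel" by measurable
    also have "(\<lambda>z. ennreal (indicator ?K z *\<^sub>R ?f z)) = (\<lambda>z. ennreal (?f z) * indicator ?K z)"
      by (auto simp: indicator_def)
    finally have "(\<integral>\<^sup>+z\<in>?K. ennreal (?f z) \<partial>distr \<tau> borel complex_of_real)
        = (\<integral>\<^sup>+y. ennreal (?f (of_real y)) * indicator ?K (complex_of_real y) \<partial>\<tau>)"
      by (intro nn_integral_distr mo) simp
    also have "\<dots> = (\<integral>\<^sup>+y. ennreal (cmod (poly P (of_real y)) * exp (- real m * q y)) \<partial>\<tau>)"
      by (rule nn_integral_cong) (simp add: sp)
    finally show ?thesis .
  qed
  show ?thesis
  proof (intro exI[of _ C] conjI C allI impI ballI)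
    fix m x and P :: "complex poly" assume "degree P \<le> m" "x \<in> K"
    then have "ennreal (cmod (poly P (of_real x)) * exp (- real m * q x))
      \<le> (SUP z\<in>?K. ennreal (cmod (poly P z) * exp (- real m * q (Re z))))"
      by (intro SUP_upper2[of "of_real x"]) auto
    then show "ennreal (cmod (poly P (of_real x)) * exp (- real m * q x))
        \<le> ennreal (C * (1 + \<epsilon>) ^ m) * (\<integral>\<^sup>+y. ennreal (cmod (poly P (of_real y)) * exp (- real m * q y)) \<partial>\<tau>)"
      using *[OF \<open>degree P \<le> m\<close>] eq by simp
  qed
qed

text \<open>The slope \<open>M\<close> of the weight is chosen such that outside of \<open>{x0 - h / 2..x0 + h / 2}\<close> the weight beats
  the growth of \<open>P\<close>, so that this part of the integral can be absorbed into the left-hand side.\<close>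

lemma local_BM_near_point:
  assumes ab: "a < b" and \<tau>: "sets \<tau> = sets (restrict_space borel {a..b})" and fin: "finite_measure \<tau>"
    and BM: "strong_weighted_BM (complex_of_real ` {a..b}) (distr \<tau> borel complex_of_real)"
    and h: "0 < h" and \<epsilon>: "0 < \<epsilon>" and x0: "x0 \<in> {a..b}"
  shows "\<exists>C>0. \<exists>m0. \<forall>m\<ge>m0. \<forall>P :: complex poly. degree P \<le> m \<longrightarrow> (\<forall>x\<in>{a..b}. \<bar>x - x0\<bar> \<le> h / 4 \<longrightarrow>
     ennreal (cmod (poly P (of_real x))) \<le> ennreal (C * (1 + \<epsilon>) ^ m) *
       (\<integral>\<^sup>+y. ennreal (cmod (poly P (of_real y))) * indicator {x0 - h/2..x0 + h/2} y \<partial>\<tau>))"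
proof -
  \<comment> \<open>\<open>{c..c + s}\<close> is the interval from which the growth of
    \<open>P\<close> will be estimated. It has to lie in \<open>{a..b}\<close> and within distance
    \<open>h / 4\<close> of \<open>x0\<close>; since \<open>2 * s \<le> b - a\<close>, there is room
    for it on at least one side of \<open>x0\<close>.\<close>
  define s where "s = min (h / 4) ((b - a) / 2)"
  define L where "L = b - a"
  define A where "A = 4 * exp 1 * L / s"
  define c where "c = (if x0 + s \<le> b then x0 else x0 - s)"
  have L: "0 < L" using ab by (simp add: L_def)
  have s: "0 < s" "s \<le> h / 4" "s \<le> L / 2"
    unfolding s_def L_def using ab h by (simp, linarith+)
  have cs: "a \<le> c \<and> c + s \<le> b \<and> x0 - h / 4 \<le> c \<and> c + s \<le> x0 + h / 4"
  proof (cases "x0 + s \<le> b")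
    case True
    then show ?thesis using s x0 h by (simp add: c_def)
  next
    case False
    moreover have "2 * s \<le> b - a" using s(3) by (simp add: L_def)
    ultimately have "a \<le> x0 - s" by simp
    then show ?thesis using False s x0 h by (simp add: c_def L_def)
  qed
  have "1 \<le> 4 * exp (1::real)" using exp_ge_add_one_self[of 1] by linarith
  then have "s * 1 \<le> L * (4 * exp 1)" using s L by (intro mult_mono) auto
  then have A: "1 \<le> A" using s by (simp add: A_def field_simps)
  \<comment> \<open>The solution of
    \<open>exp (- (M * h / 4)) * ((1 + \<epsilon>) * A) = 1 / 2\<close>, recorded as
    \<open>key\<close>: at distance more than \<open>h / 2\<close> from \<open>x0\<close> the weight
    \<open>q\<close> is at least \<open>M * h / 4\<close>, which beats both growth factors and
    leaves a geometric gain.\<close>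
  define M where "M = 4 / h * ln (2 * (1 + \<epsilon>) * A)"
  define q where "q y = M * max 0 (\<bar>y - x0\<bar> - h / 4)" for y
  have eA: "1 \<le> 2 * (1 + \<epsilon>) * A" using A \<epsilon> mult_mono[of 1 "2 * (1 + \<epsilon>)" 1 A] by simp
  have M0: "0 \<le> M" using eA h by (simp add: M_def)
  have "exp (- (M * h / 4)) = 1 / (2 * (1 + \<epsilon>) * A)"
    using h eA by (simp add: M_def exp_minus inverse_eq_divide)
  then have key: "exp (- (M * h / 4)) * ((1 + \<epsilon>) * A) = 1 / 2"
    using eA A \<epsilon> by (simp add: field_simps)
  have cq: "continuous_on {a..b} q" unfolding q_def by (intro continuous_intros)
  from weighted_BM_real[OF compact_Icc \<tau> BM cq \<epsilon>]
  obtain C where C': "0 < C \<and> (\<forall>m. \<forall>P :: complex poly. degree P \<le> m \<longrightarrow> (\<forall>x\<in>{a..b}.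
      ennreal (cmod (poly P (of_real x)) * exp (- real m * q x))
        \<le> ennreal (C * (1 + \<epsilon>) ^ m) * (\<integral>\<^sup>+y. ennreal (cmod (poly P (of_real y)) * exp (- real m * q y)) \<partial>\<tau>)))" ..
  note C = conjunct1[OF C'] and bm = conjunct2[OF C', rule_format]
  interpret finite_measure \<tau> by (rule fin)
  define T where "T = measure \<tau> (space \<tau>)"
  have T: "0 \<le> T" "emeasure \<tau> (space \<tau>) = ennreal T" by (simp_all add: T_def emeasure_eq_measure)
  \<comment> \<open>The far part of the integral will be at most \<open>C * T * (1 / 2) ^ m\<close>
    times the local maximum of \<open>P\<close>; from \<open>m0\<close> on this is less than half of
    the maximum and can be absorbed.\<close>
  have "(\<lambda>m. C * T * (1 / 2) ^ m) \<longlonglongrightarrow> 0"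
    by (intro tendsto_mult_right_zero LIMSEQ_power_zero) simp
  then have "\<forall>\<^sub>F m in sequentially. C * T * (1 / 2) ^ m < 1 / 2"
    by (rule order_tendstoD) simp
  then obtain m0 where m0: "\<And>m. m0 \<le> m \<Longrightarrow> C * T * (1 / 2) ^ m < 1 / 2"
    by (auto simp: eventually_sequentially)
  have sp: "space \<tau> = {a..b}" using sets_eq_imp_space_eq[OF \<tau>] by (simp add: space_restrict_space)
  have mo[measurable]: "(\<lambda>x. x) \<in> borel_measurable \<tau>"
    unfolding measurable_cong_sets[OF \<tau> refl] by (rule measurable_restrict_space1) simp
  show ?thesis
  proof (intro exI[of _ "2 * C"] conjI exI[of _ m0] allI impI ballI)
    show "0 < 2 * C" using C by simp
    fix m x and P :: "complex poly"
    assume m: "m0 \<le> m" and P: "degree P \<le> m" and x: "x \<in> {a..b}" "\<bar>x - x0\<bar> \<le> h / 4"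
    let ?f = "\<lambda>y. cmod (poly P (of_real y))"
    have contf: "continuous_on UNIV ?f" by (intro continuous_intros)
    then have mf: "?f \<in> borel_measurable borel" by (rule borel_measurable_continuous_onI)
    have mf'[measurable]: "?f \<in> borel_measurable \<tau>" using measurable_compose[OF mo mf] .
    let ?J = "{a..b} \<inter> {x0 - h / 4..x0 + h / 4}"
    have "x0 - h / 4 \<le> x" "x \<le> x0 + h / 4" using x(2) by linarith+
    then have J: "compact ?J" "x \<in> ?J" using x(1) by (auto intro: compact_Int_closed)
    \<comment> \<open>The inequality is applied at a maximum of the modulus of \<open>P\<close> on
      the region where \<open>q\<close> vanishes instead of at \<open>x\<close>: the growth estimate
      bounds the far part by the same maximum \<open>B\<close>, which is what permits the
      absorption.\<close>
    obtain x1 where x1: "x1 \<in> ?J" "\<And>y. y \<in> ?J \<Longrightarrow> ?f y \<le> ?f x1"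
      using continuous_attains_sup[OF J(1) _ continuous_on_subset[OF contf subset_UNIV]] J(2) by blast
    define B where "B = ?f x1"
    have B0: "0 \<le> B" by (simp add: B_def)
    have growth: "?f t \<le> A ^ m * B" if t: "t \<in> {a..b}" for t
      unfolding A_def
    proof (rule poly_growth[OF P s(1) L])
      fix y assume y: "y \<in> {c..c + s}"
      show "?f y \<le> B" unfolding B_def by (rule x1(2)) (use y cs in auto)
      show "\<bar>t - y\<bar> \<le> L" using t y cs unfolding L_def by auto
    qed
    let ?I = "\<integral>\<^sup>+y. ennreal (?f y) * indicator {x0 - h/2..x0 + h/2} y \<partial>\<tau>"
    define E where "E = A ^ m * B * exp (- (M * h / 4)) ^ m"
    have E0: "0 \<le> E" using A B0 by (simp add: E_def)
    have pt: "ennreal (?f y * exp (- real m * q y)) \<le> ennreal (?f y) * indicator {x0 - h/2..x0 + h/2} y + ennreal E"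
      if y: "y \<in> {a..b}" for y
    proof (cases "y \<in> {x0 - h/2..x0 + h/2}")
      case True
      have "0 \<le> q y" using M0 by (simp add: q_def)
      then have "?f y * exp (- real m * q y) \<le> ?f y * 1" by (intro mult_left_mono) auto
      then show ?thesis using True by (simp add: add_increasing2 ennreal_leI)
    next
      case False
      then have "h / 4 \<le> max 0 (\<bar>y - x0\<bar> - h / 4)" using h by auto
      then have "M * (h / 4) \<le> q y" unfolding q_def using M0 by (rule mult_left_mono)
      then have "real m * (M * (h / 4)) \<le> real m * q y" by (rule mult_left_mono) simp
      then have "exp (- real m * q y) \<le> exp (- (M * h / 4)) ^ m"
        unfolding exp_of_nat_mult[symmetric] by (simp add: algebra_simps)
      then have "?f y * exp (- real m * q y) \<le> (A ^ m * B) * exp (- (M * h / 4)) ^ m"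
        using growth[OF y] A B0 by (intro mult_mono) auto
      then show ?thesis using False by (simp add: E_def ennreal_leI)
    qed
    have "q x1 = 0" using x1(1) by (auto simp: q_def)
    then have "ennreal B \<le> ennreal (C * (1 + \<epsilon>) ^ m) * (\<integral>\<^sup>+y. ennreal (?f y * exp (- real m * q y)) \<partial>\<tau>)"
      using bm[OF P, of x1] x1(1) by (simp add: B_def)
    also have "\<dots> \<le> ennreal (C * (1 + \<epsilon>) ^ m) * (\<integral>\<^sup>+y. ennreal (?f y) * indicator {x0 - h/2..x0 + h/2} y + ennreal E \<partial>\<tau>)"
      by (intro mult_left_mono nn_integral_mono pt) (simp_all add: sp)
    also have "(\<integral>\<^sup>+y. ennreal (?f y) * indicator {x0 - h/2..x0 + h/2} y + ennreal E \<partial>\<tau>) = ?I + ennreal (E * T)"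
      using T E0 by (subst nn_integral_add) (auto simp: ennreal_mult)
    also have "ennreal (C * (1 + \<epsilon>) ^ m) * (?I + ennreal (E * T))
        = ennreal (C * (1 + \<epsilon>) ^ m) * ?I + ennreal (C * (1 + \<epsilon>) ^ m * (E * T))"
      using C \<epsilon> E0 T by (simp add: distrib_left ennreal_mult)
    also have "C * (1 + \<epsilon>) ^ m * (E * T) = C * T * (exp (- (M * h / 4)) * ((1 + \<epsilon>) * A)) ^ m * B"
      by (simp add: E_def power_mult_distrib mult_ac)
    also have "\<dots> = C * T * (1 / 2) ^ m * B" unfolding key ..
    also have "ennreal \<dots> \<le> ennreal (B / 2)"
      using mult_right_mono[OF less_imp_le[OF m0[OF m]] B0] by (intro ennreal_leI) simp
    finally have "ennreal B \<le> ennreal (C * (1 + \<epsilon>) ^ m) * ?I + ennreal (B / 2)"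
      by (simp add: add_left_mono)
    \<comment> \<open>The finite half can be cancelled in \<open>ennreal\<close>; doubling what
      remains gives the constant \<open>2 * C\<close>.\<close>
    moreover have "ennreal B = ennreal (B / 2) + ennreal (B / 2)"
      using B0 by (simp flip: ennreal_plus)
    ultimately have "ennreal (B / 2) \<le> ennreal (C * (1 + \<epsilon>) ^ m) * ?I"
      by (simp add: add.commute[of "_ * _"])
    then have "ennreal (B / 2) + ennreal (B / 2) \<le> ennreal (C * (1 + \<epsilon>) ^ m) * ?I + ennreal (C * (1 + \<epsilon>) ^ m) * ?I"
      by (intro add_mono)
    then have "ennreal B \<le> ennreal (2 * C * (1 + \<epsilon>) ^ m) * ?I"
      unfolding \<open>ennreal B = _\<close> distrib_right[symmetric] using C \<epsilon>
      by (simp flip: ennreal_plus add: mult.assoc)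
    moreover have "ennreal (?f x) \<le> ennreal B" unfolding B_def by (intro ennreal_leI x1(2) J(2))
    ultimately show "ennreal (?f x) \<le> ennreal (2 * C * (1 + \<epsilon>) ^ m) * ?I" by (rule order_trans[rotated])
  qed
qed

text \<open>By compactness finitely many centres suffice, and the sum of their constants serves all
  of them. If \<open>x\<close> is within \<open>h / 4\<close> of a centre, then the interval of
  radius \<open>h / 2\<close> around the centre is contained in the one of radius \<open>h\<close>
  around \<open>x\<close>, which makes the bound uniform in \<open>x\<close>.\<close>

lemma local_BM:
  assumes ab: "a < b" and \<tau>: "sets \<tau> = sets (restrict_space borel {a..b})" and fin: "finite_measure \<tau>"
    and BM: "strong_weighted_BM (complex_of_real ` {a..b}) (distr \<tau> borel complex_of_real)"
    and h: "0 < h" and \<epsilon>: "0 < \<epsilon>"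
  shows "\<exists>C>0. \<exists>m0. \<forall>m\<ge>m0. \<forall>P :: complex poly. degree P \<le> m \<longrightarrow> (\<forall>x\<in>{a..b}.
     ennreal (cmod (poly P (of_real x))) \<le> ennreal (C * (1 + \<epsilon>) ^ m) *
       (\<integral>\<^sup>+y. ennreal (cmod (poly P (of_real y))) * indicator {x - h..x + h} y \<partial>\<tau>))"
proof -
  define G where "G x0 C m0 \<longleftrightarrow> (\<forall>m\<ge>m0. \<forall>P :: complex poly. degree P \<le> m \<longrightarrow> (\<forall>x\<in>{a..b}. \<bar>x - x0\<bar> \<le> h / 4 \<longrightarrow>
     ennreal (cmod (poly P (of_real x))) \<le> ennreal (C * (1 + \<epsilon>) ^ m) *
       (\<integral>\<^sup>+y. ennreal (cmod (poly P (of_real y))) * indicator {x0 - h/2..x0 + h/2} y \<partial>\<tau>)))"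
    for x0 C and m0 :: nat
  have "\<forall>x0\<in>{a..b}. \<exists>C>0. \<exists>m0. G x0 C m0"
    unfolding G_def by (intro ballI local_BM_near_point[OF assms])
  from bchoice[OF this] obtain C where C: "\<forall>x0\<in>{a..b}. 0 < C x0 \<and> (\<exists>m0. G x0 (C x0) m0)" ..
  then have "\<forall>x0\<in>{a..b}. \<exists>m0. G x0 (C x0) m0" by blast
  from bchoice[OF this] obtain m0 where G: "\<forall>x0\<in>{a..b}. G x0 (C x0) (m0 x0)" ..
  have est: "ennreal (cmod (poly P (of_real x))) \<le> ennreal (C x0 * (1 + \<epsilon>) ^ m) *
       (\<integral>\<^sup>+y. ennreal (cmod (poly P (of_real y))) * indicator {x0 - h/2..x0 + h/2} y \<partial>\<tau>)"
    if "x0 \<in> {a..b}" "m0 x0 \<le> m" "degree P \<le> m" "x \<in> {a..b}" "\<bar>x - x0\<bar> \<le> h / 4"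
    for x0 m x and P :: "complex poly"
    using G[rule_format, OF that(1), unfolded G_def, rule_format, OF that(2-5)] .
  have "{a..b} \<subseteq> (\<Union>x0\<in>{a..b}. ball x0 (h / 4))" using h by auto
  then obtain F where F: "F \<subseteq> {a..b}" "finite F" "{a..b} \<subseteq> (\<Union>x0\<in>F. ball x0 (h / 4))"
    using compactE_image[OF compact_Icc[of a b], of "{a..b}" "\<lambda>x0. ball x0 (h / 4)"]
    by (metis open_ball)
  have Cnn: "0 \<le> C x0" if "x0 \<in> F" for x0 using C F(1) that by (auto intro: less_imp_le)
  then have Cpos: "0 < 1 + sum C F" using sum_nonneg[of F C] by simp
  show ?thesis
  proof (intro exI[of _ "1 + sum C F"] conjI Cpos exI[of _ "sum m0 F"] allI impI ballI)
    fix m x and P :: "complex poly"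
    assume m: "sum m0 F \<le> m" and P: "degree P \<le> m" and x: "x \<in> {a..b}"
    obtain x0 where x0: "x0 \<in> F" "x \<in> ball x0 (h / 4)" using F(3) x by blast
    have xx: "\<bar>x - x0\<bar> \<le> h / 4" using x0(2) by (simp add: dist_real_def abs_minus_commute)
    have "m0 x0 \<le> m" using member_le_sum[OF x0(1) _ F(2), of m0] m by simp
    then have "ennreal (cmod (poly P (of_real x))) \<le> ennreal (C x0 * (1 + \<epsilon>) ^ m) *
       (\<integral>\<^sup>+y. ennreal (cmod (poly P (of_real y))) * indicator {x0 - h/2..x0 + h/2} y \<partial>\<tau>)"
      using x0(1) F(1) by (intro est P x xx) auto
    also have "\<dots> \<le> ennreal ((1 + sum C F) * (1 + \<epsilon>) ^ m) *
       (\<integral>\<^sup>+y. ennreal (cmod (poly P (of_real y))) * indicator {x - h..x + h} y \<partial>\<tau>)"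
    proof (intro mult_mono ennreal_leI mult_right_mono nn_integral_mono)
      have "C x0 \<le> sum C F"
        by (rule member_le_sum[OF x0(1) _ F(2)]) (rule Cnn, simp)
      then show "C x0 \<le> 1 + sum C F" by simp
      fix y
      have "x - h / 4 \<le> x0" "x0 \<le> x + h / 4" using xx by linarith+
      then show "(indicator {x0 - h/2..x0 + h/2} y :: ennreal) \<le> indicator {x - h..x + h} y"
        using h by (intro indicator_leI) auto
    qed (use \<epsilon> Cpos in auto)
    finally show "ennreal (cmod (poly P (of_real x))) \<le> ennreal ((1 + sum C F) * (1 + \<epsilon>) ^ m) *
       (\<integral>\<^sup>+y. ennreal (cmod (poly P (of_real y))) * indicator {x - h..x + h} y \<partial>\<tau>)" .
  qed
qed

section \<open>The energy as a pair interaction\<close>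

locale interval_system =
  fixes p :: nat and a b r :: "nat \<Rightarrow> real" and \<Gamma> :: "nat \<Rightarrow> real set" and Q :: "nat \<Rightarrow> real \<Rightarrow> real"
  assumes p: "1 \<le> p" and ab: "i < p \<Longrightarrow> a i < b i" and \<Gamma>: "i < p \<Longrightarrow> \<Gamma> i = {a i..b i}"
    and disj: "Suc i < p \<Longrightarrow> b i < a (Suc i)" and r: "i < p \<Longrightarrow> 0 < r i" and sum_r: "(\<Sum>i<p. r i) = 1"
    and Q: "i < p \<Longrightarrow> continuous_on (\<Gamma> i) (Q i)"
begin

abbreviation "M \<equiv> M_space p \<Gamma> r"

lemma compact_\<Gamma>: "i < p \<Longrightarrow> compact (\<Gamma> i)" and closed_\<Gamma>: "i < p \<Longrightarrow> closed (\<Gamma> i)"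
  by (simp_all add: \<Gamma>)

lemma r_nonneg: "i < p \<Longrightarrow> 0 \<le> r i"
  using r less_imp_le by blast

lemma sum_r_r: "(\<Sum>i<p. \<Sum>j<p. r i * r j) = 1"
  by (simp add: sum_distrib_left[symmetric] sum_r)

lemma in_M_D: "\<nu> \<in> M \<Longrightarrow> i < p \<Longrightarrow> \<nu> i \<in> measures_of_mass (\<Gamma> i) (r i)"
  by (simp add: M_space_def PiE_iff)

lemma endpoints_less: "i < j \<Longrightarrow> j < p \<Longrightarrow> b i < a j"
proof (induction j)
  case (Suc j)
  show ?case
  proof (cases "i = j")
    case False
    then have "b i < a j" using Suc by simp
    then show ?thesis using ab[of j] disj[of j] Suc.prems by simp
  qed (use disj[of j] Suc.prems in simp)
qed simp

lemma \<Gamma>_less: "i < j \<Longrightarrow> j < p \<Longrightarrow> x \<in> \<Gamma> i \<Longrightarrow> y \<in> \<Gamma> j \<Longrightarrow> x < y"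
  using endpoints_less[of i j] by (simp add: \<Gamma>)

text \<open>A crude bound for all distances between points of the intervals; the summand 1 ensures
  \<open>0 \<le> ln D\<close>.\<close>

definition D :: real where "D = 1 + 2 * (\<Sum>i<p. \<bar>a i\<bar> + \<bar>b i\<bar>)"

lemma D_ge_1: "1 \<le> D"
  by (simp add: D_def sum_nonneg)

lemma dist_le_D:
  assumes "i < p" "j < p" "x \<in> \<Gamma> i" "y \<in> \<Gamma> j"
  shows "\<bar>x - y\<bar> \<le> D"
proof -
  have *: "\<bar>x\<bar> \<le> (\<Sum>i<p. \<bar>a i\<bar> + \<bar>b i\<bar>)" if "i < p" "x \<in> \<Gamma> i" for x i
  proof -
    have "\<bar>x\<bar> \<le> \<bar>a i\<bar> + \<bar>b i\<bar>" using that by (auto simp: \<Gamma>)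
    also have "\<dots> \<le> (\<Sum>i<p. \<bar>a i\<bar> + \<bar>b i\<bar>)"
      by (rule member_le_sum) (use that in auto)
    finally show ?thesis .
  qed
  show ?thesis using *[OF assms(1,3)] *[OF assms(2,4)] by (simp add: D_def)
qed

definition q0 :: real where "q0 = (SOME q. 0 \<le> q \<and> (\<forall>i<p. \<forall>x\<in>\<Gamma> i. \<bar>Q i x\<bar> \<le> q))"

lemma q0: "0 \<le> q0" "i < p \<Longrightarrow> x \<in> \<Gamma> i \<Longrightarrow> \<bar>Q i x\<bar> \<le> q0"
proof -
  have "\<forall>i. \<exists>q. i < p \<longrightarrow> (\<forall>x\<in>\<Gamma> i. \<bar>Q i x\<bar> \<le> q)"
  proof
    fix i
    show "\<exists>q. i < p \<longrightarrow> (\<forall>x\<in>\<Gamma> i. \<bar>Q i x\<bar> \<le> q)"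
      using compact_imp_bounded[OF compact_continuous_image[OF Q compact_\<Gamma>], of i]
      by (auto simp: bounded_iff)
  qed
  from choice[OF this] obtain q where q: "\<forall>i. i < p \<longrightarrow> (\<forall>x\<in>\<Gamma> i. \<bar>Q i x\<bar> \<le> q i)" ..
  have "\<bar>Q i x\<bar> \<le> (\<Sum>i<p. \<bar>q i\<bar>)" if "i < p" "x \<in> \<Gamma> i" for i x
  proof -
    have "\<bar>Q i x\<bar> \<le> \<bar>q i\<bar>" using q that abs_ge_self order_trans by blast
    also have "\<dots> \<le> (\<Sum>i<p. \<bar>q i\<bar>)"
      by (rule member_le_sum) (use that in auto)
    finally show ?thesis .
  qed
  then have "\<exists>q. 0 \<le> q \<and> (\<forall>i<p. \<forall>x\<in>\<Gamma> i. \<bar>Q i x\<bar> \<le> q)"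
    by (intro exI[of _ "\<Sum>i<p. \<bar>q i\<bar>"]) (auto intro: sum_nonneg)
  from someI_ex[OF this] show "0 \<le> q0" "i < p \<Longrightarrow> x \<in> \<Gamma> i \<Longrightarrow> \<bar>Q i x\<bar> \<le> q0"
    unfolding q0_def by blast+
qed

text \<open>Spreading the external field over all pairs turns twice the weighted energy, up to the
  additive constant \<open>c0\<close> that makes everything nonnegative, into a pure pair interaction.\<close>

definition c0 :: real where "c0 = 2 * ln D + 4 * q0"

text \<open>Cutting the distance at \<open>exp (- N)\<close> keeps the kernel finite and continuous
  on the diagonal. Summed over all ordered pairs of n points, the two field terms produce
  \<open>4 * n\<close> times the sum of the fields, the exponent in the square of the
  weight.\<close>

definition trunc_kernel :: "nat \<Rightarrow> nat \<Rightarrow> nat \<Rightarrow> real \<times> real \<Rightarrow> real" where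
  "trunc_kernel N i j z = c0 + 2 * Q i (fst z) + 2 * Q j (snd z)
     - real (pair_mult i j) * ln (max \<bar>fst z - snd z\<bar> (exp (- real N)))"

text \<open>As the supremum of the truncations the kernel is directly accessible to monotone
  convergence, and it takes the value infinity at coinciding points.\<close>

definition kernel :: "nat \<Rightarrow> nat \<Rightarrow> real \<times> real \<Rightarrow> ennreal" where
  "kernel i j z = (SUP N. ennreal (trunc_kernel N i j z))"

definition trunc_energy :: "nat \<Rightarrow> (nat \<Rightarrow> real measure) \<Rightarrow> real" where
  "trunc_energy N \<nu> = (\<Sum>i<p. \<Sum>j<p. LINT z:\<Gamma> i\<times>\<Gamma> j|\<nu> i \<Otimes>\<^sub>M \<nu> j. trunc_kernel N i j z)"

definition energy :: "(nat \<Rightarrow> real measure) \<Rightarrow> ennreal" where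
  "energy \<nu> = (\<Sum>i<p. \<Sum>j<p. \<integral>\<^sup>+z\<in>\<Gamma> i \<times> \<Gamma> j. kernel i j z \<partial>(\<nu> i \<Otimes>\<^sub>M \<nu> j))"

text \<open>The constant \<open>c0\<close> is calibrated for this: multiplicities are at most 2 and
  distances at most \<open>D\<close>, so the logarithm contributes at least
  \<open>- 2 * ln D\<close>, and the field terms contribute at least
  \<open>- 4 * q0\<close>.\<close>

lemma trunc_kernel_ge:
  assumes "i < p" "j < p" "z \<in> \<Gamma> i \<times> \<Gamma> j"
  shows "0 \<le> trunc_kernel N i j z"
proof -
  obtain x y where z: "z = (x, y)" "x \<in> \<Gamma> i" "y \<in> \<Gamma> j" using assms(3) by auto
  have m: "max \<bar>x - y\<bar> (exp (- real N)) \<le> D"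
    using dist_le_D[OF assms(1,2) z(2,3)] D_ge_1 by (auto intro: order_trans[of _ 1])
  have "0 < max \<bar>x - y\<bar> (exp (- real N))" by (simp add: less_max_iff_disj)
  then have l: "ln (max \<bar>x - y\<bar> (exp (- real N))) \<le> ln D"
    using m D_ge_1 by (subst ln_le_cancel_iff) auto
  have "0 \<le> ln D" using D_ge_1 by simp
  then have "real (pair_mult i j) * ln (max \<bar>x - y\<bar> (exp (- real N))) \<le> 2 * ln D"
    using l by (auto simp: pair_mult_def)
  then show ?thesis
    using q0(2)[OF assms(1) z(2)] q0(2)[OF assms(2) z(3)] unfolding trunc_kernel_def c0_def z by simp
qed

lemma continuous_on_trunc_kernel:
  assumes "i < p" "j < p"
  shows "continuous_on (\<Gamma> i \<times> \<Gamma> j) (trunc_kernel N i j)"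
proof -
  have 1: "continuous_on (\<Gamma> i \<times> \<Gamma> j) (\<lambda>z. Q i (fst z))" "continuous_on (\<Gamma> i \<times> \<Gamma> j) (\<lambda>z. Q j (snd z))"
    by (rule continuous_on_compose2[OF Q[OF assms(1)]], intro continuous_intros, auto)
      (rule continuous_on_compose2[OF Q[OF assms(2)]], intro continuous_intros, auto)
  have pos: "max \<bar>fst z - snd z\<bar> (exp (- real N)) \<noteq> 0" for z :: "real \<times> real"
    by (metis exp_gt_zero less_max_iff_disj less_irrefl)
  show ?thesis unfolding trunc_kernel_def
    by (intro continuous_intros 1 ballI pos)
qed

lemma trunc_kernel_mono:
  assumes "N \<le> N'"
  shows "trunc_kernel N i j z \<le> trunc_kernel N' i j z"
proof -
  have "0 < max \<bar>fst z - snd z\<bar> (exp (- real N'))" by (simp add: less_max_iff_disj)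
  moreover have "max \<bar>fst z - snd z\<bar> (exp (- real N')) \<le> max \<bar>fst z - snd z\<bar> (exp (- real N))"
    using assms by (intro max.mono) auto
  ultimately have "ln (max \<bar>fst z - snd z\<bar> (exp (- real N'))) \<le> ln (max \<bar>fst z - snd z\<bar> (exp (- real N)))"
    by simp
  then show ?thesis unfolding trunc_kernel_def by (intro diff_left_mono mult_left_mono) auto
qed

lemma borel_measurable_trunc_kernel:
  assumes "i < p" "j < p"
  shows "(\<lambda>z. indicator (\<Gamma> i \<times> \<Gamma> j) z *\<^sub>R trunc_kernel N i j z) \<in> borel_measurable (borel \<Otimes>\<^sub>M borel)"
  unfolding borel_prod using assms
  by (intro borel_measurable_continuous_on_indicator continuous_on_trunc_kernel borel_closed
      closed_Times closed_\<Gamma>)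

lemma borel_measurable_ennreal_trunc_kernel:
  assumes "i < p" "j < p"
  shows "(\<lambda>z. ennreal (trunc_kernel N i j z) * indicator (\<Gamma> i \<times> \<Gamma> j) z) \<in> borel_measurable (borel \<Otimes>\<^sub>M borel)"
proof -
  have "(\<lambda>z. ennreal (trunc_kernel N i j z) * indicator (\<Gamma> i \<times> \<Gamma> j) z)
      = (\<lambda>z. ennreal (indicator (\<Gamma> i \<times> \<Gamma> j) z *\<^sub>R trunc_kernel N i j z))"
    by (auto simp: indicator_def)
  then show ?thesis using borel_measurable_trunc_kernel[OF assms, of N] by simp
qed

lemma kernel_indicator:
  "kernel i j z * indicator S z = (SUP N. ennreal (trunc_kernel N i j z) * indicator S z)"
  by (simp add: kernel_def SUP_mult_right_ennreal)

lemma borel_measurable_kernel: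
  assumes "i < p" "j < p"
  shows "(\<lambda>z. kernel i j z * indicator (\<Gamma> i \<times> \<Gamma> j) z) \<in> borel_measurable (borel \<Otimes>\<^sub>M borel)"
  unfolding kernel_indicator
  by (intro borel_measurable_SUP countableI_type borel_measurable_ennreal_trunc_kernel assms)

lemma sets_M:
  assumes "\<nu> \<in> M" "i < p" "j < p"
  shows "sets (\<nu> i) = sets borel" "sets (\<nu> i \<Otimes>\<^sub>M \<nu> j) = sets (borel \<Otimes>\<^sub>M borel)"
  using measures_of_massD(1)[OF in_M_D[OF assms(1)] closed_\<Gamma>] assms(2,3)
  by (auto intro!: sets_pair_measure_cong)

lemma integral_trunc_kernel:
  assumes "\<nu> \<in> M" "i < p" "j < p"
  shows "ennreal (LINT z:\<Gamma> i\<times>\<Gamma> j|\<nu> i \<Otimes>\<^sub>M \<nu> j. trunc_kernel N i j z)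
      = (\<integral>\<^sup>+z\<in>\<Gamma> i \<times> \<Gamma> j. ennreal (trunc_kernel N i j z) \<partial>(\<nu> i \<Otimes>\<^sub>M \<nu> j))"
    "0 \<le> (LINT z:\<Gamma> i\<times>\<Gamma> j|\<nu> i \<Otimes>\<^sub>M \<nu> j. trunc_kernel N i j z)"
proof -
  have nn: "0 \<le> indicator (\<Gamma> i \<times> \<Gamma> j) z *\<^sub>R trunc_kernel N i j z" for z
    using trunc_kernel_ge[OF assms(2,3), of z N] by (auto simp: indicator_def)
  then show "0 \<le> (LINT z:\<Gamma> i\<times>\<Gamma> j|\<nu> i \<Otimes>\<^sub>M \<nu> j. trunc_kernel N i j z)"
    unfolding set_lebesgue_integral_def by (intro Bochner_Integration.integral_nonneg) (rule nn)
  have "set_integrable (\<nu> i \<Otimes>\<^sub>M \<nu> j) (\<Gamma> i \<times> \<Gamma> j) (trunc_kernel N i j)"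
    by (intro set_integrable_pair_measures_of_mass[OF in_M_D[OF assms(1)] in_M_D[OF assms(1)]]
        compact_\<Gamma> continuous_on_trunc_kernel assms)
  then have "ennreal (LINT z:\<Gamma> i\<times>\<Gamma> j|\<nu> i \<Otimes>\<^sub>M \<nu> j. trunc_kernel N i j z)
     = (\<integral>\<^sup>+z. ennreal (indicator (\<Gamma> i \<times> \<Gamma> j) z *\<^sub>R trunc_kernel N i j z) \<partial>(\<nu> i \<Otimes>\<^sub>M \<nu> j))"
    unfolding set_integrable_def set_lebesgue_integral_def
    by (intro nn_integral_eq_integral[symmetric] AE_I2 nn)
  also have "\<dots> = (\<integral>\<^sup>+z\<in>\<Gamma> i \<times> \<Gamma> j. ennreal (trunc_kernel N i j z) \<partial>(\<nu> i \<Otimes>\<^sub>M \<nu> j))"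
    by (intro nn_integral_cong) (auto simp: indicator_def)
  finally show "ennreal (LINT z:\<Gamma> i\<times>\<Gamma> j|\<nu> i \<Otimes>\<^sub>M \<nu> j. trunc_kernel N i j z)
      = (\<integral>\<^sup>+z\<in>\<Gamma> i \<times> \<Gamma> j. ennreal (trunc_kernel N i j z) \<partial>(\<nu> i \<Otimes>\<^sub>M \<nu> j))" .
qed

text \<open>Monotone convergence in the truncation level. Each truncated energy is weak-*
  continuous, so the energy appears as a supremum of continuous functions.\<close>

lemma energy_eq_SUP:
  assumes "\<nu> \<in> M"
  shows "energy \<nu> = (SUP N. ennreal (trunc_energy N \<nu>))"
proof -
  let ?I = "\<lambda>N i j. \<integral>\<^sup>+z\<in>\<Gamma> i \<times> \<Gamma> j. ennreal (trunc_kernel N i j z) \<partial>(\<nu> i \<Otimes>\<^sub>M \<nu> j)"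
  have inc: "incseq (\<lambda>N. ?I N i j)" for i j
    unfolding incseq_def by (intro allI impI nn_integral_mono mult_right_mono ennreal_leI trunc_kernel_mono) auto
  have "(\<integral>\<^sup>+z\<in>\<Gamma> i \<times> \<Gamma> j. kernel i j z \<partial>(\<nu> i \<Otimes>\<^sub>M \<nu> j)) = (SUP N. ?I N i j)" if "i < p" "j < p" for i j
    unfolding kernel_indicator
  proof (rule nn_integral_monotone_convergence_SUP)
    show "incseq (\<lambda>N z. ennreal (trunc_kernel N i j z) * indicator (\<Gamma> i \<times> \<Gamma> j) z)"
      unfolding incseq_def le_fun_def
      by (intro allI impI mult_right_mono ennreal_leI trunc_kernel_mono) auto
    show "(\<lambda>z. ennreal (trunc_kernel N i j z) * indicator (\<Gamma> i \<times> \<Gamma> j) z) \<in> borel_measurable (\<nu> i \<Otimes>\<^sub>M \<nu> j)" for N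
      using borel_measurable_ennreal_trunc_kernel[OF that]
      unfolding measurable_cong_sets[OF sets_M(2)[OF assms that] refl] .
  qed
  then have "energy \<nu> = (\<Sum>i<p. \<Sum>j<p. SUP N. ?I N i j)"
    unfolding energy_def by (intro sum.cong) auto
  also have "\<dots> = (\<Sum>i<p. SUP N. \<Sum>j<p. ?I N i j)"
    by (intro sum.cong refl ennreal_SUP_sum[symmetric] inc)
  also have "\<dots> = (SUP N. \<Sum>i<p. \<Sum>j<p. ?I N i j)"
    by (intro ennreal_SUP_sum[symmetric] incseq_sumI2) (use inc in \<open>auto simp: incseq_def intro!: sum_mono\<close>)
  also have "\<dots> = (SUP N. ennreal (trunc_energy N \<nu>))"
  proof (rule arg_cong[of _ _ Sup], rule image_cong[OF refl])
    fix N
    let ?L = "\<lambda>i j. LINT z:\<Gamma> i\<times>\<Gamma> j|\<nu> i \<Otimes>\<^sub>M \<nu> j. trunc_kernel N i j z"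
    have nn: "0 \<le> ?L i j" if "i \<in> {..<p}" "j \<in> {..<p}" for i j
      using integral_trunc_kernel(2)[OF assms] that by simp
    have "(\<Sum>i<p. \<Sum>j<p. ?I N i j) = (\<Sum>i<p. \<Sum>j<p. ennreal (?L i j))"
      by (intro sum.cong refl integral_trunc_kernel(1)[symmetric] assms) auto
    also have "\<dots> = (\<Sum>i<p. ennreal (\<Sum>j<p. ?L i j))"
      by (intro sum.cong refl sum_ennreal nn)
    also have "\<dots> = ennreal (trunc_energy N \<nu>)"
      unfolding trunc_energy_def by (intro sum_ennreal sum_nonneg nn)
    finally show "(\<Sum>i<p. \<Sum>j<p. ?I N i j) = ennreal (trunc_energy N \<nu>)" .
  qed
  finally show ?thesis .
qed

lemma continuous_map_trunc_energy:
  "continuous_map (M_topology p \<Gamma> r) euclideanreal (trunc_energy N)"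
  unfolding trunc_energy_def
proof (intro continuous_map_sum)
  fix i j assume "i \<in> {..<p}" "j \<in> {..<p}"
  then have ij: "i < p" "j < p" by auto
  have proj: "continuous_map (M_topology p \<Gamma> r) (weak_star_topology (\<Gamma> i) (r i)) (\<lambda>\<nu>. \<nu> i)" if "i < p" for i
    unfolding M_topology_def by (rule continuous_map_product_projection) (use that in simp)
  show "continuous_map (M_topology p \<Gamma> r) euclideanreal
      (\<lambda>\<nu>. LINT z:\<Gamma> i\<times>\<Gamma> j|\<nu> i \<Otimes>\<^sub>M \<nu> j. trunc_kernel N i j z)"
    by (intro continuous_map_double_integral[OF proj[OF ij(1)] proj[OF ij(2)]] compact_\<Gamma> ij r_nonneg
        continuous_on_trunc_kernel)
qed auto

lemma openin_trunc_energy_greater: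
  "openin (M_topology p \<Gamma> r) {\<nu> \<in> M. t < trunc_energy N \<nu>}"
  using openin_continuous_map_preimage[OF continuous_map_trunc_energy, of "{t<..}" N] by simp

section \<open>Upper bounds for the weight of a configuration\<close>

lemma sum_sum_coords:
  "(\<Sum>u\<in>coords p n. \<Sum>v\<in>coords p n. g u v) = (\<Sum>i<p. \<Sum>j<p. \<Sum>k<n i. \<Sum>l<n j. g (i, k) (j, l))"
  unfolding sum_coords by (rule sum.cong[OF refl], subst sum.swap) (rule refl)

text \<open>The diagonal pairs are included, which the truncation permits; the sum over a pair of
  blocks is then exactly a multiple of a double integral against the empirical measures.\<close>

definition trunc_interaction :: "nat \<Rightarrow> (nat \<Rightarrow> nat) \<Rightarrow> (nat \<times> nat \<Rightarrow> real) \<Rightarrow> real" where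
  "trunc_interaction N n X = (\<Sum>u\<in>coords p n. \<Sum>v\<in>coords p n. trunc_kernel N (fst u) (fst v) (X u, X v))"

lemma in_configs_D: "X \<in> configs p \<Gamma> n \<Longrightarrow> u \<in> coords p n \<Longrightarrow> X u \<in> \<Gamma> (fst u) \<and> fst u < p"
  by (auto simp: PiE_iff coords_def)

text \<open>The atoms of the empirical measures have mass \<open>r i / n i\<close>, while the
  interaction weights all points alike; \<theta> bounds the discrepancy from one side. One side is
  enough because the truncated kernel is nonnegative.\<close>

lemma trunc_interaction_ge:
  assumes X: "X \<in> configs p \<Gamma> n" and n: "\<And>i. i < p \<Longrightarrow> 0 < n i"
    and \<theta>: "0 \<le> \<theta>" "\<And>i. i < p \<Longrightarrow> \<theta> * r i \<le> real (n i) / m"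
  shows "\<theta>\<^sup>2 * m\<^sup>2 * trunc_energy N (j_map p r n X) \<le> trunc_interaction N n X"
proof (cases "m = 0")
  case True
  have "0 \<le> trunc_interaction N n X" unfolding trunc_interaction_def
    using in_configs_D[OF X] by (intro sum_nonneg trunc_kernel_ge) auto
  then show ?thesis using True by simp
next
  case False
  have jM: "j_map p r n X \<in> M" using X by (rule j_map_in_M_space) (use closed_\<Gamma> r n in auto)
  let ?S = "\<lambda>i j. \<Sum>k<n i. \<Sum>l<n j. trunc_kernel N i j (X (i, k), X (j, l))"
  have "\<theta>\<^sup>2 * m\<^sup>2 * (LINT z:\<Gamma> i\<times>\<Gamma> j|j_map p r n X i \<Otimes>\<^sub>M j_map p r n X j. trunc_kernel N i j z) \<le> ?S i j"
    if ij: "i < p" "j < p" for i j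
  proof -
    have nn: "0 \<le> trunc_kernel N i j (X (i, k), X (j, l))" and ind: "(X (i, k), X (j, l)) \<in> \<Gamma> i \<times> \<Gamma> j"
      if "k < n i" "l < n j" for k l
      using that ij in_configs_D[OF X, of "(i, k)"] in_configs_D[OF X, of "(j, l)"]
      by (auto intro!: trunc_kernel_ge)
    have S: "0 \<le> ?S i j" by (intro sum_nonneg nn) auto
    have "(\<integral>\<^sup>+z\<in>\<Gamma> i \<times> \<Gamma> j. ennreal (trunc_kernel N i j z) \<partial>(j_map p r n X i \<Otimes>\<^sub>M j_map p r n X j))
      = ennreal (r i / real (n i)) * ennreal (r j / real (n j)) *
        (\<Sum>k<n i. \<Sum>l<n j. ennreal (trunc_kernel N i j (X (i, k), X (j, l))) * indicator (\<Gamma> i \<times> \<Gamma> j) (X (i, k), X (j, l)))"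
      using ij r[OF ij(1)] r[OF ij(2)] unfolding j_map_def
      by (simp add: nn_integral_pair_scaled_dirac_sum[OF borel_measurable_ennreal_trunc_kernel[OF ij]])
    also have "(\<Sum>k<n i. \<Sum>l<n j. ennreal (trunc_kernel N i j (X (i, k), X (j, l))) * indicator (\<Gamma> i \<times> \<Gamma> j) (X (i, k), X (j, l)))
      = (\<Sum>k<n i. \<Sum>l<n j. ennreal (trunc_kernel N i j (X (i, k), X (j, l))))"
      using ind by (intro sum.cong) auto
    also have "\<dots> = ennreal (?S i j)"
    proof -
      have "(\<Sum>k<n i. \<Sum>l<n j. ennreal (trunc_kernel N i j (X (i, k), X (j, l))))
          = (\<Sum>k<n i. ennreal (\<Sum>l<n j. trunc_kernel N i j (X (i, k), X (j, l))))"
        by (intro sum.cong refl sum_ennreal nn) auto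
      also have "\<dots> = ennreal (?S i j)" by (intro sum_ennreal sum_nonneg nn) auto
      finally show ?thesis .
    qed
    also have "ennreal (r i / real (n i)) * ennreal (r j / real (n j)) * ennreal (?S i j)
        = ennreal (r i / real (n i) * (r j / real (n j)) * ?S i j)"
    proof -
      have "0 \<le> r i / real (n i)" "0 \<le> r j / real (n j)" using r[OF ij(1)] r[OF ij(2)] by simp_all
      then show ?thesis using S by (simp only: ennreal_mult mult_nonneg_nonneg)
    qed
    finally have nn_eq: "(\<integral>\<^sup>+z\<in>\<Gamma> i \<times> \<Gamma> j. ennreal (trunc_kernel N i j z) \<partial>(j_map p r n X i \<Otimes>\<^sub>M j_map p r n X j))
        = ennreal (r i / real (n i) * (r j / real (n j)) * ?S i j)" .
    have "0 \<le> r i / real (n i) * (r j / real (n j)) * ?S i j"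
      using r[OF ij(1)] r[OF ij(2)] S by (intro mult_nonneg_nonneg) simp_all
    note ennreal_inj[OF integral_trunc_kernel(2)[OF jM ij, of N] this]
    then have e: "(LINT z:\<Gamma> i\<times>\<Gamma> j|j_map p r n X i \<Otimes>\<^sub>M j_map p r n X j. trunc_kernel N i j z)
        = r i / real (n i) * (r j / real (n j)) * ?S i j"
      unfolding integral_trunc_kernel(1)[OF jM ij, of N] nn_eq by (rule iffD1) (rule refl)
    have \<theta>1: "0 \<le> \<theta> * r i" "0 \<le> \<theta> * r j" using \<theta>(1) r[OF ij(1)] r[OF ij(2)] by simp_all
    have "(\<theta> * r i) * (\<theta> * r j) \<le> (real (n i) / m) * (real (n j) / m)"
      using \<theta>(2)[OF ij(1)] \<theta>(2)[OF ij(2)] \<theta>1 by (intro mult_mono) auto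
    then have "m\<^sup>2 * ((\<theta> * r i) * (\<theta> * r j)) \<le> m\<^sup>2 * ((real (n i) / m) * (real (n j) / m))"
      by (intro mult_left_mono) auto
    also have "\<dots> = real (n i) * real (n j)" using False by (simp add: power2_eq_square)
    finally have "\<theta>\<^sup>2 * m\<^sup>2 * (r i / real (n i) * (r j / real (n j))) \<le> 1"
      using n[OF ij(1)] n[OF ij(2)] by (simp add: field_simps power2_eq_square)
    then have "\<theta>\<^sup>2 * m\<^sup>2 * (r i / real (n i) * (r j / real (n j))) * ?S i j \<le> 1 * ?S i j"
      using S by (rule mult_right_mono)
    then show ?thesis unfolding e by (simp add: mult_ac)
  qed
  then have "(\<Sum>i<p. \<Sum>j<p. \<theta>\<^sup>2 * m\<^sup>2 * (LINT z:\<Gamma> i\<times>\<Gamma> j|j_map p r n X i \<Otimes>\<^sub>M j_map p r n X j. trunc_kernel N i j z))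
      \<le> (\<Sum>i<p. \<Sum>j<p. ?S i j)"
    by (intro sum_mono) auto
  then show ?thesis
    unfolding trunc_energy_def trunc_interaction_def sum_sum_coords sum_distrib_left by simp
qed

text \<open>Off the diagonal the truncation only increases a gap. At a diagonal pair the gap is 1
  where the truncated kernel accounts for \<open>exp (- 2 * N)\<close>; compensating this for every
  point produces the term \<open>2 * N * m\<close>.\<close>

lemma A_weight_square_le:
  assumes X: "X \<in> configs p \<Gamma> n"
  defines "m \<equiv> real (mi_norm p n)"
  shows "(A_weight p Q n X)\<^sup>2 \<le> exp (m\<^sup>2 * c0 + 2 * real N * m - trunc_interaction N n X)"
proof -
  let ?C = "coords p n"
  let ?l = "\<lambda>u v. real (pair_mult (fst u) (fst v)) * ln (max \<bar>X u - X v\<bar> (exp (- real N)))"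
  have nn: "0 \<le> gap X u v" for u v by (simp add: gap_def)
  have le: "gap X u v \<le> exp (?l u v) * (if v = u then exp (2 * real N) else 1)" for u v
  proof (cases "u = v")
    case False
    have "0 < max \<bar>X u - X v\<bar> (exp (- real N))" by (simp add: less_max_iff_disj)
    then have "exp (?l u v) = max \<bar>X u - X v\<bar> (exp (- real N)) ^ pair_mult (fst u) (fst v)"
      by (simp add: exp_of_nat_mult)
    moreover have "\<bar>X u - X v\<bar> ^ pair_mult (fst u) (fst v) \<le> \<dots>" by (intro power_mono) auto
    ultimately show ?thesis using False by (simp add: gap_def)
  qed (simp add: gap_def pair_mult_def flip: exp_add)
  have "(\<Prod>u\<in>?C. \<Prod>v\<in>?C. gap X u v) \<le> (\<Prod>u\<in>?C. \<Prod>v\<in>?C. exp (?l u v) * (if v = u then exp (2 * real N) else 1))"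
    by (intro prod_mono conjI prod_nonneg nn le)
  also have "\<dots> = exp (\<Sum>u\<in>?C. \<Sum>v\<in>?C. ?l u v) * exp (2 * real N * m)"
    by (simp add: prod.distrib exp_sum m_def exp_of_nat_mult mult.commute)
  finally have "(A_weight p Q n X)\<^sup>2 \<le> exp (\<Sum>u\<in>?C. \<Sum>v\<in>?C. ?l u v) * exp (2 * real N * m) *
      exp (- 4 * m * (\<Sum>u\<in>?C. Q (fst u) (X u)))"
    unfolding A_weight_square m_def by (rule mult_right_mono) simp
  also have "\<dots> = exp ((\<Sum>u\<in>?C. \<Sum>v\<in>?C. ?l u v) + 2 * real N * m - 4 * m * (\<Sum>u\<in>?C. Q (fst u) (X u)))"
    by (simp flip: exp_add)
  also have "(\<Sum>u\<in>?C. \<Sum>v\<in>?C. ?l u v) = m\<^sup>2 * c0 + 4 * m * (\<Sum>u\<in>?C. Q (fst u) (X u)) - trunc_interaction N n X"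
    unfolding trunc_interaction_def trunc_kernel_def
    by (simp add: sum.distrib sum_subtractf m_def power2_eq_square sum_distrib_left algebra_simps)
  finally show ?thesis by (simp add: algebra_simps)
qed

end

section \<open>Identification with the weighted energy\<close>

text \<open>The extended integral is a difference of two nonnegative ones; the lower bound
  \<open>- c\<close> keeps the subtracted one at most \<open>c * m\<close>, so no difference of
  infinities occurs. Adding \<open>c\<close> moves everything into a single nonnegative
  integral.\<close>

lemma ext_set_integral_shift:
  fixes f :: "'a \<Rightarrow> ereal"
  assumes A: "A \<in> sets M" and fin: "emeasure M A = ennreal m" and m: "0 \<le> m" and c: "0 \<le> c"
    and meas: "(\<lambda>x. e2ennreal (f x + ereal c) * indicator A x) \<in> borel_measurable M"
    and lb: "\<And>x. x \<in> A \<Longrightarrow> - ereal c \<le> f x"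
  shows "ext_set_integral M A f = enn2ereal (\<integral>\<^sup>+x\<in>A. e2ennreal (f x + ereal c) \<partial>M) - ereal (c * m)"
proof -
  let ?g = "\<lambda>x. e2ennreal (f x + ereal c) * indicator A x"
  let ?P = "\<integral>\<^sup>+x\<in>A. e2ennreal (f x) \<partial>M" and ?N = "\<integral>\<^sup>+x\<in>A. e2ennreal (- f x) \<partial>M"
  let ?G = "\<integral>\<^sup>+x\<in>A. e2ennreal (f x + ereal c) \<partial>M"
  have pos: "e2ennreal (f x) * indicator A x = (?g x - ennreal c) * indicator A x" for x
  proof (cases "x \<in> A")
    case True
    then show ?thesis using lb[OF True] c
      by (cases "f x") (auto simp: e2ennreal_ereal ennreal_minus_if ennreal_neg infinity_ennreal_def)
  qed simp
  have neg: "e2ennreal (- f x) * indicator A x = (ennreal c - ?g x) * indicator A x" for x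
  proof (cases "x \<in> A")
    case True
    then show ?thesis using lb[OF True] c
      by (cases "f x") (auto simp: e2ennreal_ereal e2ennreal_neg ennreal_minus_if ennreal_neg)
  qed simp
  \<comment> \<open>With the truncated subtraction of \<open>ennreal\<close>, both sides equal the
    maximum of \<open>?g x\<close> and \<open>c\<close> on \<open>A\<close>. This relates the two
    parts of \<open>f\<close> by sums alone, which survive integration even with infinite
    values.\<close>
  have bal: "?g x + (ennreal c - ?g x) * indicator A x = (?g x - ennreal c) * indicator A x + ennreal c * indicator A x" for x
  proof (cases "x \<in> A")
    case True
    have "y + (ennreal c - y) = (y - ennreal c) + ennreal c" for y
      by (cases y) (auto simp: ennreal_minus_if c simp flip: ennreal_plus)
    then show ?thesis using True by simp
  qed simp
  note [measurable] = meas A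
  have mpos: "(\<lambda>x. (?g x - ennreal c) * indicator A x) \<in> borel_measurable M" by measurable
  have mneg: "(\<lambda>x. (ennreal c - ?g x) * indicator A x) \<in> borel_measurable M" by measurable
  have "?G + ?N = ?P + ennreal (c * m)"
  proof -
    have "?G + ?N = (\<integral>\<^sup>+x. ?g x + (ennreal c - ?g x) * indicator A x \<partial>M)"
      unfolding neg by (rule nn_integral_add[symmetric, OF meas mneg])
    also have "\<dots> = (\<integral>\<^sup>+x. (?g x - ennreal c) * indicator A x + ennreal c * indicator A x \<partial>M)"
      unfolding bal ..
    also have "\<dots> = ?P + (\<integral>\<^sup>+x. ennreal c * indicator A x \<partial>M)"
      unfolding pos by (rule nn_integral_add[OF mpos]) measurable
    also have "(\<integral>\<^sup>+x. ennreal c * indicator A x \<partial>M) = ennreal (c * m)"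
      using A c m by (simp add: nn_integral_cmult_indicator fin ennreal_mult)
    finally show ?thesis .
  qed
  moreover have "?N \<le> ennreal (c * m)"
  proof -
    have "?N \<le> (\<integral>\<^sup>+x. ennreal c * indicator A x \<partial>M)"
      unfolding neg by (intro nn_integral_mono mult_right_mono) auto
    also have "\<dots> = ennreal (c * m)"
      using A c m by (simp add: nn_integral_cmult_indicator fin ennreal_mult)
    finally show ?thesis .
  qed
  ultimately have "enn2ereal ?P - enn2ereal ?N = enn2ereal ?G - ereal (c * m)"
    using c m
    by (cases ?P; cases ?N; cases ?G)
      (auto simp: enn2ereal_ennreal ennreal_plus_if top_unique simp flip: ennreal_plus)
  then show ?thesis unfolding ext_set_integral_def .
qed

context interval_system
begin

text \<open>The shift by \<open>ln D\<close> makes the logarithmic kernel nonnegative on the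
  intervals, so that integrals may be exchanged.\<close>

definition log_kernel :: "real \<Rightarrow> real \<Rightarrow> ennreal" where
  "log_kernel x y = e2ennreal (eln (1 / ennreal \<bar>x - y\<bar>) + ereal (ln D))"

lemma eln_inverse_dist:
  "eln (1 / ennreal \<bar>x - y\<bar>) = (if x = y then \<infinity> else ereal (- ln \<bar>x - y\<bar>))"
proof (cases "x = y")
  case False
  then have "1 / ennreal \<bar>x - y\<bar> = ennreal (1 / \<bar>x - y\<bar>)"
    by (simp add: divide_ennreal flip: ennreal_1)
  then show ?thesis using False by (simp add: eln_def ln_div)
qed (simp add: eln_def ennreal_divide_zero)

lemma log_kernel_eq: "log_kernel x y = (if x = y then \<infinity> else ennreal (ln D - ln \<bar>x - y\<bar>))"
  by (auto simp: log_kernel_def eln_inverse_dist e2ennreal_ereal)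

lemma measurable_log_kernel [measurable]:
  "(\<lambda>z. log_kernel (fst z) (snd z)) \<in> borel_measurable (borel \<Otimes>\<^sub>M borel)"
  unfolding log_kernel_eq by measurable

definition log_int :: "real set \<Rightarrow> real measure \<Rightarrow> real set \<Rightarrow> real measure \<Rightarrow> ennreal" where
  "log_int A \<mu> B \<nu> = (\<integral>\<^sup>+x\<in>A. (\<integral>\<^sup>+y\<in>B. log_kernel x y \<partial>\<nu>) \<partial>\<mu>)"

text \<open>The shift is used twice. The inner integral, shifted by \<open>ln D\<close>, is at least
  \<open>- ln D * r j\<close>, and this bound is the constant for shifting the outer
  integral.\<close>

lemma log_energy_eq:
  assumes "\<nu> \<in> M" "i < p" "j < p"
  shows "log_energy (\<Gamma> i) (\<nu> i) (\<Gamma> j) (\<nu> j) = enn2ereal (log_int (\<Gamma> i) (\<nu> i) (\<Gamma> j) (\<nu> j)) - ereal (ln D * (r i * r j))"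
proof -
  note D1 = measures_of_massD[OF in_M_D[OF assms(1,2)] closed_\<Gamma>[OF assms(2)]]
  note D2 = measures_of_massD[OF in_M_D[OF assms(1,3)] closed_\<Gamma>[OF assms(3)]]
  have [measurable_cong]: "sets (\<nu> i) = sets borel" "sets (\<nu> j) = sets borel" by (rule D1 D2)+
  have [measurable]: "\<Gamma> i \<in> sets borel" "\<Gamma> j \<in> sets borel" using closed_\<Gamma> assms by auto
  interpret N: finite_measure "\<nu> j" by (rule D2)
  have lnD: "0 \<le> ln D" using D_ge_1 by simp
  have inner: "ext_set_integral (\<nu> j) (\<Gamma> j) (\<lambda>y. eln (1 / ennreal \<bar>x - y\<bar>))
      = enn2ereal (\<integral>\<^sup>+y\<in>\<Gamma> j. log_kernel x y \<partial>\<nu> j) - ereal (ln D * r j)" if x: "x \<in> \<Gamma> i" for x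
    unfolding log_kernel_def
  proof (rule ext_set_integral_shift[OF _ D2(4) r_nonneg[OF assms(3)] lnD])
    have "(\<lambda>y. log_kernel x y * indicator (\<Gamma> j) y) \<in> borel_measurable (\<nu> j)"
      unfolding log_kernel_eq by measurable
    then show "(\<lambda>y. e2ennreal (eln (1 / ennreal \<bar>x - y\<bar>) + ereal (ln D)) * indicator (\<Gamma> j) y) \<in> borel_measurable (\<nu> j)"
      unfolding log_kernel_def .
    fix y assume y: "y \<in> \<Gamma> j"
    show "- ereal (ln D) \<le> eln (1 / ennreal \<bar>x - y\<bar>)"
    proof (cases "x = y")
      case False
      then have "ln \<bar>x - y\<bar> \<le> ln D" using dist_le_D[OF assms(2,3) x y] D_ge_1 by (subst ln_le_cancel_iff) auto
      then show ?thesis using False unfolding eln_inverse_dist by simp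
    qed (unfold eln_inverse_dist, simp)
  qed simp
  let ?f = "\<lambda>x. ext_set_integral (\<nu> j) (\<Gamma> j) (\<lambda>y. eln (1 / ennreal \<bar>x - y\<bar>))"
  have c: "0 \<le> ln D * r j" using lnD r_nonneg[OF assms(3)] by simp
  have shift: "e2ennreal (?f x + ereal (ln D * r j)) * indicator (\<Gamma> i) x
      = (\<integral>\<^sup>+y\<in>\<Gamma> j. log_kernel x y \<partial>\<nu> j) * indicator (\<Gamma> i) x" for x
  proof (cases "x \<in> \<Gamma> i")
    case True
    have "z - ereal s + ereal s = z" for z :: ereal and s by (cases z) auto
    then show ?thesis using True by (simp add: inner)
  qed simp
  have "ext_set_integral (\<nu> i) (\<Gamma> i) ?f
      = enn2ereal (\<integral>\<^sup>+x\<in>\<Gamma> i. e2ennreal (?f x + ereal (ln D * r j)) \<partial>\<nu> i) - ereal (ln D * r j * r i)"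
  proof (rule ext_set_integral_shift[OF _ D1(4) r_nonneg[OF assms(2)] c])
    have "(\<lambda>x. \<integral>\<^sup>+y. log_kernel x y * indicator (\<Gamma> j) y \<partial>\<nu> j) \<in> borel_measurable borel"
      by (rule N.borel_measurable_nn_integral) measurable
    then show "(\<lambda>x. e2ennreal (?f x + ereal (ln D * r j)) * indicator (\<Gamma> i) x) \<in> borel_measurable (\<nu> i)"
      unfolding shift by measurable
    fix x assume "x \<in> \<Gamma> i"
    have "- ereal s \<le> enn2ereal y - ereal s" for y s
      using enn2ereal_nonneg[of y] by (cases "enn2ereal y") auto
    then show "- ereal (ln D * r j) \<le> ?f x" unfolding inner[OF \<open>x \<in> \<Gamma> i\<close>] .
  qed simp
  then show ?thesis unfolding log_energy_def log_int_def shift by (simp add: mult_ac)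
qed

text \<open>The choice of \<open>c0\<close> leaves room for \<open>ln D\<close> with its
  multiplicity and for both fields, so the second summand is nonnegative as well. The kernel can
  therefore be integrated termwise in \<open>ennreal\<close>.\<close>

lemma kernel_eq:
  assumes "i < p" "j < p" "x \<in> \<Gamma> i" "y \<in> \<Gamma> j"
  shows "kernel i j (x, y) = of_nat (pair_mult i j) * log_kernel x y +
    ennreal (c0 - real (pair_mult i j) * ln D + 2 * Q i x + 2 * Q j y)"
proof -
  let ?w = "c0 + 2 * Q i x + 2 * Q j y"
  let ?e = "real (pair_mult i j)"
  have e: "1 \<le> ?e" "?e \<le> 2" by (auto simp: pair_mult_def)
  have lnD: "0 \<le> ln D" using D_ge_1 by simp
  have w: "0 \<le> ?w - ?e * ln D"
    using q0(2)[OF assms(1,3)] q0(2)[OF assms(2,4)] mult_right_mono[OF e(2) lnD] by (simp add: c0_def)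
  show ?thesis
  proof (cases "x = y")
    case True
    \<comment> \<open>At coinciding points the level \<open>N\<close> enters with multiplicity at
      least 1, so the supremum over \<open>N\<close> is infinite.\<close>
    have "ennreal (real N) \<le> ennreal (trunc_kernel N i j (x, y))" for N
    proof -
      have "real N * 1 \<le> real N * ?e" using e by (intro mult_left_mono) auto
      moreover have "0 \<le> ?e * ln D" using e lnD by simp
      ultimately show ?thesis using True w by (intro ennreal_leI) (simp add: trunc_kernel_def max_def mult.commute)
    qed
    then have "(SUP N. ennreal (real N)) \<le> kernel i j (x, y)"
      unfolding kernel_def by (intro SUP_mono) auto
    moreover have "(SUP N. ennreal (real N)) = \<infinity>"
      using ennreal_SUP_of_nat_eq_top by (simp add: ennreal_of_nat_eq_real_of_nat)
    ultimately have "kernel i j (x, y) = \<infinity>" by (simp add: top_unique)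
    moreover have "of_nat (pair_mult i j) * \<infinity> = (\<infinity> :: ennreal)"
      by (auto simp: pair_mult_def ennreal_mult_top)
    ultimately show ?thesis using True by (simp add: log_kernel_eq)
  next
    case False
    have ld: "ln \<bar>x - y\<bar> \<le> ln D" using False dist_le_D[OF assms] D_ge_1 by (subst ln_le_cancel_iff) auto
    have "kernel i j (x, y) = ennreal (?w - ?e * ln \<bar>x - y\<bar>)"
      unfolding kernel_def
    proof (rule antisym)
      show "(SUP N. ennreal (trunc_kernel N i j (x, y))) \<le> ennreal (?w - ?e * ln \<bar>x - y\<bar>)"
      proof (rule SUP_least, rule ennreal_leI)
        fix N
        have "ln \<bar>x - y\<bar> \<le> ln (max \<bar>x - y\<bar> (exp (- real N)))"
          using False by (subst ln_le_cancel_iff) (auto simp: less_max_iff_disj)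
        then show "trunc_kernel N i j (x, y) \<le> ?w - ?e * ln \<bar>x - y\<bar>"
          unfolding trunc_kernel_def fst_conv snd_conv by (intro diff_left_mono mult_left_mono) auto
      qed
      obtain N where "- ln \<bar>x - y\<bar> \<le> real N" using real_arch_simple by blast
      then have "exp (- real N) \<le> \<bar>x - y\<bar>"
        using False by (subst (2) exp_ln[symmetric]) (auto simp del: exp_ln)
      then have "trunc_kernel N i j (x, y) = ?w - ?e * ln \<bar>x - y\<bar>"
        by (simp add: trunc_kernel_def max_def)
      then show "ennreal (?w - ?e * ln \<bar>x - y\<bar>) \<le> (SUP N. ennreal (trunc_kernel N i j (x, y)))"
        by (metis SUP_upper UNIV_I)
    qed
    also have "?w - ?e * ln \<bar>x - y\<bar> = ?e * (ln D - ln \<bar>x - y\<bar>) + (?w - ?e * ln D)"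
      by (simp add: algebra_simps)
    also have "ennreal \<dots> = ennreal (?e * (ln D - ln \<bar>x - y\<bar>)) + ennreal (?w - ?e * ln D)"
      using ld w by (intro ennreal_plus) simp_all
    also have "ennreal (?e * (ln D - ln \<bar>x - y\<bar>)) = of_nat (pair_mult i j) * log_kernel x y"
      using False by (simp add: log_kernel_eq ennreal_mult' ennreal_of_nat_eq_real_of_nat)
    finally show ?thesis by (simp add: algebra_simps)
  qed
qed

text \<open>Tonelli and the symmetry of the kernel. The symmetry reduces sums over ordered pairs of
  blocks to the sums over \<open>i < j\<close> of the weighted energy.\<close>

lemma log_int_commute:
  assumes "\<nu> \<in> M" "i < p" "j < p"
  shows "log_int (\<Gamma> i) (\<nu> i) (\<Gamma> j) (\<nu> j) = log_int (\<Gamma> j) (\<nu> j) (\<Gamma> i) (\<nu> i)"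
    "(\<integral>\<^sup>+z. log_kernel (fst z) (snd z) * indicator (\<Gamma> i \<times> \<Gamma> j) z \<partial>(\<nu> i \<Otimes>\<^sub>M \<nu> j)) = log_int (\<Gamma> i) (\<nu> i) (\<Gamma> j) (\<nu> j)"
proof -
  note D1 = measures_of_massD[OF in_M_D[OF assms(1,2)] closed_\<Gamma>[OF assms(2)]]
  note D2 = measures_of_massD[OF in_M_D[OF assms(1,3)] closed_\<Gamma>[OF assms(3)]]
  have [measurable_cong]: "sets (\<nu> i) = sets borel" "sets (\<nu> j) = sets borel" by (rule D1 D2)+
  have [measurable]: "\<Gamma> i \<in> sets borel" "\<Gamma> j \<in> sets borel" using closed_\<Gamma> assms by auto
  interpret M: finite_measure "\<nu> i" by (rule D1)
  interpret N: finite_measure "\<nu> j" by (rule D2)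
  interpret pair_sigma_finite "\<nu> i" "\<nu> j" ..
  let ?g = "\<lambda>z. log_kernel (fst z) (snd z) * indicator (\<Gamma> i \<times> \<Gamma> j) z"
  have m: "?g \<in> borel_measurable (\<nu> i \<Otimes>\<^sub>M \<nu> j)" by measurable
  have "(\<integral>\<^sup>+z. ?g z \<partial>(\<nu> i \<Otimes>\<^sub>M \<nu> j)) = (\<integral>\<^sup>+x. \<integral>\<^sup>+y. ?g (x, y) \<partial>\<nu> j \<partial>\<nu> i)"
    by (rule N.nn_integral_fst[OF m, symmetric])
  also have "\<dots> = (\<integral>\<^sup>+x. (\<integral>\<^sup>+y. log_kernel x y * indicator (\<Gamma> j) y \<partial>\<nu> j) * indicator (\<Gamma> i) x \<partial>\<nu> i)"
    by (intro nn_integral_cong) (auto simp: indicator_times indicator_def)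
  finally show 1: "(\<integral>\<^sup>+z. ?g z \<partial>(\<nu> i \<Otimes>\<^sub>M \<nu> j)) = log_int (\<Gamma> i) (\<nu> i) (\<Gamma> j) (\<nu> j)"
    unfolding log_int_def .
  have "(\<integral>\<^sup>+z. ?g z \<partial>(\<nu> i \<Otimes>\<^sub>M \<nu> j)) = (\<integral>\<^sup>+y. \<integral>\<^sup>+x. ?g (x, y) \<partial>\<nu> i \<partial>\<nu> j)"
    by (rule nn_integral_snd[OF m, symmetric])
  also have "\<dots> = (\<integral>\<^sup>+y. (\<integral>\<^sup>+x. log_kernel y x * indicator (\<Gamma> i) x \<partial>\<nu> i) * indicator (\<Gamma> j) y \<partial>\<nu> j)"
    by (intro nn_integral_cong) (auto simp: indicator_times indicator_def log_kernel_eq abs_minus_commute intro!: nn_integral_cong)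
  finally show "log_int (\<Gamma> i) (\<nu> i) (\<Gamma> j) (\<nu> j) = log_int (\<Gamma> j) (\<nu> j) (\<Gamma> i) (\<nu> i)"
    unfolding 1 log_int_def .
qed

end

lemma sum_symmetric:
  fixes g :: "nat \<Rightarrow> nat \<Rightarrow> 'a::comm_semiring_1"
  assumes "\<And>i j. i < m \<Longrightarrow> j < m \<Longrightarrow> g i j = g j i"
  shows "(\<Sum>i<m. \<Sum>j<m. g i j) = (\<Sum>i<m. g i i) + 2 * (\<Sum>i<m. \<Sum>j<i. g i j)"
  using assms
proof (induction m)
  case (Suc m)
  have "(\<Sum>i<m. g i m) = (\<Sum>j<m. g m j)" by (intro sum.cong) (auto intro: Suc.prems)
  then show ?case
    using Suc by (simp add: sum.distrib mult_2 algebra_simps)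
qed simp

lemma sum_enn2ereal_minus:
  assumes "finite I"
  shows "(\<Sum>i\<in>I. enn2ereal (f i) - ereal (g i)) = enn2ereal (\<Sum>i\<in>I. f i) - ereal (\<Sum>i\<in>I. g i)"
  using assms
proof induction
  case (insert i I)
  have "(enn2ereal x - ereal s) + (enn2ereal y - ereal t) = enn2ereal (x + y) - ereal (s + t)" for x y s t
    by (cases x; cases y) (auto simp: enn2ereal_ennreal simp flip: ennreal_plus)
  then show ?case using insert by simp
qed (simp add: zero_ennreal.rep_eq)

context interval_system
begin

lemma kernel_integral:
  assumes "\<nu> \<in> M" "i < p" "j < p"
  defines "X \<equiv> (c0 - real (pair_mult i j) * ln D) * (r i * r j)
      + 2 * (LINT x:\<Gamma> i|\<nu> i. Q i x) * r j + 2 * r i * (LINT x:\<Gamma> j|\<nu> j. Q j x)"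
  shows "0 \<le> X" "(\<integral>\<^sup>+z\<in>\<Gamma> i \<times> \<Gamma> j. kernel i j z \<partial>(\<nu> i \<Otimes>\<^sub>M \<nu> j))
    = of_nat (pair_mult i j) * log_int (\<Gamma> i) (\<nu> i) (\<Gamma> j) (\<nu> j) + ennreal X"
proof -
  note m1 = in_M_D[OF assms(1,2)] and m2 = in_M_D[OF assms(1,3)]
  note K = compact_\<Gamma>[OF assms(2)] compact_\<Gamma>[OF assms(3)]
  note s = sets_M[OF assms(1-3)]
  define w where "w z = c0 - real (pair_mult i j) * ln D + 2 * Q i (fst z) + 2 * Q j (snd z)" for z
  have cQ: "continuous_on (\<Gamma> i \<times> \<Gamma> j) (\<lambda>z. Q i (fst z))" "continuous_on (\<Gamma> i \<times> \<Gamma> j) (\<lambda>z. Q j (snd z))"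
    by (rule continuous_on_compose2[OF Q[OF assms(2)]], intro continuous_intros, auto)
      (rule continuous_on_compose2[OF Q[OF assms(3)]], intro continuous_intros, auto)
  have cw: "continuous_on (\<Gamma> i \<times> \<Gamma> j) w" unfolding w_def by (intro continuous_intros cQ)
  have w0: "0 \<le> w z" if "z \<in> \<Gamma> i \<times> \<Gamma> j" for z
  proof -
    have "real (pair_mult i j) * ln D \<le> 2 * ln D"
      using D_ge_1 by (intro mult_right_mono) (auto simp: pair_mult_def)
    then show ?thesis using that q0(2)[OF assms(2), of "fst z"] q0(2)[OF assms(3), of "snd z"]
      unfolding w_def c0_def by auto
  qed
  let ?P = "\<nu> i \<Otimes>\<^sub>M \<nu> j" and ?S = "\<Gamma> i \<times> \<Gamma> j"
  note I = set_integrable_pair_measures_of_mass[OF m1 m2 K]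
  have LQ: "(LINT z:?S|?P. Q i (fst z)) = (LINT x:\<Gamma> i|\<nu> i. Q i x) * r j"
    "(LINT z:?S|?P. Q j (snd z)) = r i * (LINT x:\<Gamma> j|\<nu> j. Q j x)"
    using set_integral_pair_product[OF m1 m2 K Q[OF assms(2)] continuous_on_const[of _ 1]]
      set_integral_pair_product[OF m1 m2 K continuous_on_const[of _ 1] Q[OF assms(3)]]
      set_integral_const_measures_of_mass[OF m1 K(1) r_nonneg[OF assms(2)], of 1]
      set_integral_const_measures_of_mass[OF m2 K(2) r_nonneg[OF assms(3)], of 1]
    by simp_all
  have Lc: "(LINT z:?S|?P. k) = k * (r i * r j)" for k :: real
    using measure_pair_measures_of_mass[OF m1 m2 K r_nonneg[OF assms(2)] r_nonneg[OF assms(3)]]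
    by (simp add: set_lebesgue_integral_def)
  have Lw: "(LINT z:?S|?P. w z) = X"
  proof -
    have "(LINT z:?S|?P. w z) = (LINT z:?S|?P. c0 - real (pair_mult i j) * ln D + 2 * Q i (fst z)) + (LINT z:?S|?P. 2 * Q j (snd z))"
      unfolding w_def by (intro set_integral_add I continuous_intros cQ)
    also have "(LINT z:?S|?P. c0 - real (pair_mult i j) * ln D + 2 * Q i (fst z))
        = (LINT z:?S|?P. c0 - real (pair_mult i j) * ln D) + (LINT z:?S|?P. 2 * Q i (fst z))"
      by (intro set_integral_add I continuous_intros cQ)
    finally show ?thesis by (simp add: Lc LQ X_def)
  qed
  have nn: "0 \<le> indicator ?S z *\<^sub>R w z" for z using w0 by (auto simp: indicator_def)
  have "ennreal (LINT z:?S|?P. w z) = (\<integral>\<^sup>+z. ennreal (indicator ?S z *\<^sub>R w z) \<partial>?P)"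
    unfolding set_lebesgue_integral_def
    using I[OF cw] by (intro nn_integral_eq_integral[symmetric] AE_I2 nn) (simp add: set_integrable_def)
  also have "\<dots> = (\<integral>\<^sup>+z. ennreal (w z) * indicator ?S z \<partial>?P)"
    by (intro nn_integral_cong) (simp add: indicator_def)
  finally have nw: "(\<integral>\<^sup>+z. ennreal (w z) * indicator ?S z \<partial>?P) = ennreal X"
    unfolding Lw by (rule sym)
  show "0 \<le> X" unfolding Lw[symmetric] set_lebesgue_integral_def
    by (intro Bochner_Integration.integral_nonneg nn)
  have "(\<lambda>z. indicator ?S z *\<^sub>R w z) \<in> borel_measurable (borel \<Otimes>\<^sub>M borel)"
    unfolding borel_prod using assms(2,3)
    by (intro borel_measurable_continuous_on_indicator cw borel_closed closed_Times closed_\<Gamma>)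
  then have "(\<lambda>z. ennreal (indicator ?S z *\<^sub>R w z)) \<in> borel_measurable (borel \<Otimes>\<^sub>M borel)"
    by measurable
  also have "(\<lambda>z. ennreal (indicator ?S z *\<^sub>R w z)) = (\<lambda>z. ennreal (w z) * indicator ?S z)"
    by (auto simp: indicator_def)
  finally have mw: "(\<lambda>z. ennreal (w z) * indicator ?S z) \<in> borel_measurable ?P"
    unfolding measurable_cong_sets[OF s(2) refl] .
  have [measurable]: "?S \<in> sets (borel \<Otimes>\<^sub>M borel)"
    using closed_\<Gamma> assms(2,3) by (intro pair_measureI borel_closed)
  have ml: "(\<lambda>z. log_kernel (fst z) (snd z) * indicator ?S z) \<in> borel_measurable ?P"
    unfolding measurable_cong_sets[OF s(2) refl] by measurable
  have "kernel i j z * indicator ?S z = of_nat (pair_mult i j) * (log_kernel (fst z) (snd z) * indicator ?S z)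
      + ennreal (w z) * indicator ?S z" for z
  proof (cases "z \<in> ?S")
    case True
    then show ?thesis
      using kernel_eq[OF assms(2,3), of "fst z" "snd z"] by (auto simp: w_def)
  qed simp
  then have "(\<integral>\<^sup>+z\<in>?S. kernel i j z \<partial>?P) = (\<integral>\<^sup>+z. of_nat (pair_mult i j) * (log_kernel (fst z) (snd z) * indicator ?S z)
      + ennreal (w z) * indicator ?S z \<partial>?P)"
    by simp
  also have "\<dots> = (\<integral>\<^sup>+z. of_nat (pair_mult i j) * (log_kernel (fst z) (snd z) * indicator ?S z) \<partial>?P) + ennreal X"
    unfolding nw[symmetric] by (rule nn_integral_add[OF borel_measurable_times_ennreal[OF borel_measurable_const ml] mw])
  also have "(\<integral>\<^sup>+z. of_nat (pair_mult i j) * (log_kernel (fst z) (snd z) * indicator ?S z) \<partial>?P)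
     = of_nat (pair_mult i j) * log_int (\<Gamma> i) (\<nu> i) (\<Gamma> j) (\<nu> j)"
    unfolding nn_integral_cmult[OF ml] log_int_commute(2)[OF assms(1-3)] ..
  finally show "(\<integral>\<^sup>+z\<in>?S. kernel i j z \<partial>?P)
    = of_nat (pair_mult i j) * log_int (\<Gamma> i) (\<nu> i) (\<Gamma> j) (\<nu> j) + ennreal X" .
qed

text \<open>The factor 2 arises in two ways: pairs inside a block have multiplicity 2, and pairs of
  different blocks are counted in both orders. As the \<open>r i\<close> sum up to 1, the constants
  add up to \<open>c0\<close> and the field terms to four times the integral of the fields, while
  all shifts by \<open>ln D\<close> cancel.\<close>

lemma energy_eq_weighted_energy:
  assumes "\<nu> \<in> M"
  shows "enn2ereal (energy \<nu>) = 2 * weighted_energy p \<Gamma> Q \<nu> + ereal c0"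
proof -
  let ?L = "\<lambda>i j. log_int (\<Gamma> i) (\<nu> i) (\<Gamma> j) (\<nu> j)"
  define q where "q i = (LINT x:\<Gamma> i|\<nu> i. Q i x)" for i
  define S1 where "S1 = (\<Sum>i<p. ?L i i)"
  define S2 where "S2 = (\<Sum>j<p. \<Sum>i<j. ?L i j)"
  define \<alpha>1 where "\<alpha>1 = (\<Sum>i<p. ln D * (r i * r i))"
  define \<alpha>2 where "\<alpha>2 = (\<Sum>j<p. \<Sum>i<j. ln D * (r i * r j))"
  define X where "X i j = (c0 - real (pair_mult i j) * ln D) * (r i * r j) + 2 * q i * r j + 2 * r i * q j" for i j
  have X0: "0 \<le> X i j" if "i < p" "j < p" for i j
    using kernel_integral(1)[OF assms that] by (simp add: X_def q_def)
  define Y where "Y = (\<Sum>i<p. \<Sum>j<p. X i j)"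
  have Y0: "0 \<le> Y" unfolding Y_def by (intro sum_nonneg X0) auto
  have "energy \<nu> = (\<Sum>i<p. \<Sum>j<p. of_nat (pair_mult i j) * ?L i j + ennreal (X i j))"
    unfolding energy_def X_def q_def by (intro sum.cong refl kernel_integral(2) assms) auto
  also have "\<dots> = (\<Sum>i<p. \<Sum>j<p. of_nat (pair_mult i j) * ?L i j) + (\<Sum>i<p. \<Sum>j<p. ennreal (X i j))"
    by (simp add: sum.distrib)
  also have "(\<Sum>i<p. \<Sum>j<p. ennreal (X i j)) = ennreal Y"
  proof -
    have "(\<Sum>i<p. \<Sum>j<p. ennreal (X i j)) = (\<Sum>i<p. ennreal (\<Sum>j<p. X i j))"
      by (intro sum.cong refl sum_ennreal X0) auto
    also have "\<dots> = ennreal Y" unfolding Y_def by (intro sum_ennreal sum_nonneg X0) auto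
    finally show ?thesis .
  qed
  also have "(\<Sum>i<p. \<Sum>j<p. of_nat (pair_mult i j) * ?L i j)
      = (\<Sum>i<p. of_nat (pair_mult i i) * ?L i i) + 2 * (\<Sum>j<p. \<Sum>i<j. of_nat (pair_mult j i) * ?L j i)"
    by (rule sum_symmetric) (use log_int_commute(1)[OF assms] in \<open>auto simp: pair_mult_def\<close>)
  also have "(\<Sum>i<p. of_nat (pair_mult i i) * ?L i i) = 2 * S1"
    by (simp add: S1_def pair_mult_def sum_distrib_left)
  also have "(\<Sum>j<p. \<Sum>i<j. of_nat (pair_mult j i) * ?L j i) = S2"
    unfolding S2_def
    by (intro sum.cong refl) (use log_int_commute(1)[OF assms] in \<open>auto simp: pair_mult_def\<close>)
  finally have E: "energy \<nu> = 2 * S1 + 2 * S2 + ennreal Y" .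
  have "(\<Sum>i<p. \<Sum>j<p. real (pair_mult i j) * (ln D * (r i * r j))) = 2 * \<alpha>1 + 2 * \<alpha>2"
    using sum_symmetric[of p "\<lambda>i j. real (pair_mult i j) * (ln D * (r i * r j))"]
    by (simp add: \<alpha>1_def \<alpha>2_def pair_mult_def sum_distrib_left mult_ac)
  moreover have "(\<Sum>i<p. \<Sum>j<p. 2 * q i * r j) = 2 * sum q {..<p}" "(\<Sum>i<p. \<Sum>j<p. 2 * r i * q j) = 2 * sum q {..<p}"
    by (simp_all add: sum_r flip: sum_distrib_left sum_distrib_right)
  moreover have "(\<Sum>i<p. \<Sum>j<p. c0 * (r i * r j)) = c0"
    using sum_r_r by (simp flip: sum_distrib_left)
  moreover have "Y = (\<Sum>i<p. \<Sum>j<p. c0 * (r i * r j)) - (\<Sum>i<p. \<Sum>j<p. real (pair_mult i j) * (ln D * (r i * r j)))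
      + (\<Sum>i<p. \<Sum>j<p. 2 * q i * r j) + (\<Sum>i<p. \<Sum>j<p. 2 * r i * q j)"
    unfolding Y_def X_def by (simp add: left_diff_distrib sum.distrib sum_subtractf mult.assoc)
  ultimately have Y: "Y = c0 - (2 * \<alpha>1 + 2 * \<alpha>2) + 4 * sum q {..<p}" by simp
  have "(\<Sum>i<p. log_energy (\<Gamma> i) (\<nu> i) (\<Gamma> i) (\<nu> i)) = enn2ereal S1 - ereal \<alpha>1"
    unfolding S1_def \<alpha>1_def using log_energy_eq[OF assms]
    by (simp flip: sum_enn2ereal_minus)
  moreover have "(\<Sum>j<p. \<Sum>i<j. log_energy (\<Gamma> i) (\<nu> i) (\<Gamma> j) (\<nu> j)) = enn2ereal S2 - ereal \<alpha>2"
    unfolding S2_def \<alpha>2_def using log_energy_eq[OF assms]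
    by (simp flip: sum_enn2ereal_minus)
  ultimately have W: "weighted_energy p \<Gamma> Q \<nu> = (enn2ereal S1 - ereal \<alpha>1) + (enn2ereal S2 - ereal \<alpha>2) + ereal (2 * sum q {..<p})"
    unfolding weighted_energy_def q_def by simp
  have two: "(2::ereal) = ereal 2" by simp
  show ?thesis
  proof (cases "S1 = \<infinity> \<or> S2 = \<infinity>")
    case True
    then have "energy \<nu> = \<infinity>" unfolding E by (auto simp: ennreal_mult_top)
    moreover have "weighted_energy p \<Gamma> Q \<nu> = \<infinity>"
      using True unfolding W by (cases S1; cases S2) (auto simp: enn2ereal_ennreal)
    ultimately show ?thesis by simp
  next
    case False
    then obtain s1 s2 where s: "S1 = ennreal s1" "0 \<le> s1" "S2 = ennreal s2" "0 \<le> s2"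
      by (cases S1; cases S2) auto
    have "2 * ennreal x = ennreal (2 * x)" if "0 \<le> x" for x using that by (simp add: ennreal_mult)
    then have "energy \<nu> = ennreal (2 * s1 + 2 * s2 + Y)"
      unfolding E using s Y0 by (simp flip: ennreal_plus)
    then have "enn2ereal (energy \<nu>) = ereal (2 * s1 + 2 * s2 + Y)"
      using s Y0 by (simp only: enn2ereal_ennreal add_nonneg_nonneg mult_nonneg_nonneg zero_le_numeral)
    then show ?thesis unfolding W two Y using s by (simp add: enn2ereal_ennreal)
  qed
qed

lemma weighted_energy_eq:
  assumes "\<nu> \<in> M"
  shows "weighted_energy p \<Gamma> Q \<nu> = (if energy \<nu> = \<infinity> then \<infinity> else ereal ((enn2real (energy \<nu>) - c0) / 2))"
proof -
  have two: "(2::ereal) = ereal 2" by simp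
  show ?thesis
    using energy_eq_weighted_energy[OF assms] unfolding two
    by (cases "weighted_energy p \<Gamma> Q \<nu>"; cases "energy \<nu>") (auto simp: enn2ereal_ennreal)
qed

text \<open>A strict lower bound of the energy is witnessed at a finite truncation level, that is by
  a weak-* continuous function. Lower semicontinuity and the local upper bound for the weight both
  rest on this.\<close>

lemma less_weighted_energy_iff:
  assumes "\<nu> \<in> M"
  shows "ereal L < weighted_energy p \<Gamma> Q \<nu> \<longleftrightarrow> (\<exists>N. 2 * L + c0 < trunc_energy N \<nu>)"
proof -
  have nn: "0 \<le> trunc_energy N \<nu>" for N
    unfolding trunc_energy_def by (intro sum_nonneg integral_trunc_kernel(2) assms) auto
  have up: "ennreal (trunc_energy N \<nu>) \<le> energy \<nu>" for N
    unfolding energy_eq_SUP[OF assms] by (rule SUP_upper) simp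
  show ?thesis
  proof
    assume A: "ereal L < weighted_energy p \<Gamma> Q \<nu>"
    show "\<exists>N. 2 * L + c0 < trunc_energy N \<nu>"
    \<comment> \<open>A negative threshold is exceeded by every truncated energy; it is treated
      apart because \<open>ennreal\<close> would turn it into 0.\<close>
    proof (cases "2 * L + c0 < 0")
      case True
      then show ?thesis using nn[of 0] by (intro exI[of _ 0]) simp
    next
      case False
      then have "ennreal (2 * L + c0) < energy \<nu>"
        using A unfolding weighted_energy_eq[OF assms]
        by (cases "energy \<nu>") (auto simp: ennreal_less_iff field_simps split: if_splits)
      then obtain N where "ennreal (2 * L + c0) < ennreal (trunc_energy N \<nu>)"
        unfolding energy_eq_SUP[OF assms] less_SUP_iff by blast
      then show ?thesis using False by (auto simp: ennreal_less_iff)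
    qed
  next
    assume "\<exists>N. 2 * L + c0 < trunc_energy N \<nu>"
    then obtain N where "2 * L + c0 < trunc_energy N \<nu>" ..
    then show "ereal L < weighted_energy p \<Gamma> Q \<nu>"
      unfolding weighted_energy_eq[OF assms] using up[of N] nn[of N]
      by (cases "energy \<nu>") (auto simp: ennreal_le_iff)
  qed
qed

lemma openin_weighted_energy_greater:
  "openin (M_topology p \<Gamma> r) {\<nu> \<in> M. ereal L < weighted_energy p \<Gamma> Q \<nu>}"
proof -
  have "{\<nu> \<in> M. ereal L < weighted_energy p \<Gamma> Q \<nu>} = (\<Union>N. {\<nu> \<in> M. 2 * L + c0 < trunc_energy N \<nu>})"
    using less_weighted_energy_iff by blast
  then show ?thesis by (auto intro!: openin_Union openin_trunc_energy_greater)
qed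

end

section \<open>The equilibrium measure\<close>

text \<open>The right-hand side counts the k with \<open>t \<le> D * exp (- k)\<close>, that is
  \<open>k \<le> ln D - ln t\<close>; as k starts at 0, there is one more of them than the integer
  part of the left-hand side.\<close>

lemma ln_diff_le_suminf_indicator:
  assumes "0 < t" "t \<le> D"
  shows "ennreal (ln D - ln t) \<le> (\<Sum>k. indicator {s. s \<le> D * exp (- real k)} t)"
proof -
  have D: "0 < D" using assms by linarith
  define N where "N = Suc (nat \<lfloor>ln D - ln t\<rfloor>)"
  have nn: "0 \<le> ln D - ln t" using assms D by simp
  have "ln D - ln t \<le> real N" unfolding N_def using nn by linarith
  then have "ennreal (ln D - ln t) \<le> of_nat N" by (simp add: ennreal_of_nat_eq_real_of_nat ennreal_leI)
  also have "\<dots> = (\<Sum>k<N. indicator {s. s \<le> D * exp (- real k)} t)"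
  proof -
    have "t \<le> D * exp (- real k)" if "k < N" for k
    proof -
      have "real k \<le> ln D - ln t" using that nn unfolding N_def by linarith
      then have "ln t \<le> ln (D * exp (- real k))" using D by (simp add: ln_mult)
      then show ?thesis using assms D by simp
    qed
    then show ?thesis by simp
  qed
  also have "\<dots> \<le> (\<Sum>k. indicator {s. s \<le> D * exp (- real k)} t)"
    by (rule sum_le_suminf) auto
  finally show ?thesis .
qed

context interval_system
begin

lemma kernel_eq_real:
  assumes "i < p" "j < p" "x \<in> \<Gamma> i" "y \<in> \<Gamma> j" "x \<noteq> y"
  shows "kernel i j (x, y) = ennreal (c0 + 2 * Q i x + 2 * Q j y - real (pair_mult i j) * ln \<bar>x - y\<bar>)"
    "0 \<le> c0 + 2 * Q i x + 2 * Q j y - real (pair_mult i j) * ln \<bar>x - y\<bar>"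
proof -
  let ?w = "c0 + 2 * Q i x + 2 * Q j y"
  let ?e = "real (pair_mult i j)"
  have e: "1 \<le> ?e" "?e \<le> 2" by (auto simp: pair_mult_def)
  have lnD: "0 \<le> ln D" using D_ge_1 by simp
  have w: "0 \<le> ?w - ?e * ln D"
    using q0(2)[OF assms(1,3)] q0(2)[OF assms(2,4)] mult_right_mono[OF e(2) lnD] by (simp add: c0_def)
  have ld: "0 \<le> ln D - ln \<bar>x - y\<bar>"
    using assms(5) dist_le_D[OF assms(1-4)] D_ge_1 by (simp add: ln_le_cancel_iff)
  then have "0 \<le> ?e * (ln D - ln \<bar>x - y\<bar>)" using e by simp
  then have "0 \<le> ?e * (ln D - ln \<bar>x - y\<bar>) + (?w - ?e * ln D)" using w by linarith
  moreover have eq: "?w - ?e * ln \<bar>x - y\<bar> = ?e * (ln D - ln \<bar>x - y\<bar>) + (?w - ?e * ln D)"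
    by (simp add: algebra_simps)
  ultimately show "0 \<le> ?w - ?e * ln \<bar>x - y\<bar>" by simp
  have "of_nat (pair_mult i j) * log_kernel x y = ennreal (?e * (ln D - ln \<bar>x - y\<bar>))"
    using assms(5) by (simp add: log_kernel_eq ennreal_mult' ennreal_of_nat_eq_real_of_nat)
  then have "kernel i j (x, y) = ennreal (?e * (ln D - ln \<bar>x - y\<bar>)) + ennreal (?w - ?e * ln D)"
    unfolding kernel_eq[OF assms(1-4)] by (simp add: algebra_simps)
  also have "\<dots> = ennreal (?w - ?e * ln \<bar>x - y\<bar>)"
    unfolding eq using ld w e by (intro ennreal_plus[symmetric]) simp_all
  finally show "kernel i j (x, y) = ennreal (?w - ?e * ln \<bar>x - y\<bar>)" .
qed

lemma kernel_diag:
  assumes "i < p" "x \<in> \<Gamma> i"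
  shows "kernel i i (x, x) = \<infinity>"
  unfolding kernel_eq[OF assms(1,1) assms(2,2)]
  by (simp add: log_kernel_eq pair_mult_def ennreal_mult_top)

text \<open>Lebesgue measure scaled to the prescribed masses, a tuple by which the infimum of the
  energy is seen to be finite.\<close>

definition uniform_tuple :: "nat \<Rightarrow> real measure" where
  "uniform_tuple = (\<lambda>i\<in>{..<p}. density lborel (\<lambda>x. ennreal (r i / (b i - a i)) * indicator {a i..b i} x))"

lemma emeasure_uniform_tuple:
  assumes "i < p" "S \<in> sets borel"
  shows "emeasure (uniform_tuple i) S = ennreal (r i / (b i - a i)) * emeasure lborel ({a i..b i} \<inter> S)"
proof -
  have "emeasure (uniform_tuple i) S
      = (\<integral>\<^sup>+x. ennreal (r i / (b i - a i)) * indicator {a i..b i} x * indicator S x \<partial>lborel)"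
    using assms by (simp add: uniform_tuple_def emeasure_density)
  also have "\<dots> = (\<integral>\<^sup>+x. ennreal (r i / (b i - a i)) * indicator ({a i..b i} \<inter> S) x \<partial>lborel)"
    by (intro nn_integral_cong) (simp add: indicator_inter_arith mult.assoc)
  finally show ?thesis using assms by (simp add: nn_integral_cmult_indicator)
qed

lemma uniform_tuple_in_M: "uniform_tuple \<in> M"
proof -
  have "uniform_tuple i \<in> measures_of_mass (\<Gamma> i) (r i)" if i: "i < p" for i
  proof (rule measures_of_massI)
    show "sets (uniform_tuple i) = sets borel" using i by (simp add: uniform_tuple_def)
    show "emeasure (uniform_tuple i) (- \<Gamma> i) = 0"
      using emeasure_uniform_tuple[OF i, of "- \<Gamma> i"] i by (simp add: \<Gamma>)
    have "emeasure (uniform_tuple i) UNIV = ennreal (r i / (b i - a i)) * ennreal (b i - a i)"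
      using emeasure_uniform_tuple[OF i, of UNIV] ab[OF i] by simp
    also have "\<dots> = ennreal (r i / (b i - a i) * (b i - a i))"
      using ab[OF i] r[OF i] by (intro ennreal_mult[symmetric]) simp_all
    finally show "emeasure (uniform_tuple i) UNIV = ennreal (r i)" using ab[OF i] by simp
  qed (rule closed_\<Gamma>[OF i])
  then show ?thesis by (simp add: M_space_def uniform_tuple_def PiE_iff)
qed

text \<open>The inner integral is dominated by the sum over k of the masses of the balls of radius
  \<open>D * exp (- k)\<close> around \<open>x\<close>. A density bounded by \<open>c\<close> makes
  these masses at most \<open>c * (2 * D) * exp (- k)\<close>, a geometric series independent of
  \<open>x\<close>.\<close>

lemma log_int_uniform_finite:
  assumes "i < p" "j < p"
  shows "log_int (\<Gamma> i) (uniform_tuple i) (\<Gamma> j) (uniform_tuple j) < \<infinity>"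
proof -
  note D1 = measures_of_massD[OF in_M_D[OF uniform_tuple_in_M assms(1)] closed_\<Gamma>[OF assms(1)]]
  note D2 = measures_of_massD[OF in_M_D[OF uniform_tuple_in_M assms(2)] closed_\<Gamma>[OF assms(2)]]
  have [measurable_cong]: "sets (uniform_tuple i) = sets borel" "sets (uniform_tuple j) = sets borel" by (rule D1 D2)+
  define c where "c = r j / (b j - a j)"
  have c: "0 \<le> c" using ab[OF assms(2)] r[OF assms(2)] by (simp add: c_def)
  have D0: "0 < D" using D_ge_1 by simp
  define K where "K = (\<Sum>k. ennreal (c * (2 * D) * exp (- 1) ^ k))"
  have "summable (\<lambda>k. c * (2 * D) * exp (- 1 :: real) ^ k)"
    by (intro summable_mult summable_geometric) simp
  then have K: "K < \<infinity>"
    unfolding K_def using c D0 by (subst suminf_ennreal2) (auto intro!: mult_nonneg_nonneg)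
  have inner: "(\<integral>\<^sup>+y\<in>\<Gamma> j. log_kernel x y \<partial>uniform_tuple j) \<le> K" if x: "x \<in> \<Gamma> i" for x
  proof -
    let ?B = "\<lambda>k. {y. \<bar>x - y\<bar> \<le> D * exp (- real k)}"
    have B: "?B k = {x - D * exp (- real k)..x + D * exp (- real k)}" for k by auto
    have [measurable]: "?B k \<in> sets borel" for k unfolding B by simp
    have "emeasure (uniform_tuple j) {x} = 0"
    proof -
      have "emeasure lborel ({a j..b j} \<inter> {x}) \<le> emeasure lborel {x}" by (intro emeasure_mono) auto
      then show ?thesis using emeasure_uniform_tuple[OF assms(2), of "{x}"] by simp
    qed
    then have "AE y in uniform_tuple j. y \<noteq> x"
      by (intro AE_I[of _ _ "{x}"]) (auto simp: D2)
    then have "AE y in uniform_tuple j. log_kernel x y * indicator (\<Gamma> j) y \<le> (\<Sum>k. indicator (?B k) y)"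
    proof eventually_elim
      case (elim y)
      show ?case
      proof (cases "y \<in> \<Gamma> j")
        case True
        have "log_kernel x y = ennreal (ln D - ln \<bar>x - y\<bar>)" using elim by (simp add: log_kernel_eq)
        also have "\<dots> \<le> (\<Sum>k. indicator {s. s \<le> D * exp (- real k)} \<bar>x - y\<bar>)"
          using elim dist_le_D[OF assms x True] by (intro ln_diff_le_suminf_indicator) auto
        also have "\<dots> = (\<Sum>k. indicator (?B k) y)" by (simp add: indicator_def)
        finally show ?thesis using True by simp
      qed simp
    qed
    then have "(\<integral>\<^sup>+y\<in>\<Gamma> j. log_kernel x y \<partial>uniform_tuple j) \<le> (\<integral>\<^sup>+y. (\<Sum>k. indicator (?B k) y) \<partial>uniform_tuple j)"
      by (rule nn_integral_mono_AE)
    also have "\<dots> = (\<Sum>k. emeasure (uniform_tuple j) (?B k))"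
      by (subst nn_integral_suminf) (auto simp: D2)
    also have "\<dots> \<le> K" unfolding K_def
    proof (intro suminf_le summableI)
      fix k
      have "emeasure (uniform_tuple j) (?B k) \<le> ennreal c * emeasure lborel (?B k)"
        unfolding c_def using emeasure_uniform_tuple[OF assms(2), of "?B k"]
        by (auto intro!: mult_left_mono emeasure_mono)
      also have "emeasure lborel (?B k) = ennreal (2 * D * exp (- real k))" unfolding B using D0 by simp
      also have "ennreal c * ennreal (2 * D * exp (- real k)) = ennreal (c * (2 * D) * exp (- 1) ^ k)"
        using c D0 by (simp add: ennreal_mult[symmetric] exp_of_nat_mult[symmetric] mult_ac)
      finally show "emeasure (uniform_tuple j) (?B k) \<le> ennreal (c * (2 * D) * exp (- 1) ^ k)" .
    qed
    finally show ?thesis .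
  qed
  have "log_int (\<Gamma> i) (uniform_tuple i) (\<Gamma> j) (uniform_tuple j) \<le> (\<integral>\<^sup>+x. K \<partial>uniform_tuple i)"
    unfolding log_int_def
  proof (rule nn_integral_mono)
    fix x
    show "(\<integral>\<^sup>+y\<in>\<Gamma> j. log_kernel x y \<partial>uniform_tuple j) * indicator (\<Gamma> i) x \<le> K"
      using inner by (cases "x \<in> \<Gamma> i") simp_all
  qed
  also have "\<dots> = K * ennreal (r i)" by (simp add: D1)
  also have "\<dots> < \<infinity>" using K by (simp add: ennreal_mult_less_top)
  finally show ?thesis .
qed

lemma weighted_energy_uniform_finite: "weighted_energy p \<Gamma> Q uniform_tuple < \<infinity>"
proof -
  have "energy uniform_tuple < \<infinity>"
    unfolding energy_def infinity_ennreal_def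
  proof (intro ennreal_sum_less_top[THEN iffD2] ballI finite_lessThan)
    fix i j assume "i \<in> {..<p}" "j \<in> {..<p}"
    then have ij: "i < p" "j < p" by auto
    show "(\<integral>\<^sup>+z\<in>\<Gamma> i \<times> \<Gamma> j. kernel i j z \<partial>(uniform_tuple i \<Otimes>\<^sub>M uniform_tuple j)) < \<top>"
      unfolding kernel_integral(2)[OF uniform_tuple_in_M ij]
      using log_int_uniform_finite[OF ij] by (simp add: ennreal_mult_less_top ennreal_of_nat_eq_real_of_nat)
  qed
  then show ?thesis using weighted_energy_eq[OF uniform_tuple_in_M] by auto
qed

section \<open>Existence of the minimizer\<close>

lemma weighted_energy_not_MInf: "\<nu> \<in> M \<Longrightarrow> weighted_energy p \<Gamma> Q \<nu> \<noteq> -\<infinity>"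
  by (simp add: weighted_energy_eq)

text \<open>If the infimum were not attained, the open superlevel sets at levels above it would
  cover the compact space, and a finite subcover would yield a larger lower bound. Since a minimizer
  exists, the tuple chosen by \<open>arg_min_on\<close> is one.\<close>

lemma equilibrium_measure_minimal:
  "equilibrium_measure p \<Gamma> r Q \<in> M"
  "\<nu> \<in> M \<Longrightarrow> weighted_energy p \<Gamma> Q (equilibrium_measure p \<Gamma> r Q) \<le> weighted_energy p \<Gamma> Q \<nu>"
proof -
  let ?W = "weighted_energy p \<Gamma> Q" and ?T = "M_topology p \<Gamma> r"
  define m where "m = (INF \<nu>\<in>M. ?W \<nu>)"
  have "\<exists>\<mu>\<in>M. ?W \<mu> = m"
  proof (rule ccontr)
    assume "\<not> (\<exists>\<mu>\<in>M. ?W \<mu> = m)"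
    then have lt: "m < ?W \<mu>" if "\<mu> \<in> M" for \<mu>
      using INF_lower[OF that, of ?W] that unfolding m_def by (auto simp: less_le)
    define U where "U c = {\<nu> \<in> M. ereal c < ?W \<nu>}" for c
    have "\<exists>c. m < ereal c \<and> \<mu> \<in> U c" if \<mu>: "\<mu> \<in> M" for \<mu>
      using ereal_dense2[OF lt[OF \<mu>]] \<mu> by (auto simp: U_def)
    then have cover: "M \<subseteq> \<Union> (U ` {c. m < ereal c})" by blast
    have "compactin ?T M"
      using compact_Hausdorff_M_topology(1)[of p a b \<Gamma> r] ab \<Gamma> r by (simp add: compact_space_def)
    moreover have "\<And>V. V \<in> U ` {c. m < ereal c} \<Longrightarrow> openin ?T V"
      unfolding U_def using openin_weighted_energy_greater by auto
    ultimately obtain \<F> where \<F>: "finite \<F>" "\<F> \<subseteq> U ` {c. m < ereal c}" "M \<subseteq> \<Union>\<F>"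
      using cover unfolding compactin_def by meson
    then obtain C where C: "finite C" "C \<subseteq> {c. m < ereal c}" "\<F> = U ` C"
      using finite_subset_image[of \<F> U "{c. m < ereal c}"] by blast
    \<comment> \<open>The space is nonempty, so the finite subcover is, and \<open>Min C\<close> is
      meaningful.\<close>
    have "C \<noteq> {}" using \<F>(3) C(3) uniform_tuple_in_M by auto
    have "ereal (Min C) \<le> ?W \<nu>" if "\<nu> \<in> M" for \<nu>
    proof -
      have "\<nu> \<in> \<Union> (U ` C)" using \<F>(3) C(3) that by blast
      then obtain c where c: "c \<in> C" "\<nu> \<in> U c" by blast
      then have "ereal (Min C) \<le> ereal c" using C(1) by simp
      also have "\<dots> < ?W \<nu>" using c(2) by (simp add: U_def)
      finally show ?thesis by simp
    qed
    then have "ereal (Min C) \<le> m" unfolding m_def by (intro INF_greatest)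
    moreover have "m < ereal (Min C)" using C(2) Min_in[OF C(1) \<open>C \<noteq> {}\<close>] by auto
    ultimately show False by simp
  qed
  then obtain \<mu> where \<mu>: "\<mu> \<in> M" "?W \<mu> = m" by blast
  have "is_arg_min ?W (\<lambda>\<nu>. \<nu> \<in> M) \<mu>"
    unfolding is_arg_min_def using \<mu> by (auto simp: m_def not_less intro: INF_lower)
  then have "is_arg_min ?W (\<lambda>\<nu>. \<nu> \<in> M) (equilibrium_measure p \<Gamma> r Q)"
    unfolding equilibrium_measure_def arg_min_on_def arg_min_def
    by (rule someI[where P = "is_arg_min ?W (\<lambda>\<nu>. \<nu> \<in> M)"])
  then show "equilibrium_measure p \<Gamma> r Q \<in> M"
    "\<nu> \<in> M \<Longrightarrow> weighted_energy p \<Gamma> Q (equilibrium_measure p \<Gamma> r Q) \<le> weighted_energy p \<Gamma> Q \<nu>"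
    unfolding is_arg_min_def by (auto simp: not_less)
qed

lemma weighted_energy_equilibrium_finite:
  "\<bar>weighted_energy p \<Gamma> Q (equilibrium_measure p \<Gamma> r Q)\<bar> \<noteq> \<infinity>"
proof -
  have "weighted_energy p \<Gamma> Q (equilibrium_measure p \<Gamma> r Q) < \<infinity>"
    using equilibrium_measure_minimal(2)[OF uniform_tuple_in_M] weighted_energy_uniform_finite
    by (rule le_less_trans)
  then show ?thesis using weighted_energy_not_MInf[OF equilibrium_measure_minimal(1)] by auto
qed

end

section \<open>Asymptotic bounds for the weight\<close>

locale multi_index_sequence = interval_system +
  fixes n :: "nat \<Rightarrow> nat \<Rightarrow> nat"
  assumes n_pos: "i < p \<Longrightarrow> 0 < n d i" and n_lim: "filterlim (\<lambda>d. mi_norm p (n d)) at_top sequentially"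
    and ratio: "i < p \<Longrightarrow> (\<lambda>d. real (n d i) / real (mi_norm p (n d))) \<longlonglongrightarrow> r i"
begin

abbreviation "m \<equiv> \<lambda>d. real (mi_norm p (n d))"

lemma m_pos: "0 < m d"
proof -
  have "0 < n d 0" using n_pos p by simp
  also have "n d 0 \<le> mi_norm p (n d)" unfolding mi_norm_def by (rule member_le_sum) (use p in auto)
  finally show ?thesis by simp
qed

lemma m_at_top: "filterlim m at_top sequentially"
  by (rule filterlim_compose[OF filterlim_real_sequentially n_lim])

lemma eventually_m_ge: "\<forall>\<^sub>F d in sequentially. t \<le> m d"
  using m_at_top by (simp add: filterlim_at_top)

text \<open>The level \<open>N\<close> is fixed by \<mu> and \<open>L\<close> before
  \<open>d\<close> varies. The slack between \<open>2 * L + c0\<close> and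
  \<open>trunc_energy N \<mu>\<close> pays for three things: the passage to a neighbourhood, the
  deviation of the block ratios from \<open>r\<close>, and the diagonal term linear in n.\<close>

lemma upper_local:
  assumes \<mu>: "\<mu> \<in> M" and L: "ereal L < weighted_energy p \<Gamma> Q \<mu>"
  shows "\<exists>G. openin (M_topology p \<Gamma> r) G \<and> \<mu> \<in> G \<and> (\<forall>\<^sub>F d in sequentially. \<forall>X\<in>configs p \<Gamma> (n d).
     j_map p r (n d) X \<in> G \<longrightarrow> (A_weight p Q (n d) X)\<^sup>2 \<le> exp (- (2 * L * (m d)\<^sup>2)))"
proof -
  obtain N where N: "2 * L + c0 < trunc_energy N \<mu>" using L less_weighted_energy_iff[OF \<mu>] by blast
  obtain t where t: "2 * L + c0 < t" "t < trunc_energy N \<mu>" using dense[OF N] by blast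
  define G where "G = {\<nu> \<in> M. t < trunc_energy N \<nu>}"
  \<comment> \<open>\<theta> < 1 makes \<open>\<theta> * r i \<le> n d i / m d\<close> true for
    large \<open>d\<close>; it is taken so close to 1 that \<open>t\<close> stays above the
    threshold after multiplication by \<theta>^2.\<close>
  have "((\<lambda>\<theta>::real. \<theta>\<^sup>2 * t) \<longlongrightarrow> 1\<^sup>2 * t) (at_left 1)" by (intro tendsto_intros)
  then have "\<forall>\<^sub>F \<theta> in at_left 1. 2 * L + c0 < \<theta>\<^sup>2 * t" using t(1) by (intro order_tendstoD) auto
  moreover have "\<forall>\<^sub>F \<theta>::real in at_left 1. \<theta> \<in> {0<..<1}" by (rule eventually_at_left_real) simp
  ultimately have "\<forall>\<^sub>F \<theta> in at_left (1::real). 2 * L + c0 < \<theta>\<^sup>2 * t \<and> \<theta> \<in> {0<..<1}" by eventually_elim simp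
  then obtain \<theta> where \<theta>: "2 * L + c0 < \<theta>\<^sup>2 * t" "0 < \<theta>" "\<theta> < 1"
    using eventually_happens'[OF trivial_limit_at_left_real] by force
  \<comment> \<open>The slack that is left; once \<open>2 * N \<le> m d * s\<close>, it absorbs the
    diagonal term.\<close>
  define s where "s = \<theta>\<^sup>2 * t - (2 * L + c0)"
  have s: "0 < s" using \<theta>(1) by (simp add: s_def)
  have "\<forall>\<^sub>F d in sequentially. \<forall>i\<in>{..<p}. \<theta> * r i \<le> real (n d i) / m d"
  proof (rule eventually_ball_finite)
    show "\<forall>i\<in>{..<p}. \<forall>\<^sub>F d in sequentially. \<theta> * r i \<le> real (n d i) / m d"
    proof
      fix i assume "i \<in> {..<p}"
      then have i: "i < p" by simp
      have "\<theta> * r i < r i" using \<theta>(3) r[OF i] by simp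
      from order_tendstoD(1)[OF ratio[OF i] this]
      show "\<forall>\<^sub>F d in sequentially. \<theta> * r i \<le> real (n d i) / m d" by eventually_elim simp
    qed
  qed simp
  then have "\<forall>\<^sub>F d in sequentially. \<forall>X\<in>configs p \<Gamma> (n d).
     j_map p r (n d) X \<in> G \<longrightarrow> (A_weight p Q (n d) X)\<^sup>2 \<le> exp (- (2 * L * (m d)\<^sup>2))"
    using eventually_m_ge[of "2 * real N / s"]
  proof eventually_elim
    case (elim d)
    show ?case
    proof (intro ballI impI)
      fix X assume X: "X \<in> configs p \<Gamma> (n d)" and G: "j_map p r (n d) X \<in> G"
      have "\<theta>\<^sup>2 * (m d)\<^sup>2 * t \<le> \<theta>\<^sup>2 * (m d)\<^sup>2 * trunc_energy N (j_map p r (n d) X)"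
        using G by (intro mult_left_mono) (auto simp: G_def)
      also have "\<dots> \<le> trunc_interaction N (n d) X"
        using elim(1) n_pos \<theta>(2) by (intro trunc_interaction_ge X) auto
      finally have 1: "(m d)\<^sup>2 * (\<theta>\<^sup>2 * t) \<le> trunc_interaction N (n d) X" by (simp add: mult_ac)
      have "2 * real N \<le> m d * s" using elim(2) s by (simp add: field_simps)
      then have "m d * (2 * real N) \<le> m d * (m d * s)" using m_pos[of d] by (intro mult_left_mono) auto
      then have "(m d)\<^sup>2 * c0 + 2 * real N * m d - trunc_interaction N (n d) X \<le> - (2 * L * (m d)\<^sup>2)"
        using 1 by (simp add: s_def power2_eq_square algebra_simps)
      then show "(A_weight p Q (n d) X)\<^sup>2 \<le> exp (- (2 * L * (m d)\<^sup>2))"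
        using A_weight_square_le[OF X, of N] by (meson exp_le_cancel_iff order_trans)
    qed
  qed
  moreover have "openin (M_topology p \<Gamma> r) G" unfolding G_def by (rule openin_trunc_energy_greater)
  moreover have "\<mu> \<in> G" using \<mu> t(2) by (simp add: G_def)
  ultimately show ?thesis by blast
qed

end

section \<open>Neighbourhoods given by finitely many test functions\<close>

text \<open>Induction over the generation of the topology: for an intersection the finite sets of
  tests are united and the smaller tolerance is taken, for a union one member is enough.\<close>

lemma weak_star_nbhd:
  assumes "openin (weak_star_topology K c) U" "\<mu> \<in> U"
  shows "\<exists>F \<epsilon>. finite F \<and> (\<forall>f\<in>F. continuous_on K f) \<and> 0 < (\<epsilon>::real) \<and> (\<forall>\<nu>\<in>measures_of_mass K c.
     (\<forall>f\<in>F. \<bar>(LINT x:K|\<nu>. f x) - (LINT x:K|\<mu>. f x)\<bar> < \<epsilon>) \<longrightarrow> \<nu> \<in> U)"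
proof -
  define near where "near F \<epsilon> U \<longleftrightarrow> (\<forall>\<nu>\<in>measures_of_mass K c.
     (\<forall>f\<in>F. \<bar>(LINT x:K|\<nu>. f x) - (LINT x:K|\<mu>. f x)\<bar> < \<epsilon>) \<longrightarrow> \<nu> \<in> U)" for F and \<epsilon> :: real and U
  have "\<exists>F \<epsilon>. finite F \<and> (\<forall>f\<in>F. continuous_on K f) \<and> 0 < \<epsilon> \<and> near F \<epsilon> U"
    using assms(1)[unfolded weak_star_topology_def openin_topology_generated_by_iff] assms(2)
  proof (induction U)
    case (Int U V)
    obtain F \<epsilon> where F: "finite F" "\<forall>f\<in>F. continuous_on K f" "0 < \<epsilon>" "near F \<epsilon> U"
      using Int.IH(1) Int.prems by blast
    obtain F' \<epsilon>' where F': "finite F'" "\<forall>f\<in>F'. continuous_on K f" "0 < \<epsilon>'" "near F' \<epsilon>' V"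
      using Int.IH(2) Int.prems by blast
    have "near (F \<union> F') (min \<epsilon> \<epsilon>') (U \<inter> V)"
      using F(4) F'(4) unfolding near_def by (auto simp: ball_Un)
    then show ?case using F F' by (intro exI[of _ "F \<union> F'"] exI[of _ "min \<epsilon> \<epsilon>'"]) auto
  next
    case (UN \<U>)
    then obtain V where V: "V \<in> \<U>" "\<mu> \<in> V" by blast
    obtain F \<epsilon> where "finite F" "\<forall>f\<in>F. continuous_on K f" "0 < \<epsilon>" "near F \<epsilon> V"
      using UN.IH[OF V] by blast
    moreover have "near F \<epsilon> (\<Union>\<U>)" using \<open>near F \<epsilon> V\<close> V(1) unfolding near_def by (meson UnionI)
    ultimately show ?case by blast
  next
    case (Basis s)
    then obtain f V where f: "continuous_on K f" "open (V :: real set)"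
      "s = {\<nu> \<in> measures_of_mass K c. (LINT x:K|\<nu>. f x) \<in> V}" by blast
    then have "(LINT x:K|\<mu>. f x) \<in> V" using Basis by blast
    then obtain \<epsilon> where \<epsilon>: "0 < \<epsilon>" "\<forall>y. dist y (LINT x:K|\<mu>. f x) < \<epsilon> \<longrightarrow> y \<in> V"
      using f(2) unfolding open_dist by blast
    have "near {f} \<epsilon> s" using \<epsilon>(2) unfolding near_def f(3) by (simp add: dist_real_def)
    then show ?case using f(1) \<epsilon>(1) by (intro exI[of _ "{f}"] exI[of _ \<epsilon>]) simp
  qed simp
  then show ?thesis unfolding near_def .
qed

definition deviation ::
    "(nat \<Rightarrow> real set) \<Rightarrow> (nat \<Rightarrow> real measure) \<Rightarrow> (nat \<Rightarrow> real measure) \<Rightarrow> nat \<times> (real \<Rightarrow> real) \<Rightarrow> real" where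
  "deviation \<Gamma> \<mu> \<nu> g = \<bar>(LINT x:\<Gamma> (fst g)|\<nu> (fst g). snd g x) - (LINT x:\<Gamma> (fst g)|\<mu> (fst g). snd g x)\<bar>"

lemma M_topology_nbhd:
  assumes "openin (M_topology p \<Gamma> r) G" "\<mu> \<in> G"
  shows "\<exists>F \<epsilon>. finite F \<and> (\<forall>g\<in>F. fst g < p \<and> continuous_on (\<Gamma> (fst g)) (snd g)) \<and> 0 < \<epsilon> \<and>
    (\<forall>\<nu>\<in>M_space p \<Gamma> r. (\<forall>g\<in>F. deviation \<Gamma> \<mu> \<nu> g < \<epsilon>) \<longrightarrow> \<nu> \<in> G)"
proof -
  obtain U where U: "\<forall>i\<in>{..<p}. openin (weak_star_topology (\<Gamma> i) (r i)) (U i)"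
    "\<mu> \<in> Pi\<^sub>E {..<p} U" "Pi\<^sub>E {..<p} U \<subseteq> G"
    using assms unfolding M_topology_def openin_product_topology_alt by meson
  have "\<forall>i\<in>{..<p}. \<exists>F \<epsilon>. finite F \<and> (\<forall>f\<in>F. continuous_on (\<Gamma> i) f) \<and> 0 < (\<epsilon>::real) \<and> (\<forall>\<nu>\<in>measures_of_mass (\<Gamma> i) (r i).
     (\<forall>f\<in>F. \<bar>(LINT x:\<Gamma> i|\<nu>. f x) - (LINT x:\<Gamma> i|\<mu> i. f x)\<bar> < \<epsilon>) \<longrightarrow> \<nu> \<in> U i)"
  proof
    fix i assume i: "i \<in> {..<p}"
    show "\<exists>F \<epsilon>. finite F \<and> (\<forall>f\<in>F. continuous_on (\<Gamma> i) f) \<and> 0 < (\<epsilon>::real) \<and> (\<forall>\<nu>\<in>measures_of_mass (\<Gamma> i) (r i).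
     (\<forall>f\<in>F. \<bar>(LINT x:\<Gamma> i|\<nu>. f x) - (LINT x:\<Gamma> i|\<mu> i. f x)\<bar> < \<epsilon>) \<longrightarrow> \<nu> \<in> U i)"
      by (rule weak_star_nbhd) (use U i in \<open>auto simp: PiE_iff\<close>)
  qed
  from bchoice[OF this] obtain F where "\<forall>i\<in>{..<p}. \<exists>\<epsilon>. finite (F i) \<and> (\<forall>f\<in>F i. continuous_on (\<Gamma> i) f) \<and> 0 < (\<epsilon>::real) \<and> (\<forall>\<nu>\<in>measures_of_mass (\<Gamma> i) (r i).
     (\<forall>f\<in>F i. \<bar>(LINT x:\<Gamma> i|\<nu>. f x) - (LINT x:\<Gamma> i|\<mu> i. f x)\<bar> < \<epsilon>) \<longrightarrow> \<nu> \<in> U i)" ..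
  from bchoice[OF this] obtain \<epsilon> where F: "\<forall>i\<in>{..<p}. finite (F i) \<and> (\<forall>f\<in>F i. continuous_on (\<Gamma> i) f) \<and> 0 < (\<epsilon> i::real) \<and> (\<forall>\<nu>\<in>measures_of_mass (\<Gamma> i) (r i).
     (\<forall>f\<in>F i. \<bar>(LINT x:\<Gamma> i|\<nu>. f x) - (LINT x:\<Gamma> i|\<mu> i. f x)\<bar> < \<epsilon> i) \<longrightarrow> \<nu> \<in> U i)" ..
  \<comment> \<open>The inserted 1 keeps the minimum meaningful without any block, as
    \<open>p\<close> is unrestricted here.\<close>
  define e where "e = Min (insert 1 (\<epsilon> ` {..<p}))"
  have e0: "0 < e" unfolding e_def using F by (subst Min_gr_iff) auto
  have el: "e \<le> \<epsilon> i" if "i < p" for i unfolding e_def using that by (intro Min_le) auto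
  show ?thesis
  proof (intro exI[of _ "\<Union>i<p. Pair i ` F i"] exI[of _ e] conjI ballI impI e0)
    fix \<nu> assume \<nu>: "\<nu> \<in> M_space p \<Gamma> r" and A: "\<forall>g\<in>\<Union>i<p. Pair i ` F i. deviation \<Gamma> \<mu> \<nu> g < e"
    have "\<nu> i \<in> U i" if i: "i < p" for i
    proof -
      have "\<nu> i \<in> measures_of_mass (\<Gamma> i) (r i)" using \<nu> i by (simp add: M_space_def PiE_iff)
      moreover have "\<bar>(LINT x:\<Gamma> i|\<nu> i. f x) - (LINT x:\<Gamma> i|\<mu> i. f x)\<bar> < \<epsilon> i" if f: "f \<in> F i" for f
      proof -
        have "(i, f) \<in> (\<Union>i<p. Pair i ` F i)" using i f by blast
        then have "deviation \<Gamma> \<mu> \<nu> (i, f) < e" using A by blast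
        then show ?thesis using el[OF i] by (simp add: deviation_def)
      qed
      ultimately show ?thesis using F i by auto
    qed
    then have "\<nu> \<in> Pi\<^sub>E {..<p} U" using \<nu> by (simp add: M_space_def PiE_iff)
    then show "\<nu> \<in> G" using U(3) by blast
  qed (use F in auto)
qed

section \<open>Second moments under a product measure\<close>

context product_prob_space
begin

lemma nn_integral_PiM_pair:
  assumes uv: "u \<in> I" "v \<in> I" "u \<noteq> v" and g: "g \<in> borel_measurable (M u \<Otimes>\<^sub>M M v)"
  shows "(\<integral>\<^sup>+X. g (X u, X v) \<partial>PiM I M) = (\<integral>\<^sup>+z. g z \<partial>(M u \<Otimes>\<^sub>M M v))"
proof -
  have r: "distr (PiM I M) (PiM {u, v} M) (\<lambda>X. restrict X {u, v}) = PiM {u, v} M"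
    using uv by (intro distr_PiM_restrict_finite) auto
  have mr: "(\<lambda>X. restrict X {u, v}) \<in> measurable (PiM I M) (PiM {u, v} M)"
    by (rule measurable_restrict_subset) (use uv in auto)
  have m: "(\<lambda>X. g (X u, X v)) \<in> borel_measurable (PiM {u, v} M)"
  proof -
    have "(\<lambda>X. (X u, X v)) \<in> measurable (PiM {u, v} M) (M u \<Otimes>\<^sub>M M v)"
      by (intro measurable_Pair measurable_component_singleton) auto
    from measurable_compose[OF this g] show ?thesis .
  qed
  have "(\<integral>\<^sup>+X. g (X u, X v) \<partial>PiM I M) = (\<integral>\<^sup>+X. g (restrict X {u, v} u, restrict X {u, v} v) \<partial>PiM I M)" by simp
  also have "\<dots> = (\<integral>\<^sup>+X. g (X u, X v) \<partial>distr (PiM I M) (PiM {u, v} M) (\<lambda>X. restrict X {u, v}))"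
    by (rule nn_integral_distr[OF mr, symmetric]) (use m in simp)
  also have "\<dots> = (\<integral>\<^sup>+X. g (X u, X v) \<partial>PiM {u, v} M)" unfolding r ..
  also have "\<dots> = (\<integral>\<^sup>+z. g z \<partial>(M u \<Otimes>\<^sub>M M v))"
    using product_nn_integral_pair[of "\<lambda>x y. g (x, y)" u v] g uv by simp
  finally show ?thesis .
qed

lemma distr_PiM_pair:
  assumes uv: "u \<in> I" "v \<in> I" "u \<noteq> v"
  shows "distr (PiM I M) (M u \<Otimes>\<^sub>M M v) (\<lambda>X. (X u, X v)) = M u \<Otimes>\<^sub>M M v"
proof (rule measure_eqI)
  have m: "(\<lambda>X. (X u, X v)) \<in> measurable (PiM I M) (M u \<Otimes>\<^sub>M M v)"
    using uv by measurable
  fix A assume "A \<in> sets (distr (PiM I M) (M u \<Otimes>\<^sub>M M v) (\<lambda>X. (X u, X v)))"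
  then have A: "A \<in> sets (M u \<Otimes>\<^sub>M M v)" by simp
  have "emeasure (distr (PiM I M) (M u \<Otimes>\<^sub>M M v) (\<lambda>X. (X u, X v))) A
      = (\<integral>\<^sup>+z. indicator A z \<partial>distr (PiM I M) (M u \<Otimes>\<^sub>M M v) (\<lambda>X. (X u, X v)))"
    using A by (simp add: nn_integral_indicator)
  also have "\<dots> = (\<integral>\<^sup>+X. indicator A (X u, X v) \<partial>PiM I M)"
    using A by (intro nn_integral_distr m) simp
  also have "\<dots> = emeasure (M u \<Otimes>\<^sub>M M v) A"
    using A by (subst nn_integral_PiM_pair[OF uv]) simp_all
  finally show "emeasure (distr (PiM I M) (M u \<Otimes>\<^sub>M M v) (\<lambda>X. (X u, X v))) A = emeasure (M u \<Otimes>\<^sub>M M v) A" .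
qed simp

text \<open>Centred independent variables are orthogonal, so in the expanded square only the
  \<open>card J\<close> diagonal terms contribute.\<close>

lemma second_moment_le:
  fixes f :: "'a \<Rightarrow> real" and B :: real
  assumes J: "finite J" "J \<subseteq> I" and m: "\<And>u. u \<in> J \<Longrightarrow> f \<in> borel_measurable (M u)"
    and mean: "\<And>u. u \<in> J \<Longrightarrow> (\<integral>x. f x \<partial>M u) = 0" and bd: "\<And>x. \<bar>f x\<bar> \<le> B"
  shows "(\<integral>\<^sup>+X. ennreal ((\<Sum>u\<in>J. f (X u))\<^sup>2) \<partial>PiM I M) \<le> ennreal (real (card J) * B\<^sup>2)"
proof -
  have mu[measurable]: "(\<lambda>X. f (X u)) \<in> borel_measurable (PiM I M)" if "u \<in> J" for u
    using measurable_compose[OF measurable_component_singleton[of u I M] m[OF that]] J that by auto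
  have int: "integrable (PiM I M) (\<lambda>X. f (X u) * f (X v))" if "u \<in> J" "v \<in> J" for u v
  proof (rule P.integrable_const_bound[of _ "B * B"])
    show "AE X in PiM I M. norm (f (X u) * f (X v)) \<le> B * B"
      unfolding real_norm_def abs_mult by (intro AE_I2 mult_mono bd) (auto intro: order_trans[OF abs_ge_zero bd])
  qed (intro borel_measurable_times mu that)
  have le: "(\<integral>X. f (X u) * f (X v) \<partial>PiM I M) \<le> (if v = u then B\<^sup>2 else 0)" if uv: "u \<in> J" "v \<in> J" for u v
  proof (cases "u = v")
    case True
    have "(\<integral>X. f (X u) * f (X u) \<partial>PiM I M) \<le> (\<integral>X. B\<^sup>2 \<partial>PiM I M)"
    proof (rule integral_mono)
      fix X
      have "\<bar>f (X u)\<bar> * \<bar>f (X u)\<bar> \<le> B * B" by (intro mult_mono bd) (auto intro: order_trans[OF abs_ge_zero bd])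
      then show "f (X u) * f (X u) \<le> B\<^sup>2" by (simp add: power2_eq_square flip: abs_mult)
    qed (use int uv in auto)
    then show ?thesis using True by (simp add: P.prob_space)
  next
    case False
    interpret pair: pair_prob_space "M u" "M v" ..
    have I: "u \<in> I" "v \<in> I" using J uv by auto
    have mp: "(\<lambda>z. f (fst z) * f (snd z)) \<in> borel_measurable (M u \<Otimes>\<^sub>M M v)"
      using m[OF uv(1)] m[OF uv(2)] by measurable
    have "integrable (M u \<Otimes>\<^sub>M M v) (\<lambda>z. f (fst z) * f (snd z))"
    proof (rule pair.P.integrable_const_bound[of _ "B * B"])
      show "AE z in M u \<Otimes>\<^sub>M M v. norm (f (fst z) * f (snd z)) \<le> B * B"
        unfolding real_norm_def abs_mult by (intro AE_I2 mult_mono bd) (auto intro: order_trans[OF abs_ge_zero bd])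
    qed (rule mp)
    from pair.integral_fst'[OF this]
    have "(\<integral>z. f (fst z) * f (snd z) \<partial>(M u \<Otimes>\<^sub>M M v)) = 0" using mean uv by simp
    moreover have "(\<integral>X. f (X u) * f (X v) \<partial>PiM I M) = (\<integral>z. f (fst z) * f (snd z) \<partial>distr (PiM I M) (M u \<Otimes>\<^sub>M M v) (\<lambda>X. (X u, X v)))"
      using I by (subst integral_distr[OF _ mp]) (auto intro!: measurable_Pair measurable_component_singleton)
    ultimately show ?thesis unfolding distr_PiM_pair[OF I False] using False by simp
  qed
  have sq: "(\<Sum>u\<in>J. f (X u))\<^sup>2 = (\<Sum>u\<in>J. \<Sum>v\<in>J. f (X u) * f (X v))" for X
    by (simp add: power2_eq_square sum_product)
  have "(\<integral>\<^sup>+X. ennreal ((\<Sum>u\<in>J. f (X u))\<^sup>2) \<partial>PiM I M) = ennreal (\<integral>X. (\<Sum>u\<in>J. f (X u))\<^sup>2 \<partial>PiM I M)"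
  proof (rule nn_integral_eq_integral)
    show "integrable (PiM I M) (\<lambda>X. (\<Sum>u\<in>J. f (X u))\<^sup>2)"
      unfolding sq using int by (intro Bochner_Integration.integrable_sum) auto
  qed simp
  also have "(\<integral>X. (\<Sum>u\<in>J. f (X u))\<^sup>2 \<partial>PiM I M) = (\<Sum>u\<in>J. \<Sum>v\<in>J. \<integral>X. f (X u) * f (X v) \<partial>PiM I M)"
    unfolding sq using int by (simp add: Bochner_Integration.integral_sum)
  also have "\<dots> \<le> (\<Sum>u\<in>J. \<Sum>v\<in>J. if v = u then B\<^sup>2 else 0)" by (intro sum_mono le)
  also have "\<dots> = real (card J) * B\<^sup>2" using J by simp
  finally show ?thesis by (simp add: ennreal_leI)
qed

end

text \<open>If \<open>F\<close> exceeded \<open>c\<close> wherever \<open>R\<close> holds, it would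
  do so almost everywhere, and its mean would be at least \<open>c\<close>.\<close>

lemma (in prob_space) exists_le_expectation:
  assumes "(\<integral>\<^sup>+x. F x \<partial>M) < c" "AE x in M. R x"
  shows "\<exists>x\<in>space M. R x \<and> F x \<le> c"
proof (rule ccontr)
  assume "\<not> (\<exists>x\<in>space M. R x \<and> F x \<le> c)"
  then have neg: "c \<le> F x" if "x \<in> space M" "R x" for x using that by (auto simp: not_le intro: less_imp_le)
  from assms(2) AE_space[of M] have "AE x in M. c \<le> F x" by eventually_elim (rule neg)
  then have "(\<integral>\<^sup>+x. c \<partial>M) \<le> (\<integral>\<^sup>+x. F x \<partial>M)" by (rule nn_integral_mono_AE)
  then show False using assms(1) by (simp add: emeasure_space_1)
qed

section \<open>Configurations of large weight near a tuple\<close>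

context interval_system
begin

text \<open>The diagonal is left out because the untruncated kernel is infinite there.\<close>

definition interaction :: "(nat \<Rightarrow> nat) \<Rightarrow> (nat \<times> nat \<Rightarrow> real) \<Rightarrow> ennreal" where
  "interaction n X = (\<Sum>u\<in>coords p n. \<Sum>v\<in>coords p n - {u}. kernel (fst u) (fst v) (X u, X v))"

text \<open>A finite interaction forces the points to be distinct, so every gap is an exponential
  and the logarithms can be summed. The missing diagonal terms of the constant and of the fields
  amount to at most \<open>(c0 + 4 * q0) * k\<close>, of lower order than k^2.\<close>

lemma A_weight_square_ge:
  assumes X: "X \<in> configs p \<Gamma> n" and H: "interaction n X \<le> ennreal h" and h: "0 \<le> h"
  defines "k \<equiv> real (mi_norm p n)"
  shows "exp (k\<^sup>2 * c0 - h - (c0 + 4 * q0) * k) \<le> (A_weight p Q n X)\<^sup>2"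
proof -
  let ?C = "coords p n"
  define e where "e u v = real (pair_mult (fst u) (fst v)) * ln \<bar>X u - X v\<bar>" for u v
  define w where "w u v = c0 + 2 * Q (fst u) (X u) + 2 * Q (fst v) (X v)" for u v
  have in\<Gamma>: "fst u < p" "X u \<in> \<Gamma> (fst u)" if "u \<in> ?C" for u using in_configs_D[OF X that] by auto
  have fin: "kernel (fst u) (fst v) (X u, X v) < \<infinity>" if "u \<in> ?C" "v \<in> ?C" "v \<noteq> u" for u v
  proof -
    have "interaction n X < \<infinity>" using H by (simp add: le_less_trans)
    then show ?thesis unfolding interaction_def using that by (simp add: less_top)
  qed
  have ne: "X u \<noteq> X v" if "u \<in> ?C" "v \<in> ?C" "v \<noteq> u" for u v
  proof
    assume eq: "X u = X v"
    consider "fst u = fst v" | "fst u < fst v" | "fst v < fst u" by linarith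
    then have "fst u = fst v"
    proof cases
      case 2
      from \<Gamma>_less[OF this in\<Gamma>(1)[OF that(2)] in\<Gamma>(2)[OF that(1)] in\<Gamma>(2)[OF that(2)]] show ?thesis using eq by simp
    next
      case 3
      from \<Gamma>_less[OF this in\<Gamma>(1)[OF that(1)] in\<Gamma>(2)[OF that(2)] in\<Gamma>(2)[OF that(1)]] show ?thesis using eq by simp
    qed
    then show False using fin[OF that] kernel_diag[OF in\<Gamma>[OF that(1)]] eq by simp
  qed
  have ker: "kernel (fst u) (fst v) (X u, X v) = ennreal (w u v - e u v)" "0 \<le> w u v - e u v"
    if "u \<in> ?C" "v \<in> ?C - {u}" for u v
    using kernel_eq_real[OF in\<Gamma>(1) in\<Gamma>(1) in\<Gamma>(2) in\<Gamma>(2), of u v] ne[of u v] that unfolding w_def e_def by auto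
  have "interaction n X = (\<Sum>u\<in>?C. \<Sum>v\<in>?C - {u}. ennreal (w u v - e u v))"
    unfolding interaction_def by (intro sum.cong refl ker)
  also have "\<dots> = (\<Sum>u\<in>?C. ennreal (\<Sum>v\<in>?C - {u}. w u v - e u v))"
    by (intro sum.cong refl sum_ennreal ker)
  also have "\<dots> = ennreal (\<Sum>u\<in>?C. \<Sum>v\<in>?C - {u}. w u v - e u v)"
    by (intro sum_ennreal sum_nonneg ker)
  finally have le: "(\<Sum>u\<in>?C. \<Sum>v\<in>?C - {u}. w u v - e u v) \<le> h"
    using H h by (simp add: ennreal_le_iff)
  have gap: "(\<Prod>v\<in>?C. gap X u v) = exp (\<Sum>v\<in>?C - {u}. e u v)" if u: "u \<in> ?C" for u
  proof -
    have "(\<Prod>v\<in>?C. gap X u v) = gap X u u * (\<Prod>v\<in>?C - {u}. gap X u v)"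
      using u by (intro prod.remove) auto
    also have "(\<Prod>v\<in>?C - {u}. gap X u v) = (\<Prod>v\<in>?C - {u}. exp (e u v))"
    proof (rule prod.cong)
      fix v assume v: "v \<in> ?C - {u}"
      then have "0 < \<bar>X u - X v\<bar>" using ne[OF u, of v] by auto
      then show "gap X u v = exp (e u v)" using v by (auto simp: gap_def e_def exp_of_nat_mult)
    qed simp
    finally show ?thesis by (simp add: gap_def exp_sum)
  qed
  have card: "real (card (?C - {u})) = k - 1" if "u \<in> ?C" for u
  proof -
    have "1 \<le> mi_norm p n" using that card_gt_0_iff[of ?C] by (auto simp: Suc_le_eq)
    then show ?thesis using that by (simp add: k_def card_Diff_singleton of_nat_diff)
  qed
  define q where "q = (\<Sum>u\<in>?C. Q (fst u) (X u))"
  have "(\<Sum>v\<in>?C - {u}. w u v) = (k - 1) * c0 + 2 * k * Q (fst u) (X u) + 2 * q - 4 * Q (fst u) (X u)" if u: "u \<in> ?C" for u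
  proof -
    have "q = Q (fst u) (X u) + (\<Sum>v\<in>?C - {u}. Q (fst v) (X v))"
      unfolding q_def using u by (intro sum.remove) auto
    moreover have "(\<Sum>v\<in>?C - {u}. w u v)
        = real (card (?C - {u})) * (c0 + 2 * Q (fst u) (X u)) + 2 * (\<Sum>v\<in>?C - {u}. Q (fst v) (X v))"
      unfolding w_def by (simp add: sum.distrib sum_distrib_left)
    ultimately show ?thesis unfolding card[OF u] by (simp add: algebra_simps)
  qed
  then have "(\<Sum>u\<in>?C. \<Sum>v\<in>?C - {u}. w u v)
      = (\<Sum>u\<in>?C. (k - 1) * c0 + 2 * k * Q (fst u) (X u) + 2 * q - 4 * Q (fst u) (X u))"
    by (intro sum.cong) auto
  also have "\<dots> = k * ((k - 1) * c0) + 2 * k * q + k * (2 * q) - 4 * q"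
    by (simp add: sum.distrib sum_subtractf q_def k_def flip: sum_distrib_left)
  finally have w: "(\<Sum>u\<in>?C. \<Sum>v\<in>?C - {u}. w u v) = k\<^sup>2 * c0 - k * c0 + 4 * k * q - 4 * q"
    by (simp add: power2_eq_square algebra_simps)
  have "\<bar>q\<bar> \<le> (\<Sum>u\<in>?C. q0)" unfolding q_def
    by (rule order_trans[OF sum_abs sum_mono]) (use q0(2) in\<Gamma> in auto)
  then have q: "\<bar>q\<bar> \<le> k * q0" by (simp add: k_def)
  have "k\<^sup>2 * c0 - h - (c0 + 4 * q0) * k \<le> (\<Sum>u\<in>?C. \<Sum>v\<in>?C - {u}. e u v) - 4 * k * q"
    using le q w by (simp add: sum_subtractf algebra_simps)
  then have "exp (k\<^sup>2 * c0 - h - (c0 + 4 * q0) * k) \<le> exp (\<Sum>u\<in>?C. \<Sum>v\<in>?C - {u}. e u v) * exp (- 4 * k * q)"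
    by (simp flip: exp_add)
  also have "exp (\<Sum>u\<in>?C. \<Sum>v\<in>?C - {u}. e u v) = (\<Prod>u\<in>?C. \<Prod>v\<in>?C. gap X u v)"
    by (simp add: gap exp_sum)
  finally show ?thesis unfolding A_weight_square k_def q_def .
qed

end

context multi_index_sequence
begin

text \<open>A point mass fills in at indices outside of the blocks, because
  \<open>product_prob_space\<close> asks for a probability measure at every index.\<close>

definition sample :: "(nat \<Rightarrow> real measure) \<Rightarrow> nat \<times> nat \<Rightarrow> real measure" where
  "sample \<mu> u = (if fst u < p then scale_measure (ennreal (1 / r (fst u))) (\<mu> (fst u)) else return borel 0)"

lemma sample:
  assumes "\<mu> \<in> M"
  shows "prob_space (sample \<mu> u)" "sets (sample \<mu> u) = sets borel"
    "fst u < p \<Longrightarrow> AE x in sample \<mu> u. x \<in> \<Gamma> (fst u)"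
    "fst u < p \<Longrightarrow> f \<in> borel_measurable borel \<Longrightarrow> (\<integral>x. (f x :: real) \<partial>sample \<mu> u) = (LINT x:\<Gamma> (fst u)|\<mu> (fst u). f x) / r (fst u)"
    "fst u < p \<Longrightarrow> g \<in> borel_measurable borel \<Longrightarrow> (\<integral>\<^sup>+x. g x \<partial>sample \<mu> u) = ennreal (1 / r (fst u)) * (\<integral>\<^sup>+x. g x \<partial>\<mu> (fst u))"
proof -
  have D: "sets (\<mu> (fst u)) = sets borel" "emeasure (\<mu> (fst u)) UNIV = ennreal (r (fst u))"
     "space (\<mu> (fst u)) = UNIV" "AE x in \<mu> (fst u). x \<in> \<Gamma> (fst u)" "emeasure (\<mu> (fst u)) (- \<Gamma> (fst u)) = 0"
     if "fst u < p"
    using measures_of_massD[OF in_M_D[OF assms that] closed_\<Gamma>[OF that]] by auto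
  show s: "sets (sample \<mu> u) = sets borel" using D by (simp add: sample_def)
  show "prob_space (sample \<mu> u)"
  proof (cases "fst u < p")
    case True
    have "ennreal (1 / r (fst u)) * ennreal (r (fst u)) = ennreal (1 / r (fst u) * r (fst u))"
      using r[OF True] by (intro ennreal_mult[symmetric]) simp_all
    then have "ennreal (1 / r (fst u)) * ennreal (r (fst u)) = 1" using r[OF True] by simp
    then show ?thesis using D[OF True] True
      by (intro prob_spaceI) (simp add: sample_def space_scale_measure)
  qed (simp add: sample_def prob_space_return)
  show "fst u < p \<Longrightarrow> AE x in sample \<mu> u. x \<in> \<Gamma> (fst u)"
    by (rule AE_I'[of "- \<Gamma> (fst u)"]) (use D closed_\<Gamma> in \<open>auto simp: null_sets_def sample_def space_scale_measure\<close>)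
  show "(\<integral>x. (f x :: real) \<partial>sample \<mu> u) = (LINT x:\<Gamma> (fst u)|\<mu> (fst u). f x) / r (fst u)"
    if "fst u < p" "f \<in> borel_measurable borel"
  proof -
    have "f \<in> borel_measurable (\<mu> (fst u))" unfolding measurable_cong_sets[OF D(1)[OF that(1)] refl] by (rule that)
    moreover have "0 \<le> 1 / r (fst u)" using r[OF that(1)] by simp
    ultimately have "(\<integral>x. f x \<partial>sample \<mu> u) = (1 / r (fst u)) *\<^sub>R (\<integral>x. f x \<partial>\<mu> (fst u))"
      using that(1) unfolding sample_def by (simp add: integral_scale_measure)
    then show ?thesis
      using set_integral_measures_of_mass_eq[OF in_M_D[OF assms that(1)] closed_\<Gamma>[OF that(1)] that(2)] by simp
  qed
  show "(\<integral>\<^sup>+x. g x \<partial>sample \<mu> u) = ennreal (1 / r (fst u)) * (\<integral>\<^sup>+x. g x \<partial>\<mu> (fst u))"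
    if "fst u < p" "g \<in> borel_measurable borel"
  proof -
    have "g \<in> borel_measurable (\<mu> (fst u))" unfolding measurable_cong_sets[OF D(1)[OF that(1)] refl] by (rule that)
    then show ?thesis using that(1) by (simp add: sample_def nn_integral_scale_measure)
  qed
qed

lemma nn_integral_sample_pair:
  assumes \<mu>: "\<mu> \<in> M" and u: "fst u < p" and v: "fst v < p" and g: "g \<in> borel_measurable (borel \<Otimes>\<^sub>M borel)"
  shows "(\<integral>\<^sup>+z. g z \<partial>(sample \<mu> u \<Otimes>\<^sub>M sample \<mu> v))
    = ennreal (1 / (r (fst u) * r (fst v))) * (\<integral>\<^sup>+z. g z \<partial>(\<mu> (fst u) \<Otimes>\<^sub>M \<mu> (fst v)))"
proof -
  note D1 = measures_of_massD[OF in_M_D[OF \<mu> u] closed_\<Gamma>[OF u]]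
  note D2 = measures_of_massD[OF in_M_D[OF \<mu> v] closed_\<Gamma>[OF v]]
  note S1 = sample(2)[OF \<mu>, of u] and S2 = sample(2)[OF \<mu>, of v]
  interpret V: prob_space "sample \<mu> v" by (rule sample(1)[OF \<mu>])
  interpret V': finite_measure "\<mu> (fst v)" by (rule D2)
  have gx: "(\<lambda>y. g (x, y)) \<in> borel_measurable borel" for x
    using g by measurable
  have m: "(\<lambda>x. \<integral>\<^sup>+y. g (x, y) \<partial>\<mu> (fst v)) \<in> borel_measurable borel"
  proof (rule V'.borel_measurable_nn_integral)
    show "case_prod (\<lambda>x y. g (x, y)) \<in> borel_measurable (borel \<Otimes>\<^sub>M \<mu> (fst v))"
      using g by (simp add: measurable_cong_sets[OF sets_pair_measure_cong[OF refl D2(1)] refl])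
  qed
  have "(\<integral>\<^sup>+z. g z \<partial>(sample \<mu> u \<Otimes>\<^sub>M sample \<mu> v)) = (\<integral>\<^sup>+x. \<integral>\<^sup>+y. g (x, y) \<partial>sample \<mu> v \<partial>sample \<mu> u)"
    using g by (intro V.nn_integral_fst[symmetric]) (simp add: measurable_cong_sets[OF sets_pair_measure_cong[OF S1 S2] refl])
  also have "\<dots> = (\<integral>\<^sup>+x. ennreal (1 / r (fst v)) * (\<integral>\<^sup>+y. g (x, y) \<partial>\<mu> (fst v)) \<partial>sample \<mu> u)"
    by (simp add: sample(5)[OF \<mu> v gx])
  also have "\<dots> = ennreal (1 / r (fst u)) * (\<integral>\<^sup>+x. ennreal (1 / r (fst v)) * (\<integral>\<^sup>+y. g (x, y) \<partial>\<mu> (fst v)) \<partial>\<mu> (fst u))"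
    by (rule sample(5)[OF \<mu> u]) (intro borel_measurable_times_ennreal borel_measurable_const m)
  also have "\<dots> = ennreal (1 / r (fst u)) * (ennreal (1 / r (fst v)) * (\<integral>\<^sup>+x. \<integral>\<^sup>+y. g (x, y) \<partial>\<mu> (fst v) \<partial>\<mu> (fst u)))"
    using m by (subst nn_integral_cmult) (simp_all add: measurable_cong_sets[OF D1(1) refl])
  also have "(\<integral>\<^sup>+x. \<integral>\<^sup>+y. g (x, y) \<partial>\<mu> (fst v) \<partial>\<mu> (fst u)) = (\<integral>\<^sup>+z. g z \<partial>(\<mu> (fst u) \<Otimes>\<^sub>M \<mu> (fst v)))"
    using g by (intro V'.nn_integral_fst) (simp add: measurable_cong_sets[OF sets_pair_measure_cong[OF D1(1) D2(1)] refl])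
  also have "ennreal (1 / r (fst u)) * (ennreal (1 / r (fst v)) * (\<integral>\<^sup>+z. g z \<partial>(\<mu> (fst u) \<Otimes>\<^sub>M \<mu> (fst v))))
     = ennreal (1 / (r (fst u) * r (fst v))) * (\<integral>\<^sup>+z. g z \<partial>(\<mu> (fst u) \<Otimes>\<^sub>M \<mu> (fst v)))"
    using r[OF u] r[OF v] by (simp add: mult.assoc[symmetric] ennreal_mult[symmetric])
  finally show ?thesis .
qed

text \<open>Points are drawn independently, those of the \<open>i\<close>-th block with law \<open>\<mu> i / r i\<close>. Adding a large
  multiple of the squared deviations to the interaction yields one nonnegative functional whose mean
  is under control, so a single configuration with a value below the mean is good in every respect.\<close>

lemma exists_good_sample:
  assumes \<mu>: "\<mu> \<in> M" and e: "energy \<mu> = ennreal e" "0 \<le> e"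
    and F: "finite F" "\<And>g. g \<in> F \<Longrightarrow> fst g < p \<and> continuous_on (\<Gamma> (fst g)) (snd g)"
    and \<epsilon>: "0 < \<epsilon>" and \<delta>: "0 < \<delta>"
  shows "\<forall>\<^sub>F d in sequentially. \<exists>X\<in>configs p \<Gamma> (n d).
     interaction (n d) X \<le> ennreal ((m d)\<^sup>2 * (e + \<delta>)) \<and>
     (\<forall>g\<in>F. deviation \<Gamma> \<mu> (j_map p r (n d) X) g < \<epsilon>)"
proof -
  \<comment> \<open>Large enough that a penalty of at most \<open>(m d)^2 * (e + \<delta>)\<close>
    forces the sum of the squared deviations to be at most \<epsilon>^2 / 2.\<close>
  define \<Lambda> where "\<Lambda> = 2 * (e + \<delta>) / \<epsilon>\<^sup>2"
  have \<Lambda>: "0 < \<Lambda>" using e \<delta> \<epsilon> by (simp add: \<Lambda>_def)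
  have "\<forall>g\<in>F. \<exists>B. \<forall>x\<in>\<Gamma> (fst g). \<bar>snd g x\<bar> \<le> B"
  proof
    fix g assume g: "g \<in> F"
    show "\<exists>B. \<forall>x\<in>\<Gamma> (fst g). \<bar>snd g x\<bar> \<le> B"
      using compact_imp_bounded[OF compact_continuous_image[of "\<Gamma> (fst g)" "snd g"]] F(2)[OF g] compact_\<Gamma>
      by (auto simp: bounded_iff)
  qed
  from bchoice[OF this] obtain B0 where B0: "\<forall>g\<in>F. \<forall>x\<in>\<Gamma> (fst g). \<bar>snd g x\<bar> \<le> B0 g" ..
  define mean where "mean g = (LINT x:\<Gamma> (fst g)|\<mu> (fst g). snd g x) / r (fst g)" for g
  \<comment> \<open>The test function centred under the sampling law; setting it to 0 off the
    interval before centring makes it bounded and Borel on the whole line.\<close>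
  define c where "c g x = indicator (\<Gamma> (fst g)) x *\<^sub>R snd g x - mean g" for g x
  define B where "B g = \<bar>B0 g\<bar> + \<bar>mean g\<bar>" for g
  have cB: "\<bar>c g x\<bar> \<le> B g" if "g \<in> F" for g x
    using B0 that unfolding c_def B_def indicator_def by (cases "x \<in> \<Gamma> (fst g)") force+
  have cm: "c g \<in> borel_measurable borel" if g: "g \<in> F" for g
    unfolding c_def using F(2)[OF g] closed_\<Gamma>
    by (intro borel_measurable_diff borel_measurable_continuous_on_indicator borel_measurable_const) auto
  have c0: "(\<integral>x. c g x \<partial>sample \<mu> u) = 0" if g: "g \<in> F" and u: "fst u = fst g" for g u
  proof -
    have up: "fst u < p" using F(2)[OF g] u by simp
    interpret prob_space "sample \<mu> u" by (rule sample(1)[OF \<mu>])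
    have "(\<integral>x. c g x \<partial>sample \<mu> u) = (LINT x:\<Gamma> (fst u)|\<mu> (fst u). c g x) / r (fst u)"
      by (rule sample(4)[OF \<mu> up cm[OF g]])
    also have "(LINT x:\<Gamma> (fst u)|\<mu> (fst u). c g x) = (LINT x:\<Gamma> (fst u)|\<mu> (fst u). snd g x - mean g)"
      unfolding set_lebesgue_integral_def by (rule Bochner_Integration.integral_cong) (auto simp: c_def u indicator_def)
    also have "\<dots> = (LINT x:\<Gamma> (fst u)|\<mu> (fst u). snd g x) - (LINT x:\<Gamma> (fst u)|\<mu> (fst u). mean g)"
      using F(2)[OF g] u by (intro set_integral_diff(2) set_integrable_measures_of_mass[OF in_M_D[OF \<mu> up] compact_\<Gamma>[OF up]]) auto
    also have "(LINT x:\<Gamma> (fst u)|\<mu> (fst u). mean g) = mean g * r (fst u)"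
      by (rule set_integral_const_measures_of_mass[OF in_M_D[OF \<mu> up] compact_\<Gamma>[OF up] r_nonneg[OF up]])
    finally show ?thesis using r[OF up] u by (simp add: mean_def)
  qed
  define dev where "dev d g X = r (fst g) / real (n d (fst g)) * (\<Sum>u\<in>{fst g} \<times> {..<n d (fst g)}. c g (X u))" for d g X
  have dev: "deviation \<Gamma> \<mu> (j_map p r (n d) X) g = \<bar>dev d g X\<bar>" if g: "g \<in> F" and X: "X \<in> configs p \<Gamma> (n d)" for d g X
  proof -
    let ?i = "fst g" and ?k = "n d (fst g)"
    have i: "?i < p" and cont: "continuous_on (\<Gamma> ?i) (snd g)" using F(2)[OF g] by auto
    have k: "0 < ?k" using n_pos[OF i] .
    have Xin: "X (?i, l) \<in> \<Gamma> ?i" if "l < ?k" for l using in_configs_D[OF X, of "(?i, l)"] i that by simp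
    have "(LINT x:\<Gamma> ?i|j_map p r (n d) X ?i. snd g x) = r ?i / real ?k * (\<Sum>l<?k. snd g (X (?i, l)))"
      using set_integral_scaled_dirac_sum[OF closed_\<Gamma>[OF i] cont, of ?k "\<lambda>l. X (?i, l)" "r ?i / real ?k"] Xin r[OF i] i
      by (simp add: j_map_def)
    moreover have "(\<Sum>u\<in>{?i} \<times> {..<?k}. c g (X u)) = (\<Sum>l<?k. c g (X (?i, l)))"
      by (rule sum.reindex_bij_witness[of _ "Pair ?i" snd]) auto
    moreover have "(\<Sum>l<?k. c g (X (?i, l))) = (\<Sum>l<?k. snd g (X (?i, l)) - mean g)"
      using Xin by (intro sum.cong) (auto simp: c_def)
    ultimately show ?thesis
      using k r[OF i] unfolding deviation_def dev_def
      by (simp add: sum_subtractf mean_def right_diff_distrib)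
  qed
  \<comment> \<open>A bound for the mean of the penalty divided by \<open>(m d)^2\<close>; it tends
    to 0 because the size of every block tends to infinity.\<close>
  define V where "V d = \<Lambda> * (\<Sum>g\<in>F. (r (fst g))\<^sup>2 * (B g)\<^sup>2 / real (n d (fst g)))" for d
  have n_inf: "filterlim (\<lambda>d. real (n d i)) at_top sequentially" if i: "i < p" for i
  proof -
    have "filterlim (\<lambda>d. real (n d i) / m d * m d) at_top sequentially"
      by (rule filterlim_tendsto_pos_mult_at_top[OF ratio[OF i] r[OF i] m_at_top])
    moreover have "real (n d i) / m d * m d = real (n d i)" for d using m_pos[of d] by simp
    ultimately show ?thesis by simp
  qed
  have "V \<longlonglongrightarrow> \<Lambda> * (\<Sum>g\<in>F. 0)" unfolding V_def
    by (intro tendsto_intros real_tendsto_divide_at_top[OF tendsto_const] n_inf) (use F(2) in auto)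
  then have V: "\<forall>\<^sub>F d in sequentially. V d < \<delta> / 3"
    using \<delta> by (intro order_tendstoD) auto
  \<comment> \<open>\<kappa> > 1 is the counterpart of \<theta>:
    \<open>n d i / m d \<le> \<kappa> * r i\<close> holds for large \<open>d\<close>, and the factor
    \<kappa>^2 raises the mean interaction by less than \<delta> / 3.\<close>
  have "((\<lambda>\<kappa>::real. \<kappa>\<^sup>2 * e) \<longlongrightarrow> 1\<^sup>2 * e) (at_right 1)" by (intro tendsto_intros)
  then have "\<forall>\<^sub>F \<kappa> in at_right 1. \<kappa>\<^sup>2 * e < e + \<delta> / 3" using \<delta> by (intro order_tendstoD) auto
  moreover have "\<forall>\<^sub>F \<kappa>::real in at_right 1. \<kappa> \<in> {1<..<2}" by (rule eventually_at_right_real) simp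
  ultimately have "\<forall>\<^sub>F \<kappa> in at_right (1::real). \<kappa>\<^sup>2 * e < e + \<delta> / 3 \<and> \<kappa> \<in> {1<..<2}" by eventually_elim simp
  then obtain \<kappa> where \<kappa>: "\<kappa>\<^sup>2 * e < e + \<delta> / 3" "1 < \<kappa>"
    using eventually_happens'[OF trivial_limit_at_right_real] by force
  have "\<forall>\<^sub>F d in sequentially. \<forall>i\<in>{..<p}. real (n d i) / m d \<le> \<kappa> * r i"
  proof (rule eventually_ball_finite)
    show "\<forall>i\<in>{..<p}. \<forall>\<^sub>F d in sequentially. real (n d i) / m d \<le> \<kappa> * r i"
    proof
      fix i assume "i \<in> {..<p}"
      then have i: "i < p" by simp
      have "r i < \<kappa> * r i" using \<kappa>(2) r[OF i] by simp
      from order_tendstoD(2)[OF ratio[OF i] this]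
      show "\<forall>\<^sub>F d in sequentially. real (n d i) / m d \<le> \<kappa> * r i" by eventually_elim simp
    qed
  qed simp
  then show ?thesis using V
  proof eventually_elim
    case (elim d)
    let ?C = "coords p (n d)"
    let ?N = "sample \<mu>"
    interpret product_prob_space ?N ?C
      unfolding product_prob_space_def product_prob_space_axioms_def product_sigma_finite_def
      using sample(1)[OF \<mu>] prob_space_imp_sigma_finite by blast
    let ?P = "PiM ?C ?N"
    have sets_pair: "sets (?N u \<Otimes>\<^sub>M ?N v) = sets (borel \<Otimes>\<^sub>M borel)" for u v
      by (intro sets_pair_measure_cong sample(2) \<mu>)
    have fstC: "fst u < p" if "u \<in> ?C" for u using that by (auto simp: coords_def)
    define ker where "ker u v z = kernel (fst u) (fst v) z * indicator (\<Gamma> (fst u) \<times> \<Gamma> (fst v)) z" for u v :: "nat \<times> nat" and z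
    have kerm: "ker u v \<in> borel_measurable (borel \<Otimes>\<^sub>M borel)" if "u \<in> ?C" "v \<in> ?C" for u v
      unfolding ker_def by (intro borel_measurable_kernel fstC that)
    have pairm: "(\<lambda>X. ker u v (X u, X v)) \<in> borel_measurable ?P" if "u \<in> ?C" "v \<in> ?C" for u v
    proof -
      have "(\<lambda>X. (X u, X v)) \<in> measurable ?P (?N u \<Otimes>\<^sub>M ?N v)"
        using that by (intro measurable_Pair measurable_component_singleton)
      moreover have "ker u v \<in> borel_measurable (?N u \<Otimes>\<^sub>M ?N v)"
        using kerm[OF that] unfolding measurable_cong_sets[OF sets_pair refl] .
      ultimately show ?thesis by (rule measurable_compose)
    qed
    define I where "I i j = (\<integral>\<^sup>+z\<in>\<Gamma> i \<times> \<Gamma> j. kernel i j z \<partial>(\<mu> i \<Otimes>\<^sub>M \<mu> j))" for i j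
    define H where "H X = (\<Sum>u\<in>?C. \<Sum>v\<in>?C - {u}. ker u v (X u, X v))" for X
    have Hm: "H \<in> borel_measurable ?P" unfolding H_def by (intro borel_measurable_sum pairm) auto
    have mean_pair: "(\<integral>\<^sup>+X. ker u v (X u, X v) \<partial>?P) = ennreal (1 / (r (fst u) * r (fst v))) * I (fst u) (fst v)"
      if "u \<in> ?C" "v \<in> ?C - {u}" for u v
    proof -
      have "(\<integral>\<^sup>+X. ker u v (X u, X v) \<partial>?P) = (\<integral>\<^sup>+z. ker u v z \<partial>(?N u \<Otimes>\<^sub>M ?N v))"
        using that kerm[of u v] by (intro nn_integral_PiM_pair) (auto simp: measurable_cong_sets[OF sets_pair refl])
      also have "\<dots> = ennreal (1 / (r (fst u) * r (fst v))) * I (fst u) (fst v)"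
        unfolding I_def ker_def[symmetric] using that by (intro nn_integral_sample_pair \<mu> fstC kerm) auto
      finally show ?thesis .
    qed
    have "(\<integral>\<^sup>+X. H X \<partial>?P) = (\<Sum>u\<in>?C. \<Sum>v\<in>?C - {u}. ennreal (1 / (r (fst u) * r (fst v))) * I (fst u) (fst v))"
    proof -
      have "(\<integral>\<^sup>+X. H X \<partial>?P) = (\<Sum>u\<in>?C. \<integral>\<^sup>+X. (\<Sum>v\<in>?C - {u}. ker u v (X u, X v)) \<partial>?P)"
        unfolding H_def by (intro nn_integral_sum borel_measurable_sum pairm) auto
      also have "\<dots> = (\<Sum>u\<in>?C. \<Sum>v\<in>?C - {u}. \<integral>\<^sup>+X. ker u v (X u, X v) \<partial>?P)"
        by (intro sum.cong refl nn_integral_sum pairm) auto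
      also have "\<dots> = (\<Sum>u\<in>?C. \<Sum>v\<in>?C - {u}. ennreal (1 / (r (fst u) * r (fst v))) * I (fst u) (fst v))"
        by (intro sum.cong refl mean_pair)
      finally show ?thesis .
    qed
    \<comment> \<open>The added terms with \<open>u = v\<close> are block means \<open>I i i\<close>
      and not values of the kernel on the diagonal, hence harmless; they complete the sum to full
      pairs of blocks, which reproduces the energy.\<close>
    also have "\<dots> \<le> (\<Sum>u\<in>?C. \<Sum>v\<in>?C. ennreal (1 / (r (fst u) * r (fst v))) * I (fst u) (fst v))"
      by (intro sum_mono sum_mono2) auto
    also have "\<dots> = (\<Sum>i<p. \<Sum>j<p. of_nat (n d i) * of_nat (n d j) * (ennreal (1 / (r i * r j)) * I i j))"
      unfolding sum_sum_coords by (simp add: mult.assoc)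
    also have "\<dots> \<le> (\<Sum>i<p. \<Sum>j<p. ennreal (\<kappa>\<^sup>2 * (m d)\<^sup>2) * I i j)"
    proof (intro sum_mono)
      fix i j assume "i \<in> {..<p}" "j \<in> {..<p}"
      then have ij: "i < p" "j < p" by auto
      have "real (n d i) \<le> \<kappa> * r i * m d" "real (n d j) \<le> \<kappa> * r j * m d"
        using elim(1) ij m_pos[of d] by (simp_all add: field_simps)
      then have "real (n d i) * real (n d j) \<le> (\<kappa> * r i * m d) * (\<kappa> * r j * m d)"
        by (intro mult_mono) (use r[OF ij(1)] \<kappa>(2) in auto)
      then have "real (n d i) * real (n d j) * (1 / (r i * r j)) \<le> \<kappa>\<^sup>2 * (m d)\<^sup>2"
        using r[OF ij(1)] r[OF ij(2)] by (simp add: field_simps power2_eq_square)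
      moreover have "of_nat (n d i) * of_nat (n d j) * ennreal (1 / (r i * r j)) = ennreal (real (n d i) * real (n d j) * (1 / (r i * r j)))"
        using r[OF ij(1)] r[OF ij(2)] by (simp only: ennreal_of_nat_eq_real_of_nat ennreal_mult[symmetric] of_nat_0_le_iff mult_nonneg_nonneg zero_le_divide_1_iff less_imp_le)
      ultimately show "of_nat (n d i) * of_nat (n d j) * (ennreal (1 / (r i * r j)) * I i j) \<le> ennreal (\<kappa>\<^sup>2 * (m d)\<^sup>2) * I i j"
        unfolding mult.assoc[symmetric] by (intro mult_right_mono) (simp_all add: ennreal_leI)
    qed
    also have "\<dots> = ennreal (\<kappa>\<^sup>2 * (m d)\<^sup>2) * energy \<mu>"
      by (simp add: energy_def I_def sum_distrib_left)
    also have "\<dots> = ennreal ((m d)\<^sup>2 * (\<kappa>\<^sup>2 * e))"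
      unfolding e(1) using e(2) by (simp add: ennreal_mult[symmetric] mult_ac)
    finally have HE: "(\<integral>\<^sup>+X. H X \<partial>?P) \<le> ennreal ((m d)\<^sup>2 * (\<kappa>\<^sup>2 * e))" .
    define S where "S X = (m d)\<^sup>2 * \<Lambda> * (\<Sum>g\<in>F. (dev d g X)\<^sup>2)" for X
    have comp: "(\<lambda>X. c g (X u)) \<in> borel_measurable ?P" if g: "g \<in> F" and u: "u \<in> ?C" for g u
    proof -
      have "c g \<in> borel_measurable (?N u)" using cm[OF g] unfolding measurable_cong_sets[OF sample(2)[OF \<mu>] refl] .
      from measurable_compose[OF measurable_component_singleton[OF u, of ?N] this] show ?thesis .
    qed
    have devm: "dev d g \<in> borel_measurable ?P" if g: "g \<in> F" for g
      unfolding dev_def using F(2)[OF g]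
      by (intro borel_measurable_times borel_measurable_const borel_measurable_sum comp g) (auto simp: coords_def)
    have dev2: "(\<integral>\<^sup>+X. ennreal ((dev d g X)\<^sup>2) \<partial>?P) \<le> ennreal ((r (fst g))\<^sup>2 * (B g)\<^sup>2 / real (n d (fst g)))" if g: "g \<in> F" for g
    proof -
      let ?i = "fst g" and ?k = "n d (fst g)"
      let ?J = "{?i} \<times> {..<?k}"
      have i: "?i < p" using F(2)[OF g] by simp
      have sub: "?J \<subseteq> ?C" using i by (auto simp: coords_def)
      have cmu: "c g \<in> borel_measurable (?N u)" for u
        using cm[OF g] unfolding measurable_cong_sets[OF sample(2)[OF \<mu>] refl] .
      have "(\<integral>\<^sup>+X. ennreal ((dev d g X)\<^sup>2) \<partial>?P) = (\<integral>\<^sup>+X. ennreal ((r ?i / real ?k)\<^sup>2) * ennreal ((\<Sum>u\<in>?J. c g (X u))\<^sup>2) \<partial>?P)"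
        unfolding dev_def power_mult_distrib by (simp add: ennreal_mult)
      also have "\<dots> = ennreal ((r ?i / real ?k)\<^sup>2) * (\<integral>\<^sup>+X. ennreal ((\<Sum>u\<in>?J. c g (X u))\<^sup>2) \<partial>?P)"
      proof (rule nn_integral_cmult)
        have "(\<lambda>X. (\<Sum>u\<in>?J. c g (X u))\<^sup>2) \<in> borel_measurable ?P"
          using sub by (intro borel_measurable_power borel_measurable_sum comp g) auto
        then show "(\<lambda>X. ennreal ((\<Sum>u\<in>?J. c g (X u))\<^sup>2)) \<in> borel_measurable ?P" by measurable
      qed
      also have "\<dots> \<le> ennreal ((r ?i / real ?k)\<^sup>2) * ennreal (real (card ?J) * (B g)\<^sup>2)"
        by (intro mult_left_mono second_moment_le sub cmu c0[OF g] cB[OF g]) auto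
      also have "\<dots> = ennreal ((r ?i / real ?k)\<^sup>2 * (real ?k * (B g)\<^sup>2))"
        by (simp add: ennreal_mult)
      also have "(r ?i / real ?k)\<^sup>2 * (real ?k * (B g)\<^sup>2) = (r ?i)\<^sup>2 * (B g)\<^sup>2 / real ?k"
        using n_pos[OF i, of d] by (simp add: power2_eq_square field_simps)
      finally show ?thesis .
    qed
    have SE: "(\<integral>\<^sup>+X. ennreal (S X) \<partial>?P) \<le> ennreal ((m d)\<^sup>2 * V d)"
    proof -
      have "(\<integral>\<^sup>+X. ennreal (S X) \<partial>?P) = (\<integral>\<^sup>+X. ennreal ((m d)\<^sup>2 * \<Lambda>) * (\<Sum>g\<in>F. ennreal ((dev d g X)\<^sup>2)) \<partial>?P)"
        unfolding S_def using \<Lambda> by (simp add: ennreal_mult sum_nonneg sum_ennreal)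
      also have "\<dots> = ennreal ((m d)\<^sup>2 * \<Lambda>) * (\<integral>\<^sup>+X. (\<Sum>g\<in>F. ennreal ((dev d g X)\<^sup>2)) \<partial>?P)"
        using devm by (intro nn_integral_cmult) measurable
      also have "(\<integral>\<^sup>+X. (\<Sum>g\<in>F. ennreal ((dev d g X)\<^sup>2)) \<partial>?P) = (\<Sum>g\<in>F. \<integral>\<^sup>+X. ennreal ((dev d g X)\<^sup>2) \<partial>?P)"
        using devm by (intro nn_integral_sum) measurable
      also have "\<dots> \<le> (\<Sum>g\<in>F. ennreal ((r (fst g))\<^sup>2 * (B g)\<^sup>2 / real (n d (fst g))))"
        by (intro sum_mono dev2)
      also have "\<dots> = ennreal (\<Sum>g\<in>F. (r (fst g))\<^sup>2 * (B g)\<^sup>2 / real (n d (fst g)))"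
        by (intro sum_ennreal) simp
      also have "ennreal ((m d)\<^sup>2 * \<Lambda>) * \<dots> = ennreal ((m d)\<^sup>2 * V d)"
        using \<Lambda> by (simp add: V_def ennreal_mult[symmetric] sum_nonneg mult.assoc)
      finally show ?thesis by (simp add: mult_left_mono)
    qed
    have Sm: "S \<in> borel_measurable ?P" unfolding S_def using devm by measurable
    have "(\<integral>\<^sup>+X. H X + ennreal (S X) \<partial>?P) = (\<integral>\<^sup>+X. H X \<partial>?P) + (\<integral>\<^sup>+X. ennreal (S X) \<partial>?P)"
      using Sm by (intro nn_integral_add Hm) measurable
    also have "\<dots> \<le> ennreal ((m d)\<^sup>2 * (\<kappa>\<^sup>2 * e)) + ennreal ((m d)\<^sup>2 * V d)"
      by (intro add_mono HE SE)
    also have "\<dots> = ennreal ((m d)\<^sup>2 * (\<kappa>\<^sup>2 * e + V d))"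
    proof -
      have "0 \<le> V d" unfolding V_def using \<Lambda> by (intro mult_nonneg_nonneg sum_nonneg) auto
      then show ?thesis using e(2) by (simp add: distrib_left ennreal_plus)
    qed
    also have "\<dots> < ennreal ((m d)\<^sup>2 * (e + \<delta>))"
    proof (rule ennreal_lessI)
      show "0 < (m d)\<^sup>2 * (e + \<delta>)" using m_pos[of d] e \<delta> by simp
      have "\<kappa>\<^sup>2 * e + V d < e + \<delta>" using \<kappa>(1) elim(2) \<delta> by simp
      then show "(m d)\<^sup>2 * (\<kappa>\<^sup>2 * e + V d) < (m d)\<^sup>2 * (e + \<delta>)"
        using m_pos[of d] by (intro mult_strict_left_mono) auto
    qed
    finally have tot: "(\<integral>\<^sup>+X. H X + ennreal (S X) \<partial>?P) < ennreal ((m d)\<^sup>2 * (e + \<delta>))" .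
    have "AE X in ?P. \<forall>u\<in>?C. X u \<in> \<Gamma> (fst u)"
      by (intro AE_finite_allI finite_coords AE_PiM_component sample \<mu> fstC)
    from P.exists_le_expectation[OF tot this] obtain X where X: "X \<in> space ?P" "\<forall>u\<in>?C. X u \<in> \<Gamma> (fst u)"
      and le: "H X + ennreal (S X) \<le> ennreal ((m d)\<^sup>2 * (e + \<delta>))" by blast
    have Xc: "X \<in> configs p \<Gamma> (n d)" using X by (auto simp: space_PiM PiE_iff)
    have "interaction (n d) X = H X"
      unfolding interaction_def H_def ker_def using X(2) by (intro sum.cong) auto
    then have 1: "interaction (n d) X \<le> ennreal ((m d)\<^sup>2 * (e + \<delta>))"
      using le by (metis add_increasing2 order_refl order_trans zero_le)
    have "ennreal (S X) \<le> ennreal ((m d)\<^sup>2 * (e + \<delta>))"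
      using le by (metis add_increasing order_refl order_trans zero_le)
    then have "S X \<le> (m d)\<^sup>2 * (e + \<delta>)" using e \<delta> by (subst (asm) ennreal_le_iff) auto
    then have "\<Lambda> * (\<Sum>g\<in>F. (dev d g X)\<^sup>2) \<le> e + \<delta>"
      using m_pos[of d] unfolding S_def mult.assoc by simp
    then have sm: "(\<Sum>g\<in>F. (dev d g X)\<^sup>2) \<le> \<epsilon>\<^sup>2 / 2"
    proof -
      have "\<Lambda> * (\<epsilon>\<^sup>2 / 2) = e + \<delta>" using \<epsilon> by (simp add: \<Lambda>_def)
      then have "\<Lambda> * (\<Sum>g\<in>F. (dev d g X)\<^sup>2) \<le> \<Lambda> * (\<epsilon>\<^sup>2 / 2)"
        using \<open>\<Lambda> * (\<Sum>g\<in>F. (dev d g X)\<^sup>2) \<le> e + \<delta>\<close> by simp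
      then show ?thesis using \<Lambda> by (simp only: mult_le_cancel_left_pos)
    qed
    have "deviation \<Gamma> \<mu> (j_map p r (n d) X) g < \<epsilon>" if g: "g \<in> F" for g
    proof -
      have "(dev d g X)\<^sup>2 \<le> (\<Sum>g\<in>F. (dev d g X)\<^sup>2)" by (rule member_le_sum[OF g _ F(1)]) simp
      also have "\<dots> < \<epsilon>\<^sup>2" by (rule le_less_trans[OF sm]) (use \<epsilon> in simp)
      finally have "\<bar>dev d g X\<bar>\<^sup>2 < \<epsilon>\<^sup>2" by simp
      then have "\<bar>dev d g X\<bar> < \<epsilon>" by (rule power2_less_imp_less) (use \<epsilon> in simp)
      then show ?thesis unfolding dev[OF g Xc] .
    qed
    then show ?case using Xc 1 by blast
  qed
qed

text \<open>The sampled configuration is unordered; sorting it within the blocks changes neither the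
  modulus of the weight nor the empirical measures.\<close>

lemma lower_configs:
  assumes \<mu>: "\<mu> \<in> M" and L: "weighted_energy p \<Gamma> Q \<mu> < ereal L"
    and G: "openin (M_topology p \<Gamma> r) G" "\<mu> \<in> G"
  shows "\<forall>\<^sub>F d in sequentially. \<exists>X\<in>ordered_configs p \<Gamma> (n d).
    j_map p r (n d) X \<in> G \<and> exp (- (L * (m d)\<^sup>2)) \<le> A_weight p Q (n d) X"
proof -
  have fin: "energy \<mu> \<noteq> \<infinity>" using L unfolding weighted_energy_eq[OF \<mu>] by auto
  then obtain e where e: "energy \<mu> = ennreal e" "0 \<le> e" by (cases "energy \<mu>") auto
  \<comment> \<open>Half of the slack pays for the sampling error in the interaction, the other half
    for the terms linear in \<open>m d\<close>.\<close>
  define \<delta> where "\<delta> = (2 * L + c0 - e) / 2"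
  have "(e - c0) / 2 < L" using L fin e unfolding weighted_energy_eq[OF \<mu>] by simp
  then have \<delta>: "0 < \<delta>" by (simp add: \<delta>_def)
  have Ld: "2 * L = e - c0 + 2 * \<delta>" by (simp add: \<delta>_def field_simps)
  obtain F \<epsilon> where F: "finite F" "\<forall>g\<in>F. fst g < p \<and> continuous_on (\<Gamma> (fst g)) (snd g)" "0 < \<epsilon>"
    "\<forall>\<nu>\<in>M. (\<forall>g\<in>F. deviation \<Gamma> \<mu> \<nu> g < \<epsilon>) \<longrightarrow> \<nu> \<in> G"
    using M_topology_nbhd[OF G] by blast
  have "\<forall>\<^sub>F d in sequentially. \<exists>X\<in>configs p \<Gamma> (n d). interaction (n d) X \<le> ennreal ((m d)\<^sup>2 * (e + \<delta>)) \<and>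
     (\<forall>g\<in>F. deviation \<Gamma> \<mu> (j_map p r (n d) X) g < \<epsilon>)"
    by (rule exists_good_sample[OF \<mu> e F(1) _ F(3) \<delta>]) (use F(2) in blast)
  then show ?thesis using eventually_m_ge[of "(c0 + 4 * q0) / \<delta>"]
  proof eventually_elim
    case (elim d)
    from elim(1) obtain X where X: "X \<in> configs p \<Gamma> (n d)" "interaction (n d) X \<le> ennreal ((m d)\<^sup>2 * (e + \<delta>))"
     "\<forall>g\<in>F. deviation \<Gamma> \<mu> (j_map p r (n d) X) g < \<epsilon>" by blast
    have "j_map p r (n d) X \<in> M" using X(1) by (rule j_map_in_M_space) (use closed_\<Gamma> r n_pos in auto)
    then have jG: "j_map p r (n d) X \<in> G" using F(4) X(3) by blast
    obtain \<pi> where \<pi>: "\<pi> \<in> block_perms p (n d)" "rearrange p (n d) \<pi> X \<in> ordered_configs p \<Gamma> (n d)"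
      using exists_rearrange_ordered[OF X(1)] \<Gamma>_less less_imp_le by metis
    let ?Y = "rearrange p (n d) \<pi> X"
    have "(c0 + 4 * q0) * m d \<le> (m d * \<delta>) * m d"
      using elim(2) \<delta> m_pos[of d] by (intro mult_right_mono) (auto simp: field_simps)
    then have "- (2 * L * (m d)\<^sup>2) \<le> (m d)\<^sup>2 * c0 - (m d)\<^sup>2 * (e + \<delta>) - (c0 + 4 * q0) * m d"
      unfolding Ld by (simp add: power2_eq_square algebra_simps)
    then have "exp (- (2 * L * (m d)\<^sup>2)) \<le> exp ((m d)\<^sup>2 * c0 - (m d)\<^sup>2 * (e + \<delta>) - (c0 + 4 * q0) * m d)" by simp
    also have "\<dots> \<le> (A_weight p Q (n d) X)\<^sup>2"
      by (rule A_weight_square_ge[OF X(1,2)]) (use e(2) \<delta> in simp)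
    also have "\<dots> = (A_weight p Q (n d) ?Y)\<^sup>2"
      using abs_A_weight_rearrange[OF \<pi>(1), of Q X] by (metis power2_abs)
    finally have "(exp (- (L * (m d)\<^sup>2)))\<^sup>2 \<le> (A_weight p Q (n d) ?Y)\<^sup>2"
      by (simp add: exp_double[symmetric] mult.assoc)
    then have "exp (- (L * (m d)\<^sup>2)) \<le> A_weight p Q (n d) ?Y"
      by (rule power2_le_imp_le) (rule A_weight_nonneg[OF \<pi>(2)])
    then show ?case using \<pi>(2) jG j_map_rearrange[OF \<pi>(1), of r X] by (intro bexI[of _ ?Y]) auto
  qed
qed

end

section \<open>Asymptotic bounds for the mass\<close>

text \<open>Induction over the set \<open>I\<close> of coordinates that have been released, the
  others being held at their values in \<open>X\<close>. The hypothesis \<open>step\<close>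
  restricts only the coordinate \<open>u\<close> itself, so it applies however the released
  coordinates have moved, and each release costs one factor \<open>K\<close>.\<close>

lemma (in product_sigma_finite) iterated_local_bound:
  fixes F :: "('i \<Rightarrow> 'a) \<Rightarrow> ennreal"
  assumes C: "finite C" and F: "F \<in> borel_measurable (PiM C M)" and X: "X \<in> space (PiM C M)"
    and N: "\<And>u. u \<in> C \<Longrightarrow> N u \<in> sets (M u)"
    and step: "\<And>u Y. u \<in> C \<Longrightarrow> Y \<in> space (PiM C M) \<Longrightarrow> Y u = X u \<Longrightarrow>
      F Y \<le> K * (\<integral>\<^sup>+y. F (Y(u := y)) * indicator (N u) y \<partial>M u)"
  shows "F X \<le> K ^ card C * (\<integral>\<^sup>+Y. F Y * (\<Prod>u\<in>C. indicator (N u) (Y u)) \<partial>PiM C M)"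
proof -
  define glue where "glue I Y = (\<lambda>u. if u \<in> I then Y u else X u)" for I and Y :: "'i \<Rightarrow> 'a"
  have glue_m: "glue I \<in> measurable (PiM I M) (PiM C M)" if "I \<subseteq> C" for I
  proof (rule measurable_PiM_single')
    fix u assume u: "u \<in> C"
    show "(\<lambda>Y. glue I Y u) \<in> measurable (PiM I M) (M u)"
    proof (cases "u \<in> I")
      case True
      then show ?thesis by (simp add: glue_def measurable_component_singleton)
    next
      case False
      then show ?thesis using X u by (simp add: glue_def space_PiM PiE_iff)
    qed
  next
    show "glue I \<in> space (PiM I M) \<rightarrow> (\<Pi>\<^sub>E u\<in>C. space (M u))"
      using X that by (auto simp: glue_def space_PiM PiE_iff extensional_def)
  qed
  have ind_m: "(\<lambda>Y. \<Prod>u\<in>I. indicator (N u) (Y u) :: ennreal) \<in> borel_measurable (PiM I M)" if "I \<subseteq> C" for I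
  proof (rule borel_measurable_prod_ennreal)
    fix u assume u: "u \<in> I"
    then have "indicator (N u) \<in> borel_measurable (M u)" using N that by (intro borel_measurable_indicator) auto
    from measurable_compose[OF measurable_component_singleton[OF u, of M] this]
    show "(\<lambda>Y. indicator (N u) (Y u) :: ennreal) \<in> borel_measurable (PiM I M)" .
  qed
  have f_m: "(\<lambda>Y. F (glue I Y) * (\<Prod>u\<in>I. indicator (N u) (Y u))) \<in> borel_measurable (PiM I M)" if "I \<subseteq> C" for I
    by (intro borel_measurable_times_ennreal measurable_compose[OF glue_m F] ind_m that)
  have "F X \<le> K ^ card I * (\<integral>\<^sup>+Y. F (glue I Y) * (\<Prod>u\<in>I. indicator (N u) (Y u)) \<partial>PiM I M)"
    if "finite I" "I \<subseteq> C" for I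
    using that
  proof (induction I)
    case empty
    have "glue {} Y = X" for Y by (simp add: glue_def)
    then show ?case by (simp add: PiM_empty)
  next
    case (insert u I)
    then have I: "I \<subseteq> C" "u \<in> C" by auto
    note fin = insert.hyps
    interpret I: finite_product_sigma_finite M I by standard (rule fin)
    let ?h = "\<lambda>Y. \<Prod>v\<in>I. indicator (N v) (Y v) :: ennreal"
    have upd: "glue (insert u I) (Y(u := y)) = (glue I Y)(u := y)" for Y y
      by (auto simp: glue_def)
    have prod_upd: "(\<Prod>v\<in>insert u I. indicator (N v) ((Y(u := y)) v)) = indicator (N u) y * ?h Y" for Y y
    proof -
      have "(\<Prod>v\<in>I. indicator (N v) ((Y(u := y)) v)) = ?h Y"
        using fin by (intro prod.cong) auto
      then show ?thesis using fin by simp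
    qed
    have m2: "(\<lambda>y. F ((glue I Y)(u := y)) * indicator (N u) y) \<in> borel_measurable (M u)" if Y: "Y \<in> space (PiM I M)" for Y
    proof -
      have gl: "glue I Y \<in> space (PiM C M)" using measurable_space[OF glue_m[OF I(1)] Y] .
      have "(\<lambda>y. (glue I Y)(u := y)) \<in> measurable (M u) (PiM C M)"
      proof (rule measurable_PiM_single')
        fix v assume v: "v \<in> C"
        show "(\<lambda>y. ((glue I Y)(u := y)) v) \<in> measurable (M u) (M v)"
          using gl v by (cases "v = u") (auto simp: space_PiM PiE_iff)
      next
        show "(\<lambda>y. (glue I Y)(u := y)) \<in> space (M u) \<rightarrow> (\<Pi>\<^sub>E v\<in>C. space (M v))"
          using gl I(2) by (auto simp: space_PiM PiE_iff extensional_def)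
      qed
      then show ?thesis using N[OF I(2)]
        by (intro borel_measurable_times_ennreal measurable_compose[OF _ F] borel_measurable_indicator)
    qed
    have "F X \<le> K ^ card I * (\<integral>\<^sup>+Y. F (glue I Y) * ?h Y \<partial>PiM I M)" by (rule insert.IH[OF I(1)])
    also have "(\<integral>\<^sup>+Y. F (glue I Y) * ?h Y \<partial>PiM I M)
        \<le> (\<integral>\<^sup>+Y. K * (\<integral>\<^sup>+y. F ((glue I Y)(u := y)) * indicator (N u) y * ?h Y \<partial>M u) \<partial>PiM I M)"
    proof (rule nn_integral_mono)
      fix Y assume Y: "Y \<in> space (PiM I M)"
      have gl: "glue I Y \<in> space (PiM C M)" using measurable_space[OF glue_m[OF I(1)] Y] .
      \<comment> \<open>As \<open>u\<close> has not been released yet, \<open>glue I Y\<close>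
        agrees with \<open>X\<close> at \<open>u\<close>, which is the premise of
        \<open>step\<close>.\<close>
      have "F (glue I Y) \<le> K * (\<integral>\<^sup>+y. F ((glue I Y)(u := y)) * indicator (N u) y \<partial>M u)"
        by (rule step[OF I(2) gl]) (use fin in \<open>simp add: glue_def\<close>)
      then have "F (glue I Y) * ?h Y \<le> K * (\<integral>\<^sup>+y. F ((glue I Y)(u := y)) * indicator (N u) y \<partial>M u) * ?h Y"
        by (rule mult_right_mono) simp
      then show "F (glue I Y) * ?h Y \<le> K * (\<integral>\<^sup>+y. F ((glue I Y)(u := y)) * indicator (N u) y * ?h Y \<partial>M u)"
        unfolding nn_integral_multc[OF m2[OF Y]] by (simp add: mult.assoc)
    qed
    also have "\<dots> = (\<integral>\<^sup>+Y. K * (\<integral>\<^sup>+y. F (glue (insert u I) (Y(u := y))) * (\<Prod>v\<in>insert u I. indicator (N v) ((Y(u := y)) v)) \<partial>M u) \<partial>PiM I M)"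
      unfolding upd prod_upd by (simp add: mult.assoc)
    also have "\<dots> = K * (\<integral>\<^sup>+Y. (\<integral>\<^sup>+y. F (glue (insert u I) (Y(u := y))) * (\<Prod>v\<in>insert u I. indicator (N v) ((Y(u := y)) v)) \<partial>M u) \<partial>PiM I M)"
    proof (rule nn_integral_cmult)
      note f = f_m[OF insert.prems]
      have "(\<lambda>(Y, y). F (glue (insert u I) (Y(u := y))) * (\<Prod>v\<in>insert u I. indicator (N v) ((Y(u := y)) v)))
          \<in> borel_measurable (PiM I M \<Otimes>\<^sub>M M u)"
        using measurable_compose[OF measurable_add_dim f] by (simp add: case_prod_unfold)
      then show "(\<lambda>Y. \<integral>\<^sup>+y. F (glue (insert u I) (Y(u := y))) * (\<Prod>v\<in>insert u I. indicator (N v) ((Y(u := y)) v)) \<partial>M u) \<in> borel_measurable (PiM I M)"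
        by (rule sigma_finite_measure.borel_measurable_nn_integral[OF sigma_finite_measures])
    qed
    also have "(\<integral>\<^sup>+Y. (\<integral>\<^sup>+y. F (glue (insert u I) (Y(u := y))) * (\<Prod>v\<in>insert u I. indicator (N v) ((Y(u := y)) v)) \<partial>M u) \<partial>PiM I M)
       = (\<integral>\<^sup>+Y. F (glue (insert u I) Y) * (\<Prod>v\<in>insert u I. indicator (N v) (Y v)) \<partial>PiM (insert u I) M)"
      by (rule product_nn_integral_insert[symmetric, OF fin f_m[OF insert.prems]])
    finally show ?case using fin by (simp add: mult_left_mono mult.assoc mult.commute[of K] mult.left_commute)
  qed
  from this[OF C order_refl]
  have "F X \<le> K ^ card C * (\<integral>\<^sup>+Y. F (glue C Y) * (\<Prod>u\<in>C. indicator (N u) (Y u)) \<partial>PiM C M)" .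
  also have "(\<integral>\<^sup>+Y. F (glue C Y) * (\<Prod>u\<in>C. indicator (N u) (Y u)) \<partial>PiM C M)
      = (\<integral>\<^sup>+Y. F Y * (\<Prod>u\<in>C. indicator (N u) (Y u)) \<partial>PiM C M)"
  proof (rule nn_integral_cong)
    fix Y assume "Y \<in> space (PiM C M)"
    then have "glue C Y = Y" using X by (auto simp: glue_def space_PiM PiE_iff extensional_def)
    then show "F (glue C Y) * (\<Prod>u\<in>C. indicator (N u) (Y u)) = F Y * (\<Prod>u\<in>C. indicator (N u) (Y u))" by simp
  qed
  finally show ?thesis .
qed

text \<open>It is enough to consider boxes. The preimage of a box is the box with its factors
  permuted by \<open>inv \<pi>\<close>, and this has the same measure because only coordinates with
  equal measures are exchanged.\<close>

lemma (in product_sigma_finite) distr_PiM_permute: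
  assumes C: "finite C" and \<pi>: "\<pi> permutes C" and M: "\<And>u. u \<in> C \<Longrightarrow> M (\<pi> u) = M u"
  shows "distr (PiM C M) (PiM C M) (\<lambda>X. \<lambda>u\<in>C. X (\<pi> u)) = PiM C M"
proof (rule PiM_eqI[OF C])
  let ?f = "\<lambda>X. \<lambda>u\<in>C. X (\<pi> u)"
  have \<pi>C: "\<pi> u \<in> C" if "u \<in> C" for u using permutes_in_image[OF \<pi>] that by simp
  have f: "?f \<in> measurable (PiM C M) (PiM C M)"
  proof (rule measurable_restrict)
    fix u assume "u \<in> C"
    then show "(\<lambda>X. X (\<pi> u)) \<in> measurable (PiM C M) (M u)"
      using measurable_component_singleton[OF \<pi>C, of u M] M by simp
  qed
  fix A assume A: "\<And>u. u \<in> C \<Longrightarrow> A u \<in> sets (M u)"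
  have inv: "inv \<pi> u \<in> C" "M (inv \<pi> u) = M u" if "u \<in> C" for u
  proof -
    show 1: "inv \<pi> u \<in> C" using permutes_in_image[OF permutes_inv[OF \<pi>]] that by simp
    show "M (inv \<pi> u) = M u" using M[OF 1] permutes_inverses(1)[OF \<pi>] by simp
  qed
  have eq: "?f -` Pi\<^sub>E C A \<inter> space (PiM C M) = Pi\<^sub>E C (\<lambda>u. A (inv \<pi> u))"
  proof (intro equalityI subsetI)
    fix X assume X: "X \<in> ?f -` Pi\<^sub>E C A \<inter> space (PiM C M)"
    have "X u \<in> A (inv \<pi> u)" if "u \<in> C" for u
    proof -
      have "?f X (inv \<pi> u) \<in> A (inv \<pi> u)" using X inv(1)[OF that] by (auto simp: PiE_iff)
      then show ?thesis using inv(1)[OF that] permutes_inverses(1)[OF \<pi>] by simp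
    qed
    then show "X \<in> Pi\<^sub>E C (\<lambda>u. A (inv \<pi> u))" using X by (auto simp: space_PiM PiE_iff)
  next
    fix X assume X: "X \<in> Pi\<^sub>E C (\<lambda>u. A (inv \<pi> u))"
    have "X (\<pi> u) \<in> A u" if "u \<in> C" for u
      using PiE_mem[OF X \<pi>C[OF that]] permutes_inverses(2)[OF \<pi>] by simp
    moreover have "X u \<in> space (M u)" if "u \<in> C" for u
      using PiE_mem[OF X that] sets.sets_into_space[OF A[OF inv(1)[OF that]]] inv(2)[OF that] by auto
    ultimately show "X \<in> ?f -` Pi\<^sub>E C A \<inter> space (PiM C M)"
      using X by (auto simp: space_PiM PiE_iff)
  qed
  have "emeasure (distr (PiM C M) (PiM C M) ?f) (Pi\<^sub>E C A) = emeasure (PiM C M) (Pi\<^sub>E C (\<lambda>u. A (inv \<pi> u)))"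
    unfolding eq[symmetric] by (rule emeasure_distr[OF f sets_PiM_I_finite[OF C A]])
  also have "\<dots> = (\<Prod>u\<in>C. emeasure (M u) (A (inv \<pi> u)))"
    by (rule emeasure_PiM[OF C]) (use A inv in metis)
  also have "\<dots> = (\<Prod>u\<in>C. emeasure (M (\<pi> u)) (A (inv \<pi> (\<pi> u))))"
    by (rule prod.reindex_bij_betw[OF permutes_imp_bij[OF \<pi>], symmetric])
  also have "\<dots> = (\<Prod>u\<in>C. emeasure (M u) (A u))"
    by (intro prod.cong refl) (simp add: M permutes_inverses(2)[OF \<pi>])
  finally show "emeasure (distr (PiM C M) (PiM C M) ?f) (Pi\<^sub>E C A) = (\<Prod>u\<in>C. emeasure (M u) (A u))" .
qed simp

section \<open>The weight without fields as a polynomial in each coordinate\<close>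

text \<open>The modulus of the weight without its field factor; the square root undoes the double
  count of pairs.\<close>

definition gap_product :: "nat \<Rightarrow> (nat \<Rightarrow> nat) \<Rightarrow> (nat \<times> nat \<Rightarrow> real) \<Rightarrow> real" where
  "gap_product p n X = sqrt (\<Prod>u\<in>coords p n. \<Prod>v\<in>coords p n. gap X u v)"

lemma gap_nonneg: "0 \<le> gap X u v"
  by (simp add: gap_def)

lemma gap_product_nonneg: "0 \<le> gap_product p n X"
  by (simp add: gap_product_def prod_nonneg gap_nonneg)

lemma abs_A_weight:
  "\<bar>A_weight p Q n X\<bar> = gap_product p n X * exp (- 2 * real (mi_norm p n) * (\<Sum>u\<in>coords p n. Q (fst u) (X u)))"
    (is "_ = _ * exp ?s")
proof -
  have "\<bar>A_weight p Q n X\<bar> = sqrt ((A_weight p Q n X)\<^sup>2)" by simp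
  also have "\<dots> = gap_product p n X * sqrt (exp (2 * ?s))"
    unfolding A_weight_square gap_product_def by (simp add: real_sqrt_mult algebra_simps)
  also have "sqrt (exp (2 * ?s)) = exp ?s" unfolding exp_double by simp
  finally show ?thesis .
qed

text \<open>Each gap with \<open>u\<close> occurs in both orders, so the square root leaves it once.
  The gaps among the other points do not depend on \<open>y\<close> and form the constant factor,
  and every other point contributes at most 2 to the degree.\<close>

lemma gap_product_update_eq_poly:
  assumes u: "u \<in> coords p n"
  shows "\<exists>P :: complex poly. degree P \<le> 2 * mi_norm p n \<and>
    (\<forall>y. gap_product p n (X(u := y)) = cmod (poly P (of_real y)))"
proof -
  let ?C = "coords p n"
  let ?C' = "?C - {u}"
  define R where "R = (\<Prod>a\<in>?C'. \<Prod>b\<in>?C'. gap X a b)"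
  define e where "e v = pair_mult (fst u) (fst v)" for v :: "nat \<times> nat"
  define P where "P = smult (complex_of_real (sqrt R)) (\<Prod>v\<in>?C'. [:- complex_of_real (X v), 1:] ^ e v)"
  have fin: "finite ?C'" by simp
  have R: "0 \<le> R" by (simp add: R_def prod_nonneg gap_nonneg)
  have "gap_product p n (X(u := y)) = cmod (poly P (of_real y))" for y
  proof -
    let ?X = "X(u := y)"
    have g: "gap ?X u v = \<bar>y - X v\<bar> ^ e v" if "v \<in> ?C'" for v
      using that by (auto simp: gap_def e_def)
    have guu: "gap ?X u u = 1" by (simp add: gap_def)
    have pb: "(\<Prod>v\<in>?C. gap ?X a v) = gap ?X a u * (\<Prod>v\<in>?C'. gap ?X a v)" for a
      by (rule prod.remove[OF finite_coords u])
    have "(\<Prod>a\<in>?C. \<Prod>b\<in>?C. gap ?X a b) = (\<Prod>b\<in>?C. gap ?X u b) * (\<Prod>a\<in>?C'. \<Prod>b\<in>?C. gap ?X a b)"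
      by (rule prod.remove[OF finite_coords u])
    also have "\<dots> = (gap ?X u u * (\<Prod>b\<in>?C'. gap ?X u b)) * ((\<Prod>a\<in>?C'. gap ?X a u) * (\<Prod>a\<in>?C'. \<Prod>b\<in>?C'. gap ?X a b))"
      unfolding pb by (simp add: prod.distrib)
    also have "(\<Prod>a\<in>?C'. gap ?X a u) = (\<Prod>b\<in>?C'. gap ?X u b)" by (simp add: gap_commute)
    also have "(\<Prod>b\<in>?C'. gap ?X u b) = (\<Prod>v\<in>?C'. \<bar>y - X v\<bar> ^ e v)" by (intro prod.cong refl g)
    also have "(\<Prod>a\<in>?C'. \<Prod>b\<in>?C'. gap ?X a b) = R"
      unfolding R_def by (intro prod.cong refl) (auto simp: gap_def)
    finally have "(\<Prod>a\<in>?C. \<Prod>b\<in>?C. gap ?X a b) = R * (\<Prod>v\<in>?C'. \<bar>y - X v\<bar> ^ e v)\<^sup>2"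
      unfolding guu power2_eq_square by (simp only: mult_1 mult_ac)
    then have "gap_product p n ?X = sqrt R * (\<Prod>v\<in>?C'. \<bar>y - X v\<bar> ^ e v)"
      by (simp add: gap_product_def real_sqrt_mult prod_nonneg)
    also have "(\<Prod>v\<in>?C'. \<bar>y - X v\<bar> ^ e v) = cmod (\<Prod>v\<in>?C'. (of_real y - of_real (X v)) ^ e v)"
      by (simp add: norm_power flip: prod_norm of_real_diff)
    also have "sqrt R * \<dots> = cmod (poly P (of_real y))"
      using R by (simp add: P_def poly_prod poly_power norm_mult)
    finally show ?thesis .
  qed
  moreover have "degree P \<le> 2 * mi_norm p n"
  proof -
    have "degree P \<le> degree (\<Prod>v\<in>?C'. [:- complex_of_real (X v), 1:] ^ e v)"
      unfolding P_def by (rule degree_smult_le)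
    also have "\<dots> \<le> (\<Sum>v\<in>?C'. degree ([:- complex_of_real (X v), 1:] ^ e v))"
      using degree_prod_sum_le[OF fin, of "\<lambda>v. [:- complex_of_real (X v), 1:] ^ e v"] unfolding o_def .
    also have "\<dots> \<le> (\<Sum>v\<in>?C'. 2)"
    proof (rule sum_mono)
      fix v
      have "degree ([:- complex_of_real (X v), 1:] ^ e v) \<le> degree [:- complex_of_real (X v), 1:] * e v"
        by (rule degree_power_le)
      also have "\<dots> \<le> 2" by (simp add: e_def pair_mult_def)
      finally show "degree ([:- complex_of_real (X v), 1:] ^ e v) \<le> 2" .
    qed
    also have "\<dots> \<le> (\<Sum>v\<in>?C. 2)" by (intro sum_mono2) auto
    finally show ?thesis by simp
  qed
  ultimately show ?thesis by blast
qed

lemma continuous_on_gap_product: "continuous_on UNIV (gap_product p n)"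
proof -
  have "continuous_on UNIV (\<lambda>X. gap X u v)" for u v
  proof (cases "u = v")
    case False
    then show ?thesis unfolding gap_def by (simp add: continuous_intros)
  qed (simp add: gap_def)
  then show ?thesis unfolding gap_product_def by (intro continuous_intros)
qed

section \<open>The reference measure on configurations\<close>

locale BM_system = multi_index_sequence +
  fixes \<tau> :: "nat \<Rightarrow> real measure"
  assumes sets_\<tau>: "i < p \<Longrightarrow> sets (\<tau> i) = sets (restrict_space borel (\<Gamma> i))"
    and finite_\<tau>: "i < p \<Longrightarrow> finite_measure (\<tau> i)"
    and BM: "i < p \<Longrightarrow> strong_weighted_BM (complex_of_real ` \<Gamma> i) (distr (\<tau> i) borel complex_of_real)"
begin

text \<open>The null measure fills in at indices outside of the blocks, because
  \<open>product_sigma_finite\<close> asks for a sigma-finite measure at every index.\<close>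

definition T :: "nat \<times> nat \<Rightarrow> real measure" where
  "T u = (if fst u < p then \<tau> (fst u) else null_measure borel)"

abbreviation "tau d \<equiv> PiM (coords p (n d)) T"

lemma finite_T: "finite_measure (T u)"
  unfolding T_def using finite_\<tau> by (auto intro: finite_measureI)

sublocale T: product_sigma_finite T
  unfolding product_sigma_finite_def
  using finite_T finite_measure.axioms(1) by blast

lemma tau_prod_eq: "tau_prod p \<tau> (n d) = tau d"
  unfolding tau_prod_def by (rule PiM_cong) (auto simp: T_def coords_def)

lemma coords_less: "u \<in> coords p (n d) \<Longrightarrow> fst u < p"
  by (auto simp: coords_def)

lemma sets_T: "u \<in> coords p (n d) \<Longrightarrow> sets (T u) = sets (restrict_space borel (\<Gamma> (fst u)))"
  using coords_less sets_\<tau> by (simp add: T_def)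

lemma space_T: "u \<in> coords p (n d) \<Longrightarrow> space (T u) = \<Gamma> (fst u)"
  using sets_eq_imp_space_eq[OF sets_T] by (simp add: space_restrict_space)

lemma space_tau: "space (tau d) = configs p \<Gamma> (n d)"
  by (simp add: space_PiM space_T cong: PiE_cong)

lemma finite_measure_tau: "finite_measure (tau d)"
proof (rule finite_measureI)
  have "emeasure (tau d) (space (tau d)) = (\<Prod>u\<in>coords p (n d). emeasure (T u) (space (T u)))"
    unfolding space_PiM by (rule T.emeasure_PiM) auto
  also have "\<dots> < \<infinity>"
    by (simp add: finite_measure.emeasure_eq_measure[OF finite_T] prod_ennreal)
  finally show "emeasure (tau d) (space (tau d)) \<noteq> \<infinity>" by simp
qed

lemma borel_measurable_tau_continuous:
  fixes f :: "_ \<Rightarrow> real"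
  assumes "continuous_on UNIV f"
  shows "f \<in> borel_measurable (tau d)"
proof (rule borel_measurableI)
  fix S :: "real set" assume "open S"
  then have "f -` S \<in> sets borel" using assms by (auto simp: continuous_on_open_vimage intro: borel_open)
  from open_Int_PiE_in_sets_PiM[OF finite_coords this sets_T]
  show "f -` S \<inter> space (tau d) \<in> sets (tau d)" unfolding space_tau .
qed

lemma sets_ordered: "ordered_configs p \<Gamma> (n d) \<in> sets (tau d)"
proof -
  define U where "U = (\<Inter>u\<in>coords p (n d). \<Inter>v\<in>coords p (n d).
    {X :: nat \<times> nat \<Rightarrow> real. fst u < fst v \<or> (fst u = fst v \<and> snd u \<le> snd v) \<longrightarrow> X u \<le> X v})"
  have "closed {X :: nat \<times> nat \<Rightarrow> real. P \<longrightarrow> X u \<le> X v}" for P u v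
    by (cases P) (auto intro!: closed_Collect_le continuous_intros)
  then have "closed U" unfolding U_def by (intro closed_INT ballI)
  then have "U \<in> sets borel" by simp
  from open_Int_PiE_in_sets_PiM[OF finite_coords this sets_T]
  have "U \<inter> configs p \<Gamma> (n d) \<in> sets (tau d)" .
  moreover have "ordered_configs p \<Gamma> (n d) = U \<inter> configs p \<Gamma> (n d)"
    unfolding ordered_configs_def U_def case_prod_unfold prod.collapse by blast
  ultimately show ?thesis by simp
qed

lemma measurable_j_map: "j_map p r (n d) \<in> measurable (tau d) (borel_of (M_topology p \<Gamma> r))"
  unfolding borel_of_def
proof (rule measurable_measure_of)
  show "{U. openin (M_topology p \<Gamma> r) U} \<subseteq> Pow (topspace (M_topology p \<Gamma> r))"
    using openin_subset by blast
  show "j_map p r (n d) \<in> space (tau d) \<rightarrow> topspace (M_topology p \<Gamma> r)"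
    unfolding space_tau using closed_\<Gamma> r n_pos by (auto intro: j_map_in_M_space)
  fix G assume "G \<in> {U. openin (M_topology p \<Gamma> r) U}"
  then have "openin (top_of_set (configs p \<Gamma> (n d))) {X \<in> topspace (top_of_set (configs p \<Gamma> (n d))). j_map p r (n d) X \<in> G}"
    by (intro openin_continuous_map_preimage[OF continuous_map_j_map]) (use closed_\<Gamma> r n_pos in auto)
  then obtain U where U: "open U" "{X \<in> topspace (top_of_set (configs p \<Gamma> (n d))). j_map p r (n d) X \<in> G} = configs p \<Gamma> (n d) \<inter> U"
    unfolding openin_open by blast
  have "j_map p r (n d) -` G \<inter> space (tau d) = U \<inter> configs p \<Gamma> (n d)"
    using U(2) unfolding space_tau by auto
  then show "j_map p r (n d) -` G \<inter> space (tau d) \<in> sets (tau d)"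
    using open_Int_PiE_in_sets_PiM[OF finite_coords borel_open[OF U(1)] sets_T] by simp
qed

lemma space_borel_of: "space (borel_of X) = topspace X"
  unfolding borel_of_def by (rule space_measure_of) (use openin_subset in blast)

lemma sets_borel_of_open: "openin X U \<Longrightarrow> U \<in> sets (borel_of X)"
  unfolding borel_of_def using openin_subset by (subst sets_measure_of) (auto intro: sigma_sets.Basic)

lemma borel_measurable_external_field:
  "(\<lambda>X. \<Sum>u\<in>coords p (n d). Q (fst u) (X u)) \<in> borel_measurable (tau d)"
proof (rule borel_measurable_sum)
  fix u assume u: "u \<in> coords p (n d)"
  have "Q (fst u) \<in> borel_measurable (restrict_space borel (\<Gamma> (fst u)))"
    by (intro borel_measurable_continuous_on_restrict Q coords_less[OF u])
  then have "Q (fst u) \<in> borel_measurable (T u)" unfolding measurable_cong_sets[OF sets_T[OF u] refl] .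
  from measurable_compose[OF measurable_component_singleton[OF u, of T] this]
  show "(\<lambda>X. Q (fst u) (X u)) \<in> borel_measurable (tau d)" .
qed

lemma borel_measurable_abs_A_weight: "(\<lambda>X. \<bar>A_weight p Q (n d) X\<bar>) \<in> borel_measurable (tau d)"
  unfolding abs_A_weight
  by (intro borel_measurable_times borel_measurable_tau_continuous continuous_on_gap_product
      borel_measurable_exp borel_measurable_external_field borel_measurable_const measurable_compose[OF _ borel_measurable_exp])

text \<open>The iterated estimate with \<open>K\<close> a local factor for polynomials of degree 2n.
  The windows are intersected with the intervals because the measurable sets of \<open>T u\<close>
  are subsets of them.\<close>

lemma gap_product_le_integral:
  assumes K: "\<And>i (P :: complex poly) x. i < p \<Longrightarrow> degree P \<le> 2 * mi_norm p (n d) \<Longrightarrow> x \<in> \<Gamma> i \<Longrightarrow>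
      ennreal (cmod (poly P (of_real x))) \<le> K * (\<integral>\<^sup>+y. ennreal (cmod (poly P (of_real y))) * indicator {x - h..x + h} y \<partial>\<tau> i)"
    and X: "X \<in> configs p \<Gamma> (n d)"
  shows "ennreal (gap_product p (n d) X) \<le> K ^ mi_norm p (n d) *
    (\<integral>\<^sup>+Y. ennreal (gap_product p (n d) Y) * (\<Prod>u\<in>coords p (n d). indicator ({X u - h..X u + h} \<inter> \<Gamma> (fst u)) (Y u)) \<partial>tau d)"
  unfolding card_coords[of p "n d", symmetric]
proof (rule T.iterated_local_bound[OF finite_coords])
  show "X \<in> space (tau d)" using X by (simp add: space_tau)
  show "(\<lambda>Y. ennreal (gap_product p (n d) Y)) \<in> borel_measurable (tau d)"
    using borel_measurable_tau_continuous[OF continuous_on_gap_product] by measurable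
  fix u assume u: "u \<in> coords p (n d)"
  show "{X u - h..X u + h} \<inter> \<Gamma> (fst u) \<in> sets (T u)"
    unfolding sets_T[OF u] using closed_\<Gamma>[OF coords_less[OF u]] by (auto simp: sets_restrict_space)
  fix Y assume Y: "Y \<in> space (tau d)" and eq: "Y u = X u"
  obtain P :: "complex poly" where P: "degree P \<le> 2 * mi_norm p (n d)"
    "\<And>y. gap_product p (n d) (Y(u := y)) = cmod (poly P (of_real y))"
    using gap_product_update_eq_poly[OF u, of Y] by blast
  have x: "X u \<in> \<Gamma> (fst u)" using in_configs_D[OF X u] by simp
  have "Y(u := X u) = Y" using eq by (metis fun_upd_triv)
  then have "gap_product p (n d) Y = cmod (poly P (of_real (X u)))" using P(2)[of "X u"] by simp
  then have "ennreal (gap_product p (n d) Y) \<le> K * (\<integral>\<^sup>+y. ennreal (cmod (poly P (of_real y))) * indicator {X u - h..X u + h} y \<partial>\<tau> (fst u))"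
    using K[OF coords_less[OF u] P(1) x] by simp
  also have "(\<integral>\<^sup>+y. ennreal (cmod (poly P (of_real y))) * indicator {X u - h..X u + h} y \<partial>\<tau> (fst u))
      = (\<integral>\<^sup>+y. ennreal (gap_product p (n d) (Y(u := y))) * indicator ({X u - h..X u + h} \<inter> \<Gamma> (fst u)) y \<partial>T u)"
  proof -
    have "T u = \<tau> (fst u)" using coords_less[OF u] by (simp add: T_def)
    moreover have "(\<integral>\<^sup>+y. ennreal (cmod (poly P (of_real y))) * indicator {X u - h..X u + h} y \<partial>T u)
      = (\<integral>\<^sup>+y. ennreal (gap_product p (n d) (Y(u := y))) * indicator ({X u - h..X u + h} \<inter> \<Gamma> (fst u)) y \<partial>T u)"
      by (rule nn_integral_cong) (simp add: P(2) space_T[OF u] indicator_def)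
    ultimately show ?thesis by simp
  qed
  finally show "ennreal (gap_product p (n d) Y) \<le> K * (\<integral>\<^sup>+y. ennreal (gap_product p (n d) (Y(u := y))) * indicator ({X u - h..X u + h} \<inter> \<Gamma> (fst u)) y \<partial>T u)" .
qed

lemma uniform_local_BM:
  assumes h: "0 < h" and \<epsilon>: "0 < \<epsilon>"
  shows "\<exists>C>0. \<exists>k0. \<forall>k\<ge>k0. \<forall>i<p. \<forall>P :: complex poly. degree P \<le> k \<longrightarrow> (\<forall>x\<in>\<Gamma> i.
     ennreal (cmod (poly P (of_real x))) \<le> ennreal (C * (1 + \<epsilon>) ^ k) *
       (\<integral>\<^sup>+y. ennreal (cmod (poly P (of_real y))) * indicator {x - h..x + h} y \<partial>\<tau> i))"
proof -
  define G where "G C k i \<longleftrightarrow> (\<forall>P :: complex poly. degree P \<le> k \<longrightarrow> (\<forall>x\<in>\<Gamma> i.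
     ennreal (cmod (poly P (of_real x))) \<le> ennreal (C * (1 + \<epsilon>) ^ k) *
       (\<integral>\<^sup>+y. ennreal (cmod (poly P (of_real y))) * indicator {x - h..x + h} y \<partial>\<tau> i)))" for C k i
  have "\<forall>i\<in>{..<p}. \<exists>C>0. \<exists>k0. \<forall>k\<ge>k0. G C k i"
  proof
    fix i assume "i \<in> {..<p}"
    then have i: "i < p" by simp
    show "\<exists>C>0. \<exists>k0. \<forall>k\<ge>k0. G C k i"
      unfolding G_def \<Gamma>[OF i]
      using sets_\<tau>[OF i] BM[OF i] unfolding \<Gamma>[OF i]
      by (intro local_BM ab[OF i] finite_\<tau>[OF i] h \<epsilon>)
  qed
  from bchoice[OF this] obtain C where C: "\<forall>i\<in>{..<p}. 0 < C i \<and> (\<exists>k0. \<forall>k\<ge>k0. G (C i) k i)" ..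
  then have "\<forall>i\<in>{..<p}. \<exists>k0. \<forall>k\<ge>k0. G (C i) k i" by blast
  from bchoice[OF this] obtain k0 where k0: "\<forall>i\<in>{..<p}. \<forall>k\<ge>k0 i. G (C i) k i" ..
  have Cnn: "0 \<le> C i" if "i \<in> {..<p}" for i using C that less_imp_le by blast
  have "G (1 + sum C {..<p}) k i" if k: "sum k0 {..<p} \<le> k" and i: "i < p" for k i
  proof -
    have "k0 i \<le> k" using member_le_sum[of i "{..<p}" k0] i k by simp
    then have g: "G (C i) k i" using k0 i by blast
    have "C i \<le> sum C {..<p}" by (rule member_le_sum) (use i Cnn in auto)
    then have "C i \<le> 1 + sum C {..<p}" by simp
    then have "ennreal (C i * (1 + \<epsilon>) ^ k) \<le> ennreal ((1 + sum C {..<p}) * (1 + \<epsilon>) ^ k)"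
      using \<epsilon> by (intro ennreal_leI mult_right_mono) auto
    then show ?thesis using g unfolding G_def by (meson mult_right_mono order_trans zero_le)
  qed
  moreover have "0 < 1 + sum C {..<p}" using sum_nonneg[of "{..<p}" C] Cnn by force
  ultimately show ?thesis unfolding G_def by blast
qed

section \<open>Masses over ordered and over all configurations\<close>

text \<open>Unnormalized: \<open>total_mass\<close> runs over all configurations, as the
  coordinatewise estimate demands, while \<open>mass\<close> keeps the ordered ones, as the law
  does.\<close>

definition total_mass :: "nat \<Rightarrow> (nat \<Rightarrow> real measure) set \<Rightarrow> ennreal" where
  "total_mass d G = (\<integral>\<^sup>+X. ennreal \<bar>A_weight p Q (n d) X\<bar> * indicator G (j_map p r (n d) X) \<partial>tau d)"

definition mass :: "nat \<Rightarrow> (nat \<Rightarrow> real measure) set \<Rightarrow> ennreal" where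
  "mass d G = (\<integral>\<^sup>+X. ennreal \<bar>A_weight p Q (n d) X\<bar> * indicator G (j_map p r (n d) X) *
     indicator (ordered_configs p \<Gamma> (n d)) X \<partial>tau d)"

text \<open>Every configuration is put in order by some block permutation, so its integrand is
  dominated by the sum over all of them. Weight, empirical measures and reference measure are
  invariant, hence every summand integrates to \<open>mass d G\<close>.\<close>

lemma total_mass_le_mass:
  assumes G: "G \<in> sets (borel_of (M_topology p \<Gamma> r))"
  shows "total_mass d G \<le> of_nat (fact (mi_norm p (n d))) * mass d G"
proof -
  let ?B = "block_perms p (n d)" and ?ord = "ordered_configs p \<Gamma> (n d)"
  let ?g = "\<lambda>X. ennreal \<bar>A_weight p Q (n d) X\<bar> * indicator G (j_map p r (n d) X)"
  let ?\<rho> = "rearrange p (n d)"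
  have inv: "?g (?\<rho> \<pi> X) = ?g X" if "\<pi> \<in> ?B" for \<pi> X
    using abs_A_weight_rearrange[OF that] j_map_rearrange[OF that] by simp
  have gm: "(\<lambda>X. ?g X * indicator ?ord X) \<in> borel_measurable (tau d)"
  proof (intro borel_measurable_times_ennreal)
    show "(\<lambda>X. ennreal \<bar>A_weight p Q (n d) X\<bar>) \<in> borel_measurable (tau d)"
      using borel_measurable_abs_A_weight by measurable
    show "(\<lambda>X. indicator G (j_map p r (n d) X) :: ennreal) \<in> borel_measurable (tau d)"
      by (rule measurable_compose[OF measurable_j_map borel_measurable_indicator[OF G]])
    show "(indicator ?ord :: _ \<Rightarrow> ennreal) \<in> borel_measurable (tau d)"
      by (rule borel_measurable_indicator[OF sets_ordered])
  qed
  have perm: "distr (tau d) (tau d) (?\<rho> \<pi>) = tau d" and pm: "?\<rho> \<pi> \<in> measurable (tau d) (tau d)" if \<pi>: "\<pi> \<in> ?B" for \<pi>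
  proof -
    have TT: "T (\<pi> u) = T u" if "u \<in> coords p (n d)" for u
      using \<pi> that by (auto simp: block_perms_def T_def)
    have p': "\<pi> permutes coords p (n d)" using \<pi> by (simp add: block_perms_def)
    show "distr (tau d) (tau d) (?\<rho> \<pi>) = tau d"
      unfolding rearrange_def by (rule T.distr_PiM_permute[OF finite_coords p' TT])
    show "?\<rho> \<pi> \<in> measurable (tau d) (tau d)"
      unfolding rearrange_def
    proof (rule measurable_restrict)
      fix u assume u: "u \<in> coords p (n d)"
      have "\<pi> u \<in> coords p (n d)" using permutes_in_image[OF p'] u by simp
      from measurable_component_singleton[OF this, of T]
      show "(\<lambda>X. X (\<pi> u)) \<in> measurable (tau d) (T u)" unfolding TT[OF u] .
    qed
  qed
  have "total_mass d G \<le> (\<integral>\<^sup>+X. (\<Sum>\<pi>\<in>?B. ?g (?\<rho> \<pi> X) * indicator ?ord (?\<rho> \<pi> X)) \<partial>tau d)"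
    unfolding total_mass_def
  proof (rule nn_integral_mono)
    fix X assume "X \<in> space (tau d)"
    then have "X \<in> configs p \<Gamma> (n d)" by (simp add: space_tau)
    from exists_rearrange_ordered[OF this] obtain \<pi> where \<pi>: "\<pi> \<in> ?B" "?\<rho> \<pi> X \<in> ?ord"
      using \<Gamma>_less less_imp_le by metis
    have "?g X = ?g (?\<rho> \<pi> X) * indicator ?ord (?\<rho> \<pi> X)" using inv[OF \<pi>(1)] \<pi>(2) by simp
    also have "\<dots> \<le> (\<Sum>\<pi>\<in>?B. ?g (?\<rho> \<pi> X) * indicator ?ord (?\<rho> \<pi> X))"
      by (rule member_le_sum[OF \<pi>(1) _ finite_block_perms(1)]) simp
    finally show "?g X \<le> (\<Sum>\<pi>\<in>?B. ?g (?\<rho> \<pi> X) * indicator ?ord (?\<rho> \<pi> X))" .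
  qed
  also have "\<dots> = (\<Sum>\<pi>\<in>?B. \<integral>\<^sup>+X. ?g (?\<rho> \<pi> X) * indicator ?ord (?\<rho> \<pi> X) \<partial>tau d)"
    by (intro nn_integral_sum measurable_compose[OF pm gm])
  also have "\<dots> = (\<Sum>\<pi>\<in>?B. mass d G)"
  proof (rule sum.cong[OF refl])
    fix \<pi> assume \<pi>: "\<pi> \<in> ?B"
    have "(\<integral>\<^sup>+X. ?g (?\<rho> \<pi> X) * indicator ?ord (?\<rho> \<pi> X) \<partial>tau d)
        = (\<integral>\<^sup>+X. ?g X * indicator ?ord X \<partial>distr (tau d) (tau d) (?\<rho> \<pi>))"
      by (rule nn_integral_distr[symmetric, OF pm[OF \<pi>]]) (use gm in simp)
    then show "(\<integral>\<^sup>+X. ?g (?\<rho> \<pi> X) * indicator ?ord (?\<rho> \<pi> X) \<partial>tau d) = mass d G"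
      unfolding perm[OF \<pi>] mass_def .
  qed
  also have "\<dots> = of_nat (card ?B) * mass d G" by simp
  also have "\<dots> \<le> of_nat (fact (mi_norm p (n d))) * mass d G"
    by (intro mult_right_mono of_nat_mono finite_block_perms(2)) simp
  finally show ?thesis .
qed

end

text \<open>The factorial is at most \<open>N ^ N = exp (N * ln N)\<close>, and
  \<open>ln N / N\<close> tends to 0.\<close>

lemma eventually_fact_le:
  assumes "0 < \<delta>"
  shows "\<forall>\<^sub>F N in sequentially. (fact N :: real) \<le> exp (\<delta> * (real N)\<^sup>2)"
proof -
  have "((\<lambda>N. ln (real N) / real N) \<longlongrightarrow> 0) sequentially"
    by (rule filterlim_compose[OF ln_x_over_x_tendsto_0 filterlim_real_sequentially])
  then have "\<forall>\<^sub>F N in sequentially. ln (real N) / real N < \<delta>" using assms by (rule order_tendstoD)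
  then show ?thesis using eventually_gt_at_top[of 0]
  proof eventually_elim
    case (elim N)
    have "(fact N :: real) \<le> real N ^ N" using fact_le_power[of N, where 'a = real] by simp
    also have "\<dots> = exp (real N * ln (real N))" using elim(2) by (simp add: exp_of_nat_mult)
    also have "\<dots> \<le> exp (\<delta> * (real N)\<^sup>2)"
    proof -
      have "ln (real N) \<le> \<delta> * real N" using elim by (simp add: field_simps)
      then have "real N * ln (real N) \<le> real N * (\<delta> * real N)" by (rule mult_left_mono) simp
      then show ?thesis by (simp add: power2_eq_square mult_ac)
    qed
    finally show ?case .
  qed
qed

section \<open>Lower bound for the mass of a neighbourhood\<close>

context interval_system
begin

lemma openin_deviation:
  assumes "finite F" "\<And>g. g \<in> F \<Longrightarrow> fst g < p \<and> continuous_on (\<Gamma> (fst g)) (snd g)"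
  shows "openin (M_topology p \<Gamma> r) {\<nu> \<in> M. \<forall>g\<in>F. deviation \<Gamma> \<mu> \<nu> g < \<epsilon>}"
  using assms
proof induction
  case empty
  have "openin (M_topology p \<Gamma> r) M" using openin_topspace[of "M_topology p \<Gamma> r"] by simp
  then show ?case by simp
next
  case (insert g F)
  let ?i = "fst g"
  have g: "?i < p" "continuous_on (\<Gamma> ?i) (snd g)" using insert.prems by auto
  have proj: "continuous_map (M_topology p \<Gamma> r) (weak_star_topology (\<Gamma> ?i) (r ?i)) (\<lambda>\<nu>. \<nu> ?i)"
    unfolding M_topology_def by (rule continuous_map_product_projection) (use g in simp)
  have "continuous_map (M_topology p \<Gamma> r) euclideanreal (\<lambda>\<nu>. LINT x:\<Gamma> ?i|\<nu> ?i. snd g x)"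
    using continuous_map_compose[OF proj continuous_map_weak_star_integral[OF g(2)]] by (simp add: comp_def)
  from openin_continuous_map_preimage[OF this, of "ball (LINT x:\<Gamma> ?i|\<mu> ?i. snd g x) \<epsilon>"]
  have "openin (M_topology p \<Gamma> r) {\<nu> \<in> M. deviation \<Gamma> \<mu> \<nu> g < \<epsilon>}"
    by (simp add: deviation_def dist_real_def abs_minus_commute)
  moreover have "openin (M_topology p \<Gamma> r) {\<nu> \<in> M. \<forall>g\<in>F. deviation \<Gamma> \<mu> \<nu> g < \<epsilon>}"
    using insert by auto
  moreover have "{\<nu> \<in> M. \<forall>g\<in>insert g F. deviation \<Gamma> \<mu> \<nu> g < \<epsilon>}
      = {\<nu> \<in> M. deviation \<Gamma> \<mu> \<nu> g < \<epsilon>} \<inter> {\<nu> \<in> M. \<forall>g\<in>F. deviation \<Gamma> \<mu> \<nu> g < \<epsilon>}" by auto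
  ultimately show ?case by (simp add: openin_Int)
qed

text \<open>Uniform continuity of finitely many functions at once; it serves the test functions of a
  neighbourhood as well as the fields \<open>Q i\<close>.\<close>

lemma common_modulus:
  assumes "finite F" "\<And>g. g \<in> F \<Longrightarrow> fst g < p \<and> continuous_on (\<Gamma> (fst g)) (snd g)" "0 < \<eta>"
  shows "\<exists>h>0. \<forall>g\<in>F. \<forall>x\<in>\<Gamma> (fst g). \<forall>y\<in>\<Gamma> (fst g). \<bar>x - y\<bar> \<le> h \<longrightarrow> \<bar>snd g x - snd g y\<bar> \<le> (\<eta>::real)"
  using assms(1,2)
proof induction
  case empty
  show ?case by (intro exI[of _ 1]) simp
next
  case (insert g F)
  obtain h where h: "0 < h" "\<forall>g\<in>F. \<forall>x\<in>\<Gamma> (fst g). \<forall>y\<in>\<Gamma> (fst g). \<bar>x - y\<bar> \<le> h \<longrightarrow> \<bar>snd g x - snd g y\<bar> \<le> \<eta>"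
    using insert by auto
  have "uniformly_continuous_on (\<Gamma> (fst g)) (snd g)"
    using insert.prems compact_\<Gamma> by (intro compact_uniformly_continuous) auto
  then obtain h' where h': "0 < h'" "\<forall>x\<in>\<Gamma> (fst g). \<forall>y\<in>\<Gamma> (fst g). dist y x < h' \<longrightarrow> dist (snd g y) (snd g x) < \<eta>"
    using assms(3) unfolding uniformly_continuous_on_def by blast
  have "\<bar>snd g x - snd g y\<bar> \<le> \<eta>" if "x \<in> \<Gamma> (fst g)" "y \<in> \<Gamma> (fst g)" "\<bar>x - y\<bar> \<le> min h (h' / 2)" for x y
  proof -
    have "dist x y < h'" using that(3) h'(1) by (simp add: dist_real_def)
    then show ?thesis using h'(2) that(1,2) by (simp add: dist_real_def less_imp_le)
  qed
  then show ?case using h h'(1) by (intro exI[of _ "min h (h' / 2)"]) auto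
qed

lemma r_le_1: "i < p \<Longrightarrow> r i \<le> 1"
  using member_le_sum[of i "{..<p}" r] r_nonneg by (simp add: sum_r)

text \<open>The average over the block changes by at most \<eta>, and its weight \<open>r i\<close>
  is at most 1.\<close>

lemma deviation_j_map_close:
  assumes X: "X \<in> configs p \<Gamma> n" and Y: "Y \<in> configs p \<Gamma> n" and n: "0 < n (fst g)"
    and g: "fst g < p" "continuous_on (\<Gamma> (fst g)) (snd g)"
    and close: "\<And>k. k < n (fst g) \<Longrightarrow> \<bar>snd g (X (fst g, k)) - snd g (Y (fst g, k))\<bar> \<le> \<eta>" and \<eta>: "0 \<le> \<eta>"
  shows "deviation \<Gamma> \<mu> (j_map p r n Y) g \<le> deviation \<Gamma> \<mu> (j_map p r n X) g + \<eta>"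
proof -
  let ?i = "fst g"
  have J: "(LINT x:\<Gamma> ?i|j_map p r n Z ?i. snd g x) = r ?i / real (n ?i) * (\<Sum>k<n ?i. snd g (Z (?i, k)))"
    if Z: "Z \<in> configs p \<Gamma> n" for Z
  proof -
    have "Z (?i, k) \<in> \<Gamma> ?i" if "k < n ?i" for k using in_configs_D[OF Z, of "(?i, k)"] g(1) that by simp
    then show ?thesis
      using set_integral_scaled_dirac_sum[OF closed_\<Gamma>[OF g(1)] g(2), of "n ?i" "\<lambda>k. Z (?i, k)" "r ?i / real (n ?i)"]
        r[OF g(1)] g(1) by (simp add: j_map_def)
  qed
  have "\<bar>(\<Sum>k<n ?i. snd g (X (?i, k))) - (\<Sum>k<n ?i. snd g (Y (?i, k)))\<bar> \<le> (\<Sum>k<n ?i. \<eta>)"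
    unfolding sum_subtractf[symmetric] by (rule order_trans[OF sum_abs sum_mono]) (use close in auto)
  then have "r ?i / real (n ?i) * \<bar>(\<Sum>k<n ?i. snd g (X (?i, k))) - (\<Sum>k<n ?i. snd g (Y (?i, k)))\<bar>
      \<le> r ?i / real (n ?i) * (real (n ?i) * \<eta>)"
    using r[OF g(1)] by (intro mult_left_mono) auto
  also have "\<dots> \<le> \<eta>" using n r_le_1[OF g(1)] \<eta> by (simp add: mult_left_le_one_le r_nonneg[OF g(1)])
  finally have "\<bar>(LINT x:\<Gamma> ?i|j_map p r n X ?i. snd g x) - (LINT x:\<Gamma> ?i|j_map p r n Y ?i. snd g x)\<bar> \<le> \<eta>"
    unfolding J[OF X] J[OF Y] right_diff_distrib[symmetric] abs_mult
    using r[OF g(1)] by simp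
  then show ?thesis unfolding deviation_def by linarith
qed

end

context BM_system
begin

lemma eventually_m_D: "(\<forall>\<^sub>F N in sequentially. R (N::nat)) \<Longrightarrow> \<forall>\<^sub>F d in sequentially. R (mi_norm p (n d))"
  by (rule eventually_compose_filterlim[OF _ n_lim])

lemma measurable_mass_integrand:
  assumes "G \<in> sets (borel_of (M_topology p \<Gamma> r))"
  shows "(\<lambda>X. ennreal \<bar>A_weight p Q (n d) X\<bar> * indicator G (j_map p r (n d) X)) \<in> borel_measurable (tau d)"
proof (intro borel_measurable_times_ennreal)
  show "(\<lambda>X. ennreal \<bar>A_weight p Q (n d) X\<bar>) \<in> borel_measurable (tau d)"
    using borel_measurable_abs_A_weight by measurable
  show "(\<lambda>X. indicator G (j_map p r (n d) X) :: ennreal) \<in> borel_measurable (tau d)"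
    by (rule measurable_compose[OF measurable_j_map borel_measurable_indicator[OF assms]])
qed

text \<open>The gap product is bounded by its integral over the configurations within
  \<open>h\<close> of \<open>X\<close> in every coordinate. All of these are mapped into
  \<open>G\<close>, and on them the sum of the fields exceeds its value at \<open>X\<close> by at
  most \<open>\<eta> * m d\<close>, so the field factor is restored at the price
  \<open>exp (2 * \<eta> * (m d)^2)\<close>.\<close>

lemma A_weight_le_total_mass:
  assumes K: "\<And>i (P :: complex poly) x. i < p \<Longrightarrow> degree P \<le> 2 * mi_norm p (n d) \<Longrightarrow> x \<in> \<Gamma> i \<Longrightarrow>
      ennreal (cmod (poly P (of_real x))) \<le> ennreal K * (\<integral>\<^sup>+y. ennreal (cmod (poly P (of_real y))) * indicator {x - h..x + h} y \<partial>\<tau> i)"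
    and K0: "0 \<le> K" and X: "X \<in> configs p \<Gamma> (n d)" and G: "openin (M_topology p \<Gamma> r) G"
    and stay: "\<And>Y. Y \<in> configs p \<Gamma> (n d) \<Longrightarrow> (\<And>u. u \<in> coords p (n d) \<Longrightarrow> \<bar>X u - Y u\<bar> \<le> h) \<Longrightarrow> j_map p r (n d) Y \<in> G"
    and mod: "\<And>i x y. i < p \<Longrightarrow> x \<in> \<Gamma> i \<Longrightarrow> y \<in> \<Gamma> i \<Longrightarrow> \<bar>x - y\<bar> \<le> h \<Longrightarrow> \<bar>Q i x - Q i y\<bar> \<le> \<eta>"
  shows "ennreal \<bar>A_weight p Q (n d) X\<bar> \<le> ennreal (K ^ mi_norm p (n d) * exp (2 * \<eta> * (m d)\<^sup>2)) * total_mass d G"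
proof -
  let ?C = "coords p (n d)" and ?q = "\<lambda>X. \<Sum>u\<in>coords p (n d). Q (fst u) (X u)"
  \<comment> \<open>A bound for the inverse of the field factor at all configurations within
    distance \<open>h\<close> of \<open>X\<close>.\<close>
  define E where "E = exp (2 * m d * ?q X + 2 * \<eta> * (m d)\<^sup>2)"
  have "ennreal (gap_product p (n d) X) \<le> ennreal K ^ mi_norm p (n d) *
    (\<integral>\<^sup>+Y. ennreal (gap_product p (n d) Y) * (\<Prod>u\<in>?C. indicator ({X u - h..X u + h} \<inter> \<Gamma> (fst u)) (Y u)) \<partial>tau d)"
    by (rule gap_product_le_integral[OF K X])
  also have "\<dots> \<le> ennreal K ^ mi_norm p (n d) *
    (\<integral>\<^sup>+Y. ennreal E * (ennreal \<bar>A_weight p Q (n d) Y\<bar> * indicator G (j_map p r (n d) Y)) \<partial>tau d)"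
  proof (intro mult_left_mono nn_integral_mono)
    fix Y assume "Y \<in> space (tau d)"
    then have Y: "Y \<in> configs p \<Gamma> (n d)" by (simp add: space_tau)
    show "ennreal (gap_product p (n d) Y) * (\<Prod>u\<in>?C. indicator ({X u - h..X u + h} \<inter> \<Gamma> (fst u)) (Y u))
        \<le> ennreal E * (ennreal \<bar>A_weight p Q (n d) Y\<bar> * indicator G (j_map p r (n d) Y))"
    proof (cases "\<forall>u\<in>?C. Y u \<in> {X u - h..X u + h} \<inter> \<Gamma> (fst u)")
      case False
      then obtain u where "u \<in> ?C" "Y u \<notin> {X u - h..X u + h} \<inter> \<Gamma> (fst u)" by blast
      then have "(\<Prod>u\<in>?C. indicator ({X u - h..X u + h} \<inter> \<Gamma> (fst u)) (Y u)) = (0 :: ennreal)"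
        by (intro prod_zero bexI[of _ u]) (auto simp: indicator_def)
      then show ?thesis by (simp only: mult_zero_right zero_le)
    next
      case True
      then have cl: "\<bar>X u - Y u\<bar> \<le> h" if "u \<in> ?C" for u using that by (auto simp: abs_le_iff algebra_simps)
      have "?q Y - ?q X \<le> (\<Sum>u\<in>?C. \<eta>)" unfolding sum_subtractf[symmetric]
      proof (rule sum_mono)
        fix u assume u: "u \<in> ?C"
        have "\<bar>Q (fst u) (X u) - Q (fst u) (Y u)\<bar> \<le> \<eta>"
          using in_configs_D[OF X u] in_configs_D[OF Y u] cl[OF u] by (intro mod) auto
        then show "Q (fst u) (Y u) - Q (fst u) (X u) \<le> \<eta>" by linarith
      qed
      then have "?q Y \<le> ?q X + \<eta> * m d" by (simp add: mult.commute)
      then have "2 * m d * ?q Y \<le> 2 * m d * (?q X + \<eta> * m d)" using m_pos[of d] by (intro mult_left_mono) auto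
      then have e: "exp (2 * m d * ?q Y) \<le> E" by (simp add: E_def power2_eq_square algebra_simps)
      have "gap_product p (n d) Y = exp (2 * m d * ?q Y) * \<bar>A_weight p Q (n d) Y\<bar>"
        unfolding abs_A_weight by (simp add: exp_minus)
      also have "\<dots> \<le> E * \<bar>A_weight p Q (n d) Y\<bar>" by (rule mult_right_mono[OF e]) simp
      finally have "ennreal (gap_product p (n d) Y) \<le> ennreal E * ennreal \<bar>A_weight p Q (n d) Y\<bar>"
        by (simp add: E_def ennreal_leI flip: ennreal_mult)
      moreover have "j_map p r (n d) Y \<in> G" by (rule stay[OF Y cl])
      ultimately show ?thesis using True by simp
    qed
  qed simp
  also have "(\<integral>\<^sup>+Y. ennreal E * (ennreal \<bar>A_weight p Q (n d) Y\<bar> * indicator G (j_map p r (n d) Y)) \<partial>tau d)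
      = ennreal E * total_mass d G"
    unfolding total_mass_def by (rule nn_integral_cmult[OF measurable_mass_integrand[OF sets_borel_of_open[OF G]]])
  finally have "ennreal (gap_product p (n d) X) \<le> ennreal K ^ mi_norm p (n d) * (ennreal E * total_mass d G)" .
  then have "ennreal (exp (- 2 * m d * ?q X)) * ennreal (gap_product p (n d) X)
     \<le> ennreal (exp (- 2 * m d * ?q X)) * (ennreal K ^ mi_norm p (n d) * (ennreal E * total_mass d G))"
    by (rule mult_left_mono) simp
  also have "\<dots> = ennreal (exp (- 2 * m d * ?q X) * (K ^ mi_norm p (n d) * E)) * total_mass d G"
    using K0 by (simp add: ennreal_mult ennreal_power E_def mult.assoc)
  also have "exp (- 2 * m d * ?q X) * (K ^ mi_norm p (n d) * E) = K ^ mi_norm p (n d) * exp (2 * \<eta> * (m d)\<^sup>2)"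
    by (simp add: E_def exp_add exp_minus)
  finally show ?thesis
    unfolding abs_A_weight by (simp add: ennreal_mult gap_product_nonneg mult.commute)
qed

text \<open>A good configuration at a level \<open>L' < L\<close> has a surrounding box that still
  maps into \<open>G\<close>; the mass of this box is bounded below, and the difference
  \<open>L - L'\<close> covers all losses.\<close>

lemma lower_mass:
  assumes \<mu>: "\<mu> \<in> M" and L: "weighted_energy p \<Gamma> Q \<mu> < ereal L"
    and G: "openin (M_topology p \<Gamma> r) G" "\<mu> \<in> G"
  shows "\<forall>\<^sub>F d in sequentially. ennreal (exp (- (L * (m d)\<^sup>2))) \<le> mass d G"
proof -
  obtain L' where L': "weighted_energy p \<Gamma> Q \<mu> < ereal L'" "L' < L"
    using ereal_dense2[OF L] by auto
  \<comment> \<open>A quarter for each of four losses: the Bernstein-Markov constant, its geometric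
    factor, the oscillation of the fields, and the factorial.\<close>
  define \<delta> where "\<delta> = (L - L') / 4"
  have \<delta>: "0 < \<delta>" using L'(2) by (simp add: \<delta>_def)
  obtain F \<epsilon> where F: "finite F" "\<forall>g\<in>F. fst g < p \<and> continuous_on (\<Gamma> (fst g)) (snd g)" "0 < \<epsilon>"
    "\<forall>\<nu>\<in>M. (\<forall>g\<in>F. deviation \<Gamma> \<mu> \<nu> g < \<epsilon>) \<longrightarrow> \<nu> \<in> G"
    using M_topology_nbhd[OF G] by blast
  \<comment> \<open>Half of the tolerance is reserved for displacing the points by at most
    \<open>h\<close>.\<close>
  define G' where "G' = {\<nu> \<in> M. \<forall>g\<in>F. deviation \<Gamma> \<mu> \<nu> g < \<epsilon> / 2}"
  have G': "openin (M_topology p \<Gamma> r) G'" "\<mu> \<in> G'"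
    using openin_deviation[OF F(1), of \<mu> "\<epsilon> / 2"] F(2,3) \<mu> by (auto simp: G'_def deviation_def)
  have "\<exists>h>0. \<forall>g\<in>F. \<forall>x\<in>\<Gamma> (fst g). \<forall>y\<in>\<Gamma> (fst g). \<bar>x - y\<bar> \<le> h \<longrightarrow> \<bar>snd g x - snd g y\<bar> \<le> \<epsilon> / 2"
    by (rule common_modulus[OF F(1)]) (use F in auto)
  then obtain h1 where h1: "0 < h1" "\<forall>g\<in>F. \<forall>x\<in>\<Gamma> (fst g). \<forall>y\<in>\<Gamma> (fst g). \<bar>x - y\<bar> \<le> h1 \<longrightarrow> \<bar>snd g x - snd g y\<bar> \<le> \<epsilon> / 2"
    by blast
  have "\<exists>h>0. \<forall>g\<in>(\<lambda>i. (i, Q i)) ` {..<p}. \<forall>x\<in>\<Gamma> (fst g). \<forall>y\<in>\<Gamma> (fst g). \<bar>x - y\<bar> \<le> h \<longrightarrow> \<bar>snd g x - snd g y\<bar> \<le> \<delta> / 2"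
    by (rule common_modulus) (use Q \<delta> in auto)
  then obtain h2 where h2: "0 < h2" "\<forall>g\<in>(\<lambda>i. (i, Q i)) ` {..<p}. \<forall>x\<in>\<Gamma> (fst g). \<forall>y\<in>\<Gamma> (fst g). \<bar>x - y\<bar> \<le> h2 \<longrightarrow> \<bar>snd g x - snd g y\<bar> \<le> \<delta> / 2"
    by blast
  define h where "h = min h1 h2"
  have h: "0 < h" "h \<le> h1" "h \<le> h2" using h1(1) h2(1) by (auto simp: h_def)
  \<comment> \<open>With this choice \<open>((1 + \<epsilon>') ^ (2 * N)) ^ N\<close> equals
    \<open>exp (\<delta> * N^2)\<close> for \<open>N\<close> points.\<close>
  define \<epsilon>' where "\<epsilon>' = exp (\<delta> / 2) - 1"
  have \<epsilon>': "0 < \<epsilon>'" using \<delta> by (simp add: \<epsilon>'_def)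
  from uniform_local_BM[OF h(1) \<epsilon>'] obtain C where C': "0 < C \<and> (\<exists>k0. \<forall>k\<ge>k0. \<forall>i<p. \<forall>P :: complex poly. degree P \<le> k \<longrightarrow> (\<forall>x\<in>\<Gamma> i.
     ennreal (cmod (poly P (of_real x))) \<le> ennreal (C * (1 + \<epsilon>') ^ k) *
       (\<integral>\<^sup>+y. ennreal (cmod (poly P (of_real y))) * indicator {x - h..x + h} y \<partial>\<tau> i)))" ..
  note C = conjunct1[OF C']
  from conjunct2[OF C'] obtain k0 where BMk: "\<forall>k\<ge>k0. \<forall>i<p. \<forall>P :: complex poly. degree P \<le> k \<longrightarrow> (\<forall>x\<in>\<Gamma> i.
     ennreal (cmod (poly P (of_real x))) \<le> ennreal (C * (1 + \<epsilon>') ^ k) *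
       (\<integral>\<^sup>+y. ennreal (cmod (poly P (of_real y))) * indicator {x - h..x + h} y \<partial>\<tau> i))" ..
  have "\<forall>\<^sub>F d in sequentially. k0 \<le> mi_norm p (n d)" using n_lim by (simp add: filterlim_at_top)
  moreover note lower_configs[OF \<mu> L'(1) G'] eventually_m_ge[of "ln C / \<delta>"] eventually_m_D[OF eventually_fact_le[OF \<delta>]]
  ultimately show ?thesis
  proof eventually_elim
    case (elim d)
    let ?N = "mi_norm p (n d)"
    from elim(2) obtain X where X: "X \<in> ordered_configs p \<Gamma> (n d)" "j_map p r (n d) X \<in> G'"
      "exp (- (L' * (m d)\<^sup>2)) \<le> A_weight p Q (n d) X" by blast
    have Xc: "X \<in> configs p \<Gamma> (n d)" using X(1) ordered_configs_subset by blast
    define K where "K = C * (1 + \<epsilon>') ^ (2 * ?N)"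
    have K0: "0 \<le> K" using C \<epsilon>' by (simp add: K_def)
    have "ennreal \<bar>A_weight p Q (n d) X\<bar> \<le> ennreal (K ^ ?N * exp (2 * (\<delta> / 2) * (m d)\<^sup>2)) * total_mass d G"
    proof (rule A_weight_le_total_mass[OF _ K0 Xc G(1)])
      fix i x and P :: "complex poly"
      assume A: "i < p" "degree P \<le> 2 * mi_norm p (n d)" "x \<in> \<Gamma> i"
      have "k0 \<le> 2 * ?N" using elim(1) by simp
      from BMk[rule_format, OF this A]
      show "ennreal (cmod (poly P (of_real x))) \<le> ennreal K * (\<integral>\<^sup>+y. ennreal (cmod (poly P (of_real y))) * indicator {x - h..x + h} y \<partial>\<tau> i)"
        unfolding K_def .
    next
      fix Y assume Y: "Y \<in> configs p \<Gamma> (n d)" and cl: "\<And>u. u \<in> coords p (n d) \<Longrightarrow> \<bar>X u - Y u\<bar> \<le> h"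
      have "deviation \<Gamma> \<mu> (j_map p r (n d) Y) g < \<epsilon>" if g: "g \<in> F" for g
      proof -
        have gp: "fst g < p" "continuous_on (\<Gamma> (fst g)) (snd g)" using F(2) g by auto
        have "deviation \<Gamma> \<mu> (j_map p r (n d) Y) g \<le> deviation \<Gamma> \<mu> (j_map p r (n d) X) g + \<epsilon> / 2"
        proof (rule deviation_j_map_close[OF Xc Y n_pos[OF gp(1)] gp])
          fix k assume k: "k < n d (fst g)"
          then have u: "(fst g, k) \<in> coords p (n d)" using gp by simp
          show "\<bar>snd g (X (fst g, k)) - snd g (Y (fst g, k))\<bar> \<le> \<epsilon> / 2"
            using h1(2) g in_configs_D[OF Xc u] in_configs_D[OF Y u] cl[OF u] h(2) by auto
        qed (use F(3) in simp)
        also have "\<dots> < \<epsilon>" using X(2) g by (auto simp: G'_def)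
        finally show ?thesis .
      qed
      moreover have "j_map p r (n d) Y \<in> M" using Y by (rule j_map_in_M_space) (use closed_\<Gamma> r n_pos in auto)
      ultimately show "j_map p r (n d) Y \<in> G" using F(4) by blast
    next
      fix i x y assume "i < p" "x \<in> \<Gamma> i" "y \<in> \<Gamma> i" "\<bar>x - y\<bar> \<le> h"
      then show "\<bar>Q i x - Q i y\<bar> \<le> \<delta> / 2" using h2(2) h(3) by auto
    qed
    also have "\<dots> \<le> ennreal (K ^ ?N * exp (2 * (\<delta> / 2) * (m d)\<^sup>2)) * (of_nat (fact ?N) * mass d G)"
      by (intro mult_left_mono total_mass_le_mass sets_borel_of_open G(1)) simp
    also have "\<dots> = ennreal (K ^ ?N * exp (\<delta> * (m d)\<^sup>2) * fact ?N) * mass d G"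
      using K0 by (simp add: ennreal_mult mult.assoc ennreal_of_nat_eq_real_of_nat)
    also have "\<dots> \<le> ennreal (exp ((L - L') * (m d)\<^sup>2)) * mass d G"
    proof (intro mult_right_mono ennreal_leI)
      have "ln C \<le> \<delta> * m d" using elim(3) \<delta> by (simp add: field_simps)
      then have "m d * ln C \<le> m d * (\<delta> * m d)" using m_pos[of d] by (intro mult_left_mono) auto
      then have "exp (m d * ln C) \<le> exp (\<delta> * (m d)\<^sup>2)" by (simp add: power2_eq_square mult_ac)
      then have c: "C ^ ?N \<le> exp (\<delta> * (m d)\<^sup>2)" using C by (simp add: exp_of_nat_mult)
      have "(1 + \<epsilon>') ^ (2 * ?N) = exp (real (2 * ?N) * (\<delta> / 2))"
        unfolding exp_of_nat_mult \<epsilon>'_def by simp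
      then have "((1 + \<epsilon>') ^ (2 * ?N)) ^ ?N = exp (real ?N * (real (2 * ?N) * (\<delta> / 2)))"
        unfolding exp_of_nat_mult[of ?N] by simp
      also have "real ?N * (real (2 * ?N) * (\<delta> / 2)) = \<delta> * (m d)\<^sup>2" by (simp add: power2_eq_square)
      finally have "K ^ ?N \<le> exp (\<delta> * (m d)\<^sup>2) * exp (\<delta> * (m d)\<^sup>2)"
        unfolding K_def power_mult_distrib using c by (simp add: mult_right_mono)
      then have "K ^ ?N * exp (\<delta> * (m d)\<^sup>2) * fact ?N
          \<le> exp (\<delta> * (m d)\<^sup>2) * exp (\<delta> * (m d)\<^sup>2) * exp (\<delta> * (m d)\<^sup>2) * exp (\<delta> * (m d)\<^sup>2)"
        using elim(4) K0 by (intro mult_mono) auto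
      also have "\<dots> = exp ((L - L') * (m d)\<^sup>2)" by (simp add: \<delta>_def field_simps flip: exp_add)
      finally show "K ^ ?N * exp (\<delta> * (m d)\<^sup>2) * fact ?N \<le> exp ((L - L') * (m d)\<^sup>2)" .
    qed simp
    finally have "ennreal (exp (- (L' * (m d)\<^sup>2))) \<le> ennreal (exp ((L - L') * (m d)\<^sup>2)) * mass d G"
      using X(3) by (meson ennreal_leI abs_ge_self order_trans)
    then have "ennreal (exp (- ((L - L') * (m d)\<^sup>2))) * ennreal (exp (- (L' * (m d)\<^sup>2)))
        \<le> ennreal (exp (- ((L - L') * (m d)\<^sup>2))) * (ennreal (exp ((L - L') * (m d)\<^sup>2)) * mass d G)"
      by (rule mult_left_mono) simp
    then show ?case
      unfolding mult.assoc[symmetric] by (simp add: algebra_simps flip: ennreal_mult exp_add)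
  qed
qed

end

lemma eln_le:
  assumes "x \<le> ennreal (exp s)"
  shows "eln x \<le> ereal s"
proof (cases x)
  case (real y)
  then have "y \<le> exp s" using assms by (simp add: ennreal_le_iff)
  show ?thesis
  proof (cases "y = 0")
    case False
    then have "ln y \<le> ln (exp s)" using \<open>y \<le> exp s\<close> real by (subst ln_le_cancel_iff) auto
    then show ?thesis using real False by (simp add: eln_def)
  qed (use real in \<open>simp add: eln_def\<close>)
qed (use assms in \<open>simp add: top_unique\<close>)

lemma le_eln: "ennreal (exp s) \<le> x \<Longrightarrow> ereal s \<le> eln x"
proof (cases x)
  case (real y)
  assume "ennreal (exp s) \<le> x"
  then have "exp s \<le> y" using real by (simp add: ennreal_le_iff)
  moreover from this have "0 < y" using exp_gt_zero[of s] by linarith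
  ultimately show ?thesis using real by (simp add: eln_def ln_ge_iff)
qed (simp add: eln_def)

section \<open>Upper bound for the mass, and positivity\<close>

context BM_system
begin

text \<open>At truncation level 0 the diagonal correction vanishes, and the truncated interaction is
  nonnegative.\<close>

lemma abs_A_weight_le:
  assumes "X \<in> configs p \<Gamma> (n d)"
  shows "\<bar>A_weight p Q (n d) X\<bar> \<le> exp ((m d)\<^sup>2 * c0)"
proof -
  have "0 \<le> trunc_interaction 0 (n d) X" unfolding trunc_interaction_def
    using in_configs_D[OF assms] by (intro sum_nonneg trunc_kernel_ge) auto
  then have "(A_weight p Q (n d) X)\<^sup>2 \<le> exp ((m d)\<^sup>2 * c0)"
    using A_weight_square_le[OF assms, of 0] by (simp add: order_trans)
  also have "\<dots> \<le> (exp ((m d)\<^sup>2 * c0))\<^sup>2"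
  proof -
    have "0 \<le> c0" using D_ge_1 q0(1) by (simp add: c0_def)
    then show ?thesis by (simp flip: exp_double)
  qed
  finally show ?thesis by (metis abs_exp_cancel abs_le_square_iff)
qed

text \<open>The reference measure has total mass at most exponential in n, which is negligible on
  the scale n^2.\<close>

lemma emeasure_tau_le: "\<exists>t\<ge>1. \<forall>d. emeasure (tau d) (space (tau d)) \<le> ennreal (t ^ mi_norm p (n d))"
proof -
  define t where "t = 1 + (\<Sum>i<p. measure (\<tau> i) (space (\<tau> i)))"
  have "emeasure (tau d) (space (tau d)) \<le> ennreal (t ^ mi_norm p (n d))" for d
  proof -
    have "emeasure (tau d) (space (tau d)) = (\<Prod>u\<in>coords p (n d). emeasure (T u) (space (T u)))"
      unfolding space_PiM by (rule T.emeasure_PiM) auto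
    also have "\<dots> = (\<Prod>u\<in>coords p (n d). ennreal (measure (T u) (space (T u))))"
      by (simp add: finite_measure.emeasure_eq_measure[OF finite_T])
    also have "\<dots> = ennreal (\<Prod>u\<in>coords p (n d). measure (T u) (space (T u)))"
      by (simp add: prod_ennreal)
    also have "(\<Prod>u\<in>coords p (n d). measure (T u) (space (T u))) \<le> (\<Prod>u\<in>coords p (n d). t)"
    proof (intro prod_mono conjI)
      fix u assume u: "u \<in> coords p (n d)"
      have "measure (\<tau> (fst u)) (space (\<tau> (fst u))) \<le> (\<Sum>i<p. measure (\<tau> i) (space (\<tau> i)))"
        by (rule member_le_sum) (use coords_less[OF u] in auto)
      then show "measure (T u) (space (T u)) \<le> t" using coords_less[OF u] by (simp add: T_def t_def)
    qed simp
    finally show ?thesis by (simp add: ennreal_leI)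
  qed
  moreover have "1 \<le> t" by (simp add: t_def sum_nonneg)
  ultimately show ?thesis by blast
qed

lemma mass_mono: "A \<subseteq> B \<Longrightarrow> mass d A \<le> mass d B"
  unfolding mass_def by (intro nn_integral_mono mult_right_mono mult_left_mono) (auto simp: indicator_def)

text \<open>The local bounds hold at levels strictly above \<open>L\<close>. Over a finite subcover
  their minimum \<open>L1\<close> is still above \<open>L\<close>, and the gap \<open>L1 - L\<close>
  absorbs the total mass of the reference measure.\<close>

lemma upper_mass:
  assumes F: "closedin (M_topology p \<Gamma> r) F" and L: "\<And>\<mu>. \<mu> \<in> F \<Longrightarrow> ereal L < weighted_energy p \<Gamma> Q \<mu>"
  shows "\<forall>\<^sub>F d in sequentially. mass d F \<le> ennreal (exp (- (L * (m d)\<^sup>2)))"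
proof -
  have FM: "F \<subseteq> M" using closedin_subset[OF F] by simp
  define good where "good G L' \<longleftrightarrow> openin (M_topology p \<Gamma> r) G \<and> (\<forall>\<^sub>F d in sequentially. \<forall>X\<in>configs p \<Gamma> (n d).
     j_map p r (n d) X \<in> G \<longrightarrow> (A_weight p Q (n d) X)\<^sup>2 \<le> exp (- (2 * L' * (m d)\<^sup>2)))" for G L'
  have "\<forall>\<mu>\<in>F. \<exists>G. \<mu> \<in> G \<and> (\<exists>L'>L. good G L')"
  proof
    fix \<mu> assume \<mu>: "\<mu> \<in> F"
    obtain L' where L': "ereal L < ereal L'" "ereal L' < weighted_energy p \<Gamma> Q \<mu>"
      using ereal_dense2[OF L[OF \<mu>]] by blast
    have "\<mu> \<in> M" using FM \<mu> by blast
    from upper_local[OF this L'(2)] show "\<exists>G. \<mu> \<in> G \<and> (\<exists>L'>L. good G L')"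
      unfolding good_def using L'(1) by auto
  qed
  from bchoice[OF this] obtain G where G: "\<forall>\<mu>\<in>F. \<mu> \<in> G \<mu> \<and> (\<exists>L'>L. good (G \<mu>) L')" ..
  then have "\<forall>\<mu>\<in>F. \<exists>L'. L < L' \<and> good (G \<mu>) L'" by blast
  from bchoice[OF this] obtain \<Lambda> where \<Lambda>: "\<forall>\<mu>\<in>F. L < \<Lambda> \<mu> \<and> good (G \<mu>) (\<Lambda> \<mu>)" ..
  have "compactin (M_topology p \<Gamma> r) F"
    using closedin_compact_space[OF _ F] compact_Hausdorff_M_topology(1)[of p a b \<Gamma> r] ab \<Gamma> r by blast
  moreover have "\<And>U. U \<in> G ` F \<Longrightarrow> openin (M_topology p \<Gamma> r) U" using \<Lambda> unfolding good_def by blast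
  moreover have "F \<subseteq> \<Union>(G ` F)" using G by blast
  ultimately obtain \<F> where "finite \<F>" "\<F> \<subseteq> G ` F" "F \<subseteq> \<Union>\<F>" unfolding compactin_def by meson
  then obtain S where S: "finite S" "S \<subseteq> F" "F \<subseteq> \<Union>(G ` S)" using finite_subset_image by metis
  \<comment> \<open>The inserted \<open>L + 1\<close> covers an empty subcover, which occurs for
    empty \<open>F\<close>.\<close>
  define L1 where "L1 = Min (insert (L + 1) (\<Lambda> ` S))"
  have L1: "L < L1" unfolding L1_def using S(1,2) \<Lambda> by (subst Min_gr_iff) auto
  have L1': "L1 \<le> \<Lambda> \<mu>" if "\<mu> \<in> S" for \<mu> unfolding L1_def using S(1) that by (intro Min_le) auto
  obtain t where t: "1 \<le> t" "\<And>d. emeasure (tau d) (space (tau d)) \<le> ennreal (t ^ mi_norm p (n d))"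
    using emeasure_tau_le by blast
  have "\<forall>\<^sub>F d in sequentially. \<forall>\<mu>\<in>S. \<forall>X\<in>configs p \<Gamma> (n d).
     j_map p r (n d) X \<in> G \<mu> \<longrightarrow> (A_weight p Q (n d) X)\<^sup>2 \<le> exp (- (2 * \<Lambda> \<mu> * (m d)\<^sup>2))"
    using \<Lambda> S(2) unfolding good_def by (intro eventually_ball_finite[OF S(1)]) blast
  then show ?thesis using eventually_m_ge[of "ln t / (L1 - L)"]
  proof eventually_elim
    case (elim d)
    have "mass d F \<le> (\<integral>\<^sup>+X. ennreal (exp (- (L1 * (m d)\<^sup>2))) \<partial>tau d)"
      unfolding mass_def
    proof (rule nn_integral_mono)
      fix X assume "X \<in> space (tau d)"
      then have X: "X \<in> configs p \<Gamma> (n d)" by (simp add: space_tau)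
      show "ennreal \<bar>A_weight p Q (n d) X\<bar> * indicator F (j_map p r (n d) X) * indicator (ordered_configs p \<Gamma> (n d)) X
          \<le> ennreal (exp (- (L1 * (m d)\<^sup>2)))"
      proof (cases "j_map p r (n d) X \<in> F")
        case True
        then obtain \<mu> where \<mu>: "\<mu> \<in> S" "j_map p r (n d) X \<in> G \<mu>" using S(3) by blast
        have "(A_weight p Q (n d) X)\<^sup>2 \<le> exp (- (2 * \<Lambda> \<mu> * (m d)\<^sup>2))" using elim(1) \<mu> X by blast
        also have "\<dots> \<le> exp (- (2 * L1 * (m d)\<^sup>2))" using L1'[OF \<mu>(1)] by (simp add: mult_right_mono)
        also have "\<dots> = (exp (- (L1 * (m d)\<^sup>2)))\<^sup>2" by (simp add: exp_double[symmetric] mult.assoc)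
        finally have "\<bar>A_weight p Q (n d) X\<bar> \<le> exp (- (L1 * (m d)\<^sup>2))"
          by (metis abs_exp_cancel abs_le_square_iff)
        then show ?thesis by (auto simp: indicator_def ennreal_leI)
      qed simp
    qed
    also have "\<dots> \<le> ennreal (exp (- (L1 * (m d)\<^sup>2))) * ennreal (t ^ mi_norm p (n d))"
      by (simp add: t(2) mult_left_mono)
    also have "\<dots> = ennreal (exp (- (L1 * (m d)\<^sup>2)) * t ^ mi_norm p (n d))"
      using t(1) by (simp add: ennreal_mult)
    also have "\<dots> \<le> ennreal (exp (- (L * (m d)\<^sup>2)))"
    proof (rule ennreal_leI)
      have "ln t \<le> (L1 - L) * m d" using elim(2) L1 by (simp add: field_simps)
      then have "m d * ln t \<le> m d * ((L1 - L) * m d)" using m_pos[of d] by (intro mult_left_mono) auto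
      then have "exp (m d * ln t) \<le> exp ((L1 - L) * (m d)\<^sup>2)" by (simp add: power2_eq_square mult_ac)
      moreover have "exp (m d * ln t) = t ^ mi_norm p (n d)" using t(1) by (simp add: exp_of_nat_mult)
      ultimately have "exp (- (L1 * (m d)\<^sup>2)) * t ^ mi_norm p (n d) \<le> exp (- (L1 * (m d)\<^sup>2)) * exp ((L1 - L) * (m d)\<^sup>2)"
        by (intro mult_left_mono) auto
      then show "exp (- (L1 * (m d)\<^sup>2)) * t ^ mi_norm p (n d) \<le> exp (- (L * (m d)\<^sup>2))"
        by (simp add: algebra_simps flip: exp_add)
    qed
    finally show ?case .
  qed
qed

lemma M_in_borel: "M \<in> sets (borel_of (M_topology p \<Gamma> r))"
  using sets.top[of "borel_of (M_topology p \<Gamma> r)"] by (simp add: space_borel_of)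

lemma mass_finite: "mass d B < \<infinity>"
proof -
  interpret finite_measure "tau d" by (rule finite_measure_tau)
  have "mass d B \<le> (\<integral>\<^sup>+X. ennreal (exp ((m d)\<^sup>2 * c0)) \<partial>tau d)"
    unfolding mass_def
    by (rule nn_integral_mono) (auto simp: space_tau indicator_def intro!: ennreal_leI abs_A_weight_le)
  also have "\<dots> < \<infinity>" using emeasure_finite[of "space (tau d)"]
    by (simp add: ennreal_mult_eq_top_iff less_top[symmetric])
  finally show ?thesis .
qed

text \<open>Equispaced points in every interval, starting at its left endpoint: a configuration of
  nonzero weight for each \<open>d\<close>.\<close>

lemma exists_separated_config: "\<exists>X\<in>configs p \<Gamma> (n d). 0 < gap_product p (n d) X"
proof
  define X where "X = (\<lambda>u\<in>coords p (n d). a (fst u) + (b (fst u) - a (fst u)) * (real (snd u) / real (n d (fst u))))"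
  show X: "X \<in> configs p \<Gamma> (n d)"
  proof (rule PiE_I)
    fix u assume u: "u \<in> coords p (n d)"
    have i: "fst u < p" and k: "snd u < n d (fst u)" using u by (auto simp: coords_def)
    have "(b (fst u) - a (fst u)) * (real (snd u) / real (n d (fst u))) \<le> (b (fst u) - a (fst u)) * 1"
      using k ab[OF i] by (intro mult_left_mono) auto
    moreover have "0 \<le> (b (fst u) - a (fst u)) * (real (snd u) / real (n d (fst u)))"
      using ab[OF i] by (intro mult_nonneg_nonneg) auto
    ultimately show "X u \<in> \<Gamma> (fst u)" using u unfolding \<Gamma>[OF i] X_def by simp
  qed (simp add: X_def)
  have "X u \<noteq> X v" if uv: "u \<in> coords p (n d)" "v \<in> coords p (n d)" "u \<noteq> v" for u v
  proof
    assume eq: "X u = X v"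
    consider "fst u = fst v" | "fst u < fst v" | "fst v < fst u" by linarith
    then show False
    proof cases
      case 1
      then have "snd u \<noteq> snd v" using uv(3) by (simp add: prod_eq_iff)
      then show False using eq uv 1 ab[OF coords_less[OF uv(2)]] n_pos[OF coords_less[OF uv(2)], of d]
        by (simp add: X_def)
    next
      case 2
      then show False using \<Gamma>_less[OF 2, of "X u" "X v"] in_configs_D[OF X uv(1)] in_configs_D[OF X uv(2)] eq by simp
    next
      case 3
      then show False using \<Gamma>_less[OF 3, of "X v" "X u"] in_configs_D[OF X uv(1)] in_configs_D[OF X uv(2)] eq by simp
    qed
  qed
  then have "0 < gap X u v" if "u \<in> coords p (n d)" "v \<in> coords p (n d)" for u v
    using that by (auto simp: gap_def)
  then show "0 < gap_product p (n d) X"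
    unfolding gap_product_def by (intro real_sqrt_gt_zero prod_pos)
qed

text \<open>Each law has to be a probability measure, so positivity is required for every
  \<open>d\<close> and not just eventually. The inequality with weight 0 and \<epsilon> = 1 holds in
  all degrees, and a window of radius \<open>D\<close> covers the whole interval, so the
  coordinatewise estimate applies to one separated configuration.\<close>

lemma mass_pos: "0 < mass d M"
proof -
  have "\<forall>i. \<exists>C. i < p \<longrightarrow> 0 < C \<and> (\<forall>k. \<forall>P :: complex poly. degree P \<le> k \<longrightarrow> (\<forall>x\<in>\<Gamma> i.
      ennreal (cmod (poly P (of_real x)) * exp (- real k * 0))
        \<le> ennreal (C * (1 + 1) ^ k) * (\<integral>\<^sup>+y. ennreal (cmod (poly P (of_real y)) * exp (- real k * 0)) \<partial>\<tau> i)))"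
  proof
    fix i
    have "\<exists>C>0. \<forall>k. \<forall>P :: complex poly. degree P \<le> k \<longrightarrow> (\<forall>x\<in>\<Gamma> i.
      ennreal (cmod (poly P (of_real x)) * exp (- real k * 0))
        \<le> ennreal (C * (1 + 1) ^ k) * (\<integral>\<^sup>+y. ennreal (cmod (poly P (of_real y)) * exp (- real k * 0)) \<partial>\<tau> i))" if "i < p"
      by (rule weighted_BM_real[OF compact_\<Gamma>[OF that] sets_\<tau>[OF that] BM[OF that] continuous_on_const zero_less_one])
    then show "\<exists>C. i < p \<longrightarrow> 0 < C \<and> (\<forall>k. \<forall>P :: complex poly. degree P \<le> k \<longrightarrow> (\<forall>x\<in>\<Gamma> i.
      ennreal (cmod (poly P (of_real x)) * exp (- real k * 0))
        \<le> ennreal (C * (1 + 1) ^ k) * (\<integral>\<^sup>+y. ennreal (cmod (poly P (of_real y)) * exp (- real k * 0)) \<partial>\<tau> i)))" by blast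
  qed
  from choice[OF this] obtain C where C: "\<forall>i. i < p \<longrightarrow> 0 < C i \<and> (\<forall>k. \<forall>P :: complex poly. degree P \<le> k \<longrightarrow> (\<forall>x\<in>\<Gamma> i.
      ennreal (cmod (poly P (of_real x)) * exp (- real k * 0))
        \<le> ennreal (C i * (1 + 1) ^ k) * (\<integral>\<^sup>+y. ennreal (cmod (poly P (of_real y)) * exp (- real k * 0)) \<partial>\<tau> i)))" ..
  define K where "K = (\<Sum>i<p. C i) * 2 ^ (2 * mi_norm p (n d))"
  have Cnn: "0 \<le> C i" if "i \<in> {..<p}" for i using C that less_imp_le by blast
  have K0: "0 \<le> K" unfolding K_def using Cnn by (intro mult_nonneg_nonneg sum_nonneg) auto
  have K: "ennreal (cmod (poly P (of_real x))) \<le> ennreal K * (\<integral>\<^sup>+y. ennreal (cmod (poly P (of_real y))) * indicator {x - D..x + D} y \<partial>\<tau> i)"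
    if i: "i < p" and P: "degree P \<le> 2 * mi_norm p (n d)" and x: "x \<in> \<Gamma> i" for i x and P :: "complex poly"
  proof -
    have "ennreal (cmod (poly P (of_real x))) \<le> ennreal (C i * 2 ^ (2 * mi_norm p (n d))) * (\<integral>\<^sup>+y. ennreal (cmod (poly P (of_real y))) \<partial>\<tau> i)"
      using conjunct2[OF C[rule_format, OF i], rule_format, OF P x] by simp
    also have "\<dots> \<le> ennreal K * (\<integral>\<^sup>+y. ennreal (cmod (poly P (of_real y))) * indicator {x - D..x + D} y \<partial>\<tau> i)"
    proof (intro mult_mono ennreal_leI nn_integral_mono)
      have "C i \<le> (\<Sum>i<p. C i)" by (rule member_le_sum) (use i Cnn in auto)
      then show "C i * 2 ^ (2 * mi_norm p (n d)) \<le> K" unfolding K_def by (intro mult_right_mono) auto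
      fix y assume "y \<in> space (\<tau> i)"
      then have "y \<in> \<Gamma> i" using sets_eq_imp_space_eq[OF sets_\<tau>[OF i]] by (simp add: space_restrict_space)
      then have "y \<in> {x - D..x + D}" using dist_le_D[OF i i x, of y] by (auto simp: abs_le_iff)
      then show "ennreal (cmod (poly P (of_real y))) \<le> ennreal (cmod (poly P (of_real y))) * indicator {x - D..x + D} y" by simp
    qed auto
    finally show ?thesis .
  qed
  obtain X where X: "X \<in> configs p \<Gamma> (n d)" "0 < gap_product p (n d) X" using exists_separated_config by blast
  have MT: "openin (M_topology p \<Gamma> r) M" using openin_topspace[of "M_topology p \<Gamma> r"] by simp
  have "ennreal \<bar>A_weight p Q (n d) X\<bar> \<le> ennreal (K ^ mi_norm p (n d) * exp (2 * (2 * q0) * (m d)\<^sup>2)) * total_mass d M"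
  proof (rule A_weight_le_total_mass[OF K K0 X(1) MT])
    fix Y assume "Y \<in> configs p \<Gamma> (n d)"
    then show "j_map p r (n d) Y \<in> M" by (rule j_map_in_M_space) (use closed_\<Gamma> r n_pos in auto)
  next
    fix i x y assume "i < p" "x \<in> \<Gamma> i" "y \<in> \<Gamma> i"
    then show "\<bar>Q i x - Q i y\<bar> \<le> 2 * q0" using q0(2)[of i x] q0(2)[of i y] by linarith
  qed
  also have "\<dots> \<le> ennreal (K ^ mi_norm p (n d) * exp (2 * (2 * q0) * (m d)\<^sup>2)) * (of_nat (fact (mi_norm p (n d))) * mass d M)"
    by (intro mult_left_mono total_mass_le_mass M_in_borel) simp
  finally have le: "ennreal \<bar>A_weight p Q (n d) X\<bar> \<le> \<dots>" .
  have "0 < \<bar>A_weight p Q (n d) X\<bar>" unfolding abs_A_weight using X(2) by simp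
  then show ?thesis using le by (cases "mass d M = 0") (auto simp: zero_less_iff_neq_zero)
qed

section \<open>Normalizing constants and laws\<close>

definition Z :: "nat \<Rightarrow> real" where "Z d = Z_const p \<Gamma> Q \<tau> (n d)"

lemma borel_measurable_ordered_A_weight:
  "(\<lambda>X. indicator (ordered_configs p \<Gamma> (n d)) X *\<^sub>R A_weight p Q (n d) X) \<in> borel_measurable (tau d)"
proof -
  have "(\<lambda>X. indicator (ordered_configs p \<Gamma> (n d)) X *\<^sub>R A_weight p Q (n d) X)
      = (\<lambda>X. indicator (ordered_configs p \<Gamma> (n d)) X *\<^sub>R \<bar>A_weight p Q (n d) X\<bar>)"
    using A_weight_nonneg by (auto simp: indicator_def)
  also have "\<dots> \<in> borel_measurable (tau d)"
    by (intro borel_measurable_scaleR borel_measurable_indicator sets_ordered borel_measurable_abs_A_weight)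
  finally show ?thesis .
qed

text \<open>The weight is nonnegative on ordered configurations, so the Bochner integral
  \<open>Z_const\<close> agrees with the nonnegative integral, whose finiteness and positivity are
  known.\<close>

lemma Z: "ennreal (Z d) = mass d M" "0 < Z d"
proof -
  let ?ord = "ordered_configs p \<Gamma> (n d)"
  have eq: "mass d M = (\<integral>\<^sup>+X. ennreal (indicator ?ord X *\<^sub>R A_weight p Q (n d) X) \<partial>tau d)"
    unfolding mass_def
  proof (rule nn_integral_cong)
    fix X assume "X \<in> space (tau d)"
    then have "j_map p r (n d) X \<in> M"
      unfolding space_tau by (rule j_map_in_M_space) (use closed_\<Gamma> r n_pos in auto)
    then show "ennreal \<bar>A_weight p Q (n d) X\<bar> * indicator M (j_map p r (n d) X) * indicator ?ord X
       = ennreal (indicator ?ord X *\<^sub>R A_weight p Q (n d) X)"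
      using A_weight_nonneg[of X p \<Gamma> "n d" Q] by (cases "X \<in> ?ord") auto
  qed
  have "Z d = (\<integral>X. indicator ?ord X *\<^sub>R A_weight p Q (n d) X \<partial>tau d)"
    unfolding Z_def Z_const_def tau_prod_eq set_lebesgue_integral_def ..
  also have "\<dots> = enn2real (mass d M)"
    unfolding eq
    by (rule integral_eq_nn_integral) (use A_weight_nonneg borel_measurable_ordered_A_weight in \<open>auto simp: indicator_def\<close>)
  finally show 1: "ennreal (Z d) = mass d M" using mass_finite[of d M] by simp
  show "0 < Z d" using mass_pos[of d] unfolding 1[symmetric] by simp
qed

abbreviation "law d \<equiv> sigma_measure p \<Gamma> r Q \<tau> (n d)"

lemma sets_sigma: "sets (law d) = sets (borel_of (M_topology p \<Gamma> r))"
  by (simp add: sigma_measure_def)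

lemma emeasure_sigma:
  assumes B: "B \<in> sets (borel_of (M_topology p \<Gamma> r))"
  shows "emeasure (law d) B = ennreal (1 / Z d) * mass d B"
proof -
  let ?ord = "ordered_configs p \<Gamma> (n d)"
  let ?R = "restrict_space (tau d) ?ord"
  let ?f = "\<lambda>X. ennreal (A_weight p Q (n d) X / Z d)"
  have ord: "?ord \<inter> space (tau d) \<in> sets (tau d)" using sets_ordered by (simp add: sets.Int)
  have j: "j_map p r (n d) \<in> measurable ?R (borel_of (M_topology p \<Gamma> r))"
    by (rule measurable_restrict_space1[OF measurable_j_map])
  have "(\<lambda>X. A_weight p Q (n d) X) \<in> borel_measurable ?R"
    using borel_measurable_ordered_A_weight ord
    by (subst borel_measurable_restrict_space_iff) (simp_all add: mult.commute)
  then have f: "?f \<in> borel_measurable ?R" by measurable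
  have pre: "j_map p r (n d) -` B \<inter> space ?R \<in> sets ?R" using measurable_sets[OF j B] .
  have "emeasure (law d) B = emeasure (density ?R ?f) (j_map p r (n d) -` B \<inter> space ?R)"
    unfolding sigma_measure_def tau_prod_eq Z_def[symmetric]
    using j B by (subst emeasure_distr) (simp_all add: measurable_cong_sets[OF sets_density refl])
  also have "\<dots> = (\<integral>\<^sup>+X. ?f X * indicator (j_map p r (n d) -` B \<inter> space ?R) X \<partial>?R)"
    by (rule emeasure_density[OF f pre])
  also have "\<dots> = (\<integral>\<^sup>+X. ?f X * indicator (j_map p r (n d) -` B \<inter> space ?R) X * indicator ?ord X \<partial>tau d)"
    by (rule nn_integral_restrict_space[OF ord])
  also have "\<dots> = (\<integral>\<^sup>+X. ennreal (1 / Z d) * (ennreal \<bar>A_weight p Q (n d) X\<bar> * indicator B (j_map p r (n d) X) * indicator ?ord X) \<partial>tau d)"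
  proof (rule nn_integral_cong)
    fix X assume X: "X \<in> space (tau d)"
    show "?f X * indicator (j_map p r (n d) -` B \<inter> space ?R) X * indicator ?ord X
       = ennreal (1 / Z d) * (ennreal \<bar>A_weight p Q (n d) X\<bar> * indicator B (j_map p r (n d) X) * indicator ?ord X)"
    proof (cases "X \<in> ?ord")
      case True
      then have "?f X = ennreal (1 / Z d) * ennreal \<bar>A_weight p Q (n d) X\<bar>"
        using A_weight_nonneg[OF True] Z(2)[of d] by (simp flip: ennreal_mult)
      then show ?thesis using True X by (simp add: space_restrict_space indicator_def mult.assoc)
    qed simp
  qed
  also have "\<dots> = ennreal (1 / Z d) * mass d B"
    unfolding mass_def
    by (intro nn_integral_cmult borel_measurable_times_ennreal[OF measurable_mass_integrand[OF B]]
        borel_measurable_indicator sets_ordered)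
  finally show ?thesis .
qed

lemma prob_space_sigma: "prob_space (law d)"
proof (rule prob_spaceI)
  have "space (law d) = M" by (simp add: sigma_measure_def space_borel_of)
  then have "emeasure (law d) (space (law d)) = ennreal (1 / Z d) * ennreal (Z d)"
    using emeasure_sigma[OF M_in_borel, of d] Z(1) by simp
  also have "\<dots> = ennreal (1 / Z d * Z d)" using Z(2)[of d] by (intro ennreal_mult[symmetric]) auto
  finally show "emeasure (law d) (space (law d)) = 1" using Z(2)[of d] by simp
qed

end

section \<open>The large deviation principle\<close>

lemma eln_mono: "x \<le> y \<Longrightarrow> eln x \<le> eln y"
proof (cases x)
  case (real s)
  assume "x \<le> y"
  show ?thesis
  proof (cases "s = 0")
    case False
    then have "x = ennreal (exp (ln s))" using real by simp
    then have "ereal (ln s) \<le> eln y" using le_eln[of "ln s" y] \<open>x \<le> y\<close> by simp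
    then show ?thesis using real False by (simp add: eln_def)
  qed (use real in \<open>simp add: eln_def\<close>)
qed (simp add: top_unique)

lemma eln_inj: "eln x = eln y \<Longrightarrow> x = y"
  by (cases x; cases y) (auto simp: eln_def split: if_splits)

text \<open>Testing with real levels below \<open>e\<close> lets all estimates be carried out at
  real levels and includes infinite energies without a separate case.\<close>

lemma ereal_le_uminus_if:
  assumes "\<And>L. ereal L < e \<Longrightarrow> x \<le> - ereal L"
  shows "x \<le> - (e :: ereal)"
proof (rule ccontr)
  assume "\<not> x \<le> - e"
  then have "- x < e" using ereal_uminus_less_reorder not_le by blast
  then obtain L where L: "- x < ereal L" "ereal L < e" using ereal_dense2 by blast
  have "x \<le> - ereal L" by (rule assms[OF L(2)])
  moreover have "- ereal L < x" using L(1) ereal_uminus_less_reorder by blast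
  ultimately show False by simp
qed

lemma ereal_uminus_le_if:
  assumes "\<And>L. e < ereal L \<Longrightarrow> - ereal L \<le> x"
  shows "- (e :: ereal) \<le> x"
proof (rule ccontr)
  assume "\<not> - e \<le> x"
  then have "e < - x" using ereal_less_uminus_reorder not_le by blast
  then obtain L where L: "e < ereal L" "ereal L < - x" using ereal_dense2 by blast
  have "- ereal L \<le> x" by (rule assms[OF L(1)])
  moreover have "x < - ereal L" using L(2) ereal_less_uminus_reorder by blast
  ultimately show False by simp
qed

section \<open>The W-functionals\<close>

context BM_system
begin

abbreviation "E \<equiv> weighted_energy p \<Gamma> Q"

lemma eln_W_upper_le:
  assumes \<mu>: "\<mu> \<in> M"
  shows "eln (W_upper p \<Gamma> r Q n \<mu>) \<le> - E \<mu>"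
proof (rule ereal_le_uminus_if)
  fix L assume "ereal L < E \<mu>"
  from upper_local[OF \<mu> this] obtain G where G: "openin (M_topology p \<Gamma> r) G" "\<mu> \<in> G"
    and ev: "\<forall>\<^sub>F d in sequentially. \<forall>X\<in>configs p \<Gamma> (n d).
     j_map p r (n d) X \<in> G \<longrightarrow> (A_weight p Q (n d) X)\<^sup>2 \<le> exp (- (2 * L * (m d)\<^sup>2))" by blast
  have "\<forall>\<^sub>F d in sequentially. W_open p \<Gamma> r Q (n d) G \<le> ennreal (exp (- L))"
    using ev
  proof eventually_elim
    case (elim d)
    show ?case unfolding W_open_def
    proof (rule SUP_least)
      fix X assume "X \<in> {X \<in> ordered_configs p \<Gamma> (n d). j_map p r (n d) X \<in> G}"
      then have X: "X \<in> ordered_configs p \<Gamma> (n d)" "j_map p r (n d) X \<in> G" by auto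
      have "(A_weight p Q (n d) X)\<^sup>2 \<le> exp (- (2 * L * (m d)\<^sup>2))"
        using elim X ordered_configs_subset by blast
      also have "\<dots> = (exp (- (L * (m d)\<^sup>2)))\<^sup>2" by (simp add: exp_double[symmetric] mult.assoc)
      finally have "A_weight p Q (n d) X \<le> exp (- (L * (m d)\<^sup>2))" by (rule power2_le_imp_le) simp
      then have "A_weight p Q (n d) X powr (1 / (m d)\<^sup>2) \<le> exp (- (L * (m d)\<^sup>2)) powr (1 / (m d)\<^sup>2)"
        using A_weight_nonneg[OF X(1)] by (intro powr_mono2) auto
      also have "\<dots> = exp (- L)" using m_pos[of d] by (simp add: powr_def)
      finally show "ennreal (A_weight p Q (n d) X powr (1 / (m d)\<^sup>2)) \<le> ennreal (exp (- L))" by (rule ennreal_leI)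
    qed
  qed
  then have "limsup (\<lambda>d. W_open p \<Gamma> r Q (n d) G) \<le> ennreal (exp (- L))" by (rule Limsup_bounded)
  then have "W_upper p \<Gamma> r Q n \<mu> \<le> ennreal (exp (- L))"
    unfolding W_upper_def using G by (intro INF_lower2[of G]) auto
  then show "eln (W_upper p \<Gamma> r Q n \<mu>) \<le> - ereal L" using eln_le[of _ "- L"] by simp
qed

text \<open>In each neighbourhood there is a good configuration for all large \<open>d\<close>, not
  just along a subsequence; this is why the limit inferior is bounded.\<close>

lemma eln_W_lower_ge:
  assumes \<mu>: "\<mu> \<in> M"
  shows "- E \<mu> \<le> eln (W_lower p \<Gamma> r Q n \<mu>)"
proof (rule ereal_uminus_le_if)
  fix L assume L: "E \<mu> < ereal L"
  have "ennreal (exp (- L)) \<le> W_lower p \<Gamma> r Q n \<mu>"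
    unfolding W_lower_def
  proof (rule INF_greatest, elim CollectE conjE)
    fix G assume G: "openin (M_topology p \<Gamma> r) G" "\<mu> \<in> G"
    show "ennreal (exp (- L)) \<le> liminf (\<lambda>d. W_open p \<Gamma> r Q (n d) G)"
    proof (rule Liminf_bounded)
      show "\<forall>\<^sub>F d in sequentially. ennreal (exp (- L)) \<le> W_open p \<Gamma> r Q (n d) G"
        using lower_configs[OF \<mu> L G]
      proof eventually_elim
        case (elim d)
        then obtain X where X: "X \<in> ordered_configs p \<Gamma> (n d)" "j_map p r (n d) X \<in> G"
          "exp (- (L * (m d)\<^sup>2)) \<le> A_weight p Q (n d) X" by blast
        have "exp (- L) = exp (- (L * (m d)\<^sup>2)) powr (1 / (m d)\<^sup>2)" using m_pos[of d] by (simp add: powr_def)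
        also have "\<dots> \<le> A_weight p Q (n d) X powr (1 / (m d)\<^sup>2)" using X(3) by (intro powr_mono2) auto
        finally show ?case
          unfolding W_open_def using X(1,2) by (intro SUP_upper2[of X] ennreal_leI) auto
      qed
    qed
  qed
  then show "- ereal L \<le> eln (W_lower p \<Gamma> r Q n \<mu>)" using le_eln[of "- L"] by simp
qed

lemma W_lower_le_W_upper: "W_lower p \<Gamma> r Q n \<mu> \<le> W_upper p \<Gamma> r Q n \<mu>"
  unfolding W_lower_def W_upper_def by (intro INF_mono') (simp add: Liminf_le_Limsup)

text \<open>The trivial inequality between \<open>W_lower\<close> and \<open>W_upper\<close> closes
  the chain, and equal logarithms give equal values because \<open>eln\<close> is injective.\<close>

lemma eln_W:
  assumes "\<mu> \<in> M"
  shows "eln (W_upper p \<Gamma> r Q n \<mu>) = - E \<mu>" "W_upper p \<Gamma> r Q n \<mu> = W_lower p \<Gamma> r Q n \<mu>"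
proof -
  have 1: "eln (W_lower p \<Gamma> r Q n \<mu>) \<le> eln (W_upper p \<Gamma> r Q n \<mu>)"
    by (rule eln_mono[OF W_lower_le_W_upper])
  note 2 = eln_W_upper_le[OF assms] and 3 = eln_W_lower_ge[OF assms]
  show "eln (W_upper p \<Gamma> r Q n \<mu>) = - E \<mu>" using 1 2 3 by (meson antisym order_trans)
  show "W_upper p \<Gamma> r Q n \<mu> = W_lower p \<Gamma> r Q n \<mu>"
    by (rule eln_inj) (use 1 2 3 in \<open>meson antisym order_trans\<close>)
qed

section \<open>Rates and the normalizing constant\<close>

definition E0 :: real where "E0 = real_of_ereal (E (equilibrium_measure p \<Gamma> r Q))"

lemma E_equilibrium: "E (equilibrium_measure p \<Gamma> r Q) = ereal E0"
  using weighted_energy_equilibrium_finite by (simp add: E0_def ereal_real')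

lemma E0_le: "\<mu> \<in> M \<Longrightarrow> ereal E0 \<le> E \<mu>"
  using equilibrium_measure_minimal(2) E_equilibrium by simp

abbreviation "rate d B \<equiv> ereal (1 / (m d)\<^sup>2) * eln (emeasure (law d) B)"

text \<open>\<open>Z d\<close> is the mass of the whole space, an open neighbourhood of the
  equilibrium tuple.\<close>

lemma eventually_Z_ge:
  assumes "0 < \<eta>"
  shows "\<forall>\<^sub>F d in sequentially. exp (- ((E0 + \<eta>) * (m d)\<^sup>2)) \<le> Z d"
proof -
  have "openin (M_topology p \<Gamma> r) M" using openin_topspace[of "M_topology p \<Gamma> r"] by simp
  from lower_mass[OF equilibrium_measure_minimal(1) _ this equilibrium_measure_minimal(1), of "E0 + \<eta>"]
  have "\<forall>\<^sub>F d in sequentially. ennreal (exp (- ((E0 + \<eta>) * (m d)\<^sup>2))) \<le> ennreal (Z d)"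
    using assms by (simp add: E_equilibrium Z(1))
  then show ?thesis using Z(2) by (simp add: ennreal_le_iff less_imp_le)
qed

text \<open>The whole space is also closed, and all its energies are at least
  \<open>E0\<close>.\<close>

lemma eventually_Z_le:
  assumes "0 < \<eta>"
  shows "\<forall>\<^sub>F d in sequentially. Z d \<le> exp (- ((E0 - \<eta>) * (m d)\<^sup>2))"
proof -
  have cl: "closedin (M_topology p \<Gamma> r) M" using closedin_topspace[of "M_topology p \<Gamma> r"] by simp
  have "ereal (E0 - \<eta>) < E \<mu>" if "\<mu> \<in> M" for \<mu>
  proof -
    have "ereal (E0 - \<eta>) < ereal E0" using assms by simp
    then show ?thesis using E0_le[OF that] by (rule less_le_trans)
  qed
  from upper_mass[OF cl this]
  have "\<forall>\<^sub>F d in sequentially. ennreal (Z d) \<le> ennreal (exp (- ((E0 - \<eta>) * (m d)\<^sup>2)))" by (simp add: Z(1))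
  then show ?thesis by (simp add: ennreal_le_iff)
qed

text \<open>Division by \<open>Z d\<close> shifts the level by \<open>E0\<close>; \<eta> is the
  error in the asymptotics of \<open>Z\<close>.\<close>

lemma limsup_rate_le:
  assumes B: "B \<in> sets (borel_of (M_topology p \<Gamma> r))" and F: "closedin (M_topology p \<Gamma> r) F" "B \<subseteq> F"
    and L: "\<And>\<mu>. \<mu> \<in> F \<Longrightarrow> ereal (L + E0) < E \<mu>" and \<eta>: "0 < \<eta>"
  shows "limsup (\<lambda>d. rate d B) \<le> ereal (- L + \<eta>)"
proof (rule Limsup_bounded)
  have "\<forall>\<^sub>F d in sequentially. mass d F \<le> ennreal (exp (- ((L + E0) * (m d)\<^sup>2)))"
    by (rule upper_mass[OF F(1)]) (rule L)
  then show "\<forall>\<^sub>F d in sequentially. rate d B \<le> ereal (- L + \<eta>)"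
    using eventually_Z_ge[OF \<eta>]
  proof eventually_elim
    case (elim d)
    have "1 / Z d \<le> exp ((E0 + \<eta>) * (m d)\<^sup>2)"
      using le_imp_inverse_le[OF elim(2)] by (simp add: exp_minus inverse_eq_divide)
    then have "emeasure (law d) B \<le> ennreal (exp ((E0 + \<eta>) * (m d)\<^sup>2)) * ennreal (exp (- ((L + E0) * (m d)\<^sup>2)))"
      unfolding emeasure_sigma[OF B] using order_trans[OF mass_mono[OF F(2)] elim(1)]
      by (intro mult_mono ennreal_leI) auto
    also have "\<dots> = ennreal (exp ((- L + \<eta>) * (m d)\<^sup>2))"
      by (simp add: algebra_simps flip: ennreal_mult exp_add)
    finally have "eln (emeasure (law d) B) \<le> ereal ((- L + \<eta>) * (m d)\<^sup>2)" by (rule eln_le)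
    then have "rate d B \<le> ereal (1 / (m d)\<^sup>2) * ereal ((- L + \<eta>) * (m d)\<^sup>2)"
      by (rule ereal_mult_left_mono) simp
    also have "\<dots> = ereal (- L + \<eta>)" using m_pos[of d] by simp
    finally show ?case .
  qed
qed

lemma liminf_rate_ge:
  assumes B: "B \<in> sets (borel_of (M_topology p \<Gamma> r))" and G: "openin (M_topology p \<Gamma> r) G" "G \<subseteq> B" "\<mu> \<in> G"
    and L: "E \<mu> < ereal (L + E0)" and \<eta>: "0 < \<eta>"
  shows "ereal (- L - \<eta>) \<le> liminf (\<lambda>d. rate d B)"
proof (rule Liminf_bounded)
  have \<mu>: "\<mu> \<in> M" using openin_subset[OF G(1)] G(3) by auto
  show "\<forall>\<^sub>F d in sequentially. ereal (- L - \<eta>) \<le> rate d B"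
    using lower_mass[OF \<mu> L G(1,3)] eventually_Z_le[OF \<eta>]
  proof eventually_elim
    case (elim d)
    have "exp ((E0 - \<eta>) * (m d)\<^sup>2) \<le> 1 / Z d"
      using le_imp_inverse_le[OF elim(2) Z(2)] by (simp add: exp_minus inverse_eq_divide)
    moreover have "ennreal (exp (- ((L + E0) * (m d)\<^sup>2))) \<le> mass d B"
      using elim(1) mass_mono[OF G(2)] order_trans by blast
    ultimately have "ennreal (exp ((E0 - \<eta>) * (m d)\<^sup>2)) * ennreal (exp (- ((L + E0) * (m d)\<^sup>2))) \<le> emeasure (law d) B"
      unfolding emeasure_sigma[OF B] by (intro mult_mono ennreal_leI) auto
    moreover have "ennreal (exp ((E0 - \<eta>) * (m d)\<^sup>2)) * ennreal (exp (- ((L + E0) * (m d)\<^sup>2)))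
        = ennreal (exp ((- L - \<eta>) * (m d)\<^sup>2))"
      by (simp add: algebra_simps flip: ennreal_mult exp_add)
    ultimately have "ereal ((- L - \<eta>) * (m d)\<^sup>2) \<le> eln (emeasure (law d) B)" by (intro le_eln) simp
    then have "ereal (1 / (m d)\<^sup>2) * ereal ((- L - \<eta>) * (m d)\<^sup>2) \<le> rate d B"
      by (rule ereal_mult_left_mono) simp
    moreover have "ereal (1 / (m d)\<^sup>2) * ereal ((- L - \<eta>) * (m d)\<^sup>2) = ereal (- L - \<eta>)" using m_pos[of d] by simp
    ultimately show ?case by simp
  qed
qed

lemma large_deviation_principle:
  "satisfies_LDP (M_topology p \<Gamma> r) law (\<lambda>d. (m d)\<^sup>2) (\<lambda>\<mu>. E \<mu> - ereal E0)"
proof -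
  let ?T = "M_topology p \<Gamma> r" and ?R = "\<lambda>\<mu>. E \<mu> - ereal E0"
  have less_R: "ereal t < ?R \<mu> \<longleftrightarrow> ereal (t + E0) < E \<mu>" for t \<mu>
    by (cases "E \<mu>") auto
  have lsc: "lower_semicontinuous_map ?T ?R"
    unfolding lower_semicontinuous_map_def
  proof
    fix c :: ereal
    show "openin ?T {x \<in> topspace ?T. c < ?R x}"
    proof (cases c)
      case (real t)
      then show ?thesis using openin_weighted_energy_greater[of "t + E0"] by (simp add: less_R)
    next
      \<comment> \<open>The energy never takes the value \<open>- \<infinity>\<close>, so this
        superlevel set is the whole space.\<close>
      case MInf
      have "- \<infinity> < ?R x" if "x \<in> topspace ?T" for x
        using weighted_energy_not_MInf[of x] that by (cases "E x") auto
      then have "{x \<in> topspace ?T. c < ?R x} = topspace ?T" using MInf by blast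
      then show ?thesis by (simp only: openin_topspace)
    qed simp
  qed
  have bounds: "- (INF x\<in>?T interior_of B. ?R x) \<le> liminf (\<lambda>d. rate d B) \<and>
      limsup (\<lambda>d. rate d B) \<le> - (INF x\<in>?T closure_of B. ?R x)" if B: "B \<in> sets (borel_of ?T)" for B
  proof
    have BM: "B \<subseteq> topspace ?T" using sets.sets_into_space[OF B] by (simp add: space_borel_of)
    have "- liminf (\<lambda>d. rate d B) \<le> ?R \<mu>" if \<mu>: "\<mu> \<in> ?T interior_of B" for \<mu>
    proof -
      have "- ?R \<mu> \<le> liminf (\<lambda>d. rate d B)"
      proof (rule ereal_uminus_le_if)
        fix L assume "?R \<mu> < ereal L"
        then obtain L' where L': "?R \<mu> < ereal L'" "ereal L' < ereal L" using ereal_dense2 by blast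
        have "E \<mu> < ereal (L' + E0)" using L'(1) by (cases "E \<mu>") auto
        \<comment> \<open>With \<eta> = \<open>L - L'\<close> the bound \<open>- L' - \<eta>\<close>
          is exactly \<open>- L\<close>.\<close>
        from liminf_rate_ge[OF B openin_interior_of interior_of_subset \<mu> this, of "L - L'"]
        show "- ereal L \<le> liminf (\<lambda>d. rate d B)" using L'(2) by simp
      qed
      then show ?thesis using ereal_uminus_le_reorder by blast
    qed
    then have "- liminf (\<lambda>d. rate d B) \<le> (INF x\<in>?T interior_of B. ?R x)" by (intro INF_greatest)
    then show "- (INF x\<in>?T interior_of B. ?R x) \<le> liminf (\<lambda>d. rate d B)" using ereal_uminus_le_reorder by blast
    show "limsup (\<lambda>d. rate d B) \<le> - (INF x\<in>?T closure_of B. ?R x)"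
    proof (rule ereal_le_uminus_if)
      fix L assume "ereal L < (INF x\<in>?T closure_of B. ?R x)"
      then obtain L' where L': "ereal L < ereal L'" "ereal L' < (INF x\<in>?T closure_of B. ?R x)" using ereal_dense2 by blast
      have "ereal (L' + E0) < E \<mu>" if "\<mu> \<in> ?T closure_of B" for \<mu>
        using L'(2) that unfolding less_R[symmetric] by (rule less_INF_D)
      \<comment> \<open>With \<eta> = \<open>L' - L\<close> the bound \<open>- L' + \<eta>\<close>
        is exactly \<open>- L\<close>.\<close>
      from limsup_rate_le[OF B closedin_closure_of closure_of_subset[OF BM] this, of "L' - L"]
      show "limsup (\<lambda>d. rate d B) \<le> - ereal L" using L'(1) by simp
    qed
  qed
  show ?thesis
    unfolding satisfies_LDP_def
  proof (intro conjI allI ballI)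
    show "compact_space ?T" by (rule compact_Hausdorff_M_topology(1)[OF ab \<Gamma> r])
    show "Hausdorff_space ?T" by (rule compact_Hausdorff_M_topology(2)[OF ab \<Gamma> r])
    show "prob_space (law d)" for d by (rule prob_space_sigma)
    show "sets (law d) = sets (borel_of ?T)" for d by (rule sets_sigma)
    show "space (law d) = topspace ?T" for d by (simp add: sigma_measure_def space_borel_of)
    show "0 < (m d)\<^sup>2" for d using m_pos[of d] by simp
    show "filterlim (\<lambda>d. (m d)\<^sup>2) at_top sequentially" using m_at_top by (intro filterlim_pow_at_top) auto
    show "0 \<le> ?R \<mu>" if "\<mu> \<in> topspace ?T" for \<mu>
      using E0_le[of \<mu>] that by (cases "E \<mu>") auto
    show "liminf (\<lambda>d. rate d B) \<le> limsup (\<lambda>d. rate d B)" for B by (rule Liminf_le_Limsup) simp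
    show "lower_semicontinuous_map ?T ?R" by (rule lsc)
    show "- (INF x\<in>?T interior_of B. ?R x) \<le> liminf (\<lambda>d. rate d B)" if "B \<in> sets (borel_of ?T)" for B
      using bounds[OF that] by (rule conjunct1)
    show "limsup (\<lambda>d. rate d B) \<le> - (INF x\<in>?T closure_of B. ?R x)" if "B \<in> sets (borel_of ?T)" for B
      using bounds[OF that] by (rule conjunct2)
  qed
qed

end

theorem theorem6p3:
  fixes p :: nat
    and a b r :: "nat \<Rightarrow> real"
    and \<Gamma> :: "nat \<Rightarrow> real set"
    and n :: "nat \<Rightarrow> nat \<Rightarrow> nat"
    and Q :: "nat \<Rightarrow> real \<Rightarrow> real"
    and \<tau> :: "nat \<Rightarrow> real measure"
  assumes "1 \<le> p"
    and "\<And>i. i < p \<Longrightarrow> a i < b i"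
    and "\<And>i. i < p \<Longrightarrow> \<Gamma> i = {a i..b i}"
    and "\<And>i. Suc i < p \<Longrightarrow> b i < a (Suc i)"
    and "\<And>i. i < p \<Longrightarrow> 0 < r i"
    and "(\<Sum>i<p. r i) = 1"
    and "\<And>d i. i < p \<Longrightarrow> 0 < n d i"
    and "filterlim (\<lambda>d. mi_norm p (n d)) at_top sequentially"
    and "\<And>i. i < p \<Longrightarrow> (\<lambda>d. real (n d i) / real (mi_norm p (n d))) \<longlonglongrightarrow> r i"
    and "\<And>i. i < p \<Longrightarrow> continuous_on (\<Gamma> i) (Q i)"
    and "\<And>i. i < p \<Longrightarrow> sets (\<tau> i) = sets (restrict_space borel (\<Gamma> i))"
    and "\<And>i. i < p \<Longrightarrow> finite_measure (\<tau> i)"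
    and "\<And>i. i < p \<Longrightarrow>
           strong_weighted_BM (complex_of_real ` \<Gamma> i) (distr (\<tau> i) borel complex_of_real)"
  shows "\<exists>W R.
    (\<forall>\<mu>\<in>M_space p \<Gamma> r. W \<mu> = W_upper p \<Gamma> r Q n \<mu> \<and> W \<mu> = W_lower p \<Gamma> r Q n \<mu>) \<and>
    (\<forall>\<mu>\<in>M_space p \<Gamma> r.
       R \<mu> = eln (W (equilibrium_measure p \<Gamma> r Q)) - eln (W \<mu>) \<and>
       R \<mu> = weighted_energy p \<Gamma> Q \<mu> - weighted_energy p \<Gamma> Q (equilibrium_measure p \<Gamma> r Q)) \<and>
    satisfies_LDP (M_topology p \<Gamma> r) (\<lambda>d. sigma_measure p \<Gamma> r Q \<tau> (n d))
      (\<lambda>d. (real (mi_norm p (n d)))\<^sup>2) R"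
proof -
  interpret BM_system p a b r \<Gamma> Q n \<tau>
    by (intro BM_system.intro multi_index_sequence.intro interval_system.intro
        BM_system_axioms.intro multi_index_sequence_axioms.intro) (fact assms)+
  \<comment> \<open>Both logarithms are negative energies and that of the equilibrium tuple is
    finite, so the difference is well defined even if the energy of \<mu> is infinite.\<close>
  have "eln (W_upper p \<Gamma> r Q n (equilibrium_measure p \<Gamma> r Q)) - eln (W_upper p \<Gamma> r Q n \<mu>) = E \<mu> - ereal E0"
    if "\<mu> \<in> M" for \<mu>
    unfolding eln_W(1)[OF that] eln_W(1)[OF equilibrium_measure_minimal(1)] E_equilibrium
    by (cases "E \<mu>") auto
  then show ?thesis
    using eln_W(2) large_deviation_principle unfolding E_equilibrium
    by (intro exI[of _ "W_upper p \<Gamma> r Q n"] exI[of _ "\<lambda>\<mu>. E \<mu> - ereal E0"] conjI ballI) simp_all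
qed

end
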